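(* Let $n\ge1$, $\nu\in[-1/2,\infty)^n$, $\gamma_\nu=\min\{1,\nu_{\min}+1/2\}$ and let $k=(k_1,\dots,k_n)\in\mathbb N^n$ be a multi-index. Denote by $\delta^k_\nu\mathcal L_\nu^{-|k|/2}(x,y)$ the kernel associated with the Riesz transform $\delta^k_\nu\mathcal L_\nu^{-|k|/2}$. Then $\delta^k_\nu\mathcal L_\nu^{-|k|/2}$ is a Calderón–Zygmund operator. That is, $\delta^k_\nu\mathcal L_\nu^{-|k|/2}$ is bounded on $L^2(\mathbb R^n_+)$ and there is a constant $C>0$ such that its kernel satisfies $$|\delta^k_\nu\mathcal L_\nu^{-|k|/2}(x,y)|\le\frac{C}{|x-y|^n},\qquad x\ne y,\ x,y\in\mathbb R^n_+,$$ and $$|\delta^k_\nu\mathcal L_\nu^{-|k|/2}(x,y)-\delta^k_\nu\mathcal L_\nu^{-|k|/2}(x,y')|+|\delta^k_\nu\mathcal L_\nu^{-|k|/2}(y,x)-\delta^k_\nu\mathcal L_\nu^{-|k|/2}(y',x)|\le C\Big(\frac{|y-y'|}{|x-y|}\Big)^{\gamma_\nu}\frac1{|x-y|^n}$$ whenever $x,y,y'\in\mathbb R^n_+$, $x\neq y$ and $|y-y'|\le|x-y|/2$.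
   Context: Notation: $\mathbb N=\{0,1,2,\dots\}$, $\mathbb R^n_+=(0,\infty)^n$ with Lebesgue measure. $\mathcal J_\nu=\{j:\nu_j>-1/2\}$ and $\nu_{\min}=\min\{\nu_j:j\in\mathcal J_\nu\}$, with $\nu_{\min}=\infty$ if $\mathcal J_\nu=\emptyset$. Laguerre operator: for $\alpha>-1$ and $m\in\mathbb N$ let $L^{m}_{\alpha}(u)=\frac{1}{m!}e^{u}u^{-\alpha}\frac{d^m}{du^m}(e^{-u}u^{m+\alpha})$ and $\varphi^\alpha_m(u)=\left(\frac{2\Gamma(m+1)}{\Gamma(m+\alpha+1)}\right)^{1/2}L^m_\alpha(u^2)u^{\alpha+1/2}e^{-u^2/2}$ for $u>0$. For $k\in\mathbb N^n$ put $\varphi_k^\nu(x)=\prod_{i=1}^n\varphi^{\nu_i}_{k_i}(x_i)$; $\{\varphi^\nu_k\}$ is an orthonormal basis of $L^2(\mathbb R^n_+)$. $\mathcal L_\nu$ is the self-adjoint operator on $L^2(\mathbb R^n_+)$ with $\mathcal L_\nu\varphi_k^\nu=(4|k|+2|\nu|+2n)\varphi_k^\nu$, where $|k|=\sum k_i$, $|\nu|=\sum\nu_i$; it extends $\sum_{i=1}^n\left[-\partial_{x_i}^2+x_i^2+\frac1{x_i^2}(\nu_i^2-\frac14)\right]$ on $C_c^\infty(\mathbb R^n_+)$. Powers $\mathcal L_\nu^{-\sigma}$ are defined spectrally. Heat kernel: the kernel of $e^{-t\mathcal L_\nu}$ is $p^\nu_t(x,y)=\prod_{j=1}^np_t^{\nu_j}(x_j,y_j)$,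 where with $r=e^{-4t}$, $p_t^{\alpha}(u,v)=\frac{2(ruv)^{1/2}}{1-r}\exp\left(-\frac12\frac{1+r}{1-r}(u^2+v^2)\right)I_\alpha\left(\frac{2r^{1/2}}{1-r}uv\right)$ and $I_\alpha$ is the modified Bessel function of the first kind. Derivatives: $\delta_{\nu_j}=\frac{\partial}{\partial x_j}+x_j-\frac1{x_j}\left(\nu_j+\frac12\right)$ and $\delta^k_\nu=\delta_{\nu_n}^{k_n}\cdots\delta_{\nu_1}^{k_1}$. The Riesz transform $\delta_\nu^k\mathcal L_\nu^{-|k|/2}$ is defined on finite linear combinations of the $\varphi^\nu_\alpha$ and extended by continuity. For $|k|\ge1$ its kernel is, for $x\ne y$, $\delta^k_\nu\mathcal L_\nu^{-|k|/2}(x,y)=\frac1{\Gamma(|k|/2)}\int_0^\infty t^{|k|/2}\delta^k_\nu p^\nu_t(x,y)\frac{dt}t$, with $\delta^k_\nu$ acting in $x$; for $k=0$ the operator is the identity, whose kernel is $0$ off the diagonal. *)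

theory Defs
  imports "HOL-Analysis.Analysis"
begin

text \<open>Points of $n$-dimensional space are vectors of type \<open>real ^ 'n\<close>, with \<open>n = CARD('n)\<close>.
  The linear order on the index type \<open>'n\<close> only serves to fix the order in which the
  partial derivatives are composed.\<close>

definition Rplus :: "(real ^ 'n) set" where
  "Rplus = {x. \<forall>j. 0 < x $ j}"

definition msize :: "nat ^ 'n \<Rightarrow> nat" where
  "msize k = (\<Sum>j\<in>UNIV. k $ j)"

definition J_nu :: "real ^ 'n \<Rightarrow> 'n set" where
  "J_nu \<nu> = {j. - 1 / 2 < \<nu> $ j}"

text \<open>The infimum of the empty set in \<open>ereal\<close> is \<open>\<infinity>\<close>; over a nonempty \<open>J_nu \<nu>\<close> it is a minimum.\<close>

definition nu_min :: "real ^ 'n \<Rightarrow> ereal" where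
  "nu_min \<nu> = (INF j\<in>J_nu \<nu>. ereal (\<nu> $ j))"

definition gamma_nu :: "real ^ 'n \<Rightarrow> real" where
  "gamma_nu \<nu> = real_of_ereal (min 1 (nu_min \<nu> + ereal (1 / 2)))"


section \<open>Laguerre functions\<close>

text \<open>Only the values for \<open>\<alpha> > -1\<close> and \<open>u > 0\<close> matter; there \<open>powr\<close> is the usual real power.\<close>

definition laguerre_L :: "real \<Rightarrow> nat \<Rightarrow> real \<Rightarrow> real" where
  "laguerre_L \<alpha> m u =
     1 / fact m * exp u * u powr (- \<alpha>) * (deriv ^^ m) (\<lambda>v. exp (- v) * v powr (real m + \<alpha>)) u"

definition phi1 :: "real \<Rightarrow> nat \<Rightarrow> real \<Rightarrow> real" where
  "phi1 \<alpha> m u =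
     sqrt (2 * Gamma (real m + 1) / Gamma (real m + \<alpha> + 1)) *
     laguerre_L \<alpha> m (u\<^sup>2) * u powr (\<alpha> + 1 / 2) * exp (- (u\<^sup>2) / 2)"

definition phi :: "real ^ 'n \<Rightarrow> nat ^ 'n \<Rightarrow> real ^ 'n \<Rightarrow> real" where
  "phi \<nu> m x = (\<Prod>i\<in>UNIV. phi1 (\<nu> $ i) (m $ i) (x $ i))"

definition eigenvalue :: "real ^ 'n \<Rightarrow> nat ^ 'n \<Rightarrow> real" where
  "eigenvalue \<nu> m = 4 * real (msize m) + 2 * (\<Sum>j\<in>UNIV. \<nu> $ j) + 2 * real CARD('n)"

definition laguerre_span :: "real ^ 'n \<Rightarrow> (real ^ 'n \<Rightarrow> complex) set" where
  "laguerre_span \<nu> =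
     {(\<lambda>x. \<Sum>m\<in>F. c m * complex_of_real (phi \<nu> m x)) | F c. finite F}"

definition laguerre_coeff ::
  "real ^ 'n \<Rightarrow> (real ^ 'n \<Rightarrow> complex) \<Rightarrow> nat ^ 'n \<Rightarrow> complex" where
  "laguerre_coeff \<nu> f m = (LINT x|lebesgue_on Rplus. f x * complex_of_real (phi \<nu> m x))"

text \<open>The spectral power $\mathcal L_\nu^s$, applied to finite linear combinations of the \<open>phi \<nu> m\<close>,
  for which the sum is finite by orthonormality. (For other \<open>f\<close> the sum may be infinite, and
  then has the default value 0.)\<close>

definition laguerre_power ::
  "real ^ 'n \<Rightarrow> real \<Rightarrow> (real ^ 'n \<Rightarrow> complex) \<Rightarrow> real ^ 'n \<Rightarrow> complex" where
  "laguerre_power \<nu> s f x =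
     (\<Sum>m | laguerre_coeff \<nu> f m \<noteq> 0.
        complex_of_real (eigenvalue \<nu> m powr s) * laguerre_coeff \<nu> f m * complex_of_real (phi \<nu> m x))"


section \<open>Derivatives and the Riesz transform\<close>

definition delta ::
  "real ^ 'n \<Rightarrow> 'n \<Rightarrow> (real ^ 'n \<Rightarrow> 'b::real_normed_vector) \<Rightarrow> real ^ 'n \<Rightarrow> 'b" where
  "delta \<nu> j f x =
     vector_derivative (\<lambda>s. f (x + s *\<^sub>R axis j 1)) (at 0) +
     (x $ j - (\<nu> $ j + 1 / 2) / x $ j) *\<^sub>R f x"

text \<open>The derivative in the first variable is applied first.\<close>

definition delta_pow ::
  "real ^ 'n::{finite,linorder} \<Rightarrow> nat ^ 'n::{finite,linorder} \<Rightarrow>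
     (real ^ 'n::{finite,linorder} \<Rightarrow> 'b::real_normed_vector) \<Rightarrow> real ^ 'n::{finite,linorder} \<Rightarrow> 'b" where
  "delta_pow \<nu> k f = fold (\<lambda>j. delta \<nu> j ^^ (k $ j)) (sorted_list_of_set UNIV) f"

text \<open>The Riesz transform on its initial domain \<open>laguerre_span \<nu>\<close>.\<close>

definition riesz ::
  "real ^ 'n::{finite,linorder} \<Rightarrow> nat ^ 'n::{finite,linorder} \<Rightarrow>
     (real ^ 'n::{finite,linorder} \<Rightarrow> complex) \<Rightarrow> real ^ 'n::{finite,linorder} \<Rightarrow> complex" where
  "riesz \<nu> k f = delta_pow \<nu> k (laguerre_power \<nu> (- (real (msize k) / 2)) f)"


section \<open>Bounded operators on square integrable functions\<close>

text \<open>Elements of $L^2$ are represented by functions, so that identities hold almost everywhere.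
  An operator as below respects equality almost everywhere, by linearity and the norm bound.\<close>

definition L2 :: "(real ^ 'n \<Rightarrow> complex) set" where
  "L2 = {f \<in> borel_measurable (lebesgue_on Rplus). integrable (lebesgue_on Rplus) (\<lambda>x. (norm (f x))\<^sup>2)}"

definition L2_norm :: "(real ^ 'n \<Rightarrow> complex) \<Rightarrow> real" where
  "L2_norm f = sqrt (LINT x|lebesgue_on Rplus. (norm (f x))\<^sup>2)"

definition L2_bounded_operator ::
  "((real ^ 'n \<Rightarrow> complex) \<Rightarrow> real ^ 'n \<Rightarrow> complex) \<Rightarrow> bool" where
  "L2_bounded_operator T \<longleftrightarrow>
     (\<forall>f\<in>L2. T f \<in> L2) \<and>
     (\<forall>f\<in>L2. \<forall>g\<in>L2. \<forall>a b. AE x in lebesgue_on Rplus.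
        T (\<lambda>z. a * f z + b * g z) x = a * T f x + b * T g x) \<and>
     (\<exists>B. \<forall>f\<in>L2. L2_norm (T f) \<le> B * L2_norm f)"


section \<open>Heat kernel and kernel of the Riesz transform\<close>

text \<open>Modified Bessel function of the first kind, for \<open>z > 0\<close>.\<close>

definition bessel_I :: "real \<Rightarrow> real \<Rightarrow> real" where
  "bessel_I \<alpha> z =
     (\<Sum>m. (z / 2) powr (2 * real m + \<alpha>) / (fact m * Gamma (real m + \<alpha> + 1)))"

definition heat_kernel1 :: "real \<Rightarrow> real \<Rightarrow> real \<Rightarrow> real \<Rightarrow> real" where
  "heat_kernel1 \<alpha> t u v =
     (let r = exp (- 4 * t) in
        2 * sqrt (r * u * v) / (1 - r) *
        exp (- (1 / 2) * ((1 + r) / (1 - r)) * (u\<^sup>2 + v\<^sup>2)) *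
        bessel_I \<alpha> (2 * sqrt r / (1 - r) * u * v))"

definition heat_kernel :: "real ^ 'n \<Rightarrow> real \<Rightarrow> real ^ 'n \<Rightarrow> real ^ 'n \<Rightarrow> real" where
  "heat_kernel \<nu> t x y = (\<Prod>j\<in>UNIV. heat_kernel1 (\<nu> $ j) t (x $ j) (y $ j))"

text \<open>Off the diagonal. The derivatives act in the first space variable \<open>x\<close>; for \<open>k = 0\<close> the
  operator is the identity, whose kernel vanishes off the diagonal.\<close>

definition riesz_kernel ::
  "real ^ 'n::{finite,linorder} \<Rightarrow> nat ^ 'n::{finite,linorder} \<Rightarrow>
     real ^ 'n::{finite,linorder} \<Rightarrow> real ^ 'n::{finite,linorder} \<Rightarrow> real" where
  "riesz_kernel \<nu> k x y =
     (if msize k = 0 then 0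
      else 1 / Gamma (real (msize k) / 2) *
        (LINT t:{0<..}|lebesgue.
           t powr (real (msize k) / 2) * delta_pow \<nu> k (\<lambda>z. heat_kernel \<nu> t z y) x / t))"

end

theory Submission
  imports Defs
begin

text \<open>Write \<open>W\<^sub>\<alpha>(u) = u^(\<alpha>+1/2) exp (- u\<^sup>2 / 2)\<close>. The logarithmic derivative of this weight cancels the
zeroth-order term of \<open>\<delta>\<close>, so \<open>\<delta>\<close> of a product of a weight and a function is the weight times the
ordinary derivative of the function (\<open>delta_pow_weighted_product\<close>). Everything therefore reduces to
ordinary derivatives, in each variable separately, of the Laguerre polynomials in \<open>u\<^sup>2\<close> and of the
heat kernel divided by the weight. The two halves of the theorem are independent of each other.

Boundedness on square integrable functions. The derivative of a Laguerre polynomial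
in \<open>u\<^sup>2\<close> of parameter \<open>a\<close> is a multiple of \<open>u\<close> times one of parameter \<open>a + 1\<close>, while the derivative of
\<open>u\<close> times one of parameter \<open>a + 1\<close> is a combination of those of parameter \<open>a\<close> of at most the same degree.
Hence the operator \<open>\<delta>\<^sup>k\<close> sends \<open>\<phi>\<^sub>m\<close> to a finite combination of the functions of another orthonormal
family, whose parameters are \<open>\<nu>\<^sub>i\<close> or \<open>\<nu>\<^sub>i + 1\<close> according to the parity of \<open>k\<^sub>i\<close>, and the claim is the
boundedness on square summable sequences of a matrix. This matrix is a tensor product of products of
one-step matrices. Of the two kinds of steps, one has a single nonzero off-diagonal; the other, once
divided by the square root of the column index, has entries of size \<open>(1/m) (l/m)^(a/2)\<close> above its
diagonal, like a Hardy operator. Schur's test with the weights \<open>(m + 1)^(-1/2)\<close> handles both, and since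
all matrices are upper triangular it is stable under products (\<open>schur_bounded_compose\<close>). The negative
power of the eigenvalue distributes over the coordinates because the eigenvalue dominates
\<open>m\<^sub>i + 1\<close> for every \<open>i\<close>. Bessel's inequality and the completeness of the space then extend the operator
from the span (\<open>bounded_extension\<close>).

Kernel estimates. By Poisson's integral, \<open>I\<^sub>\<alpha>(z)\<close> is a multiple of \<open>z\<^sup>\<alpha>\<close> times the integral of
\<open>exp (z s)\<close> against the measure \<open>(1 - s\<^sup>2)^(\<alpha>-1/2) ds\<close> on the interval from -1 to 1, or against two point
masses at its ends if \<open>\<alpha> = - 1/2\<close>. The heat kernel divided by the weight is then an average of
Gaussians, and its derivatives are averages of Gaussians times Hermite polynomials. With
\<open>\<tau> = tanh t\<close> and the variables divided by \<open>\<surd>\<tau>\<close>, the bounds become uniform in time: a little of the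
Gaussian absorbs the polynomial, and the factor \<open>(UV)\<^sup>\<beta>\<close>, \<open>\<beta> = \<alpha> + 1/2\<close>, is compensated by the decay
\<open>(1 + UV)\<^sup>-\<^sup>\<beta>\<close> of the average of \<open>exp (- U V (1 - s) / 4)\<close>. All factors depend smoothly on the second
variable except \<open>V\<^sup>\<beta>\<close>, which is only Hoelder continuous of order \<open>min 1 \<beta>\<close> at the origin when
\<open>\<beta> > 0\<close>; this is the origin of the exponent \<open>\<gamma>\<^sub>\<nu>\<close>. The one-dimensional bounds are multiplied, the
differences telescoped (\<open>product_holder\<close>), and the result integrated over time
(\<open>subordinated_integral_bound\<close>), where the factor \<open>t^(|k|/2)\<close> exactly cancels the singularity that the
derivatives create at \<open>t = 0\<close>.\<close>

section \<open>The conjugation of the derivatives to partial derivatives\<close>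

text \<open>The ground state \<open>\<phi>\<^sub>0\<close> without its normalisation; it is annihilated by \<open>\<delta>\<close>.\<close>

definition laguerre_weight :: "real \<Rightarrow> real \<Rightarrow> real" where
  "laguerre_weight \<alpha> u = u powr (\<alpha> + 1 / 2) * exp (- (u\<^sup>2) / 2)"

lemma has_real_derivative_laguerre_weight:
  assumes "0 < u"
  shows "(laguerre_weight \<alpha> has_real_derivative ((\<alpha> + 1 / 2) / u - u) * laguerre_weight \<alpha> u) (at u)"
proof -
  have "u powr (\<alpha> + 1 / 2 - 1) = u powr (\<alpha> + 1 / 2) / u"
    using assms by (subst powr_diff) simp_all
  then show ?thesis
    unfolding laguerre_weight_def
    using assms by (auto intro!: derivative_eq_intros simp: algebra_simps)
qed

lemma open_Rplus: "open (Rplus :: (real ^ 'n) set)"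
proof -
  have "(Rplus :: (real ^ 'n) set) = (\<Inter>j\<in>UNIV. {x. 0 < x $ j})"
    by (auto simp: Rplus_def)
  also have "open \<dots>"
    by (intro open_INT ballI open_Collect_less continuous_intros) auto
  finally show ?thesis .
qed

text \<open>The term \<open>x\<^sub>j - (\<nu>\<^sub>j + 1/2) / x\<^sub>j\<close> of \<open>\<delta>\<close> is minus the logarithmic derivative of the
weight, so only the derivative of the remaining factor survives. Sums of products are needed for linear
combinations of Laguerre functions; a heat kernel is the case of a single summand.\<close>

lemma delta_weighted_product:
  fixes c :: "'a \<Rightarrow> 'b::real_normed_vector"
  assumes x: "x \<in> Rplus"
    and f: "\<And>z. z \<in> Rplus \<Longrightarrow>
      f z = (\<Sum>a\<in>A. (\<Prod>i\<in>UNIV. laguerre_weight (\<nu> $ i) (z $ i) * H a i (z $ i)) *\<^sub>R c a)"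
    and H: "\<And>a. a \<in> A \<Longrightarrow> (H a j has_real_derivative H' a) (at (x $ j))"
  shows "delta \<nu> j f x =
    (\<Sum>a\<in>A. (\<Prod>i\<in>UNIV. laguerre_weight (\<nu> $ i) (x $ i) * (if i = j then H' a else H a i (x $ i))) *\<^sub>R c a)"
proof -
  define w where "w = (\<lambda>i. laguerre_weight (\<nu> $ i))"
  \<comment> \<open>The factors that do not depend on the \<open>j\<close>-th variable.\<close>
  define R where "R a = (\<Prod>i\<in>UNIV - {j}. w i (x $ i) * H a i (x $ i))" for a
  have xj: "0 < x $ j" using x by (simp add: Rplus_def)
  define p where "p s = x + s *\<^sub>R axis j 1" for s :: real
  have pi: "p s $ i = (if i = j then x $ j + s else x $ i)" for s i
    by (auto simp: p_def axis_def)
  have pR: "p s \<in> Rplus" if "s \<in> ball 0 (x $ j)" for s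
    using x that by (auto simp: Rplus_def pi)
  have prod_split: "(\<Prod>i\<in>UNIV. w i (p s $ i) * H a i (p s $ i))
      = w j (x $ j + s) * H a j (x $ j + s) * R a" for s a
  proof -
    have "(\<Prod>i\<in>UNIV. w i (p s $ i) * H a i (p s $ i))
       = w j (p s $ j) * H a j (p s $ j) * (\<Prod>i\<in>UNIV - {j}. w i (p s $ i) * H a i (p s $ i))"
      by (rule prod.remove) auto
    also have "(\<Prod>i\<in>UNIV - {j}. w i (p s $ i) * H a i (p s $ i)) = R a"
      unfolding R_def by (intro prod.cong) (auto simp: pi)
    finally show ?thesis by (simp add: pi)
  qed
  have fp: "f (p s) = (\<Sum>a\<in>A. (w j (x $ j + s) * H a j (x $ j + s) * R a) *\<^sub>R c a)"
    if "s \<in> ball 0 (x $ j)" for s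
    using f[OF pR[OF that]] prod_split[of s] by (simp add: w_def)
  define D where "D a = (((\<nu> $ j + 1 / 2) / x $ j - x $ j) * w j (x $ j) * H a j (x $ j) + w j (x $ j) * H' a) * R a" for a
  have "((\<lambda>s. \<Sum>a\<in>A. (w j (x $ j + s) * H a j (x $ j + s) * R a) *\<^sub>R c a) has_vector_derivative
      (\<Sum>a\<in>A. D a *\<^sub>R c a)) (at 0)"
  proof (rule has_vector_derivative_sum)
    fix a assume a: "a \<in> A"
    have w': "((\<lambda>s. w j (x $ j + s)) has_real_derivative ((\<nu> $ j + 1 / 2) / x $ j - x $ j) * w j (x $ j)) (at 0)"
      using has_real_derivative_laguerre_weight[OF xj, of "\<nu> $ j"]
      unfolding w_def by (simp add: DERIV_at_within_shift_lemma[of _ _ "x $ j" 0 UNIV, simplified] add.commute DERIV_shift[of _ _ 0 "x $ j", simplified])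
    have h': "((\<lambda>s. H a j (x $ j + s)) has_real_derivative H' a) (at 0)"
      using H[OF a] by (simp add: add.commute DERIV_shift[of _ _ 0 "x $ j", simplified])
    have "((\<lambda>s. w j (x $ j + s) * H a j (x $ j + s) * R a) has_real_derivative D a) (at 0)"
      unfolding D_def by (rule derivative_eq_intros w' h' refl | simp)+
    then have "((\<lambda>s. w j (x $ j + s) * H a j (x $ j + s) * R a) has_vector_derivative D a) (at 0)"
      by (simp add: has_real_derivative_iff_has_vector_derivative)
    then show "((\<lambda>s. (w j (x $ j + s) * H a j (x $ j + s) * R a) *\<^sub>R c a) has_vector_derivative D a *\<^sub>R c a) (at 0)"
      by (rule bounded_linear.has_vector_derivative[OF bounded_linear_scaleR_left])
  qed
  then have "((\<lambda>s. f (p s)) has_vector_derivative (\<Sum>a\<in>A. D a *\<^sub>R c a)) (at 0)"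
    by (rule has_vector_derivative_transform_within_open[where S = "ball 0 (x $ j)"])
       (use xj fp in auto)
  then have vd: "vector_derivative (\<lambda>s. f (p s)) (at 0) = (\<Sum>a\<in>A. D a *\<^sub>R c a)"
    by (rule vector_derivative_at)
  have fx: "f x = (\<Sum>a\<in>A. (w j (x $ j) * H a j (x $ j) * R a) *\<^sub>R c a)"
    using fp[of 0] xj by (simp add: p_def)
  have prod_if: "(\<Prod>i\<in>UNIV. w i (x $ i) * (if i = j then H' a else H a i (x $ i))) = w j (x $ j) * H' a * R a" for a
  proof -
    have "(\<Prod>i\<in>UNIV. w i (x $ i) * (if i = j then H' a else H a i (x $ i))) = w j (x $ j) * H' a *
        (\<Prod>i\<in>UNIV - {j}. w i (x $ i) * (if i = j then H' a else H a i (x $ i)))"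
      by (subst prod.remove[of _ j]) auto
    also have "(\<Prod>i\<in>UNIV - {j}. w i (x $ i) * (if i = j then H' a else H a i (x $ i))) = R a"
      unfolding R_def by (intro prod.cong) auto
    finally show ?thesis .
  qed
  have "delta \<nu> j f x = (\<Sum>a\<in>A. D a *\<^sub>R c a) + (x $ j - (\<nu> $ j + 1 / 2) / x $ j) *\<^sub>R f x"
    unfolding delta_def using vd by (simp add: p_def)
  also have "\<dots> = (\<Sum>a\<in>A. (w j (x $ j) * H' a * R a) *\<^sub>R c a)"
    unfolding fx scaleR_sum_right sum.distrib[symmetric]
  proof (intro sum.cong refl)
    fix a assume "a \<in> A"
    show "D a *\<^sub>R c a + (x $ j - (\<nu> $ j + 1 / 2) / x $ j) *\<^sub>R (w j (x $ j) * H a j (x $ j) * R a) *\<^sub>R c a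
       = (w j (x $ j) * H' a * R a) *\<^sub>R c a"
      unfolding scaleR_scaleR scaleR_left.add[symmetric] D_def
      by (rule arg_cong[where f = "\<lambda>r. r *\<^sub>R c a"]) (simp add: algebra_simps)
  qed
  also have "\<dots> = (\<Sum>a\<in>A. (\<Prod>i\<in>UNIV. w i (x $ i) * (if i = j then H' a else H a i (x $ i))) *\<^sub>R c a)"
    by (simp add: prod_if)
  finally show ?thesis by (simp add: w_def)
qed

text \<open>Here \<open>H a i p\<close> plays the role of the \<open>p\<close>-th derivative of the \<open>i\<close>-th factor of the
summand \<open>a\<close>. The hypotheses hold on the orthant only, which is enough because it is open.\<close>

lemma delta_pow_weighted_product:
  fixes c :: "'a \<Rightarrow> 'b::real_normed_vector" and \<nu> :: "real ^ 'n::{finite,linorder}"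
  assumes f: "\<And>z. z \<in> Rplus \<Longrightarrow>
      f z = (\<Sum>a\<in>A. (\<Prod>i\<in>UNIV. laguerre_weight (\<nu> $ i) (z $ i) * H a i 0 (z $ i)) *\<^sub>R c a)"
    and H: "\<And>a i p u. a \<in> A \<Longrightarrow> 0 < u \<Longrightarrow> (H a i p has_real_derivative H a i (Suc p) u) (at u)"
    and x: "x \<in> Rplus"
  shows "delta_pow \<nu> k f x =
    (\<Sum>a\<in>A. (\<Prod>i\<in>UNIV. laguerre_weight (\<nu> $ i) (x $ i) * H a i (k $ i) (x $ i)) *\<^sub>R c a)"
proof -
  define F where "F q z = (\<Sum>a\<in>A. (\<Prod>i\<in>UNIV. laguerre_weight (\<nu> $ i) (z $ i) * H a i (q i) (z $ i)) *\<^sub>R c a)"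
    for q and z :: "(real, 'n) vec"
  have step: "delta \<nu> j g x = F (q(j := Suc (q j))) x"
    if g: "\<And>z. z \<in> Rplus \<Longrightarrow> g z = F q z" and x: "x \<in> Rplus" for g q j and x :: "(real, 'n) vec"
  proof -
    have xj: "0 < x $ j" using x by (simp add: Rplus_def)
    have "delta \<nu> j g x = (\<Sum>a\<in>A. (\<Prod>i\<in>UNIV. laguerre_weight (\<nu> $ i) (x $ i) *
        (if i = j then H a j (Suc (q j)) (x $ j) else H a i (q i) (x $ i))) *\<^sub>R c a)"
      by (rule delta_weighted_product[OF x, where H = "\<lambda>a i. H a i (q i)"])
         (use g H xj in \<open>auto simp: F_def\<close>)
    also have "\<dots> = F (q(j := Suc (q j))) x"
      unfolding F_def by (intro sum.cong prod.cong arg_cong2[where f = scaleR] arg_cong2[where f = times] refl) auto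
    finally show ?thesis .
  qed
  have pow: "(delta \<nu> j ^^ p) g x = F (q(j := q j + p)) x"
    if g: "\<And>z. z \<in> Rplus \<Longrightarrow> g z = F q z" and x: "x \<in> Rplus" for g q j p and x :: "(real, 'n) vec"
    using x
  proof (induction p arbitrary: x)
    case 0
    then show ?case using g by simp
  next
    case (Suc p)
    have "(q(j := q j + p))(j := Suc ((q(j := q j + p)) j)) = q(j := q j + Suc p)"
      by (simp add: fun_eq_iff)
    with step[OF Suc.IH Suc.prems, of j] show ?case
      by (simp only: funpow.simps comp_apply)
  qed
  have fold: "fold (\<lambda>j. delta \<nu> j ^^ (k $ j)) js g x = F (\<lambda>i. if i \<in> set js then q i + k $ i else q i) x"
    if "\<And>z. z \<in> Rplus \<Longrightarrow> g z = F q z" and "x \<in> Rplus" and "distinct js" for g q js and x :: "(real, 'n) vec"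
    using that
  proof (induction js arbitrary: g q)
    case Nil
    then show ?case by simp
  next
    case (Cons j js)
    have "fold (\<lambda>j. delta \<nu> j ^^ (k $ j)) (j # js) g x = fold (\<lambda>j. delta \<nu> j ^^ (k $ j)) js ((delta \<nu> j ^^ (k $ j)) g) x"
      by simp
    also have "\<dots> = F (\<lambda>i. if i \<in> set js then (q(j := q j + k $ j)) i + k $ i else (q(j := q j + k $ j)) i) x"
      using Cons.prems by (intro Cons.IH pow) auto
    also have "(\<lambda>i. if i \<in> set js then (q(j := q j + k $ j)) i + k $ i else (q(j := q j + k $ j)) i)
       = (\<lambda>i. if i \<in> set (j # js) then q i + k $ i else q i)"
      using Cons.prems(3) by (auto simp: fun_eq_iff)
    finally show ?case .
  qed
  have "delta_pow \<nu> k f x = F (\<lambda>i. if i \<in> set (sorted_list_of_set (UNIV :: 'n set)) then 0 + k $ i else 0) x"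
    unfolding delta_pow_def by (rule fold) (use f x in \<open>auto simp: F_def\<close>)
  then show ?thesis by (simp add: F_def)
qed

section \<open>Laguerre polynomials\<close>

definition laguerre_poly :: "real \<Rightarrow> nat \<Rightarrow> real \<Rightarrow> real" where
  "laguerre_poly a m u = (\<Sum>i\<le>m. (-1) ^ i / fact i * ((real m + a) gchoose (m - i)) * u ^ i)"

text \<open>Leibniz's formula: \<open>fact j * (c gchoose j)\<close> is the falling factorial that the \<open>j\<close>-th
derivative of a power produces.\<close>

lemma deriv_funpow_exp_powr:
  assumes "0 < u"
  shows "(deriv ^^ p) (\<lambda>v. exp (- v) * v powr c) u =
    (\<Sum>j\<le>p. (-1) ^ (p + j) * real (p choose j) * (fact j * (c gchoose j)) * (exp (- u) * u powr (c - real j)))"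
  using assms
proof (induction p arbitrary: u)
  case 0
  then show ?case by simp
next
  case (Suc p)
  define f where "f j = fact j * (c gchoose j)" for j :: nat
  define x where "x j = exp (- u) * u powr (c - real j)" for j :: nat
  have f_Suc: "f (Suc j) = (c - real j) * f j" for j
  proof -
    have "fact (Suc j) * (c gchoose Suc j) = fact j * (real (Suc j) * (c gchoose Suc j))"
      by (simp add: mult_ac)
    also have "real (Suc j) * (c gchoose Suc j) = (c - real j) * (c gchoose j)"
      using gbinomial_mult_1[of c j] by (simp add: algebra_simps)
    finally show ?thesis by (simp add: f_def)
  qed
  have 1: "((\<lambda>u. \<Sum>j\<le>p. (-1) ^ (p + j) * real (p choose j) * f j * (exp (- u) * u powr (c - real j)))
     has_real_derivative (\<Sum>j\<le>p. (-1) ^ (p + j) * real (p choose j) * f j * ((c - real j) * x (Suc j) - x j))) (at u)"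
  proof (rule DERIV_sum)
    fix j assume "j \<in> {..p}"
    have e: "c - real j - 1 = c - real (Suc j)" by simp
    have "((\<lambda>u. exp (- u) * u powr (c - real j)) has_real_derivative ((c - real j) * x (Suc j) - x j)) (at u)"
      unfolding x_def e[symmetric]
      using Suc.prems by (auto intro!: derivative_eq_intros simp: algebra_simps)
    then show "((\<lambda>u. (-1) ^ (p + j) * real (p choose j) * f j * (exp (- u) * u powr (c - real j)))
       has_real_derivative (-1) ^ (p + j) * real (p choose j) * f j * ((c - real j) * x (Suc j) - x j)) (at u)"
      by (rule DERIV_cmult)
  qed
  have "((deriv ^^ p) (\<lambda>v. exp (- v) * v powr c)
     has_real_derivative (\<Sum>j\<le>p. (-1) ^ (p + j) * real (p choose j) * f j * ((c - real j) * x (Suc j) - x j))) (at u)"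
    by (rule has_field_derivative_transform_within_open[OF 1, of "{0<..}"])
       (use Suc in \<open>auto simp: f_def\<close>)
  then have "(deriv ^^ Suc p) (\<lambda>v. exp (- v) * v powr c) u =
      (\<Sum>j\<le>p. (-1) ^ (p + j) * real (p choose j) * f j * ((c - real j) * x (Suc j) - x j))"
    by (simp add: DERIV_imp_deriv)
  also have "\<dots> = (\<Sum>j\<le>p. (-1) ^ (p + j) * real (p choose j) * f (Suc j) * x (Suc j))
      - (\<Sum>j\<le>p. (-1) ^ (p + j) * real (p choose j) * f j * x j)"
    unfolding sum_subtractf[symmetric] f_Suc by (intro sum.cong refl) (simp add: algebra_simps)
  also have "(\<Sum>j\<le>p. (-1) ^ (p + j) * real (p choose j) * f j * x j)
      = (\<Sum>j\<le>Suc p. (-1) ^ (p + j) * real (p choose j) * f j * x j)"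
    by simp
  also have "\<dots> = (-1) ^ p * f 0 * x 0 - (\<Sum>j\<le>p. (-1) ^ (p + j) * real (p choose Suc j) * f (Suc j) * x (Suc j))"
    by (subst sum.atMost_Suc_shift) (simp add: sum_negf)
  also have "(\<Sum>j\<le>p. (-1) ^ (p + j) * real (p choose j) * f (Suc j) * x (Suc j)) - \<dots>
     = (-1) ^ Suc p * f 0 * x 0 + (\<Sum>j\<le>p. (-1) ^ (p + j) * real (Suc p choose Suc j) * f (Suc j) * x (Suc j))"
    by (simp add: sum.distrib algebra_simps)
  also have "\<dots> = (\<Sum>j\<le>Suc p. (-1) ^ (Suc p + j) * real (Suc p choose j) * f j * x j)"
    by (subst sum.atMost_Suc_shift) simp
  finally show ?case by (simp add: f_def x_def)
qed

lemma laguerre_L_eq: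
  assumes "0 < u"
  shows "laguerre_L a m u = laguerre_poly a m u"
proof -
  have "laguerre_L a m u = (\<Sum>j\<le>m. (-1) ^ (m + j) / fact (m - j) * ((real m + a) gchoose j) * u ^ (m - j))"
    unfolding laguerre_L_def deriv_funpow_exp_powr[OF assms] sum_distrib_left
  proof (intro sum.cong refl)
    fix j assume j: "j \<in> {..m}"
    have u: "u powr (real m + a - real j) = u powr a * u ^ (m - j)"
      using assms j by (simp flip: powr_realpow add: powr_add[symmetric] of_nat_diff algebra_simps)
    have c: "real (m choose j) * fact j / fact m = 1 / fact (m - j)"
      using j by (simp add: binomial_fact)
    have "1 / fact m * exp u * u powr - a *
         ((- 1) ^ (m + j) * real (m choose j) * (fact j * (real m + a gchoose j)) *
          (exp (- u) * u powr (real m + a - real j)))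
       = (real (m choose j) * fact j / fact m) * (exp u * exp (- u)) * (u powr - a * u powr a) *
          ((- 1) ^ (m + j) * (real m + a gchoose j) * u ^ (m - j))"
      unfolding u by (simp add: field_simps)
    also have "\<dots> = (- 1) ^ (m + j) / fact (m - j) * (real m + a gchoose j) * u ^ (m - j)"
      using assms unfolding c by (simp add: exp_minus powr_minus field_simps)
    finally show "1 / fact m * exp u * u powr - a *
         ((- 1) ^ (m + j) * real (m choose j) * (fact j * (real m + a gchoose j)) *
          (exp (- u) * u powr (real m + a - real j))) = (- 1) ^ (m + j) / fact (m - j) * (real m + a gchoose j) * u ^ (m - j)" .
  qed
  also have "\<dots> = laguerre_poly a m u"
    unfolding laguerre_poly_def
    by (rule sum.reindex_bij_witness[of _ "\<lambda>i. m - i" "\<lambda>i. m - i"])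
       (auto simp: uminus_power_if)
  finally show ?thesis .
qed

lemma laguerre_poly_0 [simp]: "laguerre_poly a 0 u = 1"
  by (simp add: laguerre_poly_def)

lemma has_real_derivative_laguerre_poly:
  "(laguerre_poly a (Suc m) has_real_derivative - laguerre_poly (a + 1) m u) (at u)"
proof -
  have par: "real (Suc m) + a = real m + (a + 1)" by simp
  have "(laguerre_poly a (Suc m) has_real_derivative
    (\<Sum>i\<le>Suc m. (-1) ^ i / fact i * ((real (Suc m) + a) gchoose (Suc m - i)) * (real i * u ^ (i - 1)))) (at u)"
    unfolding laguerre_poly_def[abs_def]
    by (rule DERIV_sum) (auto intro!: derivative_eq_intros)
  also have "(\<Sum>i\<le>Suc m. (-1) ^ i / fact i * ((real (Suc m) + a) gchoose (Suc m - i)) * (real i * u ^ (i - 1)))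
     = - laguerre_poly (a + 1) m u"
    unfolding laguerre_poly_def sum_negf[symmetric] par
    by (subst sum.atMost_Suc_shift) (auto intro!: sum.cong simp: field_simps simp del: of_nat_Suc)
  finally show ?thesis .
qed

text \<open>Pascal's rule in each coefficient.\<close>

lemma laguerre_poly_Suc_parameter:
  "laguerre_poly (a + 1) (Suc m) u = laguerre_poly (a + 1) m u + laguerre_poly a (Suc m) u"
proof -
  have g: "((real (Suc m) + (a + 1)) gchoose (Suc m - i)) = ((real m + (a + 1)) gchoose (m - i)) + ((real (Suc m) + a) gchoose (Suc m - i))"
    if "i \<le> m" for i
    using gbinomial_Suc_Suc[of "real m + (a + 1)" "m - i"] that by (simp add: Suc_diff_le algebra_simps)
  show ?thesis
  proof -
    have "(\<Sum>i\<le>m. (-1) ^ i / fact i * ((real (Suc m) + (a + 1)) gchoose (Suc m - i)) * u ^ i)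
       = (\<Sum>i\<le>m. (-1) ^ i / fact i * ((real m + (a + 1)) gchoose (m - i)) * u ^ i
           + (-1) ^ i / fact i * ((real (Suc m) + a) gchoose (Suc m - i)) * u ^ i)"
    proof (intro sum.cong refl)
      fix i assume "i \<in> {..m}"
      then have "i \<le> m" by simp
      show "(-1) ^ i / fact i * ((real (Suc m) + (a + 1)) gchoose (Suc m - i)) * u ^ i
          = (-1) ^ i / fact i * ((real m + (a + 1)) gchoose (m - i)) * u ^ i
           + (-1) ^ i / fact i * ((real (Suc m) + a) gchoose (Suc m - i)) * u ^ i"
        unfolding g[OF \<open>i \<le> m\<close>] by (simp only: distrib_left distrib_right)
    qed
    then show ?thesis
      unfolding laguerre_poly_def sum.atMost_Suc sum.distrib by simp
  qed
qed

lemma laguerre_poly_eq_sum: "laguerre_poly (a + 1) m u = (\<Sum>l\<le>m. laguerre_poly a l u)"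
  by (induction m) (simp_all add: laguerre_poly_Suc_parameter)

text \<open>The absorption identity for binomial coefficients. Since the derivative of the polynomial with
parameter \<open>a\<close> has parameter \<open>a + 1\<close>, this evaluates \<open>u\<close> times a derivative.\<close>

lemma laguerre_poly_mult_arg:
  "- u * laguerre_poly (a + 1) n u =
     real (Suc n) * laguerre_poly a (Suc n) u - (real (Suc n) + a) * laguerre_poly a n u"
proof -
  define c where "c = real (Suc n) + a"
  have g: "real (Suc n - i) * (c gchoose (Suc n - i)) = c * ((real n + a) gchoose (n - i))" if "i \<le> n" for i
    using gbinomial_absorption[of "n - i" c] that
    by (simp add: c_def Suc_diff_le algebra_simps del: of_nat_Suc) (simp add: algebra_simps)
  have "- u * laguerre_poly (a + 1) n u = (\<Sum>i\<le>n. (-1) ^ Suc i / fact i * (c gchoose (n - i)) * u ^ Suc i)"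
    unfolding laguerre_poly_def sum_distrib_left by (intro sum.cong refl) (simp add: c_def algebra_simps)
  also have "\<dots> = (\<Sum>i\<le>Suc n. (-1) ^ i / fact i * (real i * (c gchoose (Suc n - i))) * u ^ i)"
    by (subst sum.atMost_Suc_shift) (auto intro!: sum.cong simp: field_simps simp del: of_nat_Suc)
  also have "\<dots> = (\<Sum>i\<le>n. (-1) ^ i / fact i * (real i * (c gchoose (Suc n - i))) * u ^ i)
      + (-1) ^ Suc n / fact (Suc n) * real (Suc n) * u ^ Suc n"
    by simp
  also have "(\<Sum>i\<le>n. (-1) ^ i / fact i * (real i * (c gchoose (Suc n - i))) * u ^ i) =
     (\<Sum>i\<le>n. real (Suc n) * ((-1) ^ i / fact i * (c gchoose (Suc n - i)) * u ^ i) - c * ((-1) ^ i / fact i * ((real n + a) gchoose (n - i)) * u ^ i))"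
  proof (intro sum.cong refl)
    fix i assume i: "i \<in> {..n}"
    then have "real i * (c gchoose (Suc n - i)) = real (Suc n) * (c gchoose (Suc n - i)) - c * ((real n + a) gchoose (n - i))"
      using g[of i] by (simp add: of_nat_diff algebra_simps)
    then show "(-1) ^ i / fact i * (real i * (c gchoose (Suc n - i))) * u ^ i = real (Suc n) * ((-1) ^ i / fact i * (c gchoose (Suc n - i)) * u ^ i) - c * ((-1) ^ i / fact i * ((real n + a) gchoose (n - i)) * u ^ i)"
      by (simp only:) (simp add: algebra_simps add_divide_distrib)
  qed
  also have "\<dots> + (-1) ^ Suc n / fact (Suc n) * real (Suc n) * u ^ Suc n
    = real (Suc n) * (\<Sum>i\<le>Suc n. (-1) ^ i / fact i * (c gchoose (Suc n - i)) * u ^ i) - c * laguerre_poly a n u"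
    unfolding laguerre_poly_def sum_subtractf sum_distrib_left[symmetric] by (simp add: algebra_simps)
  finally show ?thesis by (simp add: laguerre_poly_def c_def)
qed

section \<open>Triangular matrices and Schur's test\<close>

definition schur_weight :: "nat \<Rightarrow> real" where "schur_weight m = sqrt (real (Suc m))"

text \<open>The hypotheses of Schur's test, with the weights \<open>1 / schur_weight\<close>, for the upper triangular
matrix \<open>D l m / schur_weight m ^ p\<close>; the number \<open>p\<close> will be an order of differentiation. Rows
are infinite, so their sums are bounded through finite partial sums.\<close>

definition schur_bounded :: "nat \<Rightarrow> (nat \<Rightarrow> nat \<Rightarrow> real) \<Rightarrow> bool" where
  "schur_bounded p D \<longleftrightarrow> (\<forall>l m. m < l \<longrightarrow> D l m = 0) \<and>
     (\<exists>C\<ge>0. (\<forall>m. (\<Sum>l\<le>m. \<bar>D l m\<bar> / schur_weight l) \<le> C * schur_weight m ^ p / schur_weight m) \<and>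
           (\<forall>l N. (\<Sum>m\<le>N. \<bar>D l m\<bar> / schur_weight m ^ p / schur_weight m) \<le> C / schur_weight l))"

lemma schur_weight_pos [simp]: "0 < schur_weight m"
  by (simp add: schur_weight_def)

lemma schur_weight_mono: "l \<le> m \<Longrightarrow> schur_weight l \<le> schur_weight m"
  by (simp add: schur_weight_def)

lemma schur_weight_sq: "schur_weight m * schur_weight m = real (Suc m)"
  by (simp add: schur_weight_def)

lemma schur_bounded_upper_triangular: "schur_bounded p D \<Longrightarrow> m < l \<Longrightarrow> D l m = 0"
  by (simp add: schur_bounded_def)

lemma schur_bounded_bounds:
  "schur_bounded p D \<Longrightarrow> \<exists>C. 0 \<le> C \<and> (\<forall>m. (\<Sum>l\<le>m. \<bar>D l m\<bar> / schur_weight l) \<le> C * schur_weight m ^ p / schur_weight m) \<and>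
     (\<forall>l N. (\<Sum>m\<le>N. \<bar>D l m\<bar> / schur_weight m ^ p / schur_weight m) \<le> C / schur_weight l)"
  unfolding schur_bounded_def by (elim conjE)

text \<open>In a product only intermediate indices \<open>q \<le> m\<close> occur, and then dividing by \<open>schur_weight m\<close>
instead of \<open>schur_weight q\<close> makes the entries smaller. So of the \<open>p + 1\<close> normalising factors one can be
given to \<open>S\<close>, and Schur's conditions for the two matrices compose.\<close>

lemma schur_bounded_compose:
  assumes "schur_bounded 1 S" "schur_bounded p D"
  shows "schur_bounded (Suc p) (\<lambda>l m. \<Sum>q\<le>m. S l q * D q m)"
proof -
  let ?s = schur_weight
  obtain C1 where S0: "\<And>l m. m < l \<Longrightarrow> S l m = 0" and C1: "C1 \<ge> 0"
    and Sc: "\<And>m. (\<Sum>l\<le>m. \<bar>S l m\<bar> / ?s l) \<le> C1"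
    and Sr: "\<And>l N. (\<Sum>m\<le>N. \<bar>S l m\<bar> / ?s m / ?s m) \<le> C1 / ?s l"
    using assms(1) unfolding schur_bounded_def by (auto simp: less_imp_neq[OF schur_weight_pos, symmetric])
  obtain C2 where D0: "\<And>l m. m < l \<Longrightarrow> D l m = 0" and C2: "C2 \<ge> 0"
    and Dc: "\<And>m. (\<Sum>l\<le>m. \<bar>D l m\<bar> / ?s l) \<le> C2 * ?s m ^ p / ?s m"
    and Dr: "\<And>l N. (\<Sum>m\<le>N. \<bar>D l m\<bar> / ?s m ^ p / ?s m) \<le> C2 / ?s l"
    using assms(2) unfolding schur_bounded_def by blast
  have s0: "?s m \<noteq> 0" "0 \<le> ?s m" for m by (auto simp: schur_weight_def)
  have col: "(\<Sum>l\<le>m. \<bar>\<Sum>q\<le>m. S l q * D q m\<bar> / ?s l) \<le> (C1 * C2) * ?s m ^ Suc p / ?s m" for m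
  proof -
    have "(\<Sum>l\<le>m. \<bar>\<Sum>q\<le>m. S l q * D q m\<bar> / ?s l) \<le> (\<Sum>l\<le>m. \<Sum>q\<le>m. \<bar>D q m\<bar> * (\<bar>S l q\<bar> / ?s l))"
      using s0 by (intro sum_mono) (auto simp: sum_divide_distrib[symmetric] abs_mult[symmetric] mult_ac times_divide_eq_right[symmetric] simp del: times_divide_eq_right intro!: divide_right_mono sum_abs simp add: times_divide_eq_right)
    also have "\<dots> = (\<Sum>q\<le>m. \<bar>D q m\<bar> * (\<Sum>l\<le>m. \<bar>S l q\<bar> / ?s l))"
      by (subst sum.swap) (simp add: sum_distrib_left)
    also have "\<dots> \<le> (\<Sum>q\<le>m. \<bar>D q m\<bar> * C1)"
    proof (intro sum_mono mult_left_mono)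
      fix q assume q: "q \<in> {..m}"
      have "(\<Sum>l\<le>m. \<bar>S l q\<bar> / ?s l) = (\<Sum>l\<le>q. \<bar>S l q\<bar> / ?s l)"
        using q by (intro sum.mono_neutral_right) (auto simp: S0)
      then show "(\<Sum>l\<le>m. \<bar>S l q\<bar> / ?s l) \<le> C1" using Sc[of q] by simp
    qed auto
    also have "\<dots> \<le> (\<Sum>q\<le>m. C1 * ?s m * (\<bar>D q m\<bar> / ?s q))"
    proof (intro sum_mono)
      fix q assume q: "q \<in> {..m}"
      have "1 \<le> ?s m / ?s q" using schur_weight_mono[of q m] q by (simp add: divide_simps s0)
      then have "\<bar>D q m\<bar> * C1 * 1 \<le> \<bar>D q m\<bar> * C1 * (?s m / ?s q)"
        using C1 by (intro mult_left_mono) auto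
      then show "\<bar>D q m\<bar> * C1 \<le> C1 * ?s m * (\<bar>D q m\<bar> / ?s q)" by (simp add: mult_ac)
    qed
    also have "\<dots> \<le> C1 * ?s m * (C2 * ?s m ^ p / ?s m)"
      unfolding sum_distrib_left[symmetric] using C1 s0 by (intro mult_left_mono Dc) auto
    finally show ?thesis by (simp add: mult_ac)
  qed
  have row: "(\<Sum>m\<le>N. \<bar>\<Sum>q\<le>m. S l q * D q m\<bar> / ?s m ^ Suc p / ?s m) \<le> (C1 * C2) / ?s l" for l N
  proof -
    have "(\<Sum>m\<le>N. \<bar>\<Sum>q\<le>m. S l q * D q m\<bar> / ?s m ^ Suc p / ?s m)
       \<le> (\<Sum>m\<le>N. \<Sum>q\<le>N. \<bar>S l q\<bar> / ?s q * (\<bar>D q m\<bar> / ?s m ^ p / ?s m))"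
    proof (intro sum_mono)
      fix m assume m: "m \<in> {..N}"
      have "\<bar>\<Sum>q\<le>m. S l q * D q m\<bar> / ?s m ^ Suc p / ?s m \<le> (\<Sum>q\<le>m. \<bar>S l q * D q m\<bar>) / ?s m ^ Suc p / ?s m"
        using s0 by (intro divide_right_mono sum_abs) auto
      also have "\<dots> = (\<Sum>q\<le>m. \<bar>S l q\<bar> / ?s m * (\<bar>D q m\<bar> / ?s m ^ p / ?s m))"
        by (simp add: sum_divide_distrib abs_mult mult_ac)
      also have "\<dots> \<le> (\<Sum>q\<le>m. \<bar>S l q\<bar> / ?s q * (\<bar>D q m\<bar> / ?s m ^ p / ?s m))"
        using s0 schur_weight_mono by (intro sum_mono mult_right_mono divide_left_mono) (auto simp: zero_less_mult_iff)
      also have "\<dots> \<le> (\<Sum>q\<le>N. \<bar>S l q\<bar> / ?s q * (\<bar>D q m\<bar> / ?s m ^ p / ?s m))"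
        using m s0 by (intro sum_mono2) auto
      finally show "\<bar>\<Sum>q\<le>m. S l q * D q m\<bar> / ?s m ^ Suc p / ?s m \<le> (\<Sum>q\<le>N. \<bar>S l q\<bar> / ?s q * (\<bar>D q m\<bar> / ?s m ^ p / ?s m))" .
    qed
    also have "\<dots> = (\<Sum>q\<le>N. \<bar>S l q\<bar> / ?s q * (\<Sum>m\<le>N. \<bar>D q m\<bar> / ?s m ^ p / ?s m))"
      by (subst sum.swap) (simp add: sum_distrib_left)
    also have "\<dots> \<le> (\<Sum>q\<le>N. \<bar>S l q\<bar> / ?s q * (C2 / ?s q))"
      using s0 by (intro sum_mono mult_left_mono Dr) auto
    also have "\<dots> = C2 * (\<Sum>q\<le>N. \<bar>S l q\<bar> / ?s q / ?s q)"
      by (simp add: sum_distrib_left mult_ac)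
    also have "\<dots> \<le> C2 * (C1 / ?s l)"
      using C2 by (intro mult_left_mono Sr)
    finally show ?thesis by (simp add: mult_ac)
  qed
  have zero: "(\<Sum>q\<le>m. S l q * D q m) = 0" if "m < l" for l m
    using that by (intro sum.neutral) (auto simp: S0)
  show ?thesis
    unfolding schur_bounded_def
    using col row zero C1 C2 by (intro conjI exI[of _ "C1 * C2"]) auto
qed

definition laguerre_norm :: "real \<Rightarrow> nat \<Rightarrow> real" where
  "laguerre_norm a m = sqrt (2 * Gamma (real m + 1) / Gamma (real m + a + 1))"

lemma Gamma_pos_shift: "-1 < a \<Longrightarrow> 0 < Gamma (real m + a + 1)"
  by (intro Gamma_real_pos) auto

lemma laguerre_norm_pos: "-1 < a \<Longrightarrow> 0 < laguerre_norm a m"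
  unfolding laguerre_norm_def by (simp add: Gamma_pos_shift Gamma_real_pos)

lemma laguerre_norm_parameter:
  assumes "-1 < a"
  shows "laguerre_norm (a + 1) m = laguerre_norm a m / sqrt (real m + a + 1)"
proof -
  have "real m + a + 1 \<notin> \<int>\<^sub>\<le>\<^sub>0"
    using assms by (intro notI) (auto elim!: nonpos_Ints_cases)
  then have "Gamma (real m + (a + 1) + 1) = (real m + a + 1) * Gamma (real m + a + 1)"
    using Gamma_plus1[of "real m + a + 1"] by (simp add: add_ac)
  then show ?thesis
    unfolding laguerre_norm_def by (simp add: real_sqrt_divide[symmetric] real_sqrt_mult[symmetric] mult_ac)
qed

lemma laguerre_norm_Suc:
  assumes "-1 < a"
  shows "laguerre_norm a (Suc m) = laguerre_norm a m * sqrt (real (Suc m) / (real m + a + 1))"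
proof -
  have "real m + a + 1 \<notin> \<int>\<^sub>\<le>\<^sub>0"
    using assms by (intro notI) (auto elim!: nonpos_Ints_cases)
  then have 1: "Gamma (real (Suc m) + a + 1) = (real m + a + 1) * Gamma (real m + a + 1)"
    using Gamma_plus1[of "real m + a + 1"] by (simp add: add_ac)
  have 2: "Gamma (real (Suc m) + 1) = real (Suc m) * Gamma (real m + 1)"
    using Gamma_plus1[of "real m + 1"] by (simp add: add_ac nonpos_Ints_def)
  show ?thesis
    unfolding laguerre_norm_def 1 2 by (simp only: real_sqrt_mult[symmetric]) (simp add: mult_ac)
qed

lemma phi1_eq:
  assumes "0 < u"
  shows "phi1 a m u = laguerre_weight a u * (laguerre_norm a m * laguerre_poly a m (u\<^sup>2))"
  unfolding phi1_def laguerre_norm_def laguerre_weight_def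
  using assms by (simp add: laguerre_L_eq mult_ac)

text \<open>Times \<open>laguerre_weight a u\<close>, this is the Laguerre function of parameter \<open>a\<close> or, if \<open>e\<close> holds,
of parameter \<open>a + 1\<close>: the derivatives of the first kind of factor are of the second kind and conversely.\<close>

definition laguerre_factor :: "real \<Rightarrow> bool \<Rightarrow> nat \<Rightarrow> real \<Rightarrow> real" where
  "laguerre_factor a e m u = (if e then u * (laguerre_norm (a + 1) m * laguerre_poly (a + 1) m (u\<^sup>2))
     else laguerre_norm a m * laguerre_poly a m (u\<^sup>2))"

text \<open>For \<open>e = False\<close> the classical lowering relation, in which the degree drops by one. For
\<open>e = True\<close> the parameter returns from \<open>a + 1\<close> to \<open>a\<close>, and the full column of entries comes from
expanding the polynomial of parameter \<open>a + 1\<close> in those of parameter \<open>a\<close>.\<close>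

definition derivative_matrix :: "real \<Rightarrow> bool \<Rightarrow> nat \<Rightarrow> nat \<Rightarrow> real" where
  "derivative_matrix a e l m =
     (if e then (if l < m then - (2 * a + 1) * (laguerre_norm (a + 1) m / laguerre_norm a l)
                 else if l = m then (2 * real m + 1) * (laguerre_norm (a + 1) m / laguerre_norm a m) else 0)
      else if m = Suc l then - 2 * sqrt (real m) else 0)"

text \<open>If \<open>e\<close> holds, the product rule gives \<open>L + 2 y L'\<close> with \<open>y = u\<^sup>2\<close>, and
\<open>laguerre_poly_mult_arg\<close> turns \<open>y L'\<close> into polynomials of parameter \<open>a + 1\<close>, which are sums of those
of parameter \<open>a\<close>.\<close>

lemma has_real_derivative_laguerre_factor:
  assumes a: "-1 < a"
  shows "(laguerre_factor a e m has_real_derivative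
     (\<Sum>l\<le>m. derivative_matrix a e l m * laguerre_factor a (\<not> e) l u)) (at u)"
proof (cases e)
  case False
  show ?thesis
  proof (cases m)
    case 0
    then show ?thesis using False by (simp add: laguerre_factor_def[abs_def] derivative_matrix_def)
  next
    case (Suc n)
    have N: "laguerre_norm a (Suc n) = sqrt (real (Suc n)) * laguerre_norm (a + 1) n"
      using a by (simp add: laguerre_norm_Suc laguerre_norm_parameter real_sqrt_divide)
    have "(laguerre_factor a e m has_real_derivative
        laguerre_norm a (Suc n) * (- laguerre_poly (a + 1) n (u\<^sup>2) * (2 * u))) (at u)"
      unfolding laguerre_factor_def[abs_def] Suc using False
      by (auto intro!: derivative_eq_intros DERIV_chain2[OF has_real_derivative_laguerre_poly])
    also have "laguerre_norm a (Suc n) * (- laguerre_poly (a + 1) n (u\<^sup>2) * (2 * u)) =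
       (\<Sum>l\<in>{n}. derivative_matrix a e l m * laguerre_factor a (\<not> e) l u)"
      using False by (simp add: derivative_matrix_def laguerre_factor_def N Suc)
    also have "\<dots> = (\<Sum>l\<le>m. derivative_matrix a e l m * laguerre_factor a (\<not> e) l u)"
      by (intro sum.mono_neutral_left) (auto simp: Suc derivative_matrix_def False)
    finally show ?thesis .
  qed
next
  case True
  define y where "y = u\<^sup>2"
  define c where "c = laguerre_norm (a + 1) m"
  have deriv: "\<exists>d. (laguerre_poly (a + 1) m has_real_derivative d) (at y) \<and>
      laguerre_poly (a + 1) m y + 2 * (y * d) = (2 * real m + 1) * laguerre_poly a m y - (2 * a + 1) * (\<Sum>l<m. laguerre_poly a l y)"
  proof (cases m)
    case 0
    then show ?thesis by (intro exI[of _ 0]) (simp add: laguerre_poly_def[abs_def])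
  next
    case (Suc n)
    have 1: "y * - laguerre_poly (a + 1 + 1) n y = real (Suc n) * laguerre_poly (a + 1) (Suc n) y - (real (Suc n) + (a + 1)) * laguerre_poly (a + 1) n y"
      using laguerre_poly_mult_arg[of y "a + 1" n] by simp
    have 2: "(\<Sum>l<m. laguerre_poly a l y) = laguerre_poly (a + 1) n y"
      by (simp add: Suc laguerre_poly_eq_sum lessThan_Suc_atMost)
    show ?thesis
      using has_real_derivative_laguerre_poly[of "a + 1" n y] unfolding 2[unfolded Suc] Suc
      by (intro exI[of _ "- laguerre_poly (a + 1 + 1) n y"] conjI) (simp_all only: 1 laguerre_poly_Suc_parameter, simp add: algebra_simps)
  qed
  then obtain d where d: "(laguerre_poly (a + 1) m has_real_derivative d) (at y)"
    and e: "laguerre_poly (a + 1) m y + 2 * (y * d) = (2 * real m + 1) * laguerre_poly a m y - (2 * a + 1) * (\<Sum>l<m. laguerre_poly a l y)"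
    by blast
  have "(laguerre_factor a e m has_real_derivative c * (laguerre_poly (a + 1) m y + 2 * (y * d))) (at u)"
  proof -
    have "((\<lambda>v. laguerre_poly (a + 1) m (v\<^sup>2)) has_real_derivative d * (2 * u)) (at u)"
      by (rule DERIV_chain2[where f = "laguerre_poly (a + 1) m"]) (use d in \<open>auto intro!: derivative_eq_intros simp: y_def\<close>)
    then show ?thesis
      unfolding laguerre_factor_def[abs_def] using True
      by (auto intro!: derivative_eq_intros simp: y_def c_def algebra_simps power2_eq_square)
  qed
  also have "c * (laguerre_poly (a + 1) m y + 2 * (y * d)) =
     (\<Sum>l<m. - (2 * a + 1) * c * laguerre_poly a l y) + (2 * real m + 1) * c * laguerre_poly a m y"
    unfolding e sum_distrib_left[symmetric] by (simp add: algebra_simps)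
  also have "\<dots> = (\<Sum>l\<le>m. derivative_matrix a e l m * laguerre_factor a (\<not> e) l u)"
    using True a laguerre_norm_pos[OF a] unfolding lessThan_Suc_atMost[symmetric] sum.lessThan_Suc
    by (auto simp: derivative_matrix_def laguerre_factor_def y_def c_def less_imp_neq[symmetric] intro!: sum.cong)
  finally show ?thesis .
qed

lemma schur_bounded_lowering: "schur_bounded 1 (derivative_matrix a False)"
proof -
  let ?s = schur_weight
  have s0: "0 \<le> ?s m" "?s m \<noteq> 0" for m by (auto simp: schur_weight_def)
  have col: "(\<Sum>l\<le>m. \<bar>derivative_matrix a False l m\<bar> / ?s l) \<le> 2" for m
  proof (cases m)
    case (Suc n)
    have "(\<Sum>l\<le>m. \<bar>derivative_matrix a False l m\<bar> / ?s l) = (\<Sum>l\<in>{n}. \<bar>derivative_matrix a False l m\<bar> / ?s l)"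
      by (intro sum.mono_neutral_right) (auto simp: Suc derivative_matrix_def)
    also have "\<dots> \<le> 2"
      by (simp add: Suc derivative_matrix_def schur_weight_def del: of_nat_Suc)
    finally show ?thesis .
  qed (simp add: derivative_matrix_def)
  have row: "(\<Sum>m\<le>N. \<bar>derivative_matrix a False l m\<bar> / ?s m / ?s m) \<le> 2 / ?s l" for l N
  proof -
    have "(\<Sum>m\<le>N. \<bar>derivative_matrix a False l m\<bar> / ?s m / ?s m) =
        (\<Sum>m\<in>{..N} \<inter> {Suc l}. \<bar>derivative_matrix a False l m\<bar> / ?s m / ?s m)"
      by (intro sum.mono_neutral_right) (auto simp: derivative_matrix_def)
    also have "\<dots> \<le> (\<Sum>m\<in>{Suc l}. \<bar>derivative_matrix a False l m\<bar> / ?s m / ?s m)"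
      using s0 by (intro sum_mono2) auto
    also have "\<dots> = 2 * ?s l / real (Suc (Suc l))"
      using schur_weight_sq[of "Suc l"] by (simp add: derivative_matrix_def schur_weight_def)
    also have "\<dots> \<le> 2 / ?s l"
      using schur_weight_sq[of l] by (simp add: divide_simps s0)
    finally show ?thesis .
  qed
  show ?thesis unfolding schur_bounded_def using col row s0
    by (intro conjI exI[of _ 2]) (auto simp: derivative_matrix_def)
qed

text \<open>Above the diagonal, \<open>derivative_matrix a True\<close> divided by \<open>schur_weight m\<close> is comparable with
\<open>R l * r m / schur_weight m\<close>, where \<open>R l\<close> grows like \<open>l^(a/2)\<close> and \<open>r m\<close> decays like
\<open>m^(-(a+1)/2)\<close>. This is Hardy's kernel. Instead of the asymptotics of Gamma functions, the recurrences for
\<open>R\<close> and \<open>r\<close> are used to compare the sums in Schur's test with telescoping ones.\<close>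

context
  fixes a :: real and R r :: "nat \<Rightarrow> real"
  assumes a: "- 1 / 2 \<le> a"
  defines "R m \<equiv> 1 / laguerre_norm a m"
  defines "r m \<equiv> 1 / (R m * schur_weight m)"
begin

lemma inverse_norm_pos: "0 < R m"
  using a laguerre_norm_pos[of a m] by (simp add: R_def)

lemma inverse_norm_Suc: "R (Suc m) = R m * sqrt ((real m + a + 1) / real (Suc m))"
  using a by (simp add: R_def laguerre_norm_Suc real_sqrt_divide)

text \<open>A discrete form of integrating a power. The constant 8 and the shift by one half are chosen
such that the induction step closes for every \<open>a \<ge> - 1/2\<close>, the extreme case included.\<close>

lemma sum_inverse_norm_le: "(\<Sum>l\<le>m. R l / schur_weight l) \<le> 8 * (real m + 1 / 2) * R m / schur_weight m"
proof (induction m)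
  case 0
  then show ?case using inverse_norm_pos[of 0] by (simp add: schur_weight_def)
next
  case (Suc m)
  let ?q = "R (Suc m) / schur_weight (Suc m)"
  have "8 * (real m + 1 / 2) * sqrt ((real m + 2) / (real m + 1 / 2)) \<le> 8 * real m + 11"
  proof (rule power2_le_imp_le)
    have "(8 * (real m + 1 / 2) * sqrt ((real m + 2) / (real m + 1 / 2)))\<^sup>2 = 64 * (real m + 1 / 2) * (real m + 2)"
    proof -
      define y where "y = real m + 1 / 2"
      have "0 < y" by (simp add: y_def)
      then have "(8 * y * sqrt ((real m + 2) / y))\<^sup>2 = 64 * y * (real m + 2)"
        by (simp add: power_mult_distrib) (simp add: power2_eq_square)
      then show ?thesis by (simp add: y_def)
    qed
    also have "\<dots> \<le> (8 * real m + 11)\<^sup>2"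
      by (simp add: power2_eq_square algebra_simps)
    finally show "(8 * (real m + 1 / 2) * sqrt ((real m + 2) / (real m + 1 / 2)))\<^sup>2 \<le> (8 * real m + 11)\<^sup>2" .
  qed simp
  moreover have "R m / schur_weight m \<le> sqrt ((real m + 2) / (real m + 1 / 2)) * ?q"
  proof -
    have p: "1 \<le> sqrt ((real m + 2) / (real m + 1 / 2)) * sqrt ((real m + a + 1) / real (Suc m)) * (schur_weight m / schur_weight (Suc m))"
    proof -
      define S y where "S = real (Suc m)" and "y = real m + 1 / 2"
      have S: "0 < S" "0 < y" "real (Suc (Suc m)) = real m + 2" by (auto simp: S_def y_def)
      have "1 \<le> sqrt ((real m + a + 1) / y)"
        using a S by (simp add: y_def)
      also have "(real m + a + 1) / y = (real m + 2) / y * ((real m + a + 1) / S) * (S / (real m + 2))"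
        using S by simp
      finally show ?thesis
        unfolding schur_weight_def S(3) S_def[symmetric] y_def[symmetric] real_sqrt_divide[symmetric] real_sqrt_mult[symmetric] .
    qed
    have "R m / schur_weight m * 1 \<le> R m / schur_weight m * (sqrt ((real m + 2) / (real m + 1 / 2)) * sqrt ((real m + a + 1) / real (Suc m)) * (schur_weight m / schur_weight (Suc m)))"
      using inverse_norm_pos[of m] schur_weight_pos[of m] by (intro mult_left_mono p divide_nonneg_pos) auto
    also have "\<dots> = sqrt ((real m + 2) / (real m + 1 / 2)) * ?q"
      by (simp add: inverse_norm_Suc schur_weight_def)
    finally show ?thesis by simp
  qed
  ultimately have "8 * (real m + 1 / 2) * (R m / schur_weight m) \<le> (8 * real m + 11) * ?q"
  proof -
    assume 1: "8 * (real m + 1 / 2) * sqrt ((real m + 2) / (real m + 1 / 2)) \<le> 8 * real m + 11"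
      and 2: "R m / schur_weight m \<le> sqrt ((real m + 2) / (real m + 1 / 2)) * ?q"
    have "8 * (real m + 1 / 2) * (R m / schur_weight m) \<le> 8 * (real m + 1 / 2) * (sqrt ((real m + 2) / (real m + 1 / 2)) * ?q)"
      using 2 by (intro mult_left_mono) auto
    also have "\<dots> = 8 * (real m + 1 / 2) * sqrt ((real m + 2) / (real m + 1 / 2)) * ?q"
      by simp
    also have "\<dots> \<le> (8 * real m + 11) * ?q"
      using 1 inverse_norm_pos[of "Suc m"] by (intro mult_right_mono divide_nonneg_pos) auto
    finally show ?thesis .
  qed
  then have "(\<Sum>l\<le>Suc m. R l / schur_weight l) \<le> (8 * real m + 11) * ?q + ?q"
    using Suc.IH by simp
  also have "\<dots> = 8 * (real (Suc m) + 1 / 2) * ?q" by (simp add: algebra_simps)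
  finally show ?case by simp
qed

lemma scaled_norm_pos: "0 < r m" using inverse_norm_pos by (simp add: r_def)

lemma scaled_norm_Suc: "r (Suc m) = r m * sqrt ((real (Suc m))\<^sup>2 / ((real m + 2) * (real m + a + 1)))"
proof -
  have "r (Suc m) = 1 / (R m * (sqrt ((real m + a + 1) / real (Suc m)) * sqrt (real m + 2)))"
    by (simp add: r_def inverse_norm_Suc schur_weight_def add.commute)
  also have "sqrt ((real m + a + 1) / real (Suc m)) * sqrt (real m + 2) =
      schur_weight m * sqrt (((real m + 2) * (real m + a + 1)) / (real (Suc m))\<^sup>2)"
  proof -
    define S where "S = real (Suc m)"
    have "0 < S" by (simp add: S_def)
    then show ?thesis
      unfolding schur_weight_def real_sqrt_mult[symmetric] S_def[symmetric]
      by (simp add: power2_eq_square mult_ac)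
  qed
  finally show ?thesis
    by (simp add: r_def real_sqrt_divide)
qed

lemma scaled_norm_decreasing: "r (Suc m) \<le> r m"
proof -
  have "(real (Suc m))\<^sup>2 \<le> (real m + 2) * (real m + 1 / 2)"
    if "m \<ge> 1" using that by (simp add: power2_eq_square algebra_simps)
  moreover have "(real (Suc m))\<^sup>2 \<le> (real m + 2) * (real m + 1 / 2)" if "m = 0"
    using that by simp
  moreover have "(real m + 2) * (real m + 1 / 2) \<le> (real m + 2) * (real m + a + 1)"
    using a by (intro mult_left_mono) auto
  ultimately have "(real (Suc m))\<^sup>2 \<le> (real m + 2) * (real m + a + 1)"
    by (cases "m = 0") (auto intro: order_trans simp del: of_nat_Suc)
  then have "sqrt ((real (Suc m))\<^sup>2 / ((real m + 2) * (real m + a + 1))) \<le> 1"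
    using a by (simp add: divide_le_eq)
  then show ?thesis
    unfolding scaled_norm_Suc using scaled_norm_pos[of m] by (simp add: mult_left_le)
qed

text \<open>The differences of a decreasing power dominate its quotients by the index. For \<open>m = 0\<close> this
can fail: if \<open>a = - 1/2\<close>, then \<open>r\<close> takes the same value at 0 and 1. Strictly above the diagonal, only
\<open>m \<ge> 1\<close> occurs.\<close>

lemma scaled_norm_le_increment:
  assumes "1 \<le> m"
  shows "r m / real (Suc m) \<le> 16 * (r m - r (Suc m))"
proof -
  define n where "n = real (Suc m)"
  have n: "n \<ge> 2" using assms by (simp add: n_def)
  have "sqrt (n\<^sup>2 / ((real m + 2) * (real m + a + 1))) \<le> 1 - 1 / (16 * n)"
  proof (rule real_le_lsqrt)
    have "n\<^sup>2 / ((real m + 2) * (real m + a + 1)) \<le> n\<^sup>2 / ((n + 1) * (n - 1 / 2))"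
      using n a by (intro divide_left_mono mult_mono mult_pos_pos) (auto simp: n_def)
    also have "\<dots> \<le> (1 - 1 / (16 * n))\<^sup>2"
    proof -
      have "0 \<le> 192 * n ^ 3 - 286 * n\<^sup>2 + 33 * n - 1"
      proof -
        define k where "k = n - 2"
        have eq: "192 * n ^ 3 - 286 * n\<^sup>2 + 33 * n - 1 = 192 * k ^ 3 + 866 * k\<^sup>2 + 1193 * k + 457"
          unfolding k_def by (simp add: power2_eq_square power3_eq_cube algebra_simps)
        have "0 \<le> k" using n by (simp add: k_def)
        then have "0 \<le> 192 * k ^ 3 + 866 * k\<^sup>2 + 1193 * k + 457" by simp
        then show ?thesis unfolding eq .
      qed
      then have "256 * n ^ 4 \<le> (16 * n - 1)\<^sup>2 * ((n + 1) * (n - 1 / 2))"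
      proof -
        have "(16 * n - 1)\<^sup>2 * ((n + 1) * (n - 1 / 2)) - 256 * n ^ 4 = (192 * n ^ 3 - 286 * n\<^sup>2 + 33 * n - 1) / 2"
          by (simp add: power2_eq_square power3_eq_cube power4_eq_xxxx field_simps)
        moreover have "0 \<le> (192 * n ^ 3 - 286 * n\<^sup>2 + 33 * n - 1) / 2"
          using \<open>0 \<le> 192 * n ^ 3 - 286 * n\<^sup>2 + 33 * n - 1\<close> by simp
        ultimately have "0 \<le> (16 * n - 1)\<^sup>2 * ((n + 1) * (n - 1 / 2)) - 256 * n ^ 4" by metis
        then show ?thesis by (simp only: diff_ge_0_iff_ge)
      qed
      then have "n\<^sup>2 * (16 * n)\<^sup>2 \<le> (16 * n - 1)\<^sup>2 * ((n + 1) * (n - 1 / 2))"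
        by (simp add: power_mult_distrib power2_eq_square power4_eq_xxxx mult_ac)
      moreover have "0 < (n + 1) * (n - 1 / 2)" "0 < (16 * n)\<^sup>2" using n by auto
      ultimately have "n\<^sup>2 / ((n + 1) * (n - 1 / 2)) \<le> (16 * n - 1)\<^sup>2 / (16 * n)\<^sup>2"
        by (subst pos_divide_le_eq) (simp_all only: times_divide_eq_left pos_le_divide_eq)
      also have "\<dots> = (1 - 1 / (16 * n))\<^sup>2"
        unfolding power_divide[symmetric] using n by (intro arg_cong[where f = "\<lambda>x. x\<^sup>2"]) (simp add: field_simps)
      finally show ?thesis .
    qed
    finally show "n\<^sup>2 / ((real m + 2) * (real m + a + 1)) \<le> (1 - 1 / (16 * n))\<^sup>2" .
  qed (use n in \<open>simp add: field_simps\<close>)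
  then have "r (Suc m) \<le> r m * (1 - 1 / (16 * n))"
    unfolding scaled_norm_Suc n_def[symmetric] using scaled_norm_pos[of m] by (intro mult_left_mono) auto
  then show ?thesis unfolding n_def[symmetric] using n scaled_norm_pos[of m] by (simp add: field_simps)
qed

lemma sum_scaled_norm_le:
  assumes "l \<le> N"
  shows "(\<Sum>m\<in>{l<..N}. r m / real (Suc m)) \<le> 16 * (r (Suc l) - r (Suc N))"
  using assms
proof (induction N rule: dec_induct)
  case base
  then show ?case by simp
next
  case (step N)
  have "{l<..Suc N} = insert (Suc N) {l<..N}" using step by auto
  then have "(\<Sum>m\<in>{l<..Suc N}. r m / real (Suc m)) = r (Suc N) / real (Suc (Suc N)) + (\<Sum>m\<in>{l<..N}. r m / real (Suc m))"
    by simp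
  also have "\<dots> \<le> 16 * (r (Suc N) - r (Suc (Suc N))) + 16 * (r (Suc l) - r (Suc N))"
    by (intro add_mono scaled_norm_le_increment step.IH) simp
  finally show ?case by simp
qed

lemma derivative_matrix_True:
  "\<bar>derivative_matrix a True l m\<bar> / schur_weight m \<le> (if l = m then 2 else if l < m then 2 * (2 * a + 1) * (R l * r m) / schur_weight m else 0)"
proof -
  let ?s = schur_weight
  consider "l = m" | "l < m" | "m < l" by linarith
  then show ?thesis
  proof cases
    case 1
    have "2 * real m + 1 \<le> 2 * (?s m * sqrt (real m + a + 1))"
    proof (rule power2_le_imp_le)
      have "(2 * real m + 1)\<^sup>2 \<le> 4 * (real (Suc m) * (real m + 1 / 2))"
        by (simp add: power2_eq_square algebra_simps)
      also have "\<dots> \<le> 4 * (real (Suc m) * (real m + a + 1))"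
        using a by (intro mult_left_mono) auto
      also have "\<dots> = (2 * (?s m * sqrt (real m + a + 1)))\<^sup>2"
        using a by (simp add: power_mult_distrib schur_weight_def)
      finally show "(2 * real m + 1)\<^sup>2 \<le> (2 * (?s m * sqrt (real m + a + 1)))\<^sup>2" .
    qed (use a in \<open>auto simp: schur_weight_def\<close>)
    then have "(2 * real m + 1) / sqrt (real m + a + 1) / ?s m \<le> 2"
      using a schur_weight_pos[of m] by (simp add: divide_simps split: if_splits) (simp add: algebra_simps)
    then show ?thesis
      using 1 a laguerre_norm_pos[of a m] by (simp add: derivative_matrix_def laguerre_norm_parameter)
  next
    case 2
    have m2: "real (Suc m) \<le> 2\<^sup>2 * (real m + a + 1)" using a by simp
    have "?s m \<le> 2 * sqrt (real m + a + 1)"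
      using real_sqrt_le_mono[OF m2] by (simp only: schur_weight_def real_sqrt_mult real_sqrt_abs abs_numeral)
    then have s: "1 / sqrt (real m + a + 1) \<le> 2 / ?s m"
      using a schur_weight_pos[of m] by (simp add: divide_simps)
    have "\<bar>derivative_matrix a True l m\<bar> / ?s m = (2 * a + 1) * (R l / R m) * (1 / sqrt (real m + a + 1)) / ?s m"
      using 2 a laguerre_norm_pos[of a m] laguerre_norm_pos[of a l]
      by (simp add: derivative_matrix_def laguerre_norm_parameter R_def abs_mult mult_ac)
    also have "\<dots> \<le> (2 * a + 1) * (R l / R m) * (2 / ?s m) / ?s m"
      using a inverse_norm_pos[of l] inverse_norm_pos[of m]
      by (intro divide_right_mono mult_left_mono s) (auto simp: less_imp_le)
    also have "\<dots> = 2 * (2 * a + 1) * (R l * r m) / ?s m"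
      using inverse_norm_pos[of m] by (simp add: r_def)
    finally show ?thesis using 2 by simp
  qed (simp add: derivative_matrix_def)
qed

text \<open>The diagonal contributes the 2 in the constant; the rest is the sum of the Hardy kernel over
its rows and columns.\<close>

lemma schur_bounded_raising: "schur_bounded 1 (derivative_matrix a True)"
proof -
  let ?s = schur_weight and ?D = "derivative_matrix a True"
  define C where "C = 2 + 32 * (2 * a + 1)"
  have s0: "0 \<le> ?s m" "?s m \<noteq> 0" for m by (auto simp: schur_weight_def)
  have R0: "0 \<le> R m" "R m \<noteq> 0" "0 \<le> r m" for m using inverse_norm_pos[of m] scaled_norm_pos[of m] by auto
  have C: "0 \<le> C" using a by (simp add: C_def)
  have col: "(\<Sum>l\<le>m. \<bar>?D l m\<bar> / ?s l) \<le> C" for m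
  proof -
    have "(\<Sum>l\<le>m. \<bar>?D l m\<bar> / ?s l) = (\<Sum>l\<le>m. \<bar>?D l m\<bar> / ?s m * ?s m / ?s l)"
      by (simp add: s0)
    also have "\<dots> \<le> (\<Sum>l\<le>m. (if l = m then 2 else if l < m then 2 * (2 * a + 1) * (R l * r m) / ?s m else 0) * ?s m / ?s l)"
      using s0 by (intro sum_mono divide_right_mono mult_right_mono derivative_matrix_True) auto
    also have "\<dots> \<le> (\<Sum>l\<le>m. (if l = m then 2 else 0) + 2 * (2 * a + 1) * r m * (R l / ?s l))"
      using a s0 R0 by (intro sum_mono) (auto simp: mult_ac)
    also have "\<dots> = 2 + 2 * (2 * a + 1) * r m * (\<Sum>l\<le>m. R l / ?s l)"
      by (simp add: sum.distrib sum_distrib_left)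
    also have "\<dots> \<le> 2 + 2 * (2 * a + 1) * r m * (8 * (real m + 1 / 2) * R m / ?s m)"
      using a R0 by (intro add_left_mono mult_left_mono sum_inverse_norm_le) auto
    also have "\<dots> = 2 + 16 * (2 * a + 1) * ((real m + 1 / 2) / (?s m * ?s m))"
      using R0 s0 by (simp add: r_def) (simp add: algebra_simps)
    also have "\<dots> \<le> 2 + 16 * (2 * a + 1) * 1"
      unfolding schur_weight_sq using a by (intro add_left_mono mult_left_mono) auto
    also have "\<dots> \<le> C" using a by (simp add: C_def)
    finally show ?thesis .
  qed
  have row: "(\<Sum>m\<le>N. \<bar>?D l m\<bar> / ?s m / ?s m) \<le> C / ?s l" for l N
  proof -
    have "(\<Sum>m\<le>N. \<bar>?D l m\<bar> / ?s m / ?s m) \<le> (\<Sum>m\<le>N. (if l = m then 2 else if l < m then 2 * (2 * a + 1) * (R l * r m) / ?s m else 0) / ?s m)"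
      using s0 by (intro sum_mono divide_right_mono derivative_matrix_True) auto
    also have "\<dots> = (\<Sum>m\<le>N. (if l = m then 2 / ?s l else 0) + (if l < m then 2 * (2 * a + 1) * R l * (r m / real (Suc m)) else 0))"
      by (intro sum.cong refl) (auto simp: schur_weight_sq mult_ac)
    also have "\<dots> = (\<Sum>m\<le>N. if l = m then 2 / ?s l else 0) + 2 * (2 * a + 1) * R l * (\<Sum>m\<le>N. if l < m then r m / real (Suc m) else 0)"
      unfolding sum.distrib sum_distrib_left by (intro arg_cong2[where f = plus] sum.cong refl) auto
    also have "\<dots> \<le> 2 / ?s l + 2 * (2 * a + 1) * R l * (16 * r l)"
    proof (intro add_mono mult_left_mono)
      show "(\<Sum>m\<le>N. if l = m then 2 / ?s l else 0) \<le> 2 / ?s l" using s0 by simp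
      show "(\<Sum>m\<le>N. if l < m then r m / real (Suc m) else 0) \<le> 16 * r l"
      proof (cases "l \<le> N")
        case True
        have "(\<Sum>m\<le>N. if l < m then r m / real (Suc m) else 0) = (\<Sum>m\<in>{l<..N}. r m / real (Suc m))"
          by (intro sum.mono_neutral_cong_right) auto
        also have "\<dots> \<le> 16 * (r (Suc l) - r (Suc N))" by (rule sum_scaled_norm_le[OF True])
        also have "\<dots> \<le> 16 * r l" using scaled_norm_decreasing[of l] R0(3)[of "Suc N"] by simp
        finally show ?thesis .
      next
        case False
        then have "(\<Sum>m\<le>N. if l < m then r m / real (Suc m) else 0) = 0" by (intro sum.neutral) auto
        then show ?thesis using R0(3)[of l] by simp
      qed
    qed (use a R0 in auto)
    also have "\<dots> = C / ?s l"
      using R0 s0 by (simp add: r_def C_def field_simps)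
    finally show ?thesis .
  qed
  show ?thesis unfolding schur_bounded_def using col row C s0
    by (intro conjI exI[of _ C]) (auto simp: derivative_matrix_def)
qed

end

text \<open>The factor to be differentiated has parameter \<open>a\<close> after an even and \<open>a + 1\<close> after an odd
number of derivatives, so the two kinds of steps alternate.\<close>

fun iterated_derivative_matrix :: "real \<Rightarrow> nat \<Rightarrow> nat \<Rightarrow> nat \<Rightarrow> real" where
  "iterated_derivative_matrix a 0 = (\<lambda>l m. if l = m then 1 else 0)"
| "iterated_derivative_matrix a (Suc p) =
     (\<lambda>l m. \<Sum>q\<le>m. derivative_matrix a (odd p) l q * iterated_derivative_matrix a p q m)"

lemma schur_bounded_iterated_derivative:
  assumes "- 1 / 2 \<le> a"
  shows "schur_bounded p (iterated_derivative_matrix a p)"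
proof (induction p)
  case 0
  show ?case
    unfolding schur_bounded_def
    by (intro conjI exI[of _ 1])
       (auto simp: if_distrib[of abs] if_distrib[of "\<lambda>x. x / _"] schur_weight_def cong: if_cong)
next
  case (Suc p)
  have "schur_bounded 1 (derivative_matrix a (odd p))"
    using schur_bounded_lowering schur_bounded_raising[OF assms] by (cases "odd p") auto
  from schur_bounded_compose[OF this Suc] show ?case by simp
qed

definition laguerre_factor_deriv :: "real \<Rightarrow> nat \<Rightarrow> nat \<Rightarrow> real \<Rightarrow> real" where
  "laguerre_factor_deriv a m p u =
     (\<Sum>l\<le>m. iterated_derivative_matrix a p l m * laguerre_factor a (odd p) l u)"

lemma laguerre_factor_deriv_0: "laguerre_factor_deriv a m 0 u = laguerre_norm a m * laguerre_poly a m (u\<^sup>2)"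
  by (simp add: laguerre_factor_deriv_def laguerre_factor_def if_distrib[of "\<lambda>x. x * _"] cong: if_cong)

lemma has_real_derivative_laguerre_factor_deriv:
  assumes "-1 < a"
  shows "(laguerre_factor_deriv a m p has_real_derivative laguerre_factor_deriv a m (Suc p) u) (at u)"
proof -
  let ?D = "iterated_derivative_matrix a p" and ?S = "derivative_matrix a (odd p)" and ?F = "laguerre_factor a (even p)"
  have "(laguerre_factor_deriv a m p has_real_derivative
     (\<Sum>l\<le>m. ?D l m * (\<Sum>q\<le>l. ?S q l * laguerre_factor a (\<not> odd p) q u))) (at u)"
    unfolding laguerre_factor_deriv_def[abs_def]
    by (intro DERIV_sum DERIV_cmult has_real_derivative_laguerre_factor assms)
  also have "(\<Sum>l\<le>m. ?D l m * (\<Sum>q\<le>l. ?S q l * laguerre_factor a (\<not> odd p) q u))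
     = (\<Sum>l\<le>m. \<Sum>q\<le>m. ?D l m * (?S q l * ?F q u))"
    unfolding sum_distrib_left
    by (intro sum.cong refl sum.mono_neutral_cong_left) (auto simp: derivative_matrix_def)
  also have "\<dots> = (\<Sum>q\<le>m. (\<Sum>l\<le>m. ?S q l * ?D l m) * ?F q u)"
    by (subst sum.swap) (simp add: sum_distrib_left sum_distrib_right mult_ac)
  also have "\<dots> = laguerre_factor_deriv a m (Suc p) u"
    by (simp add: laguerre_factor_deriv_def)
  finally show ?thesis .
qed

section \<open>Orthonormality of the Laguerre functions\<close>

text \<open>The substitution \<open>u = x\<^sup>2\<close> in Euler's integral.\<close>

lemma has_bochner_integral_Gaussian_powr:
  assumes c: "(0 :: real) < c"
  shows "has_bochner_integral lborel (\<lambda>x. indicator {0<..} x * (x powr (2 * c - 1) * exp (- (x\<^sup>2)))) (Gamma c / 2)"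
proof -
  let ?f = "\<lambda>u :: real. u powr (c - 1) / exp u"
  have "(?f has_integral Gamma c) {0..}" by (rule Gamma_integral_real[OF c])
  then have f: "(?f has_integral Gamma c) {0<..}"
  proof -
    assume *: "(?f has_integral Gamma c) {0..}"
    have "((\<lambda>t. if t \<in> {0<..} then ?f t else 0) has_integral Gamma c) {0..}"
      by (rule has_integral_spike[OF _ _ *, of "{0}"]) auto
    then show ?thesis by (subst (asm) has_integral_restrict) auto
  qed
  then have f_abs: "?f absolutely_integrable_on {0<..}"
    by (intro nonnegative_absolutely_integrable_1) (auto simp: has_integral_iff)
  have img: "(\<lambda>x::real. x\<^sup>2) ` {0<..} = {0<..}"
  proof (intro equalityI subsetI)
    fix y :: real assume "y \<in> {0<..}"
    then show "y \<in> (\<lambda>x. x\<^sup>2) ` {0<..}" by (intro image_eqI[of _ _ "sqrt y"]) auto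
  qed auto
  have "(\<lambda>x. \<bar>2 * x\<bar> * ?f (x\<^sup>2)) absolutely_integrable_on {0<..} \<and>
      integral {0<..} (\<lambda>x. \<bar>2 * x\<bar> * ?f (x\<^sup>2)) = Gamma c"
    by (subst has_absolute_integral_change_of_variables_1'[where g = "\<lambda>x. x\<^sup>2"])
       (use f f_abs img in \<open>auto intro!: derivative_eq_intros inj_onI simp: power2_eq_iff has_integral_iff\<close>)
  then have h: "set_integrable lebesgue {0<..} (\<lambda>x. \<bar>2 * x\<bar> * ?f (x\<^sup>2))"
    and "(LINT x:{0<..}|lebesgue. \<bar>2 * x\<bar> * ?f (x\<^sup>2)) = Gamma c"
    by (auto simp: set_lebesgue_integral_eq_integral)
  then have "has_bochner_integral lebesgue (\<lambda>x. indicator {0<..} x *\<^sub>R (\<bar>2 * x\<bar> * ?f (x\<^sup>2))) (Gamma c)"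
    unfolding has_bochner_integral_iff set_integrable_def set_lebesgue_integral_def by simp
  moreover have "indicator {0<..} x *\<^sub>R (\<bar>2 * x\<bar> * ?f (x\<^sup>2)) = 2 * (indicator {0<..} x * (x powr (2 * c - 1) * exp (- (x\<^sup>2))))"
    for x :: real
  proof (cases "0 < x")
    case True
    then have "x * (x\<^sup>2) powr (c - 1) = x powr (1 + 2 * (c - 1))"
      using powr_add[of x 1 "2 * (c - 1)"] by (simp add: powr_powr flip: powr_numeral)
    also have "1 + 2 * (c - 1) = 2 * c - 1" by simp
    finally show ?thesis using True by (simp add: exp_minus field_simps)
  qed simp
  ultimately have "has_bochner_integral lebesgue (\<lambda>x. 2 * (indicator {0<..} x * (x powr (2 * c - 1) * exp (- (x\<^sup>2))))) (Gamma c)"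
    by simp
  from has_bochner_integral_mult_right[OF this, of "1 / 2"]
  have "has_bochner_integral lebesgue (\<lambda>x. indicator {0<..} x * (x powr (2 * c - 1) * exp (- (x\<^sup>2)))) (Gamma c / 2)"
    by simp
  then show ?thesis
    by (simp add: has_bochner_integral_iff integrable_completion integral_completion)
qed

text \<open>The square of the weight of parameter \<open>a\<close> times a polynomial in \<open>x\<^sup>2\<close>, cut off to the half-line;
the integrals are inner products of Laguerre functions.\<close>

definition laguerre_moment_integrand :: "real \<Rightarrow> (real \<Rightarrow> real) \<Rightarrow> real \<Rightarrow> real" where
  "laguerre_moment_integrand a p x = indicator {0<..} x * (x powr (2 * a + 1) * exp (- (x\<^sup>2)) * p (x\<^sup>2))"

lemma laguerre_monomial_moment:
  assumes a: "-1 < a"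
  shows "has_bochner_integral lborel (laguerre_moment_integrand a (\<lambda>y. y ^ i)) (Gamma (a + 1 + real i) / 2)"
proof -
  have "laguerre_moment_integrand a (\<lambda>y. y ^ i) = (\<lambda>x. indicator {0<..} x * (x powr (2 * (a + 1 + real i) - 1) * exp (- (x\<^sup>2))))"
  proof (intro ext, unfold laguerre_moment_integrand_def)
    fix x :: real
    show "indicator {0<..} x * (x powr (2 * a + 1) * exp (- (x\<^sup>2)) * (x\<^sup>2) ^ i) = indicator {0<..} x * (x powr (2 * (a + 1 + real i) - 1) * exp (- (x\<^sup>2)))"
    proof (cases "0 < x")
      case True
      have "x powr (2 * (a + 1 + real i) - 1) = x powr (2 * a + 1) * (x\<^sup>2) ^ i"
      proof -
        have "x powr ((2 * a + 1) + real (2 * i)) = x powr (2 * a + 1) * (x\<^sup>2) ^ i"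
          using True unfolding powr_add by (simp only: powr_realpow power_mult)
        moreover have "(2 * a + 1) + real (2 * i) = 2 * (a + 1 + real i) - 1" by simp
        ultimately show ?thesis by (simp only:)
      qed
      then show ?thesis by simp
    qed simp
  qed
  then show ?thesis using a has_bochner_integral_Gaussian_powr[of "a + 1 + real i"] by simp
qed

text \<open>The Gamma function in each moment cancels that in the corresponding coefficient, and an alternating
sum of binomial coefficients remains.\<close>

lemma laguerre_poly_integral_0:
  assumes a: "-1 < a"
  shows "has_bochner_integral lborel (laguerre_moment_integrand a (laguerre_poly a m)) (if m = 0 then Gamma (a + 1) / 2 else 0)"
proof -
  have "has_bochner_integral lborel (\<lambda>x. \<Sum>i\<le>m. ((-1) ^ i / fact i * ((real m + a) gchoose (m - i))) * laguerre_moment_integrand a (\<lambda>y. y ^ i) x)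
     (\<Sum>i\<le>m. ((-1) ^ i / fact i * ((real m + a) gchoose (m - i))) * (Gamma (a + 1 + real i) / 2))"
    by (intro has_bochner_integral_sum has_bochner_integral_mult_right laguerre_monomial_moment a)
  moreover have "(\<lambda>x. \<Sum>i\<le>m. ((-1) ^ i / fact i * ((real m + a) gchoose (m - i))) * laguerre_moment_integrand a (\<lambda>y. y ^ i) x)
     = laguerre_moment_integrand a (laguerre_poly a m)"
    by (auto simp: laguerre_moment_integrand_def laguerre_poly_def sum_distrib_left mult_ac intro!: sum.cong)
  moreover have "(\<Sum>i\<le>m. ((-1) ^ i / fact i * ((real m + a) gchoose (m - i))) * (Gamma (a + 1 + real i) / 2))
     = Gamma (real m + a + 1) / (2 * fact m) * (\<Sum>i\<le>m. (-1) ^ i * real (m choose i))"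
    unfolding sum_distrib_left
  proof (intro sum.cong refl)
    fix i assume i: "i \<in> {..m}"
    have "real m + a + 1 \<notin> \<int>\<^sub>\<le>\<^sub>0"
      using a by (intro notI) (auto elim!: nonpos_Ints_cases)
    then have "(real m + a) gchoose (m - i) = Gamma (real m + a + 1) / (fact (m - i) * Gamma (real m + a - real (m - i) + 1))"
      by (rule gbinomial_Gamma)
    also have "real m + a - real (m - i) + 1 = a + 1 + real i"
      using i by (simp add: of_nat_diff)
    finally have g: "(real m + a) gchoose (m - i) = Gamma (real m + a + 1) / (fact (m - i) * Gamma (a + 1 + real i))" .
    have "Gamma (a + 1 + real i) > 0" using a by (intro Gamma_real_pos) auto
    then show "((-1) ^ i / fact i * ((real m + a) gchoose (m - i))) * (Gamma (a + 1 + real i) / 2)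
      = Gamma (real m + a + 1) / (2 * fact m) * ((-1) ^ i * real (m choose i))"
      unfolding g using i by (simp add: binomial_fact field_simps)
  qed
  moreover have "(\<Sum>i\<le>m. (-1) ^ i * real (m choose i)) = (if m = 0 then 1 else 0)"
    using choose_alternating_sum[of m, where 'a = real] by simp
  ultimately show ?thesis by (cases "m = 0") (simp_all add: add.commute)
qed

text \<open>A power of \<open>x\<^sup>2\<close> in the integrand raises the parameter of the weight by one, and the polynomial is
a difference of two polynomials with the raised parameter. So the induction on \<open>j\<close> has to be over all
parameters and degrees.\<close>

lemma laguerre_poly_moment:
  assumes a: "-1 < a" and "j \<le> m"
  shows "has_bochner_integral lborel (laguerre_moment_integrand a (\<lambda>y. y ^ j * laguerre_poly a m y))
    (if j = m then (-1) ^ m * Gamma (real m + a + 1) / 2 else 0)"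
  using assms
proof (induction j arbitrary: m a)
  case 0
  have "(if 0 = m then (-1) ^ m * Gamma (real m + a + 1) / 2 else 0) = (if m = 0 then Gamma (a + 1) / 2 else 0)"
    by auto
  moreover have "(\<lambda>y. y ^ 0 * laguerre_poly a m y) = laguerre_poly a m"
    by (simp add: fun_eq_iff)
  ultimately show ?case using laguerre_poly_integral_0[OF 0(1), of m] by (simp only:)
next
  case (Suc j)
  then obtain n where m: "m = Suc n" by (cases m) auto
  let ?I = "\<lambda>k. laguerre_moment_integrand (a + 1) (\<lambda>y. y ^ j * laguerre_poly (a + 1) k y)"
  have eq: "laguerre_moment_integrand a (\<lambda>y. y ^ Suc j * laguerre_poly a m y) x = ?I m x - ?I n x" for x
  proof (cases "0 < x")
    case True
    have *: "x powr (2 * (a + 1) + 1) = x powr (2 * a + 1) * x\<^sup>2"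
    proof -
      have "x powr ((2 * a + 1) + 2) = x powr (2 * a + 1) * x\<^sup>2"
        using True unfolding powr_add by simp
      moreover have "(2 * a + 1) + 2 = 2 * (a + 1) + 1" by simp
      ultimately show ?thesis by (simp only:)
    qed
    have "?I m x - ?I n x = x powr (2 * (a + 1) + 1) * exp (- (x\<^sup>2)) *
        ((x\<^sup>2) ^ j * (laguerre_poly (a + 1) (Suc n) (x\<^sup>2) - laguerre_poly (a + 1) n (x\<^sup>2)))"
      using True by (simp add: laguerre_moment_integrand_def m right_diff_distrib)
    also have "laguerre_poly (a + 1) (Suc n) (x\<^sup>2) - laguerre_poly (a + 1) n (x\<^sup>2) = laguerre_poly a m (x\<^sup>2)"
      by (simp add: laguerre_poly_Suc_parameter m)
    finally show ?thesis
      unfolding * using True by (simp add: laguerre_moment_integrand_def mult_ac)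
  qed (simp add: laguerre_moment_integrand_def)
  have 1: "has_bochner_integral lborel (?I m) 0"
    using Suc.IH[of "a + 1" m] Suc.prems by simp
  have 2: "has_bochner_integral lborel (?I n) (if j = n then (-1) ^ n * Gamma (real n + (a + 1) + 1) / 2 else 0)"
    using Suc.IH[of "a + 1" n] Suc.prems m by simp
  from has_bochner_integral_diff[OF 1 2] show ?case
    unfolding eq[abs_def] by (rule has_bochner_integral_cong[THEN iffD1, rotated -1]) (auto simp: m eq add_ac)
qed

text \<open>Expand the polynomial of the smaller degree into powers; only its leading term has a nonzero
moment.\<close>

lemma laguerre_poly_orthogonal:
  assumes a: "-1 < a" and "l \<le> m"
  shows "has_bochner_integral lborel (laguerre_moment_integrand a (\<lambda>y. laguerre_poly a l y * laguerre_poly a m y))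
    (if l = m then Gamma (real m + a + 1) / (2 * fact m) else 0)"
proof -
  let ?c = "\<lambda>j. (-1) ^ j / fact j * ((real l + a) gchoose (l - j))"
  have "has_bochner_integral lborel (\<lambda>x. \<Sum>j\<le>l. ?c j * laguerre_moment_integrand a (\<lambda>y. y ^ j * laguerre_poly a m y) x)
     (\<Sum>j\<le>l. ?c j * (if j = m then (-1) ^ m * Gamma (real m + a + 1) / 2 else 0))"
    using assms by (intro has_bochner_integral_sum has_bochner_integral_mult_right laguerre_poly_moment) auto
  moreover have "(\<lambda>x. \<Sum>j\<le>l. ?c j * laguerre_moment_integrand a (\<lambda>y. y ^ j * laguerre_poly a m y) x)
     = laguerre_moment_integrand a (\<lambda>y. laguerre_poly a l y * laguerre_poly a m y)"
    by (auto simp: laguerre_moment_integrand_def laguerre_poly_def[of a l] sum_distrib_left sum_distrib_right mult_ac intro!: sum.cong)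
  moreover have "(\<Sum>j\<le>l. ?c j * (if j = m then (-1) ^ m * Gamma (real m + a + 1) / 2 else 0))
     = (if l = m then Gamma (real m + a + 1) / (2 * fact m) else 0)"
    using assms by (auto simp: if_distrib[of "\<lambda>x. _ * x"] simp flip: power_add cong: if_cong)
  ultimately show ?thesis by simp
qed

lemma phi1_orthonormal:
  assumes a: "-1 < a"
  shows "has_bochner_integral lborel (\<lambda>x. indicator {0<..} x * (phi1 a l x * phi1 a m x)) (if l = m then 1 else 0)"
proof -
  have *: "has_bochner_integral lborel (\<lambda>x. indicator {0<..} x * (phi1 a l x * phi1 a m x)) (if l = m then 1 else 0)"
    if "l \<le> m" for l m
  proof -
    have eq: "laguerre_norm a l * laguerre_norm a m * laguerre_moment_integrand a (\<lambda>y. laguerre_poly a l y * laguerre_poly a m y) x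
       = indicator {0<..} x * (phi1 a l x * phi1 a m x)" for x
    proof (cases "0 < x")
      case True
      have "laguerre_weight a x * laguerre_weight a x = x powr (2 * a + 1) * exp (- (x\<^sup>2))"
      proof -
        have "x powr (a + 1 / 2) * x powr (a + 1 / 2) = x powr (2 * a + 1)"
          unfolding powr_add[symmetric] by simp
        moreover have "exp (- (x\<^sup>2) / 2) * exp (- (x\<^sup>2) / 2) = exp (- (x\<^sup>2))"
          unfolding exp_add[symmetric] by simp
        ultimately show ?thesis
          unfolding laguerre_weight_def by (simp only: mult_ac)
      qed
      then show ?thesis using True
        by (simp add: phi1_eq laguerre_moment_integrand_def mult_ac)
    qed (simp add: laguerre_moment_integrand_def)
    have N: "laguerre_norm a m * laguerre_norm a m * (Gamma (real m + a + 1) / (2 * fact m)) = 1"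
      using Gamma_pos_shift[OF a, of m]
    proof -
      have "Gamma (real m + 1) = fact m"
        using Gamma_fact[of m, where 'a = real] by (simp add: add.commute)
      then show ?thesis
        using Gamma_pos_shift[OF a, of m] by (simp add: laguerre_norm_def)
    qed
    have "has_bochner_integral lborel (\<lambda>x. laguerre_norm a l * laguerre_norm a m * laguerre_moment_integrand a (\<lambda>y. laguerre_poly a l y * laguerre_poly a m y) x)
       (laguerre_norm a l * laguerre_norm a m * (if l = m then Gamma (real m + a + 1) / (2 * fact m) else 0))"
      by (intro has_bochner_integral_mult_right laguerre_poly_orthogonal a that)
    moreover have "laguerre_norm a l * laguerre_norm a m * (if l = m then Gamma (real m + a + 1) / (2 * fact m) else 0) = (if l = m then 1 else 0)"
      using N by (simp only: mult_zero_right split: if_split) blast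
    ultimately show ?thesis unfolding eq by (simp only:)
  qed
  show ?thesis
    using *[of l m] *[of m l] by (cases "l \<le> m") (auto simp: mult.commute eq_commute)
qed

section \<open>Square integrable functions and bounded extension\<close>

definition sq_integrable :: "'a measure \<Rightarrow> ('a \<Rightarrow> complex) \<Rightarrow> bool" where
  "sq_integrable M f \<longleftrightarrow> f \<in> borel_measurable M \<and> integrable M (\<lambda>x. (norm (f x))\<^sup>2)"

text \<open>The square of the norm: its additivity makes it more convenient than the norm itself.\<close>

definition sq_norm :: "'a measure \<Rightarrow> ('a \<Rightarrow> complex) \<Rightarrow> real" where
  "sq_norm M f = (LINT x|M. (norm (f x))\<^sup>2)"

lemma sq_norm_nonneg: "0 \<le> sq_norm M f"
  by (simp add: sq_norm_def)

lemma norm_add_sq_le: "(norm (a + b))\<^sup>2 \<le> 2 * (norm a)\<^sup>2 + 2 * (norm (b :: complex))\<^sup>2"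
proof -
  have "(norm (a + b))\<^sup>2 \<le> (norm a + norm b)\<^sup>2"
    by (intro power_mono norm_triangle_ineq norm_ge_zero)
  also have "\<dots> \<le> 2 * (norm a)\<^sup>2 + 2 * (norm b)\<^sup>2"
    using zero_le_power2[of "norm a - norm b"] by (simp add: power2_eq_square algebra_simps)
  finally show ?thesis .
qed

lemma sq_integrable_add:
  assumes "sq_integrable M f" "sq_integrable M g"
  shows "sq_integrable M (\<lambda>x. f x + g x)"
    and "sq_norm M (\<lambda>x. f x + g x) \<le> 2 * sq_norm M f + 2 * sq_norm M g"
proof -
  have [measurable]: "f \<in> borel_measurable M" "g \<in> borel_measurable M"
    and i: "integrable M (\<lambda>x. (norm (f x))\<^sup>2)" "integrable M (\<lambda>x. (norm (g x))\<^sup>2)"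
    using assms by (auto simp: sq_integrable_def)
  have j: "integrable M (\<lambda>x. 2 * (norm (f x))\<^sup>2 + 2 * (norm (g x))\<^sup>2)"
    by (intro Bochner_Integration.integrable_add integrable_mult_right i)
  have k: "integrable M (\<lambda>x. (norm (f x + g x))\<^sup>2)"
    by (rule Bochner_Integration.integrable_bound[OF j]) (auto intro!: AE_I2 norm_add_sq_le)
  then show "sq_integrable M (\<lambda>x. f x + g x)" by (simp add: sq_integrable_def)
  have "sq_norm M (\<lambda>x. f x + g x) \<le> (LINT x|M. 2 * (norm (f x))\<^sup>2 + 2 * (norm (g x))\<^sup>2)"
    unfolding sq_norm_def by (intro integral_mono k j norm_add_sq_le)
  also have "\<dots> = 2 * sq_norm M f + 2 * sq_norm M g"
    using i by (simp add: sq_norm_def)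
  finally show "sq_norm M (\<lambda>x. f x + g x) \<le> 2 * sq_norm M f + 2 * sq_norm M g" .
qed

lemma sq_integrable_cmult:
  assumes "sq_integrable M f"
  shows "sq_integrable M (\<lambda>x. c * f x)"
    and "sq_norm M (\<lambda>x. c * f x) = (norm c)\<^sup>2 * sq_norm M f"
  using assms by (auto simp: sq_integrable_def sq_norm_def norm_mult power_mult_distrib)

lemma sq_integrable_0: "sq_integrable M (\<lambda>x. 0)"
  by (simp add: sq_integrable_def)

lemma sq_integrable_sum:
  assumes "\<And>i. i \<in> F \<Longrightarrow> sq_integrable M (f i)"
  shows "sq_integrable M (\<lambda>x. \<Sum>i\<in>F. f i x)"
  using assms by (induction F rule: infinite_finite_induct) (auto simp: sq_integrable_0 intro: sq_integrable_add)

lemma sq_integrable_diff: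
  assumes "sq_integrable M f" "sq_integrable M g"
  shows "sq_integrable M (\<lambda>x. f x - g x)"
    and "sq_norm M (\<lambda>x. f x - g x) \<le> 2 * sq_norm M f + 2 * sq_norm M g"
  using sq_integrable_add[OF assms(1) sq_integrable_cmult(1)[OF assms(2), of "-1"]]
    sq_integrable_cmult(2)[OF assms(2), of "-1"] by simp_all

lemma integrable_sq_integrable_mult:
  assumes "sq_integrable M f" "sq_integrable M g"
  shows "integrable M (\<lambda>x. f x * g x)"
proof -
  have [measurable]: "f \<in> borel_measurable M" "g \<in> borel_measurable M"
    and i: "integrable M (\<lambda>x. (norm (f x))\<^sup>2)" "integrable M (\<lambda>x. (norm (g x))\<^sup>2)"
    using assms by (auto simp: sq_integrable_def)
  have "integrable M (\<lambda>x. (norm (f x))\<^sup>2 + (norm (g x))\<^sup>2)"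
    by (intro Bochner_Integration.integrable_add i)
  then show ?thesis
  proof (rule Bochner_Integration.integrable_bound)
    show "AE x in M. norm (f x * g x) \<le> norm ((norm (f x))\<^sup>2 + (norm (g x))\<^sup>2)"
    proof (intro AE_I2)
      fix x
      have "2 * (norm (f x) * norm (g x)) \<le> (norm (f x))\<^sup>2 + (norm (g x))\<^sup>2"
        using zero_le_power2[of "norm (f x) - norm (g x)"] by (simp add: power2_eq_square algebra_simps)
      moreover have "0 \<le> norm (f x) * norm (g x)" by simp
      ultimately have "norm (f x) * norm (g x) \<le> (norm (f x))\<^sup>2 + (norm (g x))\<^sup>2" by linarith
      then show "norm (f x * g x) \<le> norm ((norm (f x))\<^sup>2 + (norm (g x))\<^sup>2)"
        by (simp add: norm_mult)
    qed
  qed simp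
qed

lemma sq_norm_eq_0_AE:
  assumes "sq_integrable M f" "sq_norm M f = 0"
  shows "AE x in M. f x = 0"
proof -
  have "AE x in M. (norm (f x))\<^sup>2 = 0"
    using integral_nonneg_eq_0_iff_AE[of M "\<lambda>x. (norm (f x))\<^sup>2"] assms
    by (simp add: sq_integrable_def sq_norm_def)
  then show ?thesis by simp
qed

text \<open>The terms decay at least like \<open>2^(-j/2)\<close>.\<close>

lemma summable_of_weighted_squares:
  fixes d :: "nat \<Rightarrow> complex"
  assumes "(\<Sum>j. ennreal (2 ^ j * (norm (d j))\<^sup>2)) < \<infinity>"
  shows "summable d"
proof -
  obtain K where K: "K \<ge> 0" "(\<Sum>j. ennreal (2 ^ j * (norm (d j))\<^sup>2)) = ennreal K"
    using assms unfolding infinity_ennreal_def less_top_ennreal by blast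
  have le: "norm (d j) \<le> sqrt K * (1 / sqrt 2) ^ j" for j
  proof -
    define g where "g j = ennreal (2 ^ j * (norm (d j))\<^sup>2)" for j
    have "g j \<le> suminf g"
      using sum_le_suminf[of g "{j}"] by (simp add: summableI)
    then have "ennreal (2 ^ j * (norm (d j))\<^sup>2) \<le> ennreal K"
      unfolding K(2)[symmetric] g_def .
    then have "2 ^ j * (norm (d j))\<^sup>2 \<le> K"
      unfolding ennreal_le_iff[OF K(1)] .
    then have "(norm (d j))\<^sup>2 \<le> K * (1 / 2) ^ j"
      by (simp add: field_simps)
    then have "norm (d j) \<le> sqrt (K * (1 / 2) ^ j)"
      by (rule real_le_rsqrt)
    also have "\<dots> = sqrt K * (1 / sqrt 2) ^ j"
      by (simp add: real_sqrt_mult real_sqrt_power real_sqrt_divide)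
    finally show ?thesis .
  qed
  have "summable (\<lambda>j. sqrt K * (1 / sqrt 2) ^ j)"
    by (intro summable_mult summable_geometric) simp
  then show ?thesis by (rule summable_comparison_test'[of _ 0]) (use le in auto)
qed

text \<open>Along a subsequence whose consecutive differences have squared norms below \<open>4\<^sup>-\<^sup>j\<close>, the sum of
these squares, weighted by \<open>2\<^sup>j\<close>, has a finite integral, so the subsequence converges almost everywhere.
Fatou's lemma bounds the distance of every late term to the pointwise limit.\<close>

lemma riesz_fischer:
  assumes S: "\<And>n. sq_integrable M (S n)"
    and cauchy: "\<And>e. 0 < e \<Longrightarrow> \<exists>N. \<forall>m\<ge>N. \<forall>n\<ge>N. sq_norm M (\<lambda>x. S m x - S n x) < e"
  shows "\<exists>h. sq_integrable M h \<and> (\<lambda>n. sq_norm M (\<lambda>x. S n x - h x)) \<longlonglongrightarrow> 0"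
proof -
  have [measurable]: "S n \<in> borel_measurable M" for n using S by (simp add: sq_integrable_def)
  have nn: "(\<integral>\<^sup>+x. ennreal ((norm (S m x - S n x))\<^sup>2) \<partial>M) = ennreal (sq_norm M (\<lambda>x. S m x - S n x))" for m n
    using sq_integrable_diff(1)[OF S[of m] S[of n]]
    by (simp add: sq_norm_def sq_integrable_def nn_integral_eq_integral)
  have "\<forall>j. \<exists>N. \<forall>m\<ge>N. \<forall>n\<ge>N. sq_norm M (\<lambda>x. S m x - S n x) < (1 / 4) ^ j"
    using cauchy by simp
  then obtain N where N: "\<And>j m n. N j \<le> m \<Longrightarrow> N j \<le> n \<Longrightarrow> sq_norm M (\<lambda>x. S m x - S n x) < (1 / 4) ^ j"
    by metis
  \<comment> \<open>Partial sums make the indices of the subsequence increasing.\<close>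
  define r where "r j = (\<Sum>i\<le>j. N i)" for j
  have r: "N j \<le> r j" "r j \<le> r (Suc j)" for j
    by (auto simp: r_def intro!: member_le_sum)
  have r_le: "i \<le> j \<Longrightarrow> r i \<le> r j" for i j by (rule lift_Suc_mono_le[of r]) (use r in auto)
  define d where "d j x = S (r (Suc j)) x - S (r j) x" for j x
  have [measurable]: "d j \<in> borel_measurable M" for j unfolding d_def by measurable
  have "(\<integral>\<^sup>+x. (\<Sum>j. ennreal (2 ^ j * (norm (d j x))\<^sup>2)) \<partial>M) = (\<Sum>j. \<integral>\<^sup>+x. ennreal (2 ^ j * (norm (d j x))\<^sup>2) \<partial>M)"
    by (rule nn_integral_suminf) measurable
  also have "\<dots> \<le> (\<Sum>j. ennreal ((1 / 2) ^ j))"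
  proof (intro suminf_le summableI)
    fix j
    have "(\<integral>\<^sup>+x. ennreal (2 ^ j * (norm (d j x))\<^sup>2) \<partial>M) = ennreal (2 ^ j) * ennreal (sq_norm M (d j))"
    proof -
      have "(\<integral>\<^sup>+x. ennreal ((norm (d j x))\<^sup>2) \<partial>M) = ennreal (sq_norm M (d j))"
        using nn[of "r (Suc j)" "r j"] by (simp add: d_def[abs_def])
      then show ?thesis
        by (subst ennreal_mult) (simp_all add: nn_integral_cmult)
    qed
    also have "\<dots> = ennreal (2 ^ j * sq_norm M (d j))"
      by (rule ennreal_mult[symmetric]) (simp_all add: sq_norm_nonneg)
    also have "\<dots> \<le> ennreal (2 ^ j * (1 / 4) ^ j)"
      using N[of j "r (Suc j)" "r j"] r[of j] unfolding d_def
      by (intro ennreal_leI mult_left_mono) auto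
    also have "2 ^ j * (1 / 4) ^ j = (1 / 2 :: real) ^ j"
      by (simp only: power_mult_distrib[symmetric]) simp
    finally show "(\<integral>\<^sup>+x. ennreal (2 ^ j * (norm (d j x))\<^sup>2) \<partial>M) \<le> ennreal ((1 / 2) ^ j)" .
  qed
  also have "\<dots> = ennreal (\<Sum>j. (1 / 2) ^ j)"
    by (intro suminf_ennreal2) (auto intro: summable_geometric)
  finally have "(\<integral>\<^sup>+x. (\<Sum>j. ennreal (2 ^ j * (norm (d j x))\<^sup>2)) \<partial>M) < \<infinity>"
    by (rule le_less_trans) simp
  then have "AE x in M. (\<Sum>j. ennreal (2 ^ j * (norm (d j x))\<^sup>2)) \<noteq> \<infinity>"
    by (intro nn_integral_noteq_infinite) auto
  then have conv: "AE x in M. convergent (\<lambda>j. S (r j) x)"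
  proof eventually_elim
    case (elim x)
    then have "summable (\<lambda>j. d j x)" by (intro summable_of_weighted_squares) (simp add: less_top)
    then have "convergent (\<lambda>n. \<Sum>j<n. d j x)" by (simp add: summable_iff_convergent)
    then have "convergent (\<lambda>n. (\<Sum>j<n. d j x) + S (r 0) x)"
      by (rule convergent_add[OF _ convergent_const])
    moreover have "(\<Sum>j<n. d j x) = S (r n) x - S (r 0) x" for n
      by (induction n) (simp_all add: d_def)
    ultimately show ?case by simp
  qed
  define h where "h x = lim (\<lambda>j. S (r j) x)" for x
  have [measurable]: "h \<in> borel_measurable M"
    unfolding h_def by (intro borel_measurable_lim_metric) measurable
  have lim: "AE x in M. (\<lambda>j. S (r j) x) \<longlonglongrightarrow> h x"
    using conv by eventually_elim (simp add: h_def convergent_LIMSEQ_iff)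
  have fatou: "(\<integral>\<^sup>+x. ennreal ((norm (S n x - h x))\<^sup>2) \<partial>M) \<le> ennreal ((1 / 4) ^ i)" if n: "N i \<le> n" for n i
  proof -
    have "(\<integral>\<^sup>+x. ennreal ((norm (S n x - h x))\<^sup>2) \<partial>M) = (\<integral>\<^sup>+x. liminf (\<lambda>j. ennreal ((norm (S n x - S (r j) x))\<^sup>2)) \<partial>M)"
    proof (rule nn_integral_cong_AE, use lim in eventually_elim)
      case (elim x)
      have "(\<lambda>j. ennreal ((norm (S n x - S (r j) x))\<^sup>2)) \<longlonglongrightarrow> ennreal ((norm (S n x - h x))\<^sup>2)"
        by (intro tendsto_intros elim)
      then show ?case by (rule lim_imp_Liminf[OF sequentially_bot, symmetric])
    qed
    also have "\<dots> \<le> liminf (\<lambda>j. \<integral>\<^sup>+x. ennreal ((norm (S n x - S (r j) x))\<^sup>2) \<partial>M)"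
      by (intro nn_integral_liminf) measurable
    also have "\<dots> \<le> liminf (\<lambda>j. ennreal ((1 / 4) ^ i))"
    proof (rule Liminf_mono)
      show "\<forall>\<^sub>F j in sequentially. (\<integral>\<^sup>+x. ennreal ((norm (S n x - S (r j) x))\<^sup>2) \<partial>M) \<le> ennreal ((1 / 4) ^ i)"
        using eventually_ge_at_top[of i]
      proof eventually_elim
        case (elim j)
        then have "N i \<le> r j" using r[of i] r_le[of i j] by linarith
        then show ?case unfolding nn using N[OF n, of "r j"] by (simp add: ennreal_leI)
      qed
    qed
    also have "\<dots> = ennreal ((1 / 4) ^ i)" by (simp add: Liminf_const)
    finally show ?thesis .
  qed
  have sqd: "sq_integrable M (\<lambda>x. S n x - h x)" "sq_norm M (\<lambda>x. S n x - h x) \<le> (1 / 4) ^ i" if n: "N i \<le> n" for n i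
  proof -
    have "(\<integral>\<^sup>+x. ennreal (norm ((norm (S n x - h x))\<^sup>2)) \<partial>M) < \<infinity>"
      using fatou[OF n] by (simp add: le_less_trans)
    then have i: "integrable M (\<lambda>x. (norm (S n x - h x))\<^sup>2)"
      by (intro integrableI_bounded) auto
    then show "sq_integrable M (\<lambda>x. S n x - h x)" by (simp add: sq_integrable_def)
    have "ennreal (sq_norm M (\<lambda>x. S n x - h x)) \<le> ennreal ((1 / 4) ^ i)"
      using fatou[OF n] i by (simp add: sq_norm_def nn_integral_eq_integral)
    then show "sq_norm M (\<lambda>x. S n x - h x) \<le> (1 / 4) ^ i" by (simp add: ennreal_le_iff)
  qed
  have "sq_integrable M (\<lambda>x. S (N 0) x - (S (N 0) x - h x))"
    by (intro sq_integrable_diff(1) S sqd(1)[of 0]) simp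
  then have h: "sq_integrable M h" by simp
  have "(\<lambda>n. sq_norm M (\<lambda>x. S n x - h x)) \<longlonglongrightarrow> 0"
  proof (rule LIMSEQ_I)
    fix e :: real assume "0 < e"
    obtain i where i: "(1 / 4 :: real) ^ i < e"
      using real_arch_pow_inv[OF \<open>0 < e\<close>, of "1 / 4"] by auto
    show "\<exists>no. \<forall>n\<ge>no. norm (sq_norm M (\<lambda>x. S n x - h x) - 0) < e"
    proof (intro exI[of _ "N i"] allI impI)
      fix n assume "N i \<le> n"
      then show "norm (sq_norm M (\<lambda>x. S n x - h x) - 0) < e"
        using le_less_trans[OF sqd(2) i] by (simp add: sq_norm_nonneg)
    qed
  qed
  with h show ?thesis by blast
qed

lemma sq_norm_complex: 
  assumes "sq_integrable M f"
  shows "integrable M (\<lambda>x. f x * cnj (f x))" "complex_of_real (sq_norm M f) = (LINT x|M. f x * cnj (f x))"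
proof -
  have eq: "f x * cnj (f x) = complex_of_real ((norm (f x))\<^sup>2)" for x
    by (rule complex_norm_square[symmetric])
  show "integrable M (\<lambda>x. f x * cnj (f x))"
    unfolding eq by (rule integrable_of_real) (use assms in \<open>simp add: sq_integrable_def\<close>)
  show "complex_of_real (sq_norm M f) = (LINT x|M. f x * cnj (f x))"
    unfolding eq sq_norm_def by (rule integral_complex_of_real[symmetric])
qed

lemma sq_integrable_cnj: "sq_integrable M f \<Longrightarrow> sq_integrable M (\<lambda>x. cnj (f x))"
  using measurable_compose[OF _ borel_measurable_continuous_onI[OF continuous_on_cnj[OF continuous_on_id]], of f M]
  by (simp add: sq_integrable_def)

lemma sq_norm_commute: "sq_norm M (\<lambda>x. f x - g x) = sq_norm M (\<lambda>x. g x - f x)"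
  by (simp add: sq_norm_def norm_minus_commute)

locale orthonormal_family =
  fixes M :: "'a measure" and e :: "'i \<Rightarrow> 'a \<Rightarrow> real"
  assumes e_sq: "\<And>m. sq_integrable M (\<lambda>x. complex_of_real (e m x))"
    and e_orth: "\<And>l m. (LINT x|M. e l x * e m x) = (if l = m then 1 else 0)"
begin

definition coeff :: "('a \<Rightarrow> complex) \<Rightarrow> 'i \<Rightarrow> complex" where
  "coeff f m = (LINT x|M. f x * complex_of_real (e m x))"

lemma coeff_sum:
  assumes "finite F"
  shows "coeff (\<lambda>x. \<Sum>m\<in>F. c m * complex_of_real (e m x)) l = (if l \<in> F then c l else 0)"
proof -
  have "coeff (\<lambda>x. \<Sum>m\<in>F. c m * complex_of_real (e m x)) l = (LINT x|M. (\<Sum>m\<in>F. c m * (complex_of_real (e m x) * complex_of_real (e l x))))"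
    by (simp add: coeff_def sum_distrib_right mult.assoc)
  also have "\<dots> = (\<Sum>m\<in>F. c m * (LINT x|M. complex_of_real (e m x * e l x)))"
    using integrable_sq_integrable_mult[OF e_sq e_sq]
    by (subst Bochner_Integration.integral_sum) (simp_all add: mult.assoc)
  also have "\<dots> = (\<Sum>m\<in>F. c m * (if m = l then 1 else 0))"
    unfolding integral_complex_of_real e_orth by (intro sum.cong refl) auto
  finally show ?thesis using assms by (simp add: if_distrib cong: if_cong)
qed

lemma coeff_linear:
  assumes "sq_integrable M f" "sq_integrable M g"
  shows "coeff (\<lambda>x. a * f x + b * g x) m = a * coeff f m + b * coeff g m"
proof -
  have "integrable M (\<lambda>x. f x * complex_of_real (e m x))" "integrable M (\<lambda>x. g x * complex_of_real (e m x))"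
    using assms by (auto intro: integrable_sq_integrable_mult e_sq)
  then show ?thesis
    unfolding coeff_def by (simp add: distrib_right mult.assoc)
qed

lemma sq_integrable_span: "sq_integrable M (\<lambda>x. \<Sum>m\<in>F. c m * complex_of_real (e m x))"
  by (intro sq_integrable_sum sq_integrable_cmult e_sq)

lemma sq_norm_span:
  assumes "finite F"
  shows "sq_norm M (\<lambda>x. \<Sum>m\<in>F. c m * complex_of_real (e m x)) = (\<Sum>m\<in>F. (norm (c m))\<^sup>2)"
proof -
  let ?s = "\<lambda>x. \<Sum>m\<in>F. c m * complex_of_real (e m x)"
  have "complex_of_real (sq_norm M ?s) = (LINT x|M. ?s x * cnj (?s x))"
    by (rule sq_norm_complex) (rule sq_integrable_span)
  also have "\<dots> = (LINT x|M. (\<Sum>m\<in>F. cnj (c m) * (?s x * complex_of_real (e m x))))"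
    by (simp add: sum_distrib_left mult_ac)
  also have "\<dots> = (\<Sum>m\<in>F. cnj (c m) * coeff ?s m)"
    unfolding coeff_def using integrable_sq_integrable_mult[OF sq_integrable_span e_sq]
    by (subst Bochner_Integration.integral_sum) simp_all
  also have "\<dots> = (\<Sum>m\<in>F. complex_of_real ((norm (c m))\<^sup>2))"
  proof (intro sum.cong refl)
    fix m assume "m \<in> F"
    then have "cnj (c m) * coeff ?s m = c m * cnj (c m)"
      by (simp only: coeff_sum[OF assms] if_True mult.commute)
    then show "cnj (c m) * coeff ?s m = complex_of_real ((norm (c m))\<^sup>2)"
      by (simp only: complex_norm_square)
  qed
  finally show ?thesis
    unfolding of_real_sum[symmetric] of_real_eq_iff .
qed

text \<open>The squared distance of \<open>f\<close> to its partial expansion is the difference of the two sides.\<close>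

lemma bessel:
  assumes f: "sq_integrable M f" and F: "finite F"
  shows "(\<Sum>m\<in>F. (norm (coeff f m))\<^sup>2) \<le> sq_norm M f"
proof -
  let ?s = "\<lambda>x. \<Sum>m\<in>F. coeff f m * complex_of_real (e m x)"
  let ?N = "\<Sum>m\<in>F. (norm (coeff f m))\<^sup>2"
  have s: "sq_integrable M ?s" by (rule sq_integrable_span)
  have d: "sq_integrable M (\<lambda>x. f x - ?s x)" by (rule sq_integrable_diff(1)[OF f s])
  have i1: "integrable M (\<lambda>x. f x * cnj (?s x))"
    by (rule integrable_sq_integrable_mult[OF f sq_integrable_cnj[OF s]])
  have fs: "(LINT x|M. f x * cnj (?s x)) = complex_of_real ?N"
  proof -
    have "(LINT x|M. f x * cnj (?s x)) = (LINT x|M. (\<Sum>m\<in>F. cnj (coeff f m) * (f x * complex_of_real (e m x))))"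
      by (simp add: sum_distrib_left mult_ac)
    also have "\<dots> = (\<Sum>m\<in>F. cnj (coeff f m) * coeff f m)"
      unfolding coeff_def[of f] using integrable_sq_integrable_mult[OF f e_sq]
      by (subst Bochner_Integration.integral_sum) simp_all
    also have "\<dots> = complex_of_real ?N"
      unfolding of_real_sum by (simp only: complex_norm_square mult.commute)
    finally show ?thesis .
  qed
  have i2: "integrable M (\<lambda>x. cnj (f x * cnj (?s x)))"
    by (rule integrable_bounded_linear[OF bounded_linear_cnj i1])
  have sf: "(LINT x|M. cnj (f x * cnj (?s x))) = complex_of_real ?N"
    unfolding integral_bounded_linear[OF bounded_linear_cnj i1] fs by (rule complex_cnj_complex_of_real)
  have "complex_of_real (sq_norm M (\<lambda>x. f x - ?s x)) = (LINT x|M. (f x - ?s x) * cnj (f x - ?s x))"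
    by (rule sq_norm_complex[OF d])
  also have "\<dots> = (LINT x|M. f x * cnj (f x) - f x * cnj (?s x) - cnj (f x * cnj (?s x)) + ?s x * cnj (?s x))"
    by (intro Bochner_Integration.integral_cong refl) (simp add: algebra_simps)
  also have "\<dots> = complex_of_real (sq_norm M f) - complex_of_real ?N - complex_of_real ?N + complex_of_real (sq_norm M ?s)"
  proof -
    have split: "(LINT x|M. p x - q x - r x + t x) = integral\<^sup>L M p - integral\<^sup>L M q - integral\<^sup>L M r + integral\<^sup>L M t"
      if "integrable M p" "integrable M q" "integrable M r" "integrable M t" for p q r t :: "'a \<Rightarrow> complex"
      using that by simp
    show ?thesis
      unfolding sq_norm_complex(2)[OF f] sq_norm_complex(2)[OF s] fs[symmetric]
      by (subst split[OF sq_norm_complex(1)[OF f] i1 i2 sq_norm_complex(1)[OF s]])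
         (simp only: sf fs)
  qed
  also have "\<dots> = complex_of_real (sq_norm M f - ?N)"
    by (simp add: sq_norm_span[OF F])
  finally have "sq_norm M (\<lambda>x. f x - ?s x) = sq_norm M f - ?N"
    unfolding of_real_eq_iff .
  then show ?thesis using sq_norm_nonneg[of M "\<lambda>x. f x - ?s x"] by linarith
qed

text \<open>Sending the \<open>m\<close>-th basis function to \<open>g m\<close> defines an operator on the span; \<open>f\<close> is mapped to
the limit of the images of its partial expansions over the sets \<open>B n\<close>. These partial images form a Cauchy
sequence by Bessel's inequality. The constant \<open>4 * K\<close> instead of \<open>K\<close> is due to the estimate
\<open>\<bar>a + b\<bar>\<^sup>2 \<le> 2 \<bar>a\<bar>\<^sup>2 + 2 \<bar>b\<bar>\<^sup>2\<close> that stands in for the triangle inequality.\<close>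

lemma bounded_extension:
  fixes g :: "'i \<Rightarrow> 'a \<Rightarrow> complex" and B :: "nat \<Rightarrow> 'i set"
  assumes B: "\<And>n. finite (B n)" "\<And>n. B n \<subseteq> B (Suc n)" "\<And>F. finite F \<Longrightarrow> \<exists>n. F \<subseteq> B n"
    and g: "\<And>m. sq_integrable M (g m)"
    and K: "0 \<le> K" "\<And>F c. finite F \<Longrightarrow> sq_norm M (\<lambda>x. \<Sum>m\<in>F. c m * g m x) \<le> K * (\<Sum>m\<in>F. (norm (c m))\<^sup>2)"
  shows "\<exists>T. (\<forall>f. sq_integrable M f \<longrightarrow> sq_integrable M (T f) \<and> sq_norm M (T f) \<le> 4 * K * sq_norm M f) \<and>
     (\<forall>f h a b. sq_integrable M f \<longrightarrow> sq_integrable M h \<longrightarrow>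
        (AE x in M. T (\<lambda>x. a * f x + b * h x) x = a * T f x + b * T h x)) \<and>
     (\<forall>F c. finite F \<longrightarrow> (AE x in M. T (\<lambda>x. \<Sum>m\<in>F. c m * complex_of_real (e m x)) x = (\<Sum>m\<in>F. c m * g m x)))"
proof -
  define S where "S f n x = (\<Sum>m\<in>B n. coeff f m * g m x)" for f n x
  define lim_of where "lim_of f h \<longleftrightarrow> sq_integrable M h \<and> (\<lambda>n. sq_norm M (\<lambda>x. S f n x - h x)) \<longlonglongrightarrow> 0" for f h
  define T where "T f = (SOME h. lim_of f h)" for f
  have B_mono: "m \<le> n \<Longrightarrow> B m \<subseteq> B n" for m n
    using lift_Suc_mono_le[of B] B(2) by blast
  have S_sq: "sq_integrable M (S f n)" for f n
    unfolding S_def[abs_def] by (intro sq_integrable_sum sq_integrable_cmult g)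
  have T: "lim_of f (T f)" if f: "sq_integrable M f" for f
  proof -
    define a where "a n = (\<Sum>m\<in>B n. (norm (coeff f m))\<^sup>2)" for n
    have "incseq a"
      unfolding a_def by (intro incseq_SucI sum_mono2 B) auto
    moreover have "a n \<le> sq_norm M f" for n
      unfolding a_def by (rule bessel[OF f B(1)])
    ultimately have "convergent a"
      using incseq_convergent[of a "sq_norm M f"] by (metis convergent_def)
    then have "Cauchy a" by (rule convergent_Cauchy)
    have diff: "sq_norm M (\<lambda>x. S f m x - S f n x) \<le> K * \<bar>a m - a n\<bar>" if "n \<le> m" for m n
    proof -
      have fin: "finite (B m)" by (rule B)
      have "S f m x - S f n x = (\<Sum>i\<in>B m - B n. coeff f i * g i x)" for x
        unfolding S_def using B_mono[OF that] fin by (simp add: sum_diff)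
      then have "sq_norm M (\<lambda>x. S f m x - S f n x) \<le> K * (\<Sum>i\<in>B m - B n. (norm (coeff f i))\<^sup>2)"
        using K(2)[of "B m - B n" "coeff f"] fin by simp
      also have "(\<Sum>i\<in>B m - B n. (norm (coeff f i))\<^sup>2) = a m - a n"
        unfolding a_def using B_mono[OF that] fin by (simp add: sum_diff)
      also have "K * (a m - a n) \<le> K * \<bar>a m - a n\<bar>"
        by (intro mult_left_mono K) auto
      finally show ?thesis .
    qed
    then have diff': "sq_norm M (\<lambda>x. S f m x - S f n x) \<le> K * \<bar>a m - a n\<bar>" for m n
      using diff[of n m] diff[of m n] sq_norm_commute[of M "S f m" "S f n"] abs_minus_commute[of "a m" "a n"]
      by (cases "n \<le> m") auto
    have "\<exists>h. sq_integrable M h \<and> (\<lambda>n. sq_norm M (\<lambda>x. S f n x - h x)) \<longlonglongrightarrow> 0"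
    proof (rule riesz_fischer)
      fix \<epsilon> :: real assume "0 < \<epsilon>"
      then have "0 < \<epsilon> / (K + 1)" using K by simp
      then obtain N where N: "\<And>m n. N \<le> m \<Longrightarrow> N \<le> n \<Longrightarrow> norm (a m - a n) < \<epsilon> / (K + 1)"
        using CauchyD[OF \<open>Cauchy a\<close>] by blast
      show "\<exists>N. \<forall>m\<ge>N. \<forall>n\<ge>N. sq_norm M (\<lambda>x. S f m x - S f n x) < \<epsilon>"
      proof (intro exI[of _ N] allI impI)
        fix m n assume "N \<le> m" "N \<le> n"
        have "sq_norm M (\<lambda>x. S f m x - S f n x) \<le> K * \<bar>a m - a n\<bar>" by (rule diff')
        also have "\<dots> \<le> (K + 1) * \<bar>a m - a n\<bar>" by (intro mult_right_mono) auto
        also have "\<dots> < (K + 1) * (\<epsilon> / (K + 1))"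
          using N[OF \<open>N \<le> m\<close> \<open>N \<le> n\<close>] K by (intro mult_strict_left_mono) auto
        also have "\<dots> = \<epsilon>" using K by simp
        finally show "sq_norm M (\<lambda>x. S f m x - S f n x) < \<epsilon>" .
      qed
    qed (rule S_sq)
    then have "\<exists>h. lim_of f h" by (simp add: lim_of_def)
    then show ?thesis unfolding T_def by (rule someI_ex)
  qed
  have unique: "AE x in M. h x = h' x" if h: "sq_integrable M h" "sq_integrable M h'"
    and s: "\<And>n. sq_integrable M (s n)"
    and l: "(\<lambda>n. sq_norm M (\<lambda>x. s n x - h x)) \<longlonglongrightarrow> 0" "(\<lambda>n. sq_norm M (\<lambda>x. s n x - h' x)) \<longlonglongrightarrow> 0"
    for s :: "nat \<Rightarrow> 'a \<Rightarrow> complex" and h h'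
  proof -
    have "(\<lambda>n. 2 * sq_norm M (\<lambda>x. s n x - h' x) + 2 * sq_norm M (\<lambda>x. s n x - h x)) \<longlonglongrightarrow> 2 * 0 + 2 * 0"
      by (intro tendsto_intros l)
    moreover have "sq_norm M (\<lambda>x. h x - h' x) \<le> 2 * sq_norm M (\<lambda>x. s n x - h' x) + 2 * sq_norm M (\<lambda>x. s n x - h x)" for n
      using sq_integrable_diff(2)[OF sq_integrable_diff(1)[OF s[of n] h(2)] sq_integrable_diff(1)[OF s[of n] h(1)]] by simp
    ultimately have "sq_norm M (\<lambda>x. h x - h' x) \<le> 0"
      by (intro LIMSEQ_le_const[of _ 0]) auto
    then have "sq_norm M (\<lambda>x. h x - h' x) = 0" using sq_norm_nonneg by (intro antisym)
    from sq_norm_eq_0_AE[OF sq_integrable_diff(1)[OF h] this] show ?thesis by simp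
  qed
  have lin: "lim_of (\<lambda>x. a * f x + b * h x) (\<lambda>x. a * T f x + b * T h x)"
    if f: "sq_integrable M f" and h: "sq_integrable M h" for f h a b
  proof -
    have Tf: "sq_integrable M (T f)" "(\<lambda>n. sq_norm M (\<lambda>x. S f n x - T f x)) \<longlonglongrightarrow> 0"
      and Th: "sq_integrable M (T h)" "(\<lambda>n. sq_norm M (\<lambda>x. S h n x - T h x)) \<longlonglongrightarrow> 0"
      using T[OF f] T[OF h] by (auto simp: lim_of_def)
    have S_lin: "S (\<lambda>x. a * f x + b * h x) n x = a * S f n x + b * S h n x" for n x
      unfolding S_def by (simp add: coeff_linear[OF f h] sum_distrib_left sum.distrib algebra_simps)
    have "(\<lambda>n. sq_norm M (\<lambda>x. S (\<lambda>x. a * f x + b * h x) n x - (a * T f x + b * T h x))) \<longlonglongrightarrow> 0"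
    proof (rule tendsto_sandwich[OF _ _ tendsto_const])
      show "(\<lambda>n. 2 * ((norm a)\<^sup>2 * sq_norm M (\<lambda>x. S f n x - T f x)) + 2 * ((norm b)\<^sup>2 * sq_norm M (\<lambda>x. S h n x - T h x))) \<longlonglongrightarrow> 0"
        using Tf(2) Th(2) by (auto intro!: tendsto_eq_intros)
      show "\<forall>\<^sub>F n in sequentially. sq_norm M (\<lambda>x. S (\<lambda>x. a * f x + b * h x) n x - (a * T f x + b * T h x))
          \<le> 2 * ((norm a)\<^sup>2 * sq_norm M (\<lambda>x. S f n x - T f x)) + 2 * ((norm b)\<^sup>2 * sq_norm M (\<lambda>x. S h n x - T h x))"
      proof (intro always_eventually allI)
        fix n
        have d: "sq_integrable M (\<lambda>x. S f n x - T f x)" "sq_integrable M (\<lambda>x. S h n x - T h x)"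
          by (intro sq_integrable_diff S_sq Tf Th)+
        have "S (\<lambda>x. a * f x + b * h x) n x - (a * T f x + b * T h x) = a * (S f n x - T f x) + b * (S h n x - T h x)" for x
          by (simp add: S_lin algebra_simps)
        then show "sq_norm M (\<lambda>x. S (\<lambda>x. a * f x + b * h x) n x - (a * T f x + b * T h x))
          \<le> 2 * ((norm a)\<^sup>2 * sq_norm M (\<lambda>x. S f n x - T f x)) + 2 * ((norm b)\<^sup>2 * sq_norm M (\<lambda>x. S h n x - T h x))"
          using sq_integrable_add(2)[OF sq_integrable_cmult(1)[OF d(1), of a] sq_integrable_cmult(1)[OF d(2), of b]]
          by (simp add: sq_integrable_cmult(2)[OF d(1)] sq_integrable_cmult(2)[OF d(2)])
      qed
    qed (simp add: sq_norm_nonneg)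
    moreover have "sq_integrable M (\<lambda>x. a * T f x + b * T h x)"
      by (intro sq_integrable_add sq_integrable_cmult Tf Th)
    ultimately show ?thesis by (simp add: lim_of_def)
  qed
  have bound: "sq_norm M (T f) \<le> 4 * K * sq_norm M f" if f: "sq_integrable M f" for f
  proof -
    have Tf: "sq_integrable M (T f)" "(\<lambda>n. sq_norm M (\<lambda>x. S f n x - T f x)) \<longlonglongrightarrow> 0"
      using T[OF f] by (auto simp: lim_of_def)
    have "(\<lambda>n. 2 * (K * sq_norm M f) + 2 * sq_norm M (\<lambda>x. S f n x - T f x)) \<longlonglongrightarrow> 2 * (K * sq_norm M f) + 2 * 0"
      by (intro tendsto_intros Tf)
    moreover have "sq_norm M (T f) \<le> 2 * (K * sq_norm M f) + 2 * sq_norm M (\<lambda>x. S f n x - T f x)" for n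
    proof -
      have "sq_norm M (T f) \<le> 2 * sq_norm M (S f n) + 2 * sq_norm M (\<lambda>x. S f n x - T f x)"
        using sq_integrable_diff(2)[OF S_sq sq_integrable_diff(1)[OF S_sq Tf(1)], of f n f n] by simp
      moreover have "sq_norm M (S f n) \<le> K * sq_norm M f"
      proof -
        have "sq_norm M (S f n) \<le> K * (\<Sum>m\<in>B n. (norm (coeff f m))\<^sup>2)"
          unfolding S_def[abs_def] by (rule K(2)[OF B(1)])
        also have "\<dots> \<le> K * sq_norm M f"
          by (intro mult_left_mono K bessel f B)
        finally show ?thesis .
      qed
      ultimately show ?thesis by linarith
    qed
    ultimately have "sq_norm M (T f) \<le> 2 * (K * sq_norm M f) + 2 * 0"
      by (intro LIMSEQ_le_const) auto
    also have "\<dots> \<le> 4 * K * sq_norm M f"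
      using mult_nonneg_nonneg[OF K(1) sq_norm_nonneg[of M f]] by linarith
    finally show ?thesis .
  qed
  have span: "lim_of (\<lambda>x. \<Sum>m\<in>F. c m * complex_of_real (e m x)) (\<lambda>x. \<Sum>m\<in>F. c m * g m x)" if F: "finite F" for F c
  proof -
    let ?f = "\<lambda>x. \<Sum>m\<in>F. c m * complex_of_real (e m x)"
    obtain n0 where n0: "F \<subseteq> B n0" using B(3)[OF F] by blast
    have "S ?f n x = (\<Sum>m\<in>F. c m * g m x)" if "n0 \<le> n" for n x
      unfolding S_def using B_mono[OF that] n0 B(1)[of n]
      by (intro sum.mono_neutral_cong_right) (auto simp: coeff_sum[OF F])
    then have "\<forall>\<^sub>F n in sequentially. sq_norm M (\<lambda>x. S ?f n x - (\<Sum>m\<in>F. c m * g m x)) = 0"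
      by (intro eventually_sequentiallyI[of n0]) (simp add: sq_norm_def)
    then have "(\<lambda>n. sq_norm M (\<lambda>x. S ?f n x - (\<Sum>m\<in>F. c m * g m x))) \<longlonglongrightarrow> 0"
      by (rule tendsto_eventually)
    moreover have "sq_integrable M (\<lambda>x. \<Sum>m\<in>F. c m * g m x)"
      by (intro sq_integrable_sum sq_integrable_cmult g)
    ultimately show ?thesis by (simp add: lim_of_def)
  qed
  have AE_T: "AE x in M. T f x = h x" if "sq_integrable M f" "lim_of f h" for f h
    using T[OF that(1)] that(2) unfolding lim_of_def by (intro unique[of "T f" h "S f"] S_sq) auto
  show ?thesis
  proof (intro exI[of _ T] conjI allI impI)
    fix f assume "sq_integrable M f"
    then show "sq_integrable M (T f)" using T by (simp add: lim_of_def)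
  next
    fix f assume "sq_integrable M f"
    then show "sq_norm M (T f) \<le> 4 * K * sq_norm M f" by (rule bound)
  next
    fix f h :: "'a \<Rightarrow> complex" and a b assume f: "sq_integrable M f" and h: "sq_integrable M h"
    show "AE x in M. T (\<lambda>x. a * f x + b * h x) x = a * T f x + b * T h x"
      by (intro AE_T lin f h sq_integrable_add sq_integrable_cmult)
  next
    fix F :: "'i set" and c :: "'i \<Rightarrow> complex" assume "finite F"
    then show "AE x in M. T (\<lambda>x. \<Sum>m\<in>F. c m * complex_of_real (e m x)) x = (\<Sum>m\<in>F. c m * g m x)"
      by (intro AE_T span sq_integrable_span)
  qed
qed

end

section \<open>Boundedness on square integrable functions\<close>

text \<open>Fubini's theorem, transported from the product measure along the coordinate bijection.\<close>

lemma has_bochner_integral_lborel_vec_prod: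
  fixes f :: "'n::finite \<Rightarrow> real \<Rightarrow> real"
  assumes f: "\<And>i. has_bochner_integral lborel (f i) (I i)"
  shows "has_bochner_integral lborel (\<lambda>x::real^'n. \<Prod>i\<in>UNIV. f i (x $ i)) (\<Prod>i\<in>UNIV. I i)"
proof -
  interpret product_sigma_finite "\<lambda>b::real^'n. lborel :: real measure" by standard
  define ax where "ax i = (axis i 1 :: real^'n)" for i :: 'n
  have inj: "inj ax" by (auto simp: ax_def inj_def axis_eq_axis)
  have Basis: "(Basis :: (real^'n) set) = range ax" by (auto simp: Basis_vec_def ax_def)
  define g where "g b = f (inv ax b)" for b
  have g: "g (ax i) = f i" for i by (simp add: g_def inj)
  have int: "integrable lborel (f i)" "integral\<^sup>L lborel (f i) = I i" for i
    using f[of i] by (auto simp: has_bochner_integral_iff)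
  have gi: "integrable lborel (g b)" for b using int by (simp add: g_def)
  have [measurable]: "f i \<in> borel_measurable borel" for i using int(1)[of i] by auto
  define T where "T h = (\<Sum>b\<in>Basis. h b *\<^sub>R b)" for h :: "real^'n \<Rightarrow> real"
  have T: "T h $ i = h (ax i)" for h i
  proof -
    have "T h \<bullet> ax i = h (ax i)"
      unfolding T_def by (rule inner_sum_left_Basis) (simp add: Basis)
    then show ?thesis by (simp add: ax_def inner_axis)
  qed
  have eq: "(\<Prod>i\<in>UNIV. f i (T h $ i)) = (\<Prod>b\<in>Basis. g b (h b))" for h
    unfolding T Basis by (simp add: prod.reindex[OF inj] g)
  have [measurable]: "T \<in> measurable (\<Pi>\<^sub>M b\<in>Basis. lborel) borel"
    unfolding T_def[abs_def] by measurable
  have lb: "lborel = distr (\<Pi>\<^sub>M b\<in>Basis. lborel) borel T"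
    unfolding T_def[abs_def] by (rule lborel_eq)
  have "integrable (\<Pi>\<^sub>M b\<in>Basis. lborel) (\<lambda>h. \<Prod>b\<in>Basis. g b (h b))"
    by (rule product_integrable_prod) (auto simp: gi)
  moreover have "(\<integral>h. (\<Prod>b\<in>Basis. g b (h b)) \<partial>(\<Pi>\<^sub>M b\<in>Basis. lborel)) = (\<Prod>b\<in>Basis. integral\<^sup>L lborel (g b))"
    by (rule product_integral_prod) (auto simp: gi)
  moreover have "(\<Prod>b\<in>Basis. integral\<^sup>L lborel (g b)) = (\<Prod>i\<in>UNIV. I i)"
    unfolding Basis by (simp add: prod.reindex[OF inj] g int)
  ultimately have "has_bochner_integral (\<Pi>\<^sub>M b\<in>Basis. lborel) (\<lambda>h. \<Prod>i\<in>UNIV. f i (T h $ i)) (\<Prod>i\<in>UNIV. I i)"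
    unfolding eq by (simp add: has_bochner_integral_iff)
  then show ?thesis
    unfolding lb by (simp add: has_bochner_integral_iff integrable_distr_eq integral_distr)
qed

lemma Rplus_sets: "(Rplus :: (real^'n) set) \<in> sets lebesgue"
  using borel_open[OF open_Rplus] by (intro sets_completionI_sets) simp

lemma phi_eq:
  assumes "x \<in> Rplus"
  shows "phi \<nu> m x = (\<Prod>i\<in>UNIV. laguerre_weight (\<nu> $ i) (x $ i) * (laguerre_norm (\<nu> $ i) (m $ i) * laguerre_poly (\<nu> $ i) (m $ i) ((x $ i)\<^sup>2)))"
  using assms by (simp add: phi_def Rplus_def phi1_eq)

lemma continuous_on_phi: "continuous_on Rplus (phi \<nu> m)"
proof -
  have "continuous_on Rplus (\<lambda>x. \<Prod>i\<in>UNIV. laguerre_weight (\<nu> $ i) (x $ i) * (laguerre_norm (\<nu> $ i) (m $ i) * laguerre_poly (\<nu> $ i) (m $ i) ((x $ i)\<^sup>2)))"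
    unfolding laguerre_weight_def laguerre_poly_def
    by (intro continuous_intros) (auto simp: Rplus_def less_imp_neq[symmetric])
  then show ?thesis
    by (rule continuous_on_cong[THEN iffD1, OF refl _, rotated]) (simp add: phi_eq)
qed

lemma phi_orthonormal:
  fixes \<nu> :: "real^'n"
  assumes \<nu>: "\<And>i. -1 < \<nu> $ i"
  shows "has_bochner_integral (lebesgue_on Rplus) (\<lambda>x. phi \<nu> l x * phi \<nu> m x) (if l = m then 1 else 0)"
proof -
  have "has_bochner_integral lborel (\<lambda>x::real^'n. \<Prod>i\<in>UNIV. indicator {0<..} (x $ i) * (phi1 (\<nu> $ i) (l $ i) (x $ i) * phi1 (\<nu> $ i) (m $ i) (x $ i)))
     (\<Prod>i\<in>UNIV. if l $ i = m $ i then 1 else 0)"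
    by (intro has_bochner_integral_lborel_vec_prod[where f = "\<lambda>i u. indicator {0<..} u * (phi1 (\<nu> $ i) (l $ i) u * phi1 (\<nu> $ i) (m $ i) u)"] phi1_orthonormal \<nu>)
  moreover have "(\<Prod>i\<in>UNIV. if l $ i = m $ i then 1 else (0::real)) = (if l = m then 1 else 0)"
    by (auto simp: vec_eq_iff)
  moreover have "(\<Prod>i\<in>UNIV. indicator {0<..} (x $ i) * (phi1 (\<nu> $ i) (l $ i) (x $ i) * phi1 (\<nu> $ i) (m $ i) (x $ i)))
     = indicator Rplus x *\<^sub>R (phi \<nu> l x * phi \<nu> m x)" for x :: "real^'n"
  proof (cases "x \<in> Rplus")
    case True
    then show ?thesis by (simp add: Rplus_def phi_def prod.distrib)
  next
    case False
    then obtain j where "\<not> 0 < x $ j" by (auto simp: Rplus_def)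
    then have "(\<Prod>i\<in>UNIV. indicator {0<..} (x $ i) * (phi1 (\<nu> $ i) (l $ i) (x $ i) * phi1 (\<nu> $ i) (m $ i) (x $ i))) = 0"
      by (intro prod_zero bexI[of _ j]) auto
    then show ?thesis using False by simp
  qed
  ultimately have "has_bochner_integral lborel (\<lambda>x. indicator Rplus x *\<^sub>R (phi \<nu> l x * phi \<nu> m x)) (if l = m then 1 else 0)"
    by simp
  then have "has_bochner_integral lebesgue (\<lambda>x. indicator Rplus x *\<^sub>R (phi \<nu> l x * phi \<nu> m x)) (if l = m then 1 else 0)"
    by (auto simp: has_bochner_integral_iff integrable_completion integral_completion)
  moreover have R: "(Rplus :: (real^'n) set) \<inter> space lebesgue \<in> sets lebesgue"
    using Rplus_sets by simp
  ultimately show ?thesis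
    unfolding has_bochner_integral_iff integrable_restrict_space[OF R] integral_restrict_space[OF R] by blast
qed

lemma sq_integrable_phi:
  assumes \<nu>: "\<And>i. -1 < \<nu> $ i"
  shows "sq_integrable (lebesgue_on Rplus) (\<lambda>x. complex_of_real (phi \<nu> m x))"
proof -
  have "phi \<nu> m \<in> borel_measurable (lebesgue_on Rplus)"
    by (intro continuous_imp_measurable_on_sets_lebesgue continuous_on_phi Rplus_sets)
  then show ?thesis
    using phi_orthonormal[OF \<nu>, of m m]
    by (simp add: sq_integrable_def has_bochner_integral_iff power2_eq_square)
qed

lemma orthonormal_family_phi:
  assumes \<nu>: "\<And>i. -1 < \<nu> $ i"
  shows "orthonormal_family (lebesgue_on Rplus) (phi \<nu>)"
  using sq_integrable_phi[OF \<nu>] phi_orthonormal[OF \<nu>]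
  by unfold_locales (auto simp: has_bochner_integral_iff)

text \<open>Boxes exhaust the multi-indices, and sums of products over a box factorise.\<close>

definition index_box :: "nat \<Rightarrow> (nat ^ 'n) set" where
  "index_box N = {m. \<forall>i. m $ i \<le> N}"

lemma index_box_eq: "(index_box N :: (nat ^ 'n) set) = vec_lambda ` (PiE UNIV (\<lambda>_. {..N}))"
proof (intro equalityI subsetI)
  fix m :: "nat ^ 'n" assume "m \<in> index_box N"
  then show "m \<in> vec_lambda ` (PiE UNIV (\<lambda>_. {..N}))"
    by (intro image_eqI[of _ _ "vec_nth m"]) (auto simp: index_box_def)
qed (auto simp: index_box_def PiE_def Pi_def)

lemma finite_index_box: "finite (index_box N :: (nat ^ 'n) set)"
  unfolding index_box_eq by (intro finite_imageI finite_PiE) auto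

lemma index_box_mono: "M \<le> N \<Longrightarrow> index_box M \<subseteq> index_box N"
  by (fastforce simp: index_box_def intro: order_trans)

lemma finite_subset_index_box:
  assumes "finite F"
  shows "\<exists>N. F \<subseteq> (index_box N :: (nat ^ 'n) set)"
proof -
  have "m \<in> index_box (\<Sum>m\<in>F. \<Sum>i\<in>UNIV. m $ i)" if m: "m \<in> F" for m :: "nat ^ 'n"
    unfolding index_box_def
  proof (intro CollectI allI)
    fix i
    have "m $ i \<le> (\<Sum>i\<in>UNIV. m $ i)" by (rule member_le_sum) auto
    also have "\<dots> \<le> (\<Sum>m\<in>F. \<Sum>i\<in>UNIV. m $ i)"
      using assms m by (intro member_le_sum[of m F "\<lambda>m. \<Sum>i\<in>UNIV. m $ i"]) auto
    finally show "m $ i \<le> (\<Sum>m\<in>F. \<Sum>i\<in>UNIV. m $ i)" .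
  qed
  then show ?thesis by blast
qed

lemma sum_index_box_prod:
  fixes f :: "'n::finite \<Rightarrow> nat \<Rightarrow> 'b::comm_semiring_1"
  shows "(\<Sum>m\<in>index_box N. \<Prod>i\<in>UNIV. f i (m $ i)) = (\<Prod>i\<in>UNIV. \<Sum>j\<le>N. f i j)"
proof -
  have "inj_on vec_lambda (PiE UNIV (\<lambda>_. {..N}) :: ('n \<Rightarrow> nat) set)"
    by (auto simp: inj_on_def vec_lambda_inject)
  then show ?thesis
    unfolding index_box_eq by (subst sum.reindex) (simp_all add: prod_sum_PiE)
qed

text \<open>Split each entry as the square root of \<open>\<bar>A l m\<bar> * w m\<close> times the square root of
\<open>\<bar>A l m\<bar> / w m\<close>, apply the Cauchy-Schwarz inequality to each row, and then sum over the columns.\<close>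

lemma schur_test:
  fixes A :: "'i \<Rightarrow> 'j \<Rightarrow> real" and c :: "'j \<Rightarrow> complex"
  assumes w: "\<And>l. l \<in> X \<Longrightarrow> 0 < v l" "\<And>m. m \<in> Y \<Longrightarrow> 0 < w m"
    and C: "0 \<le> C"
    and row: "\<And>l. l \<in> X \<Longrightarrow> (\<Sum>m\<in>Y. \<bar>A l m\<bar> * w m) \<le> C * v l"
    and col: "\<And>m. m \<in> Y \<Longrightarrow> (\<Sum>l\<in>X. \<bar>A l m\<bar> * v l) \<le> C * w m"
  shows "(\<Sum>l\<in>X. (norm (\<Sum>m\<in>Y. complex_of_real (A l m) * c m))\<^sup>2) \<le> C\<^sup>2 * (\<Sum>m\<in>Y. (norm (c m))\<^sup>2)"
proof -
  have "(\<Sum>l\<in>X. (norm (\<Sum>m\<in>Y. complex_of_real (A l m) * c m))\<^sup>2)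
     \<le> (\<Sum>l\<in>X. \<Sum>m\<in>Y. C * ((norm (c m))\<^sup>2 / w m) * (\<bar>A l m\<bar> * v l))"
  proof (rule sum_mono)
    fix l assume l: "l \<in> X"
    have "norm (\<Sum>m\<in>Y. complex_of_real (A l m) * c m) \<le> (\<Sum>m\<in>Y. \<bar>A l m\<bar> * norm (c m))"
      using norm_sum[of "\<lambda>m. complex_of_real (A l m) * c m" Y] by (simp add: norm_mult)
    also have "\<dots> = (\<Sum>m\<in>Y. sqrt (\<bar>A l m\<bar> * w m) * sqrt (\<bar>A l m\<bar> * ((norm (c m))\<^sup>2 / w m)))"
    proof (intro sum.cong refl)
      fix m assume "m \<in> Y"
      then have "0 < w m" by (rule w)
      then have "\<bar>A l m\<bar> * w m * (\<bar>A l m\<bar> * ((norm (c m))\<^sup>2 / w m)) = (\<bar>A l m\<bar> * norm (c m))\<^sup>2"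
        by (simp add: power2_eq_square)
      then show "\<bar>A l m\<bar> * norm (c m) = sqrt (\<bar>A l m\<bar> * w m) * sqrt (\<bar>A l m\<bar> * ((norm (c m))\<^sup>2 / w m))"
        unfolding real_sqrt_mult[symmetric] by simp
    qed
    finally have "(norm (\<Sum>m\<in>Y. complex_of_real (A l m) * c m))\<^sup>2 \<le>
       (\<Sum>m\<in>Y. sqrt (\<bar>A l m\<bar> * w m) * sqrt (\<bar>A l m\<bar> * ((norm (c m))\<^sup>2 / w m)))\<^sup>2"
      by (intro power_mono) auto
    also have "\<dots> \<le> (\<Sum>m\<in>Y. (sqrt (\<bar>A l m\<bar> * w m))\<^sup>2) * (\<Sum>m\<in>Y. (sqrt (\<bar>A l m\<bar> * ((norm (c m))\<^sup>2 / w m)))\<^sup>2)"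
      by (rule Cauchy_Schwarz_ineq_sum)
    also have "\<dots> = (\<Sum>m\<in>Y. \<bar>A l m\<bar> * w m) * (\<Sum>m\<in>Y. \<bar>A l m\<bar> * ((norm (c m))\<^sup>2 / w m))"
      using w(2) by (intro arg_cong2[where f = times] sum.cong refl real_sqrt_pow2) (auto simp: less_imp_le)
    also have "\<dots> \<le> (C * v l) * (\<Sum>m\<in>Y. \<bar>A l m\<bar> * ((norm (c m))\<^sup>2 / w m))"
      using w(2) by (intro mult_right_mono row l sum_nonneg) (auto simp: less_imp_le)
    also have "\<dots> = (\<Sum>m\<in>Y. C * ((norm (c m))\<^sup>2 / w m) * (\<bar>A l m\<bar> * v l))"
      by (simp add: sum_distrib_left mult_ac)
    finally show "(norm (\<Sum>m\<in>Y. complex_of_real (A l m) * c m))\<^sup>2 \<le> \<dots>" .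
  qed
  also have "\<dots> = (\<Sum>m\<in>Y. C * ((norm (c m))\<^sup>2 / w m) * (\<Sum>l\<in>X. \<bar>A l m\<bar> * v l))"
    by (subst sum.swap) (simp add: sum_distrib_left)
  also have "\<dots> \<le> (\<Sum>m\<in>Y. C * ((norm (c m))\<^sup>2 / w m) * (C * w m))"
    using C w(2) by (intro sum_mono mult_left_mono col) (auto simp: less_imp_le)
  also have "\<dots> = C\<^sup>2 * (\<Sum>m\<in>Y. (norm (c m))\<^sup>2)"
    unfolding sum_distrib_left using w(2) by (intro sum.cong refl) (fastforce simp: power2_eq_square)
  finally show ?thesis .
qed

text \<open>Coefficients of the image of \<open>phi \<nu> m\<close> in the orthonormal family with the shifted parameter.\<close>

definition riesz_matrix :: "real ^ 'n \<Rightarrow> nat ^ 'n \<Rightarrow> nat ^ 'n \<Rightarrow> nat ^ 'n \<Rightarrow> real" where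
  "riesz_matrix \<nu> k l m = eigenvalue \<nu> m powr (- (real (msize k) / 2)) *
     (\<Prod>i\<in>UNIV. iterated_derivative_matrix (\<nu> $ i) (k $ i) (l $ i) (m $ i))"

text \<open>The image of \<open>phi \<nu> m\<close> under the Riesz transform.\<close>

definition riesz_phi :: "real ^ 'n \<Rightarrow> nat ^ 'n \<Rightarrow> nat ^ 'n \<Rightarrow> real ^ 'n \<Rightarrow> real" where
  "riesz_phi \<nu> k m x = eigenvalue \<nu> m powr (- (real (msize k) / 2)) *
     (\<Prod>i\<in>UNIV. laguerre_weight (\<nu> $ i) (x $ i) * laguerre_factor_deriv (\<nu> $ i) (m $ i) (k $ i) (x $ i))"

definition shifted_parameter :: "real ^ 'n \<Rightarrow> nat ^ 'n \<Rightarrow> real ^ 'n" where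
  "shifted_parameter \<nu> k = (\<chi> i. \<nu> $ i + (if odd (k $ i) then 1 else 0))"

lemma eigenvalue_ge:
  assumes \<nu>: "\<forall>j. - 1 / 2 \<le> \<nu> $ j"
  shows "schur_weight (m $ i) ^ 2 \<le> eigenvalue (\<nu> :: real ^ 'n) m"
proof -
  have "eigenvalue \<nu> m = (\<Sum>j\<in>UNIV. 4 * real (m $ j) + 2 * \<nu> $ j + 2)"
    by (simp add: eigenvalue_def msize_def sum.distrib sum_distrib_left)
  also have "\<dots> \<ge> (\<Sum>j\<in>{i}. 4 * real (m $ j) + 2 * \<nu> $ j + 2)"
  proof (rule sum_mono2)
    fix j
    have "0 \<le> 2 * \<nu> $ j + 2" using \<nu>[rule_format, of j] by linarith
    then show "0 \<le> 4 * real (m $ j) + 2 * \<nu> $ j + 2" by simp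
  qed auto
  moreover have "1 \<le> 2 * \<nu> $ i + 2" using \<nu>[rule_format, of i] by linarith
  ultimately show ?thesis by (simp add: schur_weight_def)
qed

text \<open>Write the power of order \<open>-|k|/2\<close> of the eigenvalue as the product over \<open>i\<close> of its powers of order
\<open>- k\<^sub>i / 2\<close>. The eigenvalue dominates \<open>m\<^sub>i + 1\<close> for each \<open>i\<close> separately, so every coordinate receives the
normalisation of its own order of differentiation.\<close>

lemma riesz_matrix_le:
  assumes \<nu>: "\<forall>j. - 1 / 2 \<le> \<nu> $ j"
  shows "\<bar>riesz_matrix \<nu> k l m\<bar> \<le>
    (\<Prod>i\<in>UNIV. \<bar>iterated_derivative_matrix (\<nu> $ i) (k $ i) (l $ i) (m $ i)\<bar> / schur_weight (m $ i) ^ (k $ i))"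
proof -
  let ?L = "eigenvalue \<nu> m"
  have L: "0 < ?L"
    using eigenvalue_ge[OF \<nu>, of m "undefined"] schur_weight_pos[of "m $ undefined"]
    by (meson less_le_trans zero_less_power)
  have "?L powr (- (real (msize k) / 2)) = ?L powr (\<Sum>i\<in>UNIV. - (real (k $ i) / 2))"
    by (simp add: msize_def sum_negf sum_divide_distrib)
  also have "\<dots> = (\<Prod>i\<in>UNIV. ?L powr (- (real (k $ i) / 2)))"
    using L by (intro powr_sum) auto
  also have "\<dots> \<le> (\<Prod>i\<in>UNIV. 1 / schur_weight (m $ i) ^ (k $ i))"
  proof (intro prod_mono conjI)
    fix i
    have "?L powr (- (real (k $ i) / 2)) \<le> (schur_weight (m $ i) ^ 2) powr (- (real (k $ i) / 2))"
      using eigenvalue_ge[OF \<nu>, of m i] by (intro powr_mono2' zero_less_power schur_weight_pos) auto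
    also have "\<dots> = 1 / schur_weight (m $ i) ^ (k $ i)"
    proof -
      have "(schur_weight (m $ i) ^ 2) powr (- (real (k $ i) / 2)) = schur_weight (m $ i) powr (- real (k $ i))"
        by (simp only: powr_realpow[OF schur_weight_pos, symmetric] powr_powr) simp
      also have "\<dots> = 1 / schur_weight (m $ i) ^ (k $ i)"
        by (simp add: powr_minus powr_realpow divide_inverse)
      finally show ?thesis .
    qed
    finally show "?L powr (- (real (k $ i) / 2)) \<le> 1 / schur_weight (m $ i) ^ (k $ i)" .
  qed auto
  finally have *: "?L powr (- (real (msize k) / 2)) \<le> (\<Prod>i\<in>UNIV. 1 / schur_weight (m $ i) ^ (k $ i))" .
  have "\<bar>riesz_matrix \<nu> k l m\<bar> = ?L powr (- (real (msize k) / 2)) *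
      (\<Prod>i\<in>UNIV. \<bar>iterated_derivative_matrix (\<nu> $ i) (k $ i) (l $ i) (m $ i)\<bar>)"
    by (simp add: riesz_matrix_def abs_mult abs_prod)
  also have "\<dots> \<le> (\<Prod>i\<in>UNIV. 1 / schur_weight (m $ i) ^ (k $ i)) *
      (\<Prod>i\<in>UNIV. \<bar>iterated_derivative_matrix (\<nu> $ i) (k $ i) (l $ i) (m $ i)\<bar>)"
    by (intro mult_right_mono * prod_nonneg) auto
  also have "\<dots> = (\<Prod>i\<in>UNIV. \<bar>iterated_derivative_matrix (\<nu> $ i) (k $ i) (l $ i) (m $ i)\<bar> / schur_weight (m $ i) ^ (k $ i))"
    by (simp add: prod.distrib[symmetric])
  finally show ?thesis .
qed

text \<open>Products of the one-dimensional weights satisfy the conditions of Schur's test for the tensor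
product.\<close>

lemma riesz_matrix_schur:
  assumes \<nu>: "\<forall>j. - 1 / 2 \<le> (\<nu> :: real ^ 'n) $ j"
  shows "\<exists>C\<ge>0. \<forall>N c. (\<Sum>l\<in>index_box N. (norm (\<Sum>m\<in>index_box N. complex_of_real (riesz_matrix \<nu> k l m) * c m))\<^sup>2)
     \<le> C * (\<Sum>m\<in>index_box N. (norm (c m))\<^sup>2)"
proof -
  let ?s = schur_weight
  let ?D = "\<lambda>i. iterated_derivative_matrix (\<nu> $ i) (k $ i)"
  define E where "E i l m = \<bar>?D i l m\<bar> / ?s m ^ (k $ i)" for i l m
  have sb: "schur_bounded (k $ i) (?D i)" for i
    using \<nu> by (intro schur_bounded_iterated_derivative) auto
  have D0: "m < l \<Longrightarrow> ?D i l m = 0" for i l m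
    by (rule schur_bounded_upper_triangular[OF sb])
  define P where "P i c \<longleftrightarrow> 0 \<le> c \<and> (\<forall>m. (\<Sum>l\<le>m. \<bar>?D i l m\<bar> / ?s l) \<le> c * ?s m ^ (k $ i) / ?s m) \<and>
     (\<forall>l N. (\<Sum>m\<le>N. \<bar>?D i l m\<bar> / ?s m ^ (k $ i) / ?s m) \<le> c / ?s l)" for i c
  have "\<forall>i. \<exists>c. P i c"
    unfolding P_def by (intro allI schur_bounded_bounds sb)
  then obtain C where C: "\<And>i. P i (C i)" using choice[of P] by auto
  have c: "(\<Sum>l\<le>m. \<bar>?D i l m\<bar> / ?s l) \<le> C i * ?s m ^ (k $ i) / ?s m"
    for i m
    by (rule spec[OF conjunct1[OF conjunct2[OF C[unfolded P_def]]]])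
  have r: "(\<Sum>m\<le>N. \<bar>?D i l m\<bar> / ?s m ^ (k $ i) / ?s m) \<le> C i / ?s l" for i l N
    by (rule spec[OF spec[OF conjunct2[OF conjunct2[OF C[unfolded P_def]]]]])
  have C0: "0 \<le> C i" for i
    by (rule conjunct1[OF C[unfolded P_def]])
  have s0: "0 \<le> ?s m" "?s m \<noteq> 0" for m by (auto simp: schur_weight_def)
  have row: "(\<Sum>m\<le>N. E i l m * (1 / ?s m)) \<le> C i * (1 / ?s l)" for i l N
  proof -
    have "(\<Sum>m\<le>N. E i l m * (1 / ?s m)) = (\<Sum>m\<le>N. \<bar>?D i l m\<bar> / ?s m ^ (k $ i) / ?s m)"
      by (simp add: E_def)
    then show ?thesis using r[where i = i and l = l and N = N] by simp
  qed
  have col: "(\<Sum>l\<le>N. E i l m * (1 / ?s l)) \<le> C i * (1 / ?s m)" if "m \<le> N" for i m N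
  proof -
    have "(\<Sum>l\<le>N. E i l m * (1 / ?s l)) = (\<Sum>l\<le>m. E i l m * (1 / ?s l))"
      using that D0 by (intro sum.mono_neutral_right) (auto simp: E_def)
    also have "\<dots> = (\<Sum>l\<le>m. \<bar>?D i l m\<bar> / ?s l) / ?s m ^ (k $ i)"
      by (simp add: E_def sum_divide_distrib mult_ac)
    also have "\<dots> \<le> (C i * ?s m ^ (k $ i) / ?s m) / ?s m ^ (k $ i)"
      using s0 by (intro divide_right_mono c) auto
    also have "\<dots> = C i * (1 / ?s m)" using s0 by simp
    finally show ?thesis .
  qed
  define v where "v l = (\<Prod>i\<in>UNIV. 1 / ?s (l $ i))" for l :: "nat ^ 'n"
  have v: "0 < v l" for l by (auto simp: v_def intro!: prod_pos)
  have E0: "0 \<le> E i l m" for i l m using s0 by (simp add: E_def)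
  let ?C = "\<Prod>i\<in>UNIV. C i"
  have A: "\<bar>riesz_matrix \<nu> k l m\<bar> \<le> (\<Prod>i\<in>UNIV. E i (l $ i) (m $ i))" for l m
    unfolding E_def by (rule riesz_matrix_le[OF \<nu>])
  have Row: "(\<Sum>m\<in>index_box N. \<bar>riesz_matrix \<nu> k l m\<bar> * v m) \<le> ?C * v l" for l N
  proof -
    have "(\<Sum>m\<in>index_box N. \<bar>riesz_matrix \<nu> k l m\<bar> * v m) \<le> (\<Sum>m\<in>index_box N. (\<Prod>i\<in>UNIV. E i (l $ i) (m $ i)) * v m)"
      using v by (intro sum_mono mult_right_mono A) (auto simp: less_imp_le)
    also have "\<dots> = (\<Sum>m\<in>index_box N. \<Prod>i\<in>UNIV. E i (l $ i) (m $ i) * (1 / ?s (m $ i)))"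
      unfolding v_def by (simp only: prod.distrib)
    also have "\<dots> = (\<Prod>i\<in>UNIV. \<Sum>j\<le>N. E i (l $ i) j * (1 / ?s j))"
      by (rule sum_index_box_prod)
    also have "\<dots> \<le> (\<Prod>i\<in>UNIV. C i * (1 / ?s (l $ i)))"
      using E0 s0 by (intro prod_mono conjI row sum_nonneg) auto
    also have "\<dots> = ?C * v l" unfolding v_def by (simp only: prod.distrib)
    finally show ?thesis .
  qed
  have Col: "(\<Sum>l\<in>index_box N. \<bar>riesz_matrix \<nu> k l m\<bar> * v l) \<le> ?C * v m" if m: "m \<in> index_box N" for m N
  proof -
    have "(\<Sum>l\<in>index_box N. \<bar>riesz_matrix \<nu> k l m\<bar> * v l) \<le> (\<Sum>l\<in>index_box N. (\<Prod>i\<in>UNIV. E i (l $ i) (m $ i)) * v l)"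
      using v by (intro sum_mono mult_right_mono A) (auto simp: less_imp_le)
    also have "\<dots> = (\<Sum>l\<in>index_box N. \<Prod>i\<in>UNIV. E i (l $ i) (m $ i) * (1 / ?s (l $ i)))"
      unfolding v_def by (simp only: prod.distrib)
    also have "\<dots> = (\<Prod>i\<in>UNIV. \<Sum>j\<le>N. E i j (m $ i) * (1 / ?s j))"
      by (rule sum_index_box_prod)
    also have "\<dots> \<le> (\<Prod>i\<in>UNIV. C i * (1 / ?s (m $ i)))"
      using E0 s0 m by (intro prod_mono conjI col sum_nonneg) (auto simp: index_box_def)
    also have "\<dots> = ?C * v m" unfolding v_def by (simp only: prod.distrib)
    finally show ?thesis .
  qed
  have "0 \<le> ?C" by (intro prod_nonneg) (auto simp: C0)
  then show ?thesis
    by (intro exI[of _ "?C\<^sup>2"] conjI allI schur_test[where v = v and w = v] Row Col v) auto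
qed

lemma laguerre_weight_factor:
  assumes "0 < u"
  shows "laguerre_weight a u * laguerre_factor a e l u = phi1 (a + (if e then 1 else 0)) l u"
proof -
  have "laguerre_weight (a + 1) u = laguerre_weight a u * u"
    using powr_add[of u "a + 1 / 2" 1] assms by (simp add: laguerre_weight_def add_ac)
  then show ?thesis
    using assms by (simp add: phi1_eq laguerre_factor_def)
qed

text \<open>The parity of \<open>k\<^sub>i\<close> decides whether the \<open>i\<close>-th factor ends with parameter \<open>\<nu>\<^sub>i\<close> or \<open>\<nu>\<^sub>i + 1\<close>; both
belong to a single orthonormal family.\<close>

lemma riesz_phi_eq:
  assumes x: "x \<in> Rplus" and m: "m \<in> index_box N" and \<nu>: "\<forall>j. - 1 / 2 \<le> \<nu> $ j"
  shows "riesz_phi \<nu> k m x = (\<Sum>l\<in>index_box N. riesz_matrix \<nu> k l m * phi (shifted_parameter \<nu> k) l x)"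
proof -
  have "laguerre_weight (\<nu> $ i) (x $ i) * laguerre_factor_deriv (\<nu> $ i) (m $ i) (k $ i) (x $ i)
     = (\<Sum>j\<le>N. iterated_derivative_matrix (\<nu> $ i) (k $ i) j (m $ i) * phi1 (shifted_parameter \<nu> k $ i) j (x $ i))" for i
  proof -
    have xi: "0 < x $ i" using x by (simp add: Rplus_def)
    have D0: "iterated_derivative_matrix (\<nu> $ i) (k $ i) j (m $ i) = 0" if "m $ i < j" for j
      using schur_bounded_upper_triangular[OF schur_bounded_iterated_derivative that] \<nu> by blast
    have "laguerre_weight (\<nu> $ i) (x $ i) * laguerre_factor_deriv (\<nu> $ i) (m $ i) (k $ i) (x $ i)
       = (\<Sum>j\<le>m $ i. iterated_derivative_matrix (\<nu> $ i) (k $ i) j (m $ i) * phi1 (shifted_parameter \<nu> k $ i) j (x $ i))"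
      unfolding laguerre_factor_deriv_def sum_distrib_left shifted_parameter_def
      by (intro sum.cong refl) (simp add: laguerre_weight_factor[OF xi, symmetric] mult_ac)
    also have "\<dots> = (\<Sum>j\<le>N. iterated_derivative_matrix (\<nu> $ i) (k $ i) j (m $ i) * phi1 (shifted_parameter \<nu> k $ i) j (x $ i))"
      using m D0 by (intro sum.mono_neutral_left) (auto simp: index_box_def)
    finally show ?thesis .
  qed
  then have "riesz_phi \<nu> k m x = eigenvalue \<nu> m powr (- (real (msize k) / 2)) *
     (\<Sum>l\<in>index_box N. \<Prod>i\<in>UNIV. iterated_derivative_matrix (\<nu> $ i) (k $ i) (l $ i) (m $ i) * phi1 (shifted_parameter \<nu> k $ i) (l $ i) (x $ i))"
    unfolding riesz_phi_def
      sum_index_box_prod[where f = "\<lambda>i j. iterated_derivative_matrix (\<nu> $ i) (k $ i) j (m $ i) * phi1 (shifted_parameter \<nu> k $ i) j (x $ i)"]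
    by simp
  then show ?thesis
    by (simp add: sum_distrib_left prod.distrib riesz_matrix_def phi_def mult.assoc)
qed

lemma sq_cong_on_Rplus:
  assumes "\<And>x. x \<in> Rplus \<Longrightarrow> f x = g x"
  shows "sq_integrable (lebesgue_on Rplus) f = sq_integrable (lebesgue_on Rplus) g"
    and "sq_norm (lebesgue_on Rplus) f = sq_norm (lebesgue_on Rplus) g"
proof -
  have sp: "space (lebesgue_on Rplus) = Rplus" by simp
  show "sq_integrable (lebesgue_on Rplus) f = sq_integrable (lebesgue_on Rplus) g"
    unfolding sq_integrable_def using assms
    by (intro arg_cong2[where f = conj] measurable_cong Bochner_Integration.integrable_cong refl) (auto simp: sp)
  show "sq_norm (lebesgue_on Rplus) f = sq_norm (lebesgue_on Rplus) g"
    unfolding sq_norm_def using assms by (intro Bochner_Integration.integral_cong refl) (auto simp: sp)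
qed

lemma riesz_span_eq:
  assumes \<nu>: "\<forall>j. - 1 / 2 \<le> (\<nu> :: real ^ 'n::{finite,linorder}) $ j" and F: "finite F" and x: "x \<in> Rplus"
  shows "riesz \<nu> k (\<lambda>x. \<Sum>m\<in>F. c m * complex_of_real (phi \<nu> m x)) x = (\<Sum>m\<in>F. c m * complex_of_real (riesz_phi \<nu> k m x))"
proof -
  let ?f = "\<lambda>x. \<Sum>m\<in>F. c m * complex_of_real (phi \<nu> m x)"
  let ?L = "\<lambda>m. eigenvalue \<nu> m powr (- (real (msize k) / 2))"
  have \<nu>1: "-1 < \<nu> $ i" for i using \<nu>[rule_format, of i] by linarith
  interpret orthonormal_family "lebesgue_on Rplus" "phi \<nu>" by (rule orthonormal_family_phi[OF \<nu>1])
  have co: "laguerre_coeff \<nu> ?f m = (if m \<in> F then c m else 0)" for m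
    using coeff_sum[OF F, of c m] by (simp add: laguerre_coeff_def coeff_def)
  have power: "laguerre_power \<nu> (- (real (msize k) / 2)) ?f z = (\<Sum>m\<in>F. complex_of_real (?L m) * c m * complex_of_real (phi \<nu> m z))" for z
    unfolding laguerre_power_def using F by (intro sum.mono_neutral_cong_left) (auto simp: co split: if_splits)
  have "riesz \<nu> k ?f x = (\<Sum>m\<in>F. (\<Prod>i\<in>UNIV. laguerre_weight (\<nu> $ i) (x $ i) * laguerre_factor_deriv (\<nu> $ i) (m $ i) (k $ i) (x $ i)) *\<^sub>R (complex_of_real (?L m) * c m))"
    unfolding riesz_def
  proof (rule delta_pow_weighted_product[where H = "\<lambda>m i. laguerre_factor_deriv (\<nu> $ i) (m $ i)"])
    fix z :: "(real, 'n) vec" assume z: "z \<in> Rplus"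
    show "laguerre_power \<nu> (- (real (msize k) / 2)) ?f z = (\<Sum>m\<in>F. (\<Prod>i\<in>UNIV. laguerre_weight (\<nu> $ i) (z $ i) * laguerre_factor_deriv (\<nu> $ i) (m $ i) 0 (z $ i)) *\<^sub>R (complex_of_real (?L m) * c m))"
      unfolding power phi_eq[OF z] laguerre_factor_deriv_0 scaleR_conv_of_real by (intro sum.cong refl) (simp only: mult_ac)
  qed (use x \<nu>1 in \<open>auto intro: has_real_derivative_laguerre_factor_deriv\<close>)
  also have "\<dots> = (\<Sum>m\<in>F. c m * complex_of_real (riesz_phi \<nu> k m x))"
    unfolding riesz_phi_def scaleR_conv_of_real of_real_mult by (intro sum.cong refl) (simp only: mult_ac)
  finally show ?thesis .
qed

text \<open>On the span, the transform multiplies the sequence of coefficients by \<open>riesz_matrix\<close> and expands the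
result in a second orthonormal family. So a bound for the matrix is a bound for the operator, which then
extends by continuity.\<close>

theorem riesz_L2_bounded:
  assumes \<nu>: "\<forall>j. - 1 / 2 \<le> (\<nu> :: real ^ 'n::{finite,linorder}) $ j"
  shows "\<exists>T. L2_bounded_operator T \<and> (\<forall>f\<in>laguerre_span \<nu>. AE x in lebesgue_on Rplus. T f x = riesz \<nu> k f x)"
proof -
  let ?M = "lebesgue_on (Rplus :: (real, 'n) vec set)"
  let ?g = "\<lambda>m x. complex_of_real (riesz_phi \<nu> k m x)"
  let ?\<mu> = "shifted_parameter \<nu> k"
  have \<nu>1: "-1 < \<nu> $ i" for i using \<nu>[rule_format, of i] by linarith
  have \<mu>1: "-1 < ?\<mu> $ i" for i using \<nu>1[of i] by (simp add: shifted_parameter_def)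
  interpret e: orthonormal_family ?M "phi \<nu>" by (rule orthonormal_family_phi[OF \<nu>1])
  interpret d: orthonormal_family ?M "phi ?\<mu>" by (rule orthonormal_family_phi[OF \<mu>1])
  obtain K where K: "0 \<le> K" and S: "\<And>N c. (\<Sum>l\<in>index_box N. (norm (\<Sum>m\<in>index_box N. complex_of_real (riesz_matrix \<nu> k l m) * c m))\<^sup>2)
     \<le> K * (\<Sum>m\<in>index_box N. (norm (c m))\<^sup>2)"
    using riesz_matrix_schur[OF \<nu>, of k] by blast
  have comb: "(\<Sum>m\<in>index_box N. c m * ?g m x) = (\<Sum>l\<in>index_box N. (\<Sum>m\<in>index_box N. complex_of_real (riesz_matrix \<nu> k l m) * c m) * complex_of_real (phi ?\<mu> l x))"
    if x: "x \<in> Rplus" for N c x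
  proof -
    have "(\<Sum>m\<in>index_box N. c m * ?g m x) = (\<Sum>m\<in>index_box N. \<Sum>l\<in>index_box N. complex_of_real (riesz_matrix \<nu> k l m) * c m * complex_of_real (phi ?\<mu> l x))"
      by (intro sum.cong refl) (simp add: riesz_phi_eq[OF x _ \<nu>] sum_distrib_left mult_ac)
    then show ?thesis by (subst (asm) sum.swap) (simp add: sum_distrib_right)
  qed
  have g_sq: "sq_integrable ?M (?g m)" for m
  proof -
    obtain N where "{m} \<subseteq> index_box N" using finite_subset_index_box[of "{m}"] by auto
    then have m: "m \<in> index_box N" by simp
    have eq: "?g m x = (\<Sum>l\<in>index_box N. complex_of_real (riesz_matrix \<nu> k l m) * complex_of_real (phi ?\<mu> l x))" if "x \<in> Rplus" for x
      by (simp add: riesz_phi_eq[OF that m \<nu>])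
    have "sq_integrable ?M (\<lambda>x. \<Sum>l\<in>index_box N. complex_of_real (riesz_matrix \<nu> k l m) * complex_of_real (phi ?\<mu> l x))"
      by (rule d.sq_integrable_span)
    then show ?thesis
      by (rule sq_cong_on_Rplus(1)[THEN iffD2, rotated]) (rule eq)
  qed
  have g_bound: "sq_norm ?M (\<lambda>x. \<Sum>m\<in>F. c m * ?g m x) \<le> K * (\<Sum>m\<in>F. (norm (c m))\<^sup>2)" if F: "finite F" for F c
  proof -
    obtain N where N: "F \<subseteq> index_box N" using finite_subset_index_box[OF F] by auto
    let ?c = "\<lambda>m. if m \<in> F then c m else 0"
    have "sq_norm ?M (\<lambda>x. \<Sum>m\<in>F. c m * ?g m x) = sq_norm ?M (\<lambda>x. \<Sum>m\<in>index_box N. ?c m * ?g m x)"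
      using N by (intro arg_cong[where f = "sq_norm ?M"] ext sum.mono_neutral_cong_left) (auto simp: finite_index_box)
    also have "\<dots> = sq_norm ?M (\<lambda>x. \<Sum>l\<in>index_box N. (\<Sum>m\<in>index_box N. complex_of_real (riesz_matrix \<nu> k l m) * ?c m) * complex_of_real (phi ?\<mu> l x))"
      by (intro sq_cong_on_Rplus(2) comb)
    also have "\<dots> = (\<Sum>l\<in>index_box N. (norm (\<Sum>m\<in>index_box N. complex_of_real (riesz_matrix \<nu> k l m) * ?c m))\<^sup>2)"
      by (rule d.sq_norm_span) (rule finite_index_box)
    also have "\<dots> \<le> K * (\<Sum>m\<in>index_box N. (norm (?c m))\<^sup>2)" by (rule S)
    also have "(\<Sum>m\<in>index_box N. (norm (?c m))\<^sup>2) = (\<Sum>m\<in>F. (norm (c m))\<^sup>2)"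
      using N by (intro sum.mono_neutral_cong_right) (auto simp: finite_index_box)
    finally show ?thesis .
  qed
  have "\<exists>T. (\<forall>f. sq_integrable ?M f \<longrightarrow> sq_integrable ?M (T f) \<and> sq_norm ?M (T f) \<le> 4 * K * sq_norm ?M f) \<and>
     (\<forall>f h a b. sq_integrable ?M f \<longrightarrow> sq_integrable ?M h \<longrightarrow>
        (AE x in ?M. T (\<lambda>x. a * f x + b * h x) x = a * T f x + b * T h x)) \<and>
     (\<forall>F c. finite F \<longrightarrow> (AE x in ?M. T (\<lambda>x. \<Sum>m\<in>F. c m * complex_of_real (phi \<nu> m x)) x = (\<Sum>m\<in>F. c m * ?g m x)))"
  proof (rule e.bounded_extension[where B = index_box])
    show "0 \<le> K" by (rule K)
    show "finite (index_box n)" "index_box n \<subseteq> index_box (Suc n)" for n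
      by (rule finite_index_box) (simp add: index_box_mono)
    show "\<exists>n. F \<subseteq> index_box n" if "finite F" for F :: "(nat, 'n) vec set"
      using that by (rule finite_subset_index_box)
  qed (rule g_sq g_bound; assumption)+
  then obtain T where T: "\<forall>f. sq_integrable ?M f \<longrightarrow> sq_integrable ?M (T f) \<and> sq_norm ?M (T f) \<le> 4 * K * sq_norm ?M f"
    and lin: "\<forall>f h a b. sq_integrable ?M f \<longrightarrow> sq_integrable ?M h \<longrightarrow>
        (AE x in ?M. T (\<lambda>x. a * f x + b * h x) x = a * T f x + b * T h x)"
    and span: "\<forall>F c. finite F \<longrightarrow> (AE x in ?M. T (\<lambda>x. \<Sum>m\<in>F. c m * complex_of_real (phi \<nu> m x)) x = (\<Sum>m\<in>F. c m * ?g m x))"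
    by (elim exE conjE)
  have L2: "L2 = {f. sq_integrable ?M f}"
    by (auto simp: L2_def sq_integrable_def)
  have L2n: "L2_norm f = sqrt (sq_norm ?M f)" for f
    by (simp add: L2_norm_def sq_norm_def)
  have "L2_bounded_operator T"
    unfolding L2_bounded_operator_def L2
  proof (intro conjI ballI allI exI[of _ "sqrt (4 * K)"])
    fix f assume "f \<in> {f. sq_integrable ?M f}"
    then show "L2_norm (T f) \<le> sqrt (4 * K) * L2_norm f"
      using T unfolding L2n by (simp only: real_sqrt_mult[symmetric]) simp
  qed (use T lin in auto)
  moreover have "AE x in ?M. T f x = riesz \<nu> k f x" if f_in: "f \<in> laguerre_span \<nu>" for f
  proof -
    obtain F c where F: "finite F" and f: "f = (\<lambda>x. \<Sum>m\<in>F. c m * complex_of_real (phi \<nu> m x))"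
      using f_in unfolding laguerre_span_def by blast
    have "AE x in ?M. x \<in> Rplus" by (rule AE_I2) simp
    with span[rule_format, OF F, of c] show ?thesis
      unfolding f by eventually_elim (simp add: riesz_span_eq[OF \<nu> F])
  qed
  ultimately show ?thesis by blast
qed

section \<open>The measure in Poisson's integral for the Bessel function\<close>

lemma has_bochner_integral_lborel_nonneg:
  fixes f :: "real \<Rightarrow> real"
  assumes f: "(f has_integral I) S" and nn: "\<And>x. x \<in> S \<Longrightarrow> 0 \<le> f x"
    and [measurable]: "S \<in> sets borel" "f \<in> borel_measurable borel"
  shows "has_bochner_integral lborel (\<lambda>x. indicator S x * f x) I"
proof -
  have a: "f absolutely_integrable_on S"
    using f nn by (intro nonnegative_absolutely_integrable_1) (auto simp: has_integral_iff)
  then have "(LINT x:S|lebesgue. f x) = I"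
    using f by (simp add: set_lebesgue_integral_eq_integral has_integral_iff)
  with a have "has_bochner_integral lebesgue (\<lambda>x. indicator S x *\<^sub>R f x) I"
    unfolding has_bochner_integral_iff set_integrable_def set_lebesgue_integral_def by simp
  then show ?thesis
    by (simp add: has_bochner_integral_iff integrable_completion integral_completion)
qed

text \<open>The measure \<open>(1 - s\<^sup>2)^(\<beta>-1) ds\<close> on the interval from -1 to 1 and its limiting case \<open>\<beta> = 0\<close> share the
properties listed here, so the kernel is estimated for both at once. The moments identify the Laplace
transform with a Bessel function of order \<open>\<beta> - 1/2\<close>; the decay is Watson's lemma at \<open>s = 1\<close> without its
leading constant.\<close>

locale bessel_measure =
  fixes \<beta> :: real and M :: "real measure"
  assumes beta: "0 \<le> \<beta>"
    and fin: "finite_measure M"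
    and sets_M [measurable_cong]: "sets M = sets borel"
    and bounded: "AE s in M. - 1 \<le> s \<and> s \<le> 1"
    and mass_pos: "0 < (LINT s|M. (1 :: real))"
    and odd_moment: "\<And>j. odd j \<Longrightarrow> (LINT s|M. s ^ j) = (0 :: real)"
    and even_moment: "\<And>j. (2 * \<beta> + 2 * real j + 1) * (LINT s|M. s ^ (2 * j + 2)) = (2 * real j + 1) * (LINT s|M. s ^ (2 * j))"
    and decay: "\<exists>D\<ge>0. \<forall>w\<ge>0. (LINT s|M. exp (- (w * (1 - s)))) \<le> D * (1 + w) powr (- \<beta>)"

text \<open>Unit masses at 1 and -1: the normalised measures concentrate at the ends of the interval as
\<open>\<beta>\<close> tends to 0, and \<open>I\<^sub>-\<^sub>1\<^sub>/\<^sub>2\<close> is a hyperbolic cosine divided by a square root.\<close>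

lemma bessel_measure_0: "bessel_measure 0 (distr (count_space UNIV) borel (\<lambda>b :: bool. if b then 1 else -1))"
proof -
  let ?T = "\<lambda>b :: bool. if b then 1 else -1 :: real"
  let ?M = "distr (count_space UNIV) borel ?T"
  have T [measurable]: "?T \<in> measurable (count_space UNIV) borel" by simp
  have int: "(LINT s|?M. f s) = f 1 + f (-1)" if [measurable]: "f \<in> borel_measurable borel" for f :: "real \<Rightarrow> real"
    by (simp add: integral_distr lebesgue_integral_count_space_finite UNIV_bool)
  show ?thesis
  proof (rule bessel_measure.intro)
    show "finite_measure ?M"
      by (intro finite_measure.finite_measure_distr finite_measureI) auto
    show "AE s in ?M. - 1 \<le> s \<and> s \<le> 1"
      by (subst AE_distr_iff) (auto simp: AE_count_space)
    show "\<exists>D\<ge>0. \<forall>w\<ge>0. (LINT s|?M. exp (- (w * (1 - s)))) \<le> D * (1 + w) powr (- 0)"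
      by (intro exI[of _ 2]) (auto simp: int)
    show "0 < (LINT s|?M. (1 :: real))"
      by (subst int) auto
  qed (simp_all add: int)
qed

text \<open>For \<open>\<beta> > 0\<close> the measure is absolutely continuous, with a density that is unbounded if \<open>\<beta> < 1\<close>.\<close>

context
  fixes \<beta> :: real
  assumes \<beta>: "0 < \<beta>"
begin

definition jacobi_density :: "real \<Rightarrow> real" where
  "jacobi_density s = indicator {-1<..<1} s * (1 - s\<^sup>2) powr (\<beta> - 1)"

lemma jacobi_density_measurable [measurable]: "jacobi_density \<in> borel_measurable borel"
  unfolding jacobi_density_def by measurable

lemma jacobi_density_nonneg: "0 \<le> jacobi_density s"
  by (simp add: jacobi_density_def)

lemma powr_le_max:
  assumes "1 \<le> x" "x \<le> 2"
  shows "x powr (\<beta> - 1) \<le> max 1 (2 powr (\<beta> - 1))"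
proof (cases "1 \<le> \<beta>")
  case True
  then have "x powr (\<beta> - 1) \<le> 2 powr (\<beta> - 1)" using assms by (intro powr_mono2) auto
  then show ?thesis by simp
next
  case False
  then have "x powr (\<beta> - 1) \<le> x powr 0" using assms by (intro powr_mono) auto
  then show ?thesis using assms by simp
qed

text \<open>On the right half of the interval the factor \<open>1 + s\<close> is between 1 and 2, so only the singularity
at 1 matters.\<close>

lemma jacobi_density_le:
  "0 \<le> s \<Longrightarrow> jacobi_density s \<le> max 1 (2 powr (\<beta> - 1)) * (indicator {0..2} (1 - s) * (1 - s) powr (\<beta> - 1))"
proof (cases "s < 1")
  case True
  assume "0 \<le> s"
  have "(1 - s\<^sup>2) powr (\<beta> - 1) = ((1 + s) * (1 - s)) powr (\<beta> - 1)"
    by (simp add: power2_eq_square algebra_simps)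
  also have "\<dots> = (1 + s) powr (\<beta> - 1) * (1 - s) powr (\<beta> - 1)"
    using True \<open>0 \<le> s\<close> by (intro powr_mult)
  also have "\<dots> \<le> max 1 (2 powr (\<beta> - 1)) * (1 - s) powr (\<beta> - 1)"
    using True \<open>0 \<le> s\<close> by (intro mult_right_mono powr_le_max) auto
  finally show ?thesis using True \<open>0 \<le> s\<close> by (simp add: jacobi_density_def)
qed (simp add: jacobi_density_def)

lemma jacobi_density_even: "jacobi_density (- s) = jacobi_density s"
  by (auto simp: jacobi_density_def indicator_def)

lemma integrable_jacobi_density: "integrable lborel jacobi_density"
proof -
  let ?K = "max 1 (2 powr (\<beta> - 1))"
  let ?p = "\<lambda>r. indicator {0..2} r * r powr (\<beta> - 1) :: real"
  have "((\<lambda>r. r powr (\<beta> - 1)) has_integral 2 powr (\<beta> - 1 + 1) / (\<beta> - 1 + 1)) {0..2}"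
    using \<beta> by (intro has_integral_powr_from_0) auto
  then have p: "integrable lborel ?p"
    by (intro integrable.intros[OF has_bochner_integral_lborel_nonneg]) auto
  have p1: "integrable lborel (\<lambda>s. ?p (1 - s))" "integrable lborel (\<lambda>s. ?p (1 + s))"
    using lborel_integrable_real_affine[OF p, of "-1" 1] lborel_integrable_real_affine[OF p, of 1 1] by simp_all
  have "integrable lborel (\<lambda>s. ?K * (?p (1 - s) + ?p (1 + s)))"
    by (intro integrable_mult_right Bochner_Integration.integrable_add p1)
  then show ?thesis
  proof (rule Bochner_Integration.integrable_bound)
    show "AE s in lborel. norm (jacobi_density s) \<le> norm (?K * (?p (1 - s) + ?p (1 + s)))"
    proof (intro AE_I2)
      fix s
      have nn: "0 \<le> ?K * ?p (1 - s)" "0 \<le> ?K * ?p (1 + s)" by auto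
      have "jacobi_density s \<le> ?K * ?p (1 - s) + ?K * ?p (1 + s)"
      proof (cases "0 \<le> s")
        case True
        then show ?thesis using jacobi_density_le[OF True] nn by linarith
      next
        case False
        then show ?thesis using jacobi_density_le[of "- s"] nn by (simp only: jacobi_density_even diff_minus_eq_add) linarith
      qed
      then show "norm (jacobi_density s) \<le> norm (?K * (?p (1 - s) + ?p (1 + s)))"
        using nn jacobi_density_nonneg[of s] by (simp add: distrib_left)
    qed
  qed measurable
qed

definition jacobi_measure :: "real measure" where
  "jacobi_measure = density lborel (\<lambda>s. ennreal (jacobi_density s))"

lemma sets_jacobi_measure [measurable_cong]: "sets jacobi_measure = sets borel"
  by (simp add: jacobi_measure_def)

lemma integral_jacobi_measure:
  assumes [measurable]: "f \<in> borel_measurable borel"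
  shows "integral\<^sup>L jacobi_measure f = (LINT s|lborel. jacobi_density s * f s)"
  unfolding jacobi_measure_def by (subst integral_density) (auto simp: jacobi_density_nonneg)

lemma integrable_jacobi_bounded:
  assumes [measurable]: "f \<in> borel_measurable borel" and f: "\<And>s. -1 < s \<Longrightarrow> s < 1 \<Longrightarrow> \<bar>f s\<bar> \<le> C"
  shows "integrable lborel (\<lambda>s. jacobi_density s * f s)"
proof (rule Bochner_Integration.integrable_bound)
  show "integrable lborel (\<lambda>s. C * jacobi_density s)"
    by (intro integrable_mult_right integrable_jacobi_density)
  show "AE s in lborel. norm (jacobi_density s * f s) \<le> norm (C * jacobi_density s)"
  proof (intro AE_I2)
    fix s
    show "norm (jacobi_density s * f s) \<le> norm (C * jacobi_density s)"
    proof (cases "-1 < s \<and> s < 1")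
      case True
      then have "\<bar>f s\<bar> \<le> \<bar>C\<bar>" using f[of s] by linarith
      then show ?thesis
        by (simp add: abs_mult mult.commute mult_right_mono)
    qed (auto simp: jacobi_density_def)
  qed
qed measurable

lemma jacobi_odd_moment:
  assumes "odd j"
  shows "(LINT s|lborel. jacobi_density s * s ^ j) = 0"
proof -
  have "(LINT s|lborel. jacobi_density s * s ^ j) = (LINT s|lborel. jacobi_density (0 + (-1) * s) * (0 + (-1) * s) ^ j)"
    by (subst lborel_integral_real_affine[where c = "-1" and t = 0]) simp_all
  also have "\<dots> = - (LINT s|lborel. jacobi_density s * s ^ j)"
    using assms by (simp add: jacobi_density_even)
  finally show ?thesis by simp
qed

text \<open>Integrate the derivative of \<open>s^(2j+1) (1 - s\<^sup>2)\<^sup>\<beta>\<close>, which vanishes at both ends.\<close>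

lemma jacobi_even_moment:
  "(2 * \<beta> + 2 * real j + 1) * (LINT s|lborel. jacobi_density s * s ^ (2 * j + 2))
     = (2 * real j + 1) * (LINT s|lborel. jacobi_density s * s ^ (2 * j))"
proof -
  have bnd: "\<bar>s ^ i\<bar> \<le> 1" if "-1 < s" "s < 1" for s :: real and i
    using that power_le_one[of "\<bar>s\<bar>" i] by (simp add: power_abs)
  have i1: "integrable lborel (\<lambda>s. jacobi_density s * s ^ i)" for i
    by (rule integrable_jacobi_bounded[of _ 1]) (use bnd in auto)
  let ?F = "\<lambda>s. s ^ (2 * j + 1) * (1 - s\<^sup>2) powr \<beta> :: real"
  let ?F' = "\<lambda>s. jacobi_density s * ((2 * real j + 1) * s ^ (2 * j) - (2 * \<beta> + 2 * real j + 1) * s ^ (2 * j + 2))"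
  have "(?F' has_integral (?F 1 - ?F (-1))) {-1..1}"
  proof (rule fundamental_theorem_of_calculus_interior)
    show "continuous_on {-1..1} ?F"
      using \<beta> by (intro continuous_on_mult continuous_on_powr' continuous_intros) (auto simp: abs_square_le_1 abs_le_iff)
    fix s :: real assume s: "s \<in> {-1<..<1}"
    then have s2: "s\<^sup>2 < 1" by (simp add: abs_square_less_1 abs_less_iff)
    have p: "(1 - s\<^sup>2) powr \<beta> = (1 - s\<^sup>2) powr (\<beta> - 1) * (1 - s\<^sup>2)"
      using s2 powr_add[of "1 - s\<^sup>2" "\<beta> - 1" 1] by simp
    have "(?F has_real_derivative (s ^ (2 * j + 1) * (\<beta> * (1 - s\<^sup>2) powr (\<beta> - 1) * (- 2 * s)) + real (2 * j + 1) * s ^ (2 * j) * (1 - s\<^sup>2) powr \<beta>)) (at s)"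
    proof (rule DERIV_mult')
      show "((\<lambda>s. s ^ (2 * j + 1)) has_real_derivative real (2 * j + 1) * s ^ (2 * j)) (at s)"
        using DERIV_pow[of "2 * j + 1" s] by simp
      show "((\<lambda>s. (1 - s\<^sup>2) powr \<beta>) has_real_derivative \<beta> * (1 - s\<^sup>2) powr (\<beta> - 1) * (- 2 * s)) (at s)"
        using s2 by (auto intro!: derivative_eq_intros)
    qed
    also have "s ^ (2 * j + 1) * (\<beta> * (1 - s\<^sup>2) powr (\<beta> - 1) * (- 2 * s)) + real (2 * j + 1) * s ^ (2 * j) * (1 - s\<^sup>2) powr \<beta> = ?F' s"
      unfolding p using s by (simp add: jacobi_density_def power_add power2_eq_square algebra_simps)
    finally show "(?F has_vector_derivative ?F' s) (at s)"
      by (simp only: has_real_derivative_iff_has_vector_derivative)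
  qed simp
  then have "(?F' has_integral 0) {-1..1}" by simp
  then have "((\<lambda>s. if s \<in> {-1..1} then ?F' s else 0) has_integral 0) UNIV"
    by (simp only: has_integral_restrict_UNIV)
  moreover have "(\<lambda>s. if s \<in> {-1..1} then ?F' s else 0) = ?F'"
    by (auto simp: fun_eq_iff jacobi_density_def)
  ultimately have z: "(?F' has_integral 0) UNIV" by simp
  have eq: "?F' = (\<lambda>s. (2 * real j + 1) * (jacobi_density s * s ^ (2 * j)) - (2 * \<beta> + 2 * real j + 1) * (jacobi_density s * s ^ (2 * j + 2)))"
    by (simp add: fun_eq_iff algebra_simps)
  have int: "integrable lborel ?F'"
    unfolding eq by (intro Bochner_Integration.integrable_diff integrable_mult_right i1)
  have "integral\<^sup>L lborel ?F' = 0"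
    using has_integral_integral_lborel[OF int] z by (rule has_integral_unique)
  then show ?thesis
    unfolding eq Bochner_Integration.integral_diff[OF integrable_mult_right[OF i1] integrable_mult_right[OF i1]] integral_mult_right_zero
    by simp
qed

lemma jacobi_mass_pos: "0 < (LINT s|lborel. jacobi_density s)"
proof -
  define c where "c = min 1 ((3 / 4) powr (\<beta> - 1))"
  have c: "0 < c" by (simp add: c_def)
  have "(LINT s|lborel. c * indicator {-1/2..1/2::real} s) \<le> (LINT s|lborel. jacobi_density s)"
  proof (rule integral_mono)
    fix s :: real
    show "c * indicator {-1/2..1/2} s \<le> jacobi_density s"
    proof (cases "s \<in> {-1/2..1/2}")
      case True
      then have "\<bar>s\<bar> \<le> 1 / 2" by auto
      then have "s\<^sup>2 \<le> (1 / 2)\<^sup>2" by (simp add: abs_le_square_iff[symmetric])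
      then have s: "3 / 4 \<le> 1 - s\<^sup>2" "1 - s\<^sup>2 \<le> 1" by (auto simp: power2_eq_square)
      have "c \<le> (1 - s\<^sup>2) powr (\<beta> - 1)"
      proof (cases "1 \<le> \<beta>")
        case True
        then have "(3 / 4) powr (\<beta> - 1) \<le> (1 - s\<^sup>2) powr (\<beta> - 1)" using s by (intro powr_mono2) auto
        then show ?thesis by (simp add: c_def)
      next
        case False
        then have "1 powr (\<beta> - 1) \<le> (1 - s\<^sup>2) powr (\<beta> - 1)" using s by (intro powr_mono2') auto
        then show ?thesis by (simp add: c_def)
      qed
      then show ?thesis using True by (simp add: jacobi_density_def)
    qed (simp add: jacobi_density_nonneg)
  qed (auto intro: integrable_jacobi_density)
  moreover have "(LINT s|lborel. c * indicator {-1/2..1/2::real} s) = c" by simp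
  ultimately show ?thesis using c by linarith
qed

text \<open>For \<open>s \<ge> 0\<close> compare with Euler's integral in the variable \<open>1 - s\<close>, which scales like \<open>w\<^sup>-\<^sup>\<beta>\<close>; for
\<open>s < 0\<close> the exponential itself is small.\<close>

lemma jacobi_decay:
  "\<exists>D\<ge>0. \<forall>w\<ge>0. (LINT s|lborel. jacobi_density s * exp (- (w * (1 - s)))) \<le> D * (1 + w) powr (- \<beta>)"
proof -
  let ?K = "max 1 (2 powr (\<beta> - 1))"
  define m where "m = (LINT s|lborel. jacobi_density s)"
  have m: "0 < m" using jacobi_mass_pos by (simp add: m_def)
  define g where "g r = indicator {0..} r * (r powr (\<beta> - 1) / exp r)" for r :: real
  have g: "has_bochner_integral lborel g (Gamma \<beta>)"
    unfolding g_def using has_bochner_integral_lborel_nonneg[OF Gamma_integral_real[OF \<beta>]] by simp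
  \<comment> \<open>An elementary bound, from \<open>1 + y \<le> exp y\<close> with \<open>y = x / \<beta>\<close>.\<close>
  obtain E where E: "0 < E" "\<And>x. 1 \<le> x \<Longrightarrow> exp (- x) \<le> E * x powr (- \<beta>)"
  proof
    show "0 < \<beta> powr \<beta> " using \<beta> by simp
    fix x :: real assume "1 \<le> x"
    have "x / \<beta> \<le> exp (x / \<beta>)" using exp_ge_add_one_self[of "x / \<beta>"] by linarith
    then have "(x / \<beta>) powr \<beta> \<le> exp (x / \<beta>) powr \<beta>" using \<open>1 \<le> x\<close> \<beta> by (intro powr_mono2) auto
    also have "\<dots> = exp x" using \<beta> by (simp add: exp_powr_real)
    finally have "x powr \<beta> / \<beta> powr \<beta> \<le> exp x" using \<open>1 \<le> x\<close> \<beta> by (simp add: powr_divide)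
    then show "exp (- x) \<le> \<beta> powr \<beta> * x powr (- \<beta>)"
      using \<open>1 \<le> x\<close> \<beta> by (simp add: exp_minus powr_minus field_simps)
  qed
  define D where "D = exp 2 * (?K * Gamma \<beta> + E * m)"
  have Gp: "0 < Gamma \<beta>" using \<beta> by (rule Gamma_real_pos)
  have D: "0 \<le> D" unfolding D_def using E m Gp by (intro mult_nonneg_nonneg add_nonneg_nonneg) auto
  show ?thesis
  proof (intro exI[of _ D] conjI allI impI D)
    fix w :: real assume w: "0 \<le> w"
    \<comment> \<open>Passing from \<open>w\<close> to \<open>1 + w\<close> costs at most \<open>exp 2\<close> on the interval and avoids the singular value 0.\<close>
    define v where "v = 1 + w"
    have v: "1 \<le> v" "0 < v" using w by (auto simp: v_def)
    have "has_bochner_integral lborel (\<lambda>s. g (v + (- v) * s)) (Gamma \<beta> /\<^sub>R \<bar>- v\<bar>)"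
      using v g by (subst lborel_has_bochner_integral_real_affine_iff[symmetric]) auto
    then have gv: "integrable lborel (\<lambda>s. g (v * (1 - s)))" "(LINT s|lborel. g (v * (1 - s))) = Gamma \<beta> / v"
      using v by (simp_all add: has_bochner_integral_iff right_diff_distrib divide_inverse mult.commute)
    have pw: "jacobi_density s * exp (- (w * (1 - s))) \<le>
        exp 2 * (?K * (v powr (1 - \<beta>) * g (v * (1 - s))) + exp (- v) * jacobi_density s)" for s
    proof (cases "-1 < s \<and> s < 1")
      case True
      have "- (w * (1 - s)) = (1 - s) + - (v * (1 - s))" by (simp add: v_def algebra_simps)
      then have "exp (- (w * (1 - s))) = exp (1 - s) * exp (- (v * (1 - s)))"
        by (simp only: exp_add)
      also have "\<dots> \<le> exp 2 * exp (- (v * (1 - s)))" using True by simp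
      finally have e: "exp (- (w * (1 - s))) \<le> exp 2 * exp (- (v * (1 - s)))" .
      have gnn: "0 \<le> g x" for x by (simp add: g_def)
      have "jacobi_density s * exp (- (v * (1 - s))) \<le> ?K * (v powr (1 - \<beta>) * g (v * (1 - s))) + exp (- v) * jacobi_density s"
      proof (cases "0 \<le> s")
        case s: True
        have "jacobi_density s * exp (- (v * (1 - s))) \<le> (?K * (1 - s) powr (\<beta> - 1)) * exp (- (v * (1 - s)))"
          using jacobi_density_le[OF s] True s by (intro mult_right_mono) auto
        also have "(1 - s) powr (\<beta> - 1) = v powr (1 - \<beta>) * (v * (1 - s)) powr (\<beta> - 1)"
          using v True by (simp add: powr_mult powr_add[symmetric] mult.assoc[symmetric])
        also have "?K * (v powr (1 - \<beta>) * (v * (1 - s)) powr (\<beta> - 1)) * exp (- (v * (1 - s))) = ?K * (v powr (1 - \<beta>) * g (v * (1 - s)))"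
          using v True by (simp add: g_def exp_minus divide_inverse)
        finally show ?thesis using jacobi_density_nonneg[of s] by (simp add: add_increasing2)
      next
        case s: False
        have "exp (- (v * (1 - s))) \<le> exp (- v)" using v s by (simp add: mult_le_cancel_left1)
        then have "jacobi_density s * exp (- (v * (1 - s))) \<le> jacobi_density s * exp (- v)"
          by (intro mult_left_mono jacobi_density_nonneg)
        moreover have "0 \<le> ?K * (v powr (1 - \<beta>) * g (v * (1 - s)))" using gnn by simp
        ultimately show ?thesis by (simp add: mult.commute)
      qed
      then have "exp 2 * (jacobi_density s * exp (- (v * (1 - s)))) \<le> exp 2 * (?K * (v powr (1 - \<beta>) * g (v * (1 - s))) + exp (- v) * jacobi_density s)"
        by simp
      moreover have "jacobi_density s * exp (- (w * (1 - s))) \<le> exp 2 * (jacobi_density s * exp (- (v * (1 - s))))"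
        using mult_left_mono[OF e jacobi_density_nonneg[of s]] by (simp add: mult_ac)
      ultimately show ?thesis by linarith
    qed (auto simp: jacobi_density_def g_def)
    have "(LINT s|lborel. jacobi_density s * exp (- (w * (1 - s)))) \<le>
       (LINT s|lborel. exp 2 * (?K * (v powr (1 - \<beta>) * g (v * (1 - s))) + exp (- v) * jacobi_density s))"
    proof (intro integral_mono pw)
      show "integrable lborel (\<lambda>s. jacobi_density s * exp (- (w * (1 - s))))"
        by (rule integrable_jacobi_bounded[of _ 1]) (use w in auto)
      show "integrable lborel (\<lambda>s. exp 2 * (?K * (v powr (1 - \<beta>) * g (v * (1 - s))) + exp (- v) * jacobi_density s))"
        by (intro integrable_mult_right Bochner_Integration.integrable_add gv integrable_jacobi_density)
    qed
    also have "\<dots> = exp 2 * (?K * (v powr (1 - \<beta>) * (Gamma \<beta> / v)) + exp (- v) * m)"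
      unfolding m_def gv(2)[symmetric] using gv(1) integrable_jacobi_density
      by (subst Bochner_Integration.integral_mult_right_zero, subst Bochner_Integration.integral_add) (auto intro!: integrable_mult_right)
    also have "v powr (1 - \<beta>) * (Gamma \<beta> / v) = Gamma \<beta> * v powr (- \<beta>)"
      using v by (simp add: powr_diff powr_minus divide_inverse)
    also have "exp 2 * (?K * (Gamma \<beta> * v powr (- \<beta>)) + exp (- v) * m) \<le> exp 2 * (?K * (Gamma \<beta> * v powr (- \<beta>)) + (E * v powr (- \<beta>)) * m)"
      using E(2)[OF v(1)] m by (intro mult_left_mono add_left_mono mult_right_mono) auto
    also have "\<dots> = D * (1 + w) powr (- \<beta>)" by (simp add: D_def v_def algebra_simps)
    finally show "(LINT s|lborel. jacobi_density s * exp (- (w * (1 - s)))) \<le> D * (1 + w) powr (- \<beta>)" .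
  qed
qed

lemma bessel_measure_jacobi: "bessel_measure \<beta> jacobi_measure"
proof (rule bessel_measure.intro)
  show "0 \<le> \<beta>" using \<beta> by simp
  show "finite_measure jacobi_measure"
  proof (rule finite_measureI)
    have "emeasure jacobi_measure (space jacobi_measure) = (\<integral>\<^sup>+s. ennreal (jacobi_density s) \<partial>lborel)"
      by (simp add: jacobi_measure_def emeasure_density)
    also have "\<dots> = ennreal (LINT s|lborel. jacobi_density s)"
      by (intro nn_integral_eq_integral integrable_jacobi_density) (simp add: jacobi_density_nonneg)
    finally show "emeasure jacobi_measure (space jacobi_measure) \<noteq> \<infinity>" by simp
  qed
  show "AE s in jacobi_measure. - 1 \<le> s \<and> s \<le> 1"
    unfolding jacobi_measure_def by (subst AE_density) (auto simp: jacobi_density_def indicator_def intro!: AE_I2)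
  show "0 < (LINT s|jacobi_measure. (1 :: real))"
    using jacobi_mass_pos by (subst integral_jacobi_measure) simp_all
  show "(LINT s|jacobi_measure. s ^ j) = 0" if "odd j" for j
    using jacobi_odd_moment[OF that] by (simp add: integral_jacobi_measure)
  show "(2 * \<beta> + 2 * real j + 1) * (LINT s|jacobi_measure. s ^ (2 * j + 2)) = (2 * real j + 1) * (LINT s|jacobi_measure. s ^ (2 * j))" for j
    using jacobi_even_moment[of j] by (simp add: integral_jacobi_measure)
  show "\<exists>D\<ge>0. \<forall>w\<ge>0. (LINT s|jacobi_measure. exp (- (w * (1 - s)))) \<le> D * (1 + w) powr (- \<beta>)"
    using jacobi_decay by (simp add: integral_jacobi_measure)
qed (rule sets_jacobi_measure)

end

lemma bessel_measure_exists: "0 \<le> \<beta> \<Longrightarrow> \<exists>M. bessel_measure \<beta> M"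
  using bessel_measure_0 bessel_measure_jacobi[of \<beta>] by (cases "\<beta> = 0") (auto simp: less_le)

context bessel_measure
begin

interpretation finite_measure M by (rule fin)

lemma integrable_bounded_on_interval:
  fixes f :: "real \<Rightarrow> real"
  assumes [measurable]: "f \<in> borel_measurable borel" and f: "\<And>s. -1 \<le> s \<Longrightarrow> s \<le> 1 \<Longrightarrow> \<bar>f s\<bar> \<le> C"
  shows "integrable M f"
proof (rule integrable_const_bound[of _ C])
  show "AE s in M. norm (f s) \<le> C"
    using bounded by eventually_elim (simp add: f)
qed measurable

lemma integral_mono_on_interval:
  fixes f g :: "real \<Rightarrow> real"
  assumes "integrable M f" "integrable M g" and le: "\<And>s. -1 \<le> s \<Longrightarrow> s \<le> 1 \<Longrightarrow> f s \<le> g s"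
  shows "integral\<^sup>L M f \<le> integral\<^sup>L M g"
  using assms(1,2)
proof (rule integral_mono_AE)
  show "AE s in M. f s \<le> g s"
    using bounded by eventually_elim (simp add: le)
qed

lemma abs_integral_le_on_interval:
  fixes f g :: "real \<Rightarrow> real"
  assumes "integrable M f" "integrable M g" and le: "\<And>s. -1 \<le> s \<Longrightarrow> s \<le> 1 \<Longrightarrow> \<bar>f s\<bar> \<le> g s"
  shows "\<bar>integral\<^sup>L M f\<bar> \<le> integral\<^sup>L M g"
proof -
  have "\<bar>integral\<^sup>L M f\<bar> \<le> (LINT s|M. \<bar>f s\<bar>)" by (rule integral_abs_bound)
  also have "\<dots> \<le> integral\<^sup>L M g"
    using assms by (intro integral_mono_on_interval) auto
  finally show ?thesis .
qed

lemma power_interval: "-1 \<le> s \<Longrightarrow> s \<le> 1 \<Longrightarrow> \<bar>s ^ i\<bar> \<le> (1 :: real)"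
  using power_le_one[of "\<bar>s\<bar>" i] by (simp add: power_abs abs_le_iff)

lemma integrable_power: "integrable M (\<lambda>s. s ^ i)"
  by (rule integrable_bounded_on_interval[of _ 1]) (auto intro: power_interval)

abbreviation mass :: real where "mass \<equiv> (LINT s|M. (1 :: real))"

lemma even_moment_eq:
  "(LINT s|M. s ^ (2 * m)) = mass * Gamma (\<beta> + 1 / 2) * fact (2 * m) / (4 ^ m * fact m * Gamma (real m + \<beta> + 1 / 2))"
proof (induction m)
  case 0
  have "0 < Gamma (\<beta> + 1 / 2)" using beta by (intro Gamma_real_pos) auto
  then show ?case by simp
next
  case (Suc m)
  define G where "G = Gamma (real m + \<beta> + 1 / 2)"
  have G: "0 < G" unfolding G_def using beta by (intro Gamma_real_pos) auto
  have "real m + \<beta> + 1 / 2 \<notin> \<int>\<^sub>\<le>\<^sub>0" using beta by (intro notI) (auto elim!: nonpos_Ints_cases)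
  from Gamma_plus1[OF this] have GS: "Gamma (real (Suc m) + \<beta> + 1 / 2) = (real m + \<beta> + 1 / 2) * G"
    by (simp add: G_def add_ac)
  have p: "0 < 2 * \<beta> + 2 * real m + 1" "0 < real m + \<beta> + 1 / 2" using beta by auto
  have "(LINT s|M. s ^ (2 * Suc m)) = (2 * real m + 1) * (LINT s|M. s ^ (2 * m)) / (2 * \<beta> + 2 * real m + 1)"
    using even_moment[of m] p by (simp add: field_simps)
  also have "\<dots> = (2 * real m + 1) * (mass * Gamma (\<beta> + 1 / 2) * fact (2 * m) / (4 ^ m * fact m * G)) / (2 * (real m + \<beta> + 1 / 2))"
    unfolding Suc.IH G_def[symmetric] by (simp add: algebra_simps)
  also have "\<dots> = mass * Gamma (\<beta> + 1 / 2) * ((2 * (real m + 1)) * (2 * real m + 1) * fact (2 * m)) / ((4 * 4 ^ m) * ((real m + 1) * fact m) * ((real m + \<beta> + 1 / 2) * G))"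
  proof -
    have "(x * (c * y / (d * e * g))) / (2 * h) = c * ((2 * n) * x * y) / ((4 * d) * (n * e) * (h * g))"
      if "n \<noteq> 0" for x c y d e g h n :: real
      using that by (simp add: divide_simps) 
    from this[of "real m + 1" "2 * real m + 1" "mass * Gamma (\<beta> + 1 / 2)" "fact (2 * m)" "4 ^ m" "fact m" G "real m + \<beta> + 1 / 2"]
    show ?thesis by linarith
  qed
  also have "(2 * (real m + 1)) * (2 * real m + 1) * fact (2 * m) = fact (2 * Suc m)"
    by (simp add: algebra_simps)
  also have "(real m + 1) * fact m = fact (Suc m)" by (simp add: algebra_simps)
  finally show ?case unfolding GS by simp
qed

text \<open>The exponential series may be integrated term by term, since the measure is finite and lives on a
bounded interval.\<close>

lemma laplace_transform_sums: "(\<lambda>j. z ^ j / fact j * (LINT s|M. s ^ j)) sums (LINT s|M. exp (z * s))"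
proof -
  define f where "f j s = z ^ j / fact j * s ^ j" for j and s :: real
  have f: "integrable M (f j)" for j unfolding f_def[abs_def] by (intro integrable_mult_right integrable_power)
  have ex: "(\<lambda>j. f j s) sums exp (z * s)" for s
    using exp_converges[of "z * s"] by (simp add: f_def power_mult_distrib divide_inverse mult_ac)
  have exn: "summable (\<lambda>j. norm (f j s))" for s
    using summable_norm_exp[of "z * s"] by (simp add: f_def power_mult_distrib divide_inverse mult_ac abs_mult power_abs)
  have le: "(LINT s|M. norm (f j s)) \<le> \<bar>z\<bar> ^ j / fact j * mass" for j
  proof -
    have "(LINT s|M. norm (f j s)) \<le> (LINT s|M. \<bar>z\<bar> ^ j / fact j * 1)"
    proof (rule integral_mono_on_interval)
      fix s :: real assume "-1 \<le> s" "s \<le> 1"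
      then show "norm (f j s) \<le> \<bar>z\<bar> ^ j / fact j * 1"
        using mult_left_mono[OF power_interval[of s j], of "\<bar>z\<bar> ^ j / fact j"] by (simp add: f_def abs_mult power_abs)
    qed (use f in auto)
    then show ?thesis by (simp add: mult_ac)
  qed
  have "summable (\<lambda>j. \<bar>z\<bar> ^ j / fact j * mass)"
    using summable_exp[of "\<bar>z\<bar>"] by (intro summable_mult2) (simp add: divide_inverse mult.commute)
  then have s: "summable (\<lambda>j. LINT s|M. norm (f j s))"
    by (rule summable_comparison_test'[of _ 0]) (use le in auto)
  have "(\<lambda>j. integral\<^sup>L M (f j)) sums (LINT s|M. (\<Sum>j. f j s))"
    using summable_sums[OF summable_integral[OF f _ s]] integral_suminf[OF f _ s] exn by simp
  moreover have "(\<Sum>j. f j s) = exp (z * s)" for s using sums_unique[OF ex[of s]] by simp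
  moreover have "integral\<^sup>L M (f j) = z ^ j / fact j * (LINT s|M. s ^ j)" for j
    unfolding f_def[abs_def] by simp
  ultimately show ?thesis by simp
qed

text \<open>Poisson's integral. The odd moments vanish, and the recurrence of the even moments is that of the
coefficients of the Bessel series.\<close>

lemma bessel_I_eq_laplace_transform:
  assumes z: "0 < z" and \<nu>: "\<nu> + 1 / 2 = \<beta>"
  shows "bessel_I \<nu> z = z powr \<nu> * (LINT s|M. exp (z * s)) / (2 powr \<nu> * Gamma (\<nu> + 1) * mass)"
proof -
  have Gp: "0 < Gamma (\<beta> + 1 / 2)" using beta by (intro Gamma_real_pos) auto
  have "(\<lambda>m. z ^ (2 * m) / fact (2 * m) * (LINT s|M. s ^ (2 * m))) sums (LINT s|M. exp (z * s))"
  proof (rule sums_mono_reindex[THEN iffD2])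
    show "strict_mono (\<lambda>m::nat. 2 * m)" by (auto simp: strict_mono_def)
    show "(\<lambda>j. z ^ j / fact j * (LINT s|M. s ^ j)) sums (LINT s|M. exp (z * s))" by (rule laplace_transform_sums)
    fix j :: nat assume "j \<notin> range (\<lambda>m. 2 * m)"
    then have "odd j" by (auto elim!: evenE)
    then show "z ^ j / fact j * (LINT s|M. s ^ j) = 0" by (simp add: odd_moment)
  qed
  then have "(\<lambda>m. z powr \<nu> / (2 powr \<nu> * Gamma (\<nu> + 1) * mass) * (z ^ (2 * m) / fact (2 * m) * (LINT s|M. s ^ (2 * m))))
     sums (z powr \<nu> / (2 powr \<nu> * Gamma (\<nu> + 1) * mass) * (LINT s|M. exp (z * s)))"
    by (rule sums_mult)
  moreover have "z powr \<nu> / (2 powr \<nu> * Gamma (\<nu> + 1) * mass) * (z ^ (2 * m) / fact (2 * m) * (LINT s|M. s ^ (2 * m)))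
     = (z / 2) powr (2 * real m + \<nu>) / (fact m * Gamma (real m + \<nu> + 1))" for m
  proof -
    have b: "\<beta> + 1 / 2 = \<nu> + 1" "real m + \<beta> + 1 / 2 = real m + \<nu> + 1" using \<nu> by auto
    have "(z / 2) powr (2 * real m + \<nu>) = (z / 2) powr (real (2 * m)) * (z / 2) powr \<nu>"
      by (simp add: powr_add)
    also have "(z / 2) powr (real (2 * m)) = z ^ (2 * m) / 4 ^ m"
    proof -
      have "0 < z / 2" using z by simp
      then have "(z / 2) powr (real (2 * m)) = (z / 2) ^ (2 * m)" by (rule powr_realpow)
      also have "\<dots> = z ^ (2 * m) / 4 ^ m" by (simp add: power_divide power_mult)
      finally show ?thesis .
    qed
    also have "(z / 2) powr \<nu> = z powr \<nu> / 2 powr \<nu>" using z by (simp add: powr_divide)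
    finally have e: "(z / 2) powr (2 * real m + \<nu>) = z ^ (2 * m) / 4 ^ m * (z powr \<nu> / 2 powr \<nu>)" .
    show ?thesis
      unfolding even_moment_eq e b using Gp mass_pos b by (simp add: mult_ac)
  qed
  ultimately have "bessel_I \<nu> z = z powr \<nu> / (2 powr \<nu> * Gamma (\<nu> + 1) * mass) * (LINT s|M. exp (z * s))"
    unfolding bessel_I_def by (simp add: sums_unique[symmetric])
  then show ?thesis by simp
qed

end

section \<open>Weighted kernels of Gaussian type\<close>

lemma powr_times_gaussian_bounded:
  assumes "0 \<le> p" "0 < c"
  shows "\<exists>K>0. \<forall>x\<ge>0. (1 + x) powr p * exp (- (c * x\<^sup>2)) \<le> (K :: real)"
proof (intro exI[of _ "exp (p\<^sup>2 / (4 * c))"] conjI allI impI)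
  fix x :: real assume x: "0 \<le> x"
  have "(1 + x) powr p \<le> exp x powr p"
    using x assms by (intro powr_mono2) auto
  also have "\<dots> = exp (p * x)" by (simp add: exp_powr_real mult.commute)
  finally have "(1 + x) powr p * exp (- (c * x\<^sup>2)) \<le> exp (p * x) * exp (- (c * x\<^sup>2))"
    by (intro mult_right_mono) auto
  also have "\<dots> = exp (p * x - c * x\<^sup>2)" by (simp add: exp_diff exp_minus divide_inverse)
  also have "p * x - c * x\<^sup>2 \<le> p\<^sup>2 / (4 * c)"
  proof -
    have "0 \<le> (2 * c * x - p)\<^sup>2" by simp
    then have "(p * x - c * x\<^sup>2) * (4 * c) \<le> p\<^sup>2"
      by (simp add: power2_eq_square algebra_simps)
    then show ?thesis using assms by (simp add: pos_le_divide_eq)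
  qed
  finally show "(1 + x) powr p * exp (- (c * x\<^sup>2)) \<le> exp (p\<^sup>2 / (4 * c))" by simp
qed simp

text \<open>For \<open>\<beta> \<le> 1\<close> the power is globally Hoelder continuous of order \<open>\<beta>\<close>; for \<open>\<beta> > 1\<close> the mean value
theorem applies, with a derivative that grows. For increments below 1, a Hoelder bound of order \<open>\<gamma>\<close>
follows from both. For \<open>\<beta> = 0\<close> the power is constant, so any \<open>\<gamma>\<close> is allowed.\<close>

lemma powr_diff_le_holder:
  fixes \<beta> \<gamma> :: real
  assumes V: "0 < V" "V \<le> V'" "V' \<le> V + 1" and g: "0 < \<gamma>" "\<gamma> \<le> 1" and b: "0 \<le> \<beta>" "\<beta> = 0 \<or> \<gamma> \<le> \<beta>"
  shows "\<bar>V' powr \<beta> - V powr \<beta>\<bar> \<le> (1 + \<beta>) * (V' - V) powr \<gamma> * (1 + V') powr \<beta>"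
proof -
  define d where "d = V' - V"
  have d: "0 \<le> d" "d \<le> 1" "V' = V + d" using V by (auto simp: d_def)
  have nn: "0 \<le> V' powr \<beta> - V powr \<beta>" using V b by (simp add: powr_mono2)
  have one: "1 \<le> (1 + V') powr \<beta>" using V b by (intro ge_one_powr_ge_zero) auto
  have "V' powr \<beta> - V powr \<beta> \<le> (1 + \<beta>) * d powr \<gamma> * (1 + V') powr \<beta>"
  proof (cases "d = 0 \<or> \<beta> = 0")
    case True
    then show ?thesis using d V b by auto
  next
    case False
    then have dp: "0 < d" and bp: "0 < \<beta>" "\<gamma> \<le> \<beta>" using d b by auto
    show ?thesis
    proof (cases "\<beta> \<le> 1")
      case True
      have "V' powr \<beta> - V powr \<beta> = V' * V' powr (\<beta> - 1) - V * V powr (\<beta> - 1)"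
        using V by (simp add: powr_diff)
      also have "\<dots> \<le> V' * V' powr (\<beta> - 1) - V * V' powr (\<beta> - 1)"
        using V True by (intro diff_left_mono mult_left_mono powr_mono2') auto
      also have "\<dots> = d * V' powr (\<beta> - 1)" by (simp add: d algebra_simps)
      also have "\<dots> \<le> d * d powr (\<beta> - 1)"
        using dp d V True by (intro mult_left_mono powr_mono2') auto
      also have "\<dots> = d powr \<beta>" using dp by (simp add: powr_diff)
      also have "\<dots> \<le> d powr \<gamma>" using dp d bp by (intro powr_mono') auto
      also have "\<dots> = 1 * d powr \<gamma> * 1" by simp
      also have "\<dots> \<le> (1 + \<beta>) * d powr \<gamma> * (1 + V') powr \<beta>"
        using bp one by (intro mult_mono) auto
      finally show ?thesis .
    next
      case False
      have "\<exists>z. z > V \<and> z < V' \<and> V' powr \<beta> - V powr \<beta> = (V' - V) * (\<beta> * z powr (\<beta> - 1))"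
        using V dp d by (intro MVT2) (auto intro!: derivative_eq_intros)
      then obtain z where z: "V < z" "z < V'" "V' powr \<beta> - V powr \<beta> = d * (\<beta> * z powr (\<beta> - 1))"
        by (auto simp: d_def)
      have "z powr (\<beta> - 1) \<le> (1 + V') powr (\<beta> - 1)" using z V False by (intro powr_mono2) auto
      also have "\<dots> \<le> (1 + V') powr \<beta>" using V by (intro powr_mono) auto
      finally have zz: "z powr (\<beta> - 1) \<le> (1 + V') powr \<beta>" .
      have dg: "d \<le> d powr \<gamma>" using powr_mono'[of \<gamma> 1 d] dp d g by simp
      have "d * (\<beta> * z powr (\<beta> - 1)) \<le> d powr \<gamma> * ((1 + \<beta>) * (1 + V') powr \<beta>)"
        using dg zz bp by (intro mult_mono) auto
      then show ?thesis unfolding z(3) by (simp add: mult_ac)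
    qed
  qed
  then show ?thesis using nn by (simp add: d_def)
qed

text \<open>The exponent is \<open>- (U\<^sup>2 + V\<^sup>2 - 2 U V s) / 8\<close>, in the form that shows both its sign and the part that
does not depend on \<open>s\<close>.\<close>

definition gaussian_factor :: "real \<Rightarrow> real \<Rightarrow> real \<Rightarrow> real" where
  "gaussian_factor U V s = exp (- (((U - V)\<^sup>2 + 2 * U * V * (1 - s)) / 8))"

text \<open>Integrands that obey Gaussian bounds together with their derivatives in the second variable. The
constant is explicit because the estimates have to be uniform over the time-dependent members.\<close>

definition gaussian_family :: "real \<Rightarrow> (real \<Rightarrow> real \<Rightarrow> real \<Rightarrow> real) \<Rightarrow> bool" where
  "gaussian_family C f \<longleftrightarrow> (\<forall>U>0. \<forall>V>0. f U V \<in> borel_measurable borel \<and>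
     (\<forall>s. -1 \<le> s \<longrightarrow> s \<le> 1 \<longrightarrow> \<bar>f U V s\<bar> \<le> C * gaussian_factor U V s \<and>
        (\<exists>d. ((\<lambda>x. f U x s) has_real_derivative d) (at V) \<and> \<bar>d\<bar> \<le> C * gaussian_factor U V s)))"

text \<open>By the mean value theorem. Moving the intermediate point back to \<open>V\<close> halves the rate of the
Gaussian and costs a constant since the increment is at most 1; the remaining factor only improves when
\<open>V\<close> grows, as \<open>s \<le> 1\<close>.\<close>

lemma gaussian_family_lipschitz:
  assumes f: "gaussian_family C f" and C: "0 \<le> C" and UV: "0 < U" "0 < V" "V \<le> V'" "V' \<le> V + 1" and s: "-1 \<le> s" "s \<le> 1"
  shows "\<bar>f U V' s - f U V s\<bar> \<le> (C * exp (1 / 8) * (V' - V) * exp (- ((U - V)\<^sup>2 / 16))) * exp (- (U * V / 4 * (1 - s)))"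
proof (cases "V = V'")
  case False
  then have VV: "V < V'" using UV by simp
  define B where "B = C * exp (1 / 8) * exp (- ((U - V)\<^sup>2 / 16)) * exp (- (U * V / 4 * (1 - s)))"
  have "\<forall>x. \<exists>d. 0 < x \<longrightarrow> ((\<lambda>x. f U x s) has_real_derivative d) (at x) \<and> \<bar>d\<bar> \<le> C * gaussian_factor U x s"
    using f UV(1) s unfolding gaussian_family_def by blast
  then obtain d where d: "\<And>x. 0 < x \<Longrightarrow> ((\<lambda>x. f U x s) has_real_derivative d x) (at x)"
    and db: "\<And>x. 0 < x \<Longrightarrow> \<bar>d x\<bar> \<le> C * gaussian_factor U x s"
    by metis
  obtain z where z: "V < z" "z < V'" "f U V' s - f U V s = (V' - V) * d z"
    using MVT2[OF VV, of "\<lambda>x. f U x s" d] d UV by force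
  have "gaussian_factor U z s \<le> exp (1 / 8) * exp (- ((U - V)\<^sup>2 / 16)) * exp (- (U * V / 4 * (1 - s)))"
  proof -
    have "U * V * (1 - s) \<le> U * z * (1 - s)"
      using z s UV by (intro mult_right_mono mult_left_mono) auto
    moreover have "(U - V)\<^sup>2 \<le> 2 * (U - z)\<^sup>2 + 2"
    proof -
      have "(U - V)\<^sup>2 \<le> 2 * (U - z)\<^sup>2 + 2 * (z - V)\<^sup>2"
        using zero_le_power2[of "(U - z) - (z - V)"] by (simp add: power2_eq_square algebra_simps)
      moreover have "(z - V)\<^sup>2 \<le> 1\<^sup>2" using z UV by (intro power_mono) auto
      ultimately show ?thesis by simp
    qed
    ultimately have "- (((U - z)\<^sup>2 + 2 * U * z * (1 - s)) / 8) \<le> 1 / 8 + (- ((U - V)\<^sup>2 / 16)) + (- (U * V / 4 * (1 - s)))"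
      by (simp add: field_simps)
    then show ?thesis unfolding gaussian_factor_def exp_add[symmetric] by simp
  qed
  then have "\<bar>d z\<bar> \<le> B"
    using db[of z] z UV C unfolding B_def
    by (smt (verit, ccfv_threshold) mult.assoc mult_left_mono)
  then have "\<bar>(V' - V) * d z\<bar> \<le> (V' - V) * B"
    using VV by (simp add: abs_mult mult_left_mono)
  then show ?thesis unfolding z(3) B_def by (simp only: mult_ac)
qed simp

lemma exp_gaussian_split:
  "gaussian_factor U V s = exp (- ((U - V)\<^sup>2 / 8)) * exp (- (U * V / 4 * (1 - s)))"
  unfolding gaussian_factor_def exp_add[symmetric] by (simp add: field_simps)

text \<open>A Peetre-type inequality. It controls a power of \<open>(1 + U) (1 + V)\<close> by the same power of \<open>1 + U V\<close>,
which the decay of the Laplace transform compensates, and by a power of \<open>1 + \<bar>U - V\<bar>\<close>, which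
the Gaussian absorbs.\<close>

lemma one_plus_mult_le:
  assumes "0 \<le> U" "0 \<le> (V :: real)"
  shows "(1 + U) * (1 + V) \<le> 2 * ((1 + U * V) * (1 + \<bar>U - V\<bar>))"
proof -
  have *: "(1 + U) * (1 + V) \<le> 2 * ((1 + U * V) * (1 + (V - U)))" if "0 \<le> U" "U \<le> V" for U V :: real
  proof -
    have "2 * U \<le> 1 + U * U" using zero_le_power2[of "1 - U"] by (simp add: power2_eq_square algebra_simps)
    moreover have "U * U \<le> U * V" using that by (intro mult_left_mono) auto
    ultimately have "2 * U \<le> 1 + U * V" by (rule order_trans[OF _ add_left_mono])
    then have "0 \<le> (1 + U * V - 2 * U) + (V - U)" using that by simp
    then have "1 + U + V + U * V \<le> 2 + 2 * (U * V) + 2 * (V - U)" by (simp add: algebra_simps)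
    also have "\<dots> \<le> 2 + 2 * (U * V) + 2 * (V - U) + 2 * (U * V * (V - U))"
      using that by simp
    finally have "1 + U + V + U * V \<le> 2 + 2 * (U * V) + 2 * (V - U) + 2 * (U * V * (V - U))" .
    then show ?thesis by (simp add: algebra_simps)
  qed
  show ?thesis
    using *[of U V] *[of V U] assms by (cases "U \<le> V") (auto simp: abs_if mult.commute)
qed

context bessel_measure
begin

interpretation finite_measure M by (rule fin)

text \<open>The shape of the derivatives of the heat kernel after rescaling; the power combines the
factor \<open>\<surd>(U V)\<close> of the heat kernel with the factor \<open>z\<^sup>\<nu>\<close> in Poisson's integral.\<close>

definition weighted_kernel :: "(real \<Rightarrow> real \<Rightarrow> real \<Rightarrow> real) \<Rightarrow> real \<Rightarrow> real \<Rightarrow> real" where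
  "weighted_kernel f U V = (U * V) powr \<beta> * (LINT s|M. f U V s)"

lemma laplace_decay:
  "\<exists>D\<ge>0. \<forall>U>0. \<forall>V>0. (LINT s|M. exp (- (U * V / 4 * (1 - s)))) \<le> D * (1 + U * V) powr (- \<beta>)"
proof -
  obtain D where D: "D \<ge> 0" "\<And>w. 0 \<le> w \<Longrightarrow> (LINT s|M. exp (- (w * (1 - s)))) \<le> D * (1 + w) powr (- \<beta>)"
    using decay by blast
  show ?thesis
  proof (intro exI[of _ "D * 4 powr \<beta>"] conjI allI impI)
    fix U V :: real assume UV: "0 < U" "0 < V"
    have "(LINT s|M. exp (- (U * V / 4 * (1 - s)))) \<le> D * (1 + U * V / 4) powr (- \<beta>)"
      using UV by (intro D) auto
    also have "\<dots> \<le> D * ((1 + U * V) / 4) powr (- \<beta>)"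
      using UV beta D by (intro mult_left_mono powr_mono2') (auto intro: add_pos_pos)
    also have "((1 + U * V) / 4) powr (- \<beta>) = 4 powr \<beta> * (1 + U * V) powr (- \<beta>)"
      using UV by (simp add: powr_divide powr_minus field_simps)
    finally show "(LINT s|M. exp (- (U * V / 4 * (1 - s)))) \<le> D * 4 powr \<beta> * (1 + U * V) powr (- \<beta>)"
      by (simp add: mult_ac)
  qed (use D in auto)
qed

lemma integrable_gaussian_family:
  assumes "gaussian_family C f" "0 \<le> C" "0 < U" "0 < V"
  shows "integrable M (f U V)"
proof (rule integrable_bounded_on_interval[of _ C])
  show "f U V \<in> borel_measurable borel" using assms by (simp add: gaussian_family_def)
  fix s :: real assume s: "-1 \<le> s" "s \<le> 1"
  have "0 \<le> U * V * (1 - s)" using assms s by simp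
  then have "gaussian_factor U V s \<le> 1" by (simp add: gaussian_factor_def)
  then have "C * gaussian_factor U V s \<le> C * 1" using assms by (intro mult_left_mono) auto
  then show "\<bar>f U V s\<bar> \<le> C" using assms s unfolding gaussian_family_def by fastforce
qed

lemma integrable_laplace: "0 < U \<Longrightarrow> 0 < V \<Longrightarrow> integrable M (\<lambda>s. exp (- (U * V / 4 * (1 - s))))"
  by (rule integrable_bounded_on_interval[of _ 1]) auto

text \<open>The size bound multiplies \<open>(U V)\<^sup>\<beta>\<close> with the decay of the Laplace transform. If the increment exceeds
1, the size bound also gives the Hoelder bound. Otherwise the difference is split into that of the powers
and that of the integrals: the former is Hoelder continuous of order \<open>\<gamma>\<close>, the latter Lipschitz
continuous.\<close>

lemma weighted_kernel_estimates:
  assumes g: "0 < \<gamma>" "\<gamma> \<le> 1" "\<beta> = 0 \<or> \<gamma> \<le> \<beta>" and C: "0 \<le> C"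
  shows "\<exists>K\<ge>0. \<forall>f. gaussian_family C f \<longrightarrow>
    (\<forall>U>0. \<forall>V>0. \<bar>weighted_kernel f U V\<bar> \<le> K * exp (- ((U - V)\<^sup>2 / 16))) \<and>
    (\<forall>U>0. \<forall>V>0. \<forall>V'>0. \<bar>weighted_kernel f U V - weighted_kernel f U V'\<bar>
        \<le> K * \<bar>V - V'\<bar> powr \<gamma> * (exp (- ((U - V)\<^sup>2 / 16)) + exp (- ((U - V')\<^sup>2 / 16))))"
proof -
  obtain D where D: "0 \<le> D" and J: "\<And>U V. 0 < U \<Longrightarrow> 0 < V \<Longrightarrow> (LINT s|M. exp (- (U * V / 4 * (1 - s)))) \<le> D * (1 + U * V) powr (- \<beta>)"
    using laplace_decay by blast
  obtain K1 where K1: "0 < K1" "\<And>x. 0 \<le> x \<Longrightarrow> (1 + x) powr \<beta> * exp (- (1 / 16 * x\<^sup>2)) \<le> K1"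
    using powr_times_gaussian_bounded[OF beta, of "1 / 16"] by auto
  have J0: "\<bar>integral\<^sup>L M h\<bar> \<le> b * (D * (1 + U * V) powr (- \<beta>))"
    if "integrable M h" "\<And>s. -1 \<le> s \<Longrightarrow> s \<le> 1 \<Longrightarrow> \<bar>h s\<bar> \<le> b * exp (- (U * V / 4 * (1 - s)))" "0 \<le> b" "0 < U" "0 < V" for h b U V
  proof -
    have "\<bar>integral\<^sup>L M h\<bar> \<le> (LINT s|M. b * exp (- (U * V / 4 * (1 - s))))"
      using that integrable_laplace by (intro abs_integral_le_on_interval) auto
    also have "\<dots> = b * (LINT s|M. exp (- (U * V / 4 * (1 - s))))" by simp
    also have "\<dots> \<le> b * (D * (1 + U * V) powr (- \<beta>))"
      using that by (intro mult_left_mono J) auto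
    finally show ?thesis .
  qed
  have I0: "\<bar>LINT s|M. f U V s\<bar> \<le> (C * exp (- ((U - V)\<^sup>2 / 8))) * (D * (1 + U * V) powr (- \<beta>))"
    if f: "gaussian_family C f" and UV: "0 < U" "0 < V" for f U V
    using integrable_gaussian_family[OF f C UV] C f UV unfolding gaussian_family_def
    by (intro J0) (auto simp: exp_gaussian_split mult.assoc)
  have UVb: "(U * V) powr \<beta> * (1 + U * V) powr (- \<beta>) \<le> 1" if "0 < U" "0 < V" for U V :: real
  proof -
    have "(U * V) powr \<beta> \<le> (1 + U * V) powr \<beta>" using that beta by (intro powr_mono2) auto
    then have "(U * V) powr \<beta> * (1 + U * V) powr (- \<beta>) \<le> (1 + U * V) powr \<beta> * (1 + U * V) powr (- \<beta>)"
      by (intro mult_right_mono) auto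
    also have "\<dots> = 1"
      using that unfolding powr_add[symmetric] by (simp add: add_pos_pos less_imp_neq[symmetric])
    finally show ?thesis .
  qed
  \<comment> \<open>The form of the bound in which one of the two powers has been replaced by its Hoelder increment.\<close>
  have UVb2: "U powr \<beta> * (1 + V) powr \<beta> * exp (- ((U - V)\<^sup>2 / 8)) * (1 + U * V) powr (- \<beta>) \<le> 2 powr \<beta> * K1 * exp (- ((U - V)\<^sup>2 / 16))"
    if "0 < U" "0 < V" for U V :: real
  proof -
    have pos: "0 < 1 + U * V" using that by (simp add: add_pos_pos)
    have "U powr \<beta> * (1 + V) powr \<beta> \<le> (1 + U) powr \<beta> * (1 + V) powr \<beta>"
      using that beta by (intro mult_right_mono powr_mono2) auto
    also have "\<dots> = ((1 + U) * (1 + V)) powr \<beta>" using that by (simp add: powr_mult)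
    also have "\<dots> \<le> (2 * ((1 + U * V) * (1 + \<bar>U - V\<bar>))) powr \<beta>"
      using that beta by (intro powr_mono2 one_plus_mult_le) auto
    also have "\<dots> = 2 powr \<beta> * ((1 + U * V) powr \<beta> * (1 + \<bar>U - V\<bar>) powr \<beta>)"
      using pos by (simp add: powr_mult)
    finally have 1: "U powr \<beta> * (1 + V) powr \<beta> \<le> 2 powr \<beta> * ((1 + U * V) powr \<beta> * (1 + \<bar>U - V\<bar>) powr \<beta>)" .
    have e8: "exp (- ((U - V)\<^sup>2 / 8)) = exp (- (1 / 16 * \<bar>U - V\<bar>\<^sup>2)) * exp (- ((U - V)\<^sup>2 / 16))"
      unfolding exp_add[symmetric] by simp
    have "U powr \<beta> * (1 + V) powr \<beta> * exp (- ((U - V)\<^sup>2 / 8)) * (1 + U * V) powr (- \<beta>)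
      \<le> 2 powr \<beta> * ((1 + U * V) powr \<beta> * (1 + \<bar>U - V\<bar>) powr \<beta>) * exp (- ((U - V)\<^sup>2 / 8)) * (1 + U * V) powr (- \<beta>)"
      by (intro mult_right_mono 1) auto
    also have "\<dots> = 2 powr \<beta> * ((1 + U * V) powr \<beta> * (1 + U * V) powr (- \<beta>)) * ((1 + \<bar>U - V\<bar>) powr \<beta> * exp (- (1 / 16 * \<bar>U - V\<bar>\<^sup>2))) * exp (- ((U - V)\<^sup>2 / 16))"
      unfolding e8 by (simp only: mult_ac)
    also have "(1 + U * V) powr \<beta> * (1 + U * V) powr (- \<beta>) = 1"
      using pos unfolding powr_add[symmetric] by simp
    also have "2 powr \<beta> * 1 * ((1 + \<bar>U - V\<bar>) powr \<beta> * exp (- (1 / 16 * \<bar>U - V\<bar>\<^sup>2))) * exp (- ((U - V)\<^sup>2 / 16))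
      \<le> 2 powr \<beta> * 1 * K1 * exp (- ((U - V)\<^sup>2 / 16))"
      by (intro mult_right_mono mult_left_mono K1) auto
    finally show ?thesis by simp
  qed
  define K where "K = C * D + (C * D * (1 + \<beta>) * 2 powr \<beta> * K1 + C * exp (1 / 8) * D)"
  have K0: "0 \<le> C * D" "0 \<le> C * D * (1 + \<beta>) * 2 powr \<beta> * K1" "0 \<le> C * exp (1 / 8) * D"
    using C D beta K1 by auto
  then have K: "0 \<le> K" by (simp add: K_def)
  have size: "\<bar>weighted_kernel f U V\<bar> \<le> K * exp (- ((U - V)\<^sup>2 / 16))"
    if f: "gaussian_family C f" and UV: "0 < U" "0 < V" for f U V
  proof -
    have "\<bar>weighted_kernel f U V\<bar> \<le> (U * V) powr \<beta> * ((C * exp (- ((U - V)\<^sup>2 / 8))) * (D * (1 + U * V) powr (- \<beta>)))"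
      unfolding weighted_kernel_def abs_mult using I0[OF f UV] by (simp add: mult_left_mono)
    also have "\<dots> = (C * D * exp (- ((U - V)\<^sup>2 / 8))) * ((U * V) powr \<beta> * (1 + U * V) powr (- \<beta>))"
      by (simp only: mult_ac)
    also have "\<dots> \<le> (C * D * exp (- ((U - V)\<^sup>2 / 8))) * 1"
      using C D UV by (intro mult_left_mono UVb) auto
    also have "\<dots> \<le> C * D * exp (- ((U - V)\<^sup>2 / 16))"
      using C D by (simp add: mult_left_mono)
    also have "\<dots> \<le> K * exp (- ((U - V)\<^sup>2 / 16))"
      using K0 by (intro mult_right_mono) (auto simp: K_def)
    finally show ?thesis .
  qed
  have close: "\<bar>weighted_kernel f U V' - weighted_kernel f U V\<bar>
      \<le> K * (V' - V) powr \<gamma> * (exp (- ((U - V)\<^sup>2 / 16)) + exp (- ((U - V')\<^sup>2 / 16)))"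
    if f: "gaussian_family C f" and UV: "0 < U" "0 < V" "V \<le> V'" "V' \<le> V + 1" for f U V V'
  proof -
    have V': "0 < V'" using UV by simp
    have int: "integrable M (f U V)" "integrable M (f U V')"
      using integrable_gaussian_family[OF f C] UV V' by auto
    define F F' where "F = (LINT s|M. f U V s)" and "F' = (LINT s|M. f U V' s)"
    have dg: "V' - V \<le> (V' - V) powr \<gamma>"
      using UV g powr_mono'[of \<gamma> 1 "V' - V"] by (cases "V = V'") auto
    have "weighted_kernel f U V' - weighted_kernel f U V = U powr \<beta> * (V' powr \<beta> - V powr \<beta>) * F' + (U * V) powr \<beta> * (F' - F)"
      unfolding weighted_kernel_def F_def F'_def using UV V' by (simp add: powr_mult algebra_simps)
    then have split: "\<bar>weighted_kernel f U V' - weighted_kernel f U V\<bar> \<le> \<bar>U powr \<beta> * (V' powr \<beta> - V powr \<beta>) * F'\<bar> + \<bar>(U * V) powr \<beta> * (F' - F)\<bar>"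
      by simp
    have "\<bar>U powr \<beta> * (V' powr \<beta> - V powr \<beta>) * F'\<bar> = U powr \<beta> * \<bar>V' powr \<beta> - V powr \<beta>\<bar> * \<bar>F'\<bar>"
      by (simp add: abs_mult)
    also have "\<dots> \<le> U powr \<beta> * ((1 + \<beta>) * (V' - V) powr \<gamma> * (1 + V') powr \<beta>) * ((C * exp (- ((U - V')\<^sup>2 / 8))) * (D * (1 + U * V') powr (- \<beta>)))"
      unfolding F'_def using UV V' g beta by (intro mult_mono mult_left_mono powr_diff_le_holder I0 f) auto
    also have "\<dots> = C * D * (1 + \<beta>) * (V' - V) powr \<gamma> * (U powr \<beta> * (1 + V') powr \<beta> * exp (- ((U - V')\<^sup>2 / 8)) * (1 + U * V') powr (- \<beta>))"
      by (simp only: mult_ac)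
    also have "\<dots> \<le> C * D * (1 + \<beta>) * (V' - V) powr \<gamma> * (2 powr \<beta> * K1 * exp (- ((U - V')\<^sup>2 / 16)))"
      using C D beta UV V' by (intro mult_left_mono UVb2) auto
    also have "\<dots> = (C * D * (1 + \<beta>) * 2 powr \<beta> * K1) * ((V' - V) powr \<gamma> * exp (- ((U - V')\<^sup>2 / 16)))"
      by (simp only: mult_ac)
    also have "\<dots> \<le> K * ((V' - V) powr \<gamma> * exp (- ((U - V')\<^sup>2 / 16)))"
      using K0 by (intro mult_right_mono) (auto simp: K_def)
    finally have t1: "\<bar>U powr \<beta> * (V' powr \<beta> - V powr \<beta>) * F'\<bar> \<le> K * ((V' - V) powr \<gamma> * exp (- ((U - V')\<^sup>2 / 16)))" .
    have "\<bar>F' - F\<bar> \<le> (C * exp (1 / 8) * (V' - V) * exp (- ((U - V)\<^sup>2 / 16))) * (D * (1 + U * V) powr (- \<beta>))"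
    proof -
      have "F' - F = (LINT s|M. f U V' s - f U V s)" unfolding F_def F'_def using int by simp
      also have "\<bar>\<dots>\<bar> \<le> (C * exp (1 / 8) * (V' - V) * exp (- ((U - V)\<^sup>2 / 16))) * (D * (1 + U * V) powr (- \<beta>))"
        using int C UV gaussian_family_lipschitz[OF f C UV] by (intro J0) auto
      finally show ?thesis .
    qed
    then have "\<bar>(U * V) powr \<beta> * (F' - F)\<bar> \<le> (U * V) powr \<beta> * ((C * exp (1 / 8) * (V' - V) * exp (- ((U - V)\<^sup>2 / 16))) * (D * (1 + U * V) powr (- \<beta>)))"
      by (simp add: abs_mult mult_left_mono)
    also have "\<dots> = (C * exp (1 / 8) * D * (V' - V) * exp (- ((U - V)\<^sup>2 / 16))) * ((U * V) powr \<beta> * (1 + U * V) powr (- \<beta>))"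
      by (simp only: mult_ac)
    also have "\<dots> \<le> (C * exp (1 / 8) * D * (V' - V) * exp (- ((U - V)\<^sup>2 / 16))) * 1"
      using C D UV by (intro mult_left_mono UVb) auto
    also have "\<dots> = (C * exp (1 / 8) * D) * ((V' - V) * exp (- ((U - V)\<^sup>2 / 16)))" by simp
    also have "\<dots> \<le> K * ((V' - V) powr \<gamma> * exp (- ((U - V)\<^sup>2 / 16)))"
      using K0 K UV dg by (intro mult_mono mult_right_mono) (auto simp: K_def)
    finally have t2: "\<bar>(U * V) powr \<beta> * (F' - F)\<bar> \<le> K * ((V' - V) powr \<gamma> * exp (- ((U - V)\<^sup>2 / 16)))" .
    show ?thesis using split t1 t2 by (simp add: distrib_left mult.assoc)
  qed
  show ?thesis
  proof (intro exI[of _ K] conjI K allI impI)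
    fix f and U V :: real assume "gaussian_family C f" "0 < U" "0 < V"
    then show "\<bar>weighted_kernel f U V\<bar> \<le> K * exp (- ((U - V)\<^sup>2 / 16))" by (rule size)
  next
    fix f and U V V' :: real assume f: "gaussian_family C f" and UV: "0 < U" "0 < V" "0 < V'"
    let ?e = "exp (- ((U - V)\<^sup>2 / 16)) + exp (- ((U - V')\<^sup>2 / 16))"
    show "\<bar>weighted_kernel f U V - weighted_kernel f U V'\<bar> \<le> K * \<bar>V - V'\<bar> powr \<gamma> * ?e"
    proof (cases "\<bar>V - V'\<bar> \<le> 1")
      case True
      show ?thesis
      proof (cases "V \<le> V'")
        case le: True
        then show ?thesis using close[OF f UV(1,2) le] True
          by (simp add: abs_minus_commute[of "weighted_kernel f U V"])
      next
        case False
        then show ?thesis using close[OF f UV(1,3), of V] True by (simp add: add.commute)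
      qed
    next
      case False
      have "\<bar>weighted_kernel f U V - weighted_kernel f U V'\<bar> \<le> K * exp (- ((U - V)\<^sup>2 / 16)) + K * exp (- ((U - V')\<^sup>2 / 16))"
        using size[OF f UV(1,2)] size[OF f UV(1,3)] by linarith
      also have "\<dots> = K * 1 * ?e" by (simp add: distrib_left)
      also have "\<dots> \<le> K * \<bar>V - V'\<bar> powr \<gamma> * ?e"
        using K False g by (intro mult_right_mono mult_left_mono ge_one_powr_ge_zero add_nonneg_nonneg) auto
      finally show ?thesis .
    qed
  qed
qed

end

section \<open>Derivatives of the one-dimensional heat kernel\<close>

text \<open>The polynomials \<open>a^(k/2) He\<^sub>k(z / \<surd>a)\<close> of the probabilists' Hermite polynomials \<open>He\<^sub>k\<close>. In this form they
also make sense for \<open>a = 0\<close>, the limit of large time, and admit bounds that are uniform for \<open>a\<close> from 0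
to 1.\<close>

fun scaled_hermite :: "real \<Rightarrow> nat \<Rightarrow> real \<Rightarrow> real" where
  "scaled_hermite a 0 z = 1"
| "scaled_hermite a (Suc 0) z = z"
| "scaled_hermite a (Suc (Suc k)) z = z * scaled_hermite a (Suc k) z - a * real (Suc k) * scaled_hermite a k z"

lemma scaled_hermite_Suc:
  "scaled_hermite a (Suc k) z = z * scaled_hermite a k z - a * (real k * scaled_hermite a (k - 1) z)"
  by (cases k) simp_all

lemma has_real_derivative_scaled_hermite:
  "(scaled_hermite a k has_real_derivative real k * scaled_hermite a (k - 1) z) (at z)"
proof (induction k rule: less_induct)
  case (less k)
  consider "k = 0" | "k = 1" | j where "k = Suc (Suc j)"
    by (metis One_nat_def not0_implies_Suc)
  then show ?case
  proof cases
    case 1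
    then show ?thesis by (simp add: fun_eq_iff)
  next
    case 2
    have "scaled_hermite a (Suc 0) = (\<lambda>z. z)" by (simp add: fun_eq_iff)
    then show ?thesis using 2 by simp
  next
    case (3 j)
    have d: "(scaled_hermite a (Suc j) has_real_derivative real (Suc j) * scaled_hermite a j z) (at z)"
      "(scaled_hermite a j has_real_derivative real j * scaled_hermite a (j - 1) z) (at z)"
      using less[of "Suc j"] less[of j] 3 by simp_all
    have "((\<lambda>z. z * scaled_hermite a (Suc j) z - a * real (Suc j) * scaled_hermite a j z) has_real_derivative
       (1 * scaled_hermite a (Suc j) z + (real (Suc j) * scaled_hermite a j z) * z) - a * real (Suc j) * (real j * scaled_hermite a (j - 1) z)) (at z)"
      by (intro DERIV_diff DERIV_mult DERIV_cmult DERIV_ident d)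
    also have "(1 * scaled_hermite a (Suc j) z + (real (Suc j) * scaled_hermite a j z) * z) - a * real (Suc j) * (real j * scaled_hermite a (j - 1) z)
       = real k * scaled_hermite a (k - 1) z"
    proof -
      have "(1 * scaled_hermite a (Suc j) z + (real (Suc j) * scaled_hermite a j z) * z) - a * real (Suc j) * (real j * scaled_hermite a (j - 1) z)
        = scaled_hermite a (Suc j) z + real (Suc j) * (z * scaled_hermite a j z - a * (real j * scaled_hermite a (j - 1) z))"
        by (simp add: algebra_simps)
      also have "\<dots> = scaled_hermite a (Suc j) z + real (Suc j) * scaled_hermite a (Suc j) z"
        by (simp only: scaled_hermite_Suc[symmetric])
      also have "\<dots> = real k * scaled_hermite a (k - 1) z"
        by (simp add: 3 algebra_simps del: scaled_hermite.simps)
      finally show ?thesis .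
    qed
    also have "(\<lambda>z. z * scaled_hermite a (Suc j) z - a * real (Suc j) * scaled_hermite a j z) = scaled_hermite a k"
      by (simp add: 3 fun_eq_iff)
    finally show ?thesis .
  qed
qed

lemma scaled_hermite_scale: "scaled_hermite (c\<^sup>2 * a) k (c * z) = c ^ k * scaled_hermite a k z"
  by (induction a k z rule: scaled_hermite.induct) (simp_all add: algebra_simps power2_eq_square)

lemma scaled_hermite_bound:
  "\<exists>C\<ge>0. \<forall>a z W. 0 \<le> a \<longrightarrow> a \<le> 1 \<longrightarrow> 1 \<le> W \<longrightarrow> \<bar>z\<bar> \<le> W \<longrightarrow> \<bar>scaled_hermite a k z\<bar> \<le> C * W ^ k"
proof (induction k rule: less_induct)
  case (less k)
  consider "k = 0" | "k = 1" | j where "k = Suc (Suc j)"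
    by (metis One_nat_def not0_implies_Suc)
  then show ?case
  proof cases
    case (3 j)
    have "Suc j < k" "j < k" using 3 by auto
    from less[OF this(1)] obtain C1 where C1: "0 \<le> C1"
      and C1': "\<forall>a z W. 0 \<le> a \<longrightarrow> a \<le> 1 \<longrightarrow> 1 \<le> W \<longrightarrow> \<bar>z\<bar> \<le> W \<longrightarrow> \<bar>scaled_hermite a (Suc j) z\<bar> \<le> C1 * W ^ Suc j"
      by (elim exE conjE)
    from less[OF \<open>j < k\<close>] obtain C0 where C0: "0 \<le> C0"
      and C0': "\<forall>a z W. 0 \<le> a \<longrightarrow> a \<le> 1 \<longrightarrow> 1 \<le> W \<longrightarrow> \<bar>z\<bar> \<le> W \<longrightarrow> \<bar>scaled_hermite a j z\<bar> \<le> C0 * W ^ j"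
      by (elim exE conjE)
    show ?thesis
    proof (intro exI[of _ "C1 + real (Suc j) * C0"] conjI allI impI)
      fix a z W :: real assume a: "0 \<le> a" "a \<le> 1" "1 \<le> W" "\<bar>z\<bar> \<le> W"
      have "\<bar>scaled_hermite a k z\<bar> \<le> \<bar>z\<bar> * \<bar>scaled_hermite a (Suc j) z\<bar> + a * real (Suc j) * \<bar>scaled_hermite a j z\<bar>"
        unfolding 3 scaled_hermite.simps(3)
        using abs_triangle_ineq4[of "z * scaled_hermite a (Suc j) z" "a * real (Suc j) * scaled_hermite a j z"] a
        by (simp only: abs_mult abs_of_nonneg abs_of_nat)
      also have "\<dots> \<le> W * (C1 * W ^ Suc j) + 1 * real (Suc j) * (C0 * W ^ j)"
        using a C0 C1 by (intro add_mono mult_mono C0'[rule_format] C1'[rule_format]) auto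
      also have "W ^ j \<le> W ^ k" using a 3 by (intro power_increasing) auto
      then have "W * (C1 * W ^ Suc j) + 1 * real (Suc j) * (C0 * W ^ j) \<le> W * (C1 * W ^ Suc j) + 1 * real (Suc j) * (C0 * W ^ k)"
        using C0 by (intro add_left_mono mult_left_mono) auto
      also have "\<dots> = (C1 + real (Suc j) * C0) * W ^ k"
        by (simp add: 3 algebra_simps)
      finally show "\<bar>scaled_hermite a k z\<bar> \<le> (C1 + real (Suc j) * C0) * W ^ k" .
    qed (use C0 C1 in auto)
  qed (auto intro!: exI[of _ 1])
qed

lemma continuous_on_scaled_hermite [continuous_intros]:
  "continuous_on S f \<Longrightarrow> continuous_on S (\<lambda>x. scaled_hermite a k (f x))"
proof -
  have "continuous_on UNIV (scaled_hermite a k)"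
    by (intro continuous_at_imp_continuous_on ballI DERIV_isCont[OF has_real_derivative_scaled_hermite])
  then show "continuous_on S f \<Longrightarrow> continuous_on S (\<lambda>x. scaled_hermite a k (f x))"
    by (rule continuous_on_compose2) auto
qed

lemma borel_measurable_scaled_hermite [measurable]:
  assumes [measurable]: "f \<in> borel_measurable N" "g \<in> borel_measurable N"
  shows "(\<lambda>x. scaled_hermite (f x) k (g x)) \<in> borel_measurable N"
proof (induction k rule: less_induct)
  case (less k)
  consider "k = 0" | "k = 1" | j where "k = Suc (Suc j)"
    by (metis One_nat_def not0_implies_Suc)
  then show ?case
  proof cases
    case (3 j)
    then have [measurable]: "(\<lambda>x. scaled_hermite (f x) (Suc j) (g x)) \<in> borel_measurable N" "(\<lambda>x. scaled_hermite (f x) j (g x)) \<in> borel_measurable N"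
      using less[of "Suc j"] less[of j] by auto
    show ?thesis unfolding 3 scaled_hermite.simps by measurable
  qed auto
qed

text \<open>The \<open>k\<close>-th derivative of the Gaussian in Poisson's integral for the heat kernel at time \<open>t\<close>, where
\<open>\<tau> = tanh t\<close> and both variables are divided by \<open>\<surd>\<tau>\<close>.\<close>

definition riesz_integrand :: "nat \<Rightarrow> real \<Rightarrow> real \<Rightarrow> real \<Rightarrow> real \<Rightarrow> real" where
  "riesz_integrand k \<tau> U V s =
     scaled_hermite ((1 - \<tau>)\<^sup>2 / 2) k ((1 - \<tau>\<^sup>2) / 2 * (V * s) - (1 - \<tau>)\<^sup>2 / 2 * U) *
     exp ((1 - \<tau>\<^sup>2) / 2 * (U * V * s) - (1 + \<tau>\<^sup>2) / 4 * (U\<^sup>2 + V\<^sup>2))"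

text \<open>The exponent is \<open>- Q / 4\<close> with \<open>Q = (U\<^sup>2 + V\<^sup>2 - 2 U V s) + \<tau>\<^sup>2 (U\<^sup>2 + V\<^sup>2 + 2 U V s)\<close>, and the argument of the
polynomial, like the linear factors that differentiation creates, is at most \<open>2 (1 + Q)\<close>. So half of the
exponential absorbs the polynomial, uniformly in \<open>\<tau>\<close>, and the second part of \<open>Q\<close> may be dropped.\<close>

lemma gaussian_family_riesz_integrand:
  "\<exists>C\<ge>0. \<forall>\<tau>. 0 < \<tau> \<longrightarrow> \<tau> < 1 \<longrightarrow> gaussian_family C (riesz_integrand k \<tau>) \<and> gaussian_family C (\<lambda>U V. riesz_integrand k \<tau> V U)"
proof -
  obtain C where C: "0 \<le> C" "\<And>a z W. 0 \<le> a \<Longrightarrow> a \<le> 1 \<Longrightarrow> 1 \<le> W \<Longrightarrow> \<bar>z\<bar> \<le> W \<Longrightarrow> \<bar>scaled_hermite a k z\<bar> \<le> C * W ^ k"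
    using scaled_hermite_bound[of k] by blast
  obtain C' where C': "0 \<le> C'" "\<And>a z W. 0 \<le> a \<Longrightarrow> a \<le> 1 \<Longrightarrow> 1 \<le> W \<Longrightarrow> \<bar>z\<bar> \<le> W \<Longrightarrow> \<bar>scaled_hermite a (k - 1) z\<bar> \<le> C' * W ^ (k - 1)"
    using scaled_hermite_bound[of "k - 1"] by blast
  define n where "n = real (8 * (k + 1))"
  define K where "K = (2 * n) ^ (k + 1)"
  have n: "1 \<le> n" by (simp add: n_def)
  define C1 where "C1 = real k * C' + C"
  have C1: "0 \<le> C1" "C \<le> C1" using C C' by (auto simp: C1_def)
  have absorb: "(2 * (1 + Q)) ^ (k + 1) * exp (- (Q / 4)) \<le> K * exp (- (Q / 8))" if "0 \<le> Q" for Q :: real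
  proof -
    have "(1 + Q) / n \<le> 1 + Q / n" using that n by (simp add: field_simps)
    also have "\<dots> \<le> exp (Q / n)" by (rule exp_ge_add_one_self)
    finally have "1 + Q \<le> n * exp (Q / n)" using n by (simp add: field_simps)
    then have "(2 * (1 + Q)) ^ (k + 1) \<le> (2 * (n * exp (Q / n))) ^ (k + 1)"
      using that by (intro power_mono) auto
    also have "\<dots> = K * exp (Q / n) ^ (k + 1)" unfolding K_def by (simp only: power_mult_distrib mult.assoc)
    also have "exp (Q / n) ^ (k + 1) = exp (Q / 8)"
      unfolding exp_of_nat_mult[symmetric] by (simp add: n_def field_simps)
    finally have "(2 * (1 + Q)) ^ (k + 1) * exp (- (Q / 4)) \<le> K * exp (Q / 8) * exp (- (Q / 4))"
      by (intro mult_right_mono) auto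
    also have "\<dots> = K * exp (- (Q / 8))"
      unfolding mult.assoc exp_add[symmetric] by simp
    finally show ?thesis .
  qed
  have main: "\<bar>riesz_integrand k \<tau> U V s\<bar> \<le> C1 * K * gaussian_factor U V s"
      "\<exists>d. ((\<lambda>x. riesz_integrand k \<tau> U x s) has_real_derivative d) (at V) \<and> \<bar>d\<bar> \<le> C1 * K * gaussian_factor U V s"
      "\<exists>d. ((\<lambda>x. riesz_integrand k \<tau> x V s) has_real_derivative d) (at U) \<and> \<bar>d\<bar> \<le> C1 * K * gaussian_factor U V s"
    if t: "0 < \<tau>" "\<tau> < 1" and UV: "0 < U" "0 < V" and s: "-1 \<le> s" "s \<le> 1" for \<tau> U V s
  proof -
    define A B where "A = (1 - \<tau>)\<^sup>2 / 2" and "B = (1 - \<tau>\<^sup>2) / 2"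
    \<comment> \<open>The quadratic forms of the two Gaussians; the exponent of the integrand is \<open>- Q / 4\<close>.\<close>
    define q q' where "q = (U - V)\<^sup>2 + 2 * U * V * (1 - s)" and "q' = (U - V)\<^sup>2 + 2 * U * V * (1 + s)"
    define Q where "Q = \<tau>\<^sup>2 * q' + q"
    define z where "z = B * (V * s) - A * U"
    define y where "y = B * (U * s) - (1 + \<tau>\<^sup>2) / 2 * V"
    define y' where "y' = B * (V * s) - (1 + \<tau>\<^sup>2) / 2 * U"
    have tt: "0 \<le> \<tau>\<^sup>2" "\<tau>\<^sup>2 \<le> 1" using t by (auto simp: power_le_one)
    have A: "0 \<le> A" "A \<le> 1" using t power_le_one[of "1 - \<tau>" 2] by (auto simp: A_def)
    have B: "0 \<le> B" "B \<le> 1 / 2" using tt by (auto simp: B_def)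
    have q0: "0 \<le> q" "0 \<le> q'" using UV s by (auto simp: q_def q'_def)
    have Q0: "0 \<le> Q" "q \<le> Q" using q0 tt by (auto simp: Q_def)
    have s2: "s\<^sup>2 \<le> 1" using s by (simp add: abs_square_le_1 abs_le_iff)
    have qV: "(V * s - U)\<^sup>2 \<le> q"
    proof -
      have "q - (V * s - U)\<^sup>2 = V\<^sup>2 * (1 - s\<^sup>2)" by (simp add: q_def power2_eq_square algebra_simps)
      moreover have "0 \<le> V\<^sup>2 * (1 - s\<^sup>2)" using s2 by simp
      ultimately show ?thesis by linarith
    qed
    have qU: "(U * s - V)\<^sup>2 \<le> q"
    proof -
      have "q - (U * s - V)\<^sup>2 = U\<^sup>2 * (1 - s\<^sup>2)" by (simp add: q_def power2_eq_square algebra_simps)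
      moreover have "0 \<le> U\<^sup>2 * (1 - s\<^sup>2)" using s2 by simp
      ultimately show ?thesis by linarith
    qed
    have tUV: "\<tau>\<^sup>2 * (U\<^sup>2 + V\<^sup>2) \<le> Q / 2"
    proof -
      have "\<tau>\<^sup>2 * (U\<^sup>2 + V\<^sup>2) = (\<tau>\<^sup>2 * q' + \<tau>\<^sup>2 * q) / 2"
        by (simp add: q_def q'_def power2_eq_square algebra_simps)
      moreover have "\<tau>\<^sup>2 * q \<le> q" using tt q0 by (simp add: mult_left_le_one_le)
      ultimately show ?thesis by (simp add: Q_def)
    qed
    \<comment> \<open>\<open>B * x\<close> is controlled by the root of \<open>q\<close>, while \<open>\<tau> X\<close> needs the second part of \<open>Q\<close>, which carries the factor \<open>\<tau>\<^sup>2\<close>.\<close>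
    have small: "\<bar>B * x + r * X\<bar> \<le> 2 * (1 + Q)" if x: "x\<^sup>2 \<le> q" and r: "\<bar>r\<bar> \<le> \<tau>" and X: "X = U \<or> X = V" for x r X
    proof -
      have "r\<^sup>2 * X\<^sup>2 \<le> \<tau>\<^sup>2 * X\<^sup>2"
        using r t by (intro mult_right_mono) (auto simp: abs_le_square_iff[symmetric])
      also have "\<dots> \<le> \<tau>\<^sup>2 * (U\<^sup>2 + V\<^sup>2)" using X tt by (intro mult_left_mono) auto
      also have "\<dots> \<le> Q / 2" by (rule tUV)
      finally have rX: "(r * X)\<^sup>2 \<le> Q / 2" by (simp add: power_mult_distrib)
      have "(B * x)\<^sup>2 \<le> 1 * q"
        unfolding power_mult_distrib using B x q0 power_mono[OF B(2) B(1), of 2]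
        by (intro mult_mono) (auto simp: power2_eq_square)
      then have Bx: "(B * x)\<^sup>2 \<le> Q" using Q0 by linarith
      have *: "\<bar>w\<bar> \<le> (1 + w\<^sup>2) / 2" for w :: real
        using zero_le_power2[of "1 - \<bar>w\<bar>"] by (simp add: power2_eq_square algebra_simps)
      have "\<bar>B * x + r * X\<bar> \<le> (1 + (B * x)\<^sup>2) / 2 + (1 + (r * X)\<^sup>2) / 2"
        using abs_triangle_ineq[of "B * x" "r * X"] *[of "B * x"] *[of "r * X"] by linarith
      also have "\<dots> \<le> (1 + Q) / 2 + (1 + Q / 2) / 2"
        using Bx rX by (intro add_mono divide_right_mono) auto
      also have "\<dots> \<le> 2 * (1 + Q)" using Q0(1) by (simp add: field_simps)
      finally show ?thesis .
    qed
    have z: "\<bar>z\<bar> \<le> 2 * (1 + Q)"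
    proof -
      have "z = B * (V * s - U) + (\<tau> * (1 - \<tau>)) * U"
        by (simp add: z_def A_def B_def power2_eq_square field_simps)
      moreover have "\<bar>\<tau> * (1 - \<tau>)\<bar> \<le> \<tau>" using t by (simp add: abs_mult mult_left_le)
      ultimately show ?thesis using small[OF qV, of "\<tau> * (1 - \<tau>)" U] by simp
    qed
    have r2: "\<bar>- (\<tau>\<^sup>2)\<bar> \<le> \<tau>" using t by (simp add: power2_eq_square mult_left_le)
    have y: "\<bar>y\<bar> \<le> 2 * (1 + Q)"
    proof -
      have "y = B * (U * s - V) + (- (\<tau>\<^sup>2)) * V"
        by (simp add: y_def B_def field_simps)
      then show ?thesis using small[OF qU r2, of V] by simp
    qed
    have y': "\<bar>y'\<bar> \<le> 2 * (1 + Q)"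
    proof -
      have "y' = B * (V * s - U) + (- (\<tau>\<^sup>2)) * U"
        by (simp add: y'_def B_def field_simps)
      then show ?thesis using small[OF qV r2, of U] by simp
    qed
    define W where "W = 2 * (1 + Q)"
    have W: "1 \<le> W" using Q0 by (simp add: W_def)
    have expo: "(1 - \<tau>\<^sup>2) / 2 * (U * V * s) - (1 + \<tau>\<^sup>2) / 4 * (U\<^sup>2 + V\<^sup>2) = - (Q / 4)"
      by (simp add: Q_def q_def q'_def power2_eq_square field_simps)
    have expoB: "B * (U * V * s) - (1 + \<tau>\<^sup>2) / 4 * (U\<^sup>2 + V\<^sup>2) = - (Q / 4)"
      unfolding B_def by (rule expo)
    have fin: "X * exp (- (Q / 4)) \<le> C1 * K * gaussian_factor U V s" if "X \<le> C1 * W ^ (k + 1)" for X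
    proof -
      have "X * exp (- (Q / 4)) \<le> C1 * (W ^ (k + 1) * exp (- (Q / 4)))"
        using that by (simp add: mult.assoc[symmetric] mult_right_mono)
      also have "\<dots> \<le> C1 * (K * exp (- (Q / 8)))"
        unfolding W_def using C1 Q0 by (intro mult_left_mono absorb)
      also have "\<dots> \<le> C1 * (K * gaussian_factor U V s)"
        using C1 Q0 n unfolding gaussian_factor_def q_def[symmetric] by (intro mult_left_mono) (auto simp: K_def)
      finally show ?thesis by (simp add: mult.assoc)
    qed
    let ?P = "scaled_hermite A k z" and ?P' = "real k * scaled_hermite A (k - 1) z"
    have P: "\<bar>?P\<bar> \<le> C * W ^ k" using C(2)[OF A W] z by (simp add: W_def)
    have P': "\<bar>?P'\<bar> \<le> real k * C' * W ^ k"
    proof -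
      have "\<bar>scaled_hermite A (k - 1) z\<bar> \<le> C' * W ^ (k - 1)" using C'(2)[OF A W] z by (simp add: W_def)
      also have "\<dots> \<le> C' * W ^ k" using C' W by (intro mult_left_mono power_increasing) auto
      finally show ?thesis by (simp add: abs_mult mult.assoc mult_left_mono)
    qed
    have P'': "\<bar>?P'\<bar> \<le> real k * C' * W ^ (k + 1)"
    proof -
      have "W ^ k \<le> W ^ (k + 1)" using W by (intro power_increasing) auto
      then show ?thesis using P' C' by (meson mult_left_mono order_trans mult_nonneg_nonneg of_nat_0_le_iff)
    qed
    have f_eq: "riesz_integrand k \<tau> U V s = ?P * exp (- (Q / 4))"
      unfolding riesz_integrand_def expo unfolding A_def[symmetric] B_def[symmetric] z_def ..
    show "\<bar>riesz_integrand k \<tau> U V s\<bar> \<le> C1 * K * gaussian_factor U V s"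
    proof -
      have "\<bar>?P\<bar> \<le> C1 * W ^ (k + 1)"
        using P C C1 W by (elim order_trans) (intro mult_mono power_increasing, auto)
      then show ?thesis unfolding f_eq abs_mult abs_exp_cancel by (rule fin)
    qed
    have Dbound: "\<bar>?P' * c + ?P * w\<bar> \<le> C1 * W ^ (k + 1)" if "\<bar>c\<bar> \<le> 1" "\<bar>w\<bar> \<le> W" for c w
    proof -
      have "\<bar>?P' * c + ?P * w\<bar> \<le> \<bar>?P'\<bar> * \<bar>c\<bar> + \<bar>?P\<bar> * \<bar>w\<bar>"
        unfolding abs_mult[symmetric] by (rule abs_triangle_ineq)
      also have "\<dots> \<le> (real k * C' * W ^ (k + 1)) * 1 + (C * W ^ k) * W"
        using that P P'' C C' W by (intro add_mono mult_mono) auto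
      also have "\<dots> = C1 * W ^ (k + 1)" by (simp add: C1_def algebra_simps)
      finally show ?thesis .
    qed
    show "\<exists>d. ((\<lambda>x. riesz_integrand k \<tau> U x s) has_real_derivative d) (at V) \<and> \<bar>d\<bar> \<le> C1 * K * gaussian_factor U V s"
    proof (intro exI[of _ "(?P' * (B * s) + ?P * y) * exp (- (Q / 4))"] conjI)
      have 1: "((\<lambda>x. scaled_hermite A k (B * (x * s) - A * U)) has_real_derivative ?P' * (B * s)) (at V)"
        unfolding z_def
        by (rule DERIV_chain2[where f = "scaled_hermite A k" and g = "\<lambda>x. B * (x * s) - A * U"],
            rule has_real_derivative_scaled_hermite)
           (auto intro!: derivative_eq_intros)
      have 2: "((\<lambda>x. exp (B * (U * x * s) - (1 + \<tau>\<^sup>2) / 4 * (U\<^sup>2 + x\<^sup>2))) has_real_derivative exp (- (Q / 4)) * y) (at V)"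
        unfolding expo[symmetric] B_def[symmetric]
        by (auto intro!: derivative_eq_intros simp: y_def algebra_simps)
      show "((\<lambda>x. riesz_integrand k \<tau> U x s) has_real_derivative (?P' * (B * s) + ?P * y) * exp (- (Q / 4))) (at V)"
        unfolding riesz_integrand_def A_def[symmetric] B_def[symmetric]
        by (rule DERIV_cong[OF DERIV_mult[OF 1 2]]) (unfold expoB z_def, simp add: algebra_simps)
      have "\<bar>B * s\<bar> \<le> 1" using B s by (simp add: abs_mult abs_le_iff mult_le_one)
      then show "\<bar>(?P' * (B * s) + ?P * y) * exp (- (Q / 4))\<bar> \<le> C1 * K * gaussian_factor U V s"
        unfolding abs_mult[of _ "exp _"] abs_exp_cancel using y by (intro fin Dbound) (auto simp: W_def)
    qed
    show "\<exists>d. ((\<lambda>x. riesz_integrand k \<tau> x V s) has_real_derivative d) (at U) \<and> \<bar>d\<bar> \<le> C1 * K * gaussian_factor U V s"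
    proof (intro exI[of _ "(?P' * (- A) + ?P * y') * exp (- (Q / 4))"] conjI)
      have 1: "((\<lambda>x. scaled_hermite A k (B * (V * s) - A * x)) has_real_derivative ?P' * (- A)) (at U)"
        unfolding z_def
        by (rule DERIV_chain2[where f = "scaled_hermite A k" and g = "\<lambda>x. B * (V * s) - A * x"],
            rule has_real_derivative_scaled_hermite)
           (auto intro!: derivative_eq_intros)
      have 2: "((\<lambda>x. exp (B * (x * V * s) - (1 + \<tau>\<^sup>2) / 4 * (x\<^sup>2 + V\<^sup>2))) has_real_derivative exp (- (Q / 4)) * y') (at U)"
        unfolding expo[symmetric] B_def[symmetric]
        by (auto intro!: derivative_eq_intros simp: y'_def algebra_simps)
      show "((\<lambda>x. riesz_integrand k \<tau> x V s) has_real_derivative (?P' * (- A) + ?P * y') * exp (- (Q / 4))) (at U)"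
        unfolding riesz_integrand_def A_def[symmetric] B_def[symmetric]
        by (rule DERIV_cong[OF DERIV_mult[OF 1 2]]) (unfold expoB z_def, simp add: algebra_simps)
      show "\<bar>(?P' * (- A) + ?P * y') * exp (- (Q / 4))\<bar> \<le> C1 * K * gaussian_factor U V s"
        unfolding abs_mult[of _ "exp _"] abs_exp_cancel using y' A by (intro fin Dbound) (auto simp: W_def)
    qed
  qed
  have sym: "gaussian_factor U V s = gaussian_factor V U s" for U V s
    by (simp add: gaussian_factor_def power2_commute[of V U] mult_ac)
  have meas: "riesz_integrand k \<tau> U V \<in> borel_measurable borel" for \<tau> U V
    unfolding riesz_integrand_def by measurable
  have "0 \<le> C1 * K" using C1 n by (auto simp: K_def)
  moreover have "gaussian_family (C1 * K) (riesz_integrand k \<tau>)" if t: "0 < \<tau>" "\<tau> < 1" for \<tau>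
    unfolding gaussian_family_def by (intro allI impI conjI meas main(1,2)[OF t]; assumption)
  moreover have "gaussian_family (C1 * K) (\<lambda>U V. riesz_integrand k \<tau> V U)" if t: "0 < \<tau>" "\<tau> < 1" for \<tau>
    unfolding gaussian_family_def
  proof (intro allI impI conjI meas)
    fix U V s :: real assume UV: "0 < U" "0 < V" "-1 \<le> s" "s \<le> 1"
    show "\<bar>riesz_integrand k \<tau> V U s\<bar> \<le> C1 * K * gaussian_factor U V s"
      using main(1)[OF t UV(2,1,3,4)] by (simp only: sym)
    show "\<exists>d. ((\<lambda>x. riesz_integrand k \<tau> x U s) has_real_derivative d) (at V) \<and> \<bar>d\<bar> \<le> C1 * K * gaussian_factor U V s"
      using main(3)[OF t UV(2,1,3,4)] by (simp only: sym)
  qed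
  ultimately show ?thesis by blast
qed

context bessel_measure
begin

interpretation finite_measure M by (rule fin)

text \<open>Since each \<open>F (Suc p)\<close> is itself differentiable, Taylor's formula bounds the difference quotients
uniformly on the bounded support of the measure.\<close>

lemma has_real_derivative_integral:
  fixes F :: "nat \<Rightarrow> real \<Rightarrow> real \<Rightarrow> real"
  assumes deriv: "\<And>p x s. ((\<lambda>x. F p x s) has_real_derivative F (Suc p) x s) (at x)"
    and cont: "\<And>p. continuous_on UNIV (\<lambda>(x, s). F p x s)"
  shows "((\<lambda>x. LINT s|M. F p x s) has_real_derivative (LINT s|M. F (Suc p) u s)) (at u)"
proof -
  have bnd: "\<exists>C. \<forall>x s. \<bar>x - u\<bar> \<le> 1 \<longrightarrow> -1 \<le> s \<longrightarrow> s \<le> 1 \<longrightarrow> \<bar>F p x s\<bar> \<le> C" for p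
  proof -
    have "compact ((\<lambda>(x, s). F p x s) ` ({u - 1..u + 1} \<times> {-1..1}))"
      by (intro compact_continuous_image continuous_on_subset[OF cont] compact_Times) auto
    from compact_imp_bounded[OF this] obtain C where C: "\<forall>y\<in>(\<lambda>(x, s). F p x s) ` ({u - 1..u + 1} \<times> {-1..1}). norm y \<le> C"
      unfolding bounded_iff by (elim exE)
    show ?thesis
    proof (intro exI[of _ C] allI impI)
      fix x s :: real assume "\<bar>x - u\<bar> \<le> 1" "-1 \<le> s" "s \<le> 1"
      then have "(x, s) \<in> {u - 1..u + 1} \<times> {-1..1}" by (auto simp: abs_le_iff)
      from C[rule_format, OF imageI[OF this]] show "\<bar>F p x s\<bar> \<le> C" by simp
    qed
  qed
  have meas [measurable]: "F p x \<in> borel_measurable borel" for p x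
  proof (rule borel_measurable_continuous_onI)
    have "continuous_on UNIV (\<lambda>s. (\<lambda>(x, s). F p x s) (x, s))"
      by (rule continuous_on_compose2[OF cont]) (auto intro!: continuous_intros)
    then show "continuous_on UNIV (F p x)" by simp
  qed
  have int: "integrable M (F p x)" if "\<bar>x - u\<bar> \<le> 1" for p x
  proof -
    obtain C where "\<forall>x s. \<bar>x - u\<bar> \<le> 1 \<longrightarrow> -1 \<le> s \<longrightarrow> s \<le> 1 \<longrightarrow> \<bar>F p x s\<bar> \<le> C" using bnd by blast
    then show ?thesis using that by (intro integrable_bounded_on_interval[of _ C]) auto
  qed
  obtain C where C: "\<forall>x s. \<bar>x - u\<bar> \<le> 1 \<longrightarrow> -1 \<le> s \<longrightarrow> s \<le> 1 \<longrightarrow> \<bar>F (Suc (Suc p)) x s\<bar> \<le> C" using bnd by blast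
  have taylor: "\<bar>F p x s - F p u s - (x - u) * F (Suc p) u s\<bar> \<le> C * (x - u)\<^sup>2"
    if x: "\<bar>x - u\<bar> \<le> 1" and s: "-1 \<le> s" "s \<le> 1" for x s
  proof -
    have lip: "\<bar>F (Suc p) y s - F (Suc p) u s\<bar> \<le> C * \<bar>y - u\<bar>" if "y \<in> closed_segment u x" for y
    proof -
      have yx: "\<bar>z - u\<bar> \<le> 1" if "z \<in> closed_segment u y" for z
        using that \<open>y \<in> closed_segment u x\<close> x by (auto simp: closed_segment_eq_real_ivl split: if_splits)
      have "norm (F (Suc p) y s - F (Suc p) u s) \<le> C * norm (y - u)"
        by (rule field_differentiable_bound[of "closed_segment u y" "\<lambda>x. F (Suc p) x s" "\<lambda>x. F (Suc (Suc p)) x s"])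
           (use deriv yx C s in \<open>auto intro: has_field_derivative_at_within\<close>)
      then show ?thesis by simp
    qed
    have "norm ((F p x s - x * F (Suc p) u s) - (F p u s - u * F (Suc p) u s)) \<le> (C * \<bar>x - u\<bar>) * norm (x - u)"
    proof (rule field_differentiable_bound[of "closed_segment u x" "\<lambda>x. F p x s - x * F (Suc p) u s" "\<lambda>x. F (Suc p) x s - F (Suc p) u s"])
      fix y assume y: "y \<in> closed_segment u x"
      show "((\<lambda>x. F p x s - x * F (Suc p) u s) has_real_derivative F (Suc p) y s - F (Suc p) u s) (at y within closed_segment u x)"
        by (rule has_field_derivative_at_within) (auto intro!: derivative_eq_intros deriv)
      have "0 \<le> C" using C[rule_format, of u s] s by force
      have "\<bar>y - u\<bar> \<le> \<bar>x - u\<bar>" using y by (auto simp: closed_segment_eq_real_ivl split: if_splits)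
      then have "C * \<bar>y - u\<bar> \<le> C * \<bar>x - u\<bar>" using \<open>0 \<le> C\<close> by (intro mult_left_mono)
      then show "norm (F (Suc p) y s - F (Suc p) u s) \<le> C * \<bar>x - u\<bar>" using lip[OF y] by simp
    qed auto
    then show ?thesis by (simp add: power2_eq_square algebra_simps abs_mult_self_eq flip: abs_mult)
  qed
  define I where "I p x = (LINT s|M. F p x s)" for p x
  have est: "\<bar>I p x - I p u - (x - u) * I (Suc p) u\<bar> \<le> C * mass * (x - u)\<^sup>2" if x: "\<bar>x - u\<bar> \<le> 1" for x
  proof -
    have i: "integrable M (F p x)" "integrable M (F p u)" "integrable M (F (Suc p) u)" using int x by auto
    have "I p x - I p u - (x - u) * I (Suc p) u = (LINT s|M. F p x s - F p u s - (x - u) * F (Suc p) u s)"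
      unfolding I_def using i by simp
    also have "\<bar>\<dots>\<bar> \<le> (LINT s|M. C * (x - u)\<^sup>2 * 1)"
      using i taylor[OF x] by (intro abs_integral_le_on_interval) auto
    also have "\<dots> = C * mass * (x - u)\<^sup>2" by (simp add: mult_ac)
    finally show ?thesis .
  qed
  have "((\<lambda>x. (I p x - I p u) / (x - u)) \<longlongrightarrow> I (Suc p) u) (at u)"
  proof (rule LIM_zero_cancel, rule Lim_null_comparison)
    show "\<forall>\<^sub>F x in at u. norm ((I p x - I p u) / (x - u) - I (Suc p) u) \<le> \<bar>C * mass\<bar> * \<bar>x - u\<bar>"
      unfolding eventually_at
    proof (intro exI[of _ 1] conjI ballI impI)
      fix x assume x: "x \<noteq> u \<and> dist x u < 1"
      then have xu: "\<bar>x - u\<bar> \<le> 1" "x - u \<noteq> 0" by (auto simp: dist_real_def)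
      have "(I p x - I p u) / (x - u) - I (Suc p) u = (I p x - I p u - (x - u) * I (Suc p) u) / (x - u)"
        using xu by (simp add: field_simps)
      then have "norm ((I p x - I p u) / (x - u) - I (Suc p) u) = \<bar>I p x - I p u - (x - u) * I (Suc p) u\<bar> / \<bar>x - u\<bar>"
        by (simp add: abs_divide)
      also have "\<dots> \<le> (\<bar>C * mass\<bar> * \<bar>x - u\<bar>\<^sup>2) / \<bar>x - u\<bar>"
      proof (intro divide_right_mono)
        have "C * mass * (x - u)\<^sup>2 \<le> \<bar>C * mass\<bar> * \<bar>x - u\<bar>\<^sup>2"
          unfolding power2_abs by (intro mult_right_mono abs_ge_self zero_le_power2)
        with est[OF xu(1)] show "\<bar>I p x - I p u - (x - u) * I (Suc p) u\<bar> \<le> \<bar>C * mass\<bar> * \<bar>x - u\<bar>\<^sup>2"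
          by (rule order_trans)
      qed simp
      also have "\<dots> = \<bar>C * mass\<bar> * \<bar>x - u\<bar>" using xu unfolding power2_eq_square by (simp del: abs_mult_self_eq)
      finally show "norm ((I p x - I p u) / (x - u) - I (Suc p) u) \<le> \<bar>C * mass\<bar> * \<bar>x - u\<bar>" .
    qed auto
    have "((\<lambda>x. \<bar>C * mass\<bar> * \<bar>x - u\<bar>) \<longlongrightarrow> \<bar>C * mass\<bar> * \<bar>u - u\<bar>) (at u)"
      by (intro tendsto_intros)
    then show "((\<lambda>x. \<bar>C * mass\<bar> * \<bar>x - u\<bar>) \<longlongrightarrow> 0) (at u)" by simp
  qed
  then show ?thesis unfolding has_field_derivative_iff I_def .
qed

text \<open>The normalisation in Poisson's integral.\<close>

definition heat_constant :: real where
  "heat_constant = 1 / (2 powr (\<beta> - 1 / 2) * Gamma (\<beta> + 1 / 2) * mass)"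

text \<open>The \<open>p\<close>-th derivative in \<open>u\<close> of the heat kernel divided by the weight in \<open>u\<close>. Here \<open>b = 1 / sinh (2 t)\<close>
and \<open>a = coth (2 t) - 1\<close>; the 1 is subtracted because the weight takes part of the Gaussian in \<open>u\<close>.\<close>

definition heat_factor :: "nat \<Rightarrow> real \<Rightarrow> real \<Rightarrow> real \<Rightarrow> real" where
  "heat_factor p t v u = (let \<tau> = tanh t; a = (1 - \<tau>)\<^sup>2 / (2 * \<tau>); b = (1 - \<tau>\<^sup>2) / (2 * \<tau>) in
     heat_constant * v powr \<beta> * exp (- ((1 + \<tau>\<^sup>2) / (4 * \<tau>) * v\<^sup>2)) * b powr (\<beta> + 1 / 2) *
     (LINT s|M. scaled_hermite a p (b * v * s - a * u) * exp (b * v * s * u - a * u\<^sup>2 / 2)))"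

lemma has_real_derivative_heat_factor:
  "(heat_factor p t v has_real_derivative heat_factor (Suc p) t v u) (at u)"
proof -
  define \<tau> where "\<tau> = tanh t"
  define a b where "a = (1 - \<tau>)\<^sup>2 / (2 * \<tau>)" and "b = (1 - \<tau>\<^sup>2) / (2 * \<tau>)"
  define F where "F p x s = scaled_hermite a p (b * v * s - a * x) * exp (b * v * s * x - a * x\<^sup>2 / 2)" for p x s
  define c where "c = heat_constant * v powr \<beta> * exp (- ((1 + \<tau>\<^sup>2) / (4 * \<tau>) * v\<^sup>2)) * b powr (\<beta> + 1 / 2)"
  have hf: "heat_factor p t v = (\<lambda>x. c * (LINT s|M. F p x s))" for p
    by (simp add: heat_factor_def fun_eq_iff Let_def F_def c_def a_def b_def \<tau>_def)
  have "((\<lambda>x. LINT s|M. F p x s) has_real_derivative (LINT s|M. F (Suc p) u s)) (at u)"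
  proof (rule has_real_derivative_integral)
    fix p x s
    have 1: "((\<lambda>x. scaled_hermite a p (b * v * s - a * x)) has_real_derivative real p * scaled_hermite a (p - 1) (b * v * s - a * x) * (- a)) (at x)"
      by (rule DERIV_chain2[where f = "scaled_hermite a p", OF has_real_derivative_scaled_hermite])
         (auto intro!: derivative_eq_intros)
    have 2: "((\<lambda>x. exp (b * v * s * x - a * x\<^sup>2 / 2)) has_real_derivative exp (b * v * s * x - a * x\<^sup>2 / 2) * (b * v * s - a * x)) (at x)"
      by (auto intro!: derivative_eq_intros)
    show "((\<lambda>x. F p x s) has_real_derivative F (Suc p) x s) (at x)"
      unfolding F_def using DERIV_mult[OF 1 2] by (simp add: scaled_hermite_Suc[of a p] algebra_simps)
  next
    fix p
    show "continuous_on UNIV (\<lambda>(x, s). F p x s)"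
      unfolding F_def split_beta by (intro continuous_intros) auto
  qed
  then show ?thesis unfolding hf by (rule DERIV_cmult)
qed

text \<open>With \<open>\<tau> = tanh t\<close> one has \<open>r = ((1 - \<tau>) / (1 + \<tau>))\<^sup>2\<close> for the parameter \<open>r = exp (- 4 t)\<close>; then insert
Poisson's integral.\<close>

lemma heat_kernel1_eq:
  assumes \<nu>: "\<nu> + 1 / 2 = \<beta>" and t: "0 < t" and uv: "0 < u" "0 < v"
  shows "heat_kernel1 \<nu> t u v = laguerre_weight \<nu> u * heat_factor 0 t v u"
proof -
  define \<tau> where "\<tau> = tanh t"
  define a b where "a = (1 - \<tau>)\<^sup>2 / (2 * \<tau>)" and "b = (1 - \<tau>\<^sup>2) / (2 * \<tau>)"
  define q where "q = exp (- 2 * t)"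
  have q: "0 < q" "q < 1" using t by (auto simp: q_def)
  have tq: "\<tau> = (1 - q) / (1 + q)" by (simp add: \<tau>_def q_def tanh_real_altdef)
  have \<tau>: "0 < \<tau>" "\<tau> < 1" using q by (auto simp: tq)
  have r: "exp (- 4 * t) = q\<^sup>2" by (simp add: q_def flip: exp_of_nat_mult) 
  have q1: "1 - q \<noteq> 0" "1 + q \<noteq> 0" "1 - q\<^sup>2 \<noteq> 0" using q by (auto simp: power2_eq_1_iff)
  have fac: "1 - q\<^sup>2 = (1 - q) * (1 + q)" by (simp add: power2_eq_square algebra_simps)
  have b: "b = 2 * q / (1 - q\<^sup>2)"
    unfolding b_def tq fac using q1 by (simp add: divide_simps power2_eq_square) (simp add: algebra_simps)
  have cth: "(1 + q\<^sup>2) / (1 - q\<^sup>2) = (1 + \<tau>\<^sup>2) / (2 * \<tau>)"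
    unfolding tq fac using q1 by (simp add: divide_simps power2_eq_square) (simp add: algebra_simps)
  have b0: "0 < b" using \<tau> by (simp add: b_def power_less_one_iff)
  have a1: "1 + a = (1 + \<tau>\<^sup>2) / (2 * \<tau>)"
    using \<tau> by (simp add: a_def field_simps power2_eq_square)
  define z where "z = b * u * v"
  have z: "0 < z" using b0 uv by (simp add: z_def)
  have \<nu>1: "\<nu> + 1 = \<beta> + 1 / 2" "\<nu> = \<beta> - 1 / 2" using \<nu> by auto
  have "heat_kernel1 \<nu> t u v = b * sqrt (u * v) * exp (- (1 / 2) * ((1 + \<tau>\<^sup>2) / (2 * \<tau>)) * (u\<^sup>2 + v\<^sup>2)) * bessel_I \<nu> z"
  proof -
    have "2 * sqrt (q\<^sup>2 * u * v) / (1 - q\<^sup>2) = b * sqrt (u * v)"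
      using q by (simp add: b real_sqrt_mult)
    moreover have "2 * sqrt (q\<^sup>2) / (1 - q\<^sup>2) * u * v = z" using q by (simp add: b z_def)
    ultimately show ?thesis
      unfolding heat_kernel1_def Let_def r cth by simp
  qed
  also have "bessel_I \<nu> z = heat_constant * z powr \<nu> * (LINT s|M. exp (z * s))"
    using bessel_I_eq_laplace_transform[OF z \<nu>] unfolding heat_constant_def \<nu>1(1)[symmetric] \<nu>1(2)[symmetric]
    by simp
  also have "exp (- (1 / 2) * ((1 + \<tau>\<^sup>2) / (2 * \<tau>)) * (u\<^sup>2 + v\<^sup>2)) =
     exp (- (u\<^sup>2) / 2) * exp (- (a * u\<^sup>2 / 2)) * exp (- ((1 + \<tau>\<^sup>2) / (4 * \<tau>) * v\<^sup>2))"
    unfolding exp_add[symmetric] a1[symmetric]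
  proof (rule arg_cong[where f = exp])
    have eq: "(1 + \<tau>\<^sup>2) / (4 * \<tau>) = (1 + a) / 2" using \<tau> unfolding a1 by simp
    show "- (1 / 2) * (1 + a) * (u\<^sup>2 + v\<^sup>2) = - (u\<^sup>2) / 2 + - (a * u\<^sup>2 / 2) + - ((1 + \<tau>\<^sup>2) / (4 * \<tau>) * v\<^sup>2)"
      unfolding eq by (simp add: field_simps)
  qed
  finally have 1: "heat_kernel1 \<nu> t u v = b * sqrt (u * v) * (exp (- (u\<^sup>2) / 2) * exp (- (a * u\<^sup>2 / 2)) * exp (- ((1 + \<tau>\<^sup>2) / (4 * \<tau>) * v\<^sup>2)))
      * (heat_constant * z powr \<nu> * (LINT s|M. exp (z * s)))" .
  have pw: "b * sqrt (u * v) * z powr \<nu> = u powr \<beta> * v powr \<beta> * b powr (\<beta> + 1 / 2)"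
  proof -
    have 1: "sqrt (u * v) = u powr (1 / 2) * v powr (1 / 2)"
      using uv by (simp add: real_sqrt_mult powr_half_sqrt)
    have 2: "z powr \<nu> = b powr \<nu> * u powr \<nu> * v powr \<nu>"
      unfolding z_def using b0 uv by (simp add: powr_mult)
    have 3: "b = b powr 1" using b0 by simp
    have 4: "1 + \<nu> = \<beta> + 1 / 2" "1 / 2 + \<nu> = \<beta>" using \<nu> by auto
    have "b * sqrt (u * v) * z powr \<nu> = b powr 1 * (u powr (1 / 2) * v powr (1 / 2)) * (b powr \<nu> * u powr \<nu> * v powr \<nu>)"
      unfolding 1 2 3[symmetric] ..
    also have "\<dots> = (u powr (1 / 2) * u powr \<nu>) * (v powr (1 / 2) * v powr \<nu>) * (b powr 1 * b powr \<nu>)"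
      by (simp only: mult_ac)
    also have "\<dots> = u powr \<beta> * v powr \<beta> * b powr (\<beta> + 1 / 2)"
      unfolding powr_add[symmetric] 4 ..
    finally show ?thesis .
  qed
  have int: "exp (- (a * u\<^sup>2 / 2)) * (LINT s|M. exp (z * s)) = (LINT s|M. exp (b * v * s * u - a * u\<^sup>2 / 2))"
  proof -
    have "exp (b * v * s * u - a * u\<^sup>2 / 2) = exp (- (a * u\<^sup>2 / 2)) * exp (z * s)" for s
      unfolding exp_add[symmetric] z_def by (simp add: mult_ac)
    then show ?thesis by (simp only: integral_mult_right_zero)
  qed
  have "heat_kernel1 \<nu> t u v = exp (- (u\<^sup>2) / 2) * heat_constant * exp (- ((1 + \<tau>\<^sup>2) / (4 * \<tau>) * v\<^sup>2)) *
      (b * sqrt (u * v) * z powr \<nu>) * (exp (- (a * u\<^sup>2 / 2)) * (LINT s|M. exp (z * s)))"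
    unfolding 1 by (simp only: mult_ac)
  also have "\<dots> = laguerre_weight \<nu> u * heat_factor 0 t v u"
    unfolding pw int laguerre_weight_def heat_factor_def Let_def \<tau>_def[symmetric] a_def[symmetric] b_def[symmetric] \<nu> scaled_hermite.simps mult_1
    by (simp only: mult_ac)
  finally show ?thesis .
qed

lemma borel_measurable_heat_factor: "(\<lambda>t. heat_factor p t v u) \<in> borel_measurable borel"
proof -
  have [measurable]: "tanh \<in> borel_measurable (borel :: real measure)"
    by (intro borel_measurable_continuous_onI continuous_intros) auto
  show ?thesis
    unfolding heat_factor_def Let_def by measurable
qed

text \<open>Parabolic scaling: after dividing the variables by \<open>\<surd>\<tau>\<close>, the time enters only through bounded
coefficients and the explicit powers in front. Each derivative contributes one factor \<open>1 / \<surd>\<tau>\<close>.\<close>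

lemma heat_factor_rescaled:
  assumes \<nu>: "\<nu> + 1 / 2 = \<beta>" and t: "0 < t" and uv: "0 < u" "0 < v" 
  defines "\<tau> \<equiv> tanh t"
  shows "laguerre_weight \<nu> u * heat_factor p t v u = heat_constant * ((1 - \<tau>\<^sup>2) / 2) powr (\<beta> + 1 / 2) * (1 / sqrt \<tau>) ^ (p + 1) *
     weighted_kernel (riesz_integrand p \<tau>) (u / sqrt \<tau>) (v / sqrt \<tau>)"
proof -
  have \<tau>: "0 < \<tau>" using t by (simp add: \<tau>_def)
  define a b where "a = (1 - \<tau>)\<^sup>2 / (2 * \<tau>)" and "b = (1 - \<tau>\<^sup>2) / (2 * \<tau>)"
  define A B where "A = (1 - \<tau>)\<^sup>2 / 2" and "B = (1 - \<tau>\<^sup>2) / 2"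
  define w where "w = sqrt \<tau>"
  have w: "0 < w" "w * w = \<tau>" "w\<^sup>2 = \<tau>" using \<tau> by (auto simp: w_def)
  define U V where "U = u / w" and "V = v / w"
  have UV: "0 < U" "0 < V" using uv w by (auto simp: U_def V_def)
  have u: "u = w * U" "v = w * V" using w by (auto simp: U_def V_def)
  have \<tau>1: "\<tau> < 1" by (simp add: \<tau>_def tanh_real_lt_1)
  have ab: "a = A / w\<^sup>2" "b = B / w\<^sup>2" by (simp_all add: a_def b_def A_def B_def w)
  have "0 \<le> \<tau>\<^sup>2" "\<tau>\<^sup>2 \<le> 1" using \<tau> \<tau>1 by (auto simp: power_le_one)
  then have B0: "0 \<le> B" by (simp add: B_def)
  have herm: "scaled_hermite a p (b * v * s - a * u) = (1 / w) ^ p * scaled_hermite A p (B * (V * s) - A * U)" for s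
  proof -
    have "b * v * s - a * u = (1 / w) * (B * (V * s) - A * U)"
      unfolding ab u using w(1) by (simp add: field_simps power2_eq_square)
    moreover have "a = (1 / w)\<^sup>2 * A" unfolding ab by (simp add: power_divide)
    ultimately show ?thesis by (simp only: scaled_hermite_scale)
  qed
  have expo: "exp (- (u\<^sup>2) / 2) * exp (- ((1 + \<tau>\<^sup>2) / (4 * \<tau>) * v\<^sup>2)) * exp (b * v * s * u - a * u\<^sup>2 / 2)
      = exp (B * (U * V * s) - (1 + \<tau>\<^sup>2) / 4 * (U\<^sup>2 + V\<^sup>2))" for s
    unfolding exp_add[symmetric]
  proof (rule arg_cong[where f = exp])
    have 1: "b * v * s * u = B * (U * V * s)" unfolding ab u using w(1) by (simp add: power2_eq_square)
    have 2: "(1 + \<tau>\<^sup>2) / (4 * \<tau>) * v\<^sup>2 = (1 + \<tau>\<^sup>2) / 4 * V\<^sup>2" unfolding u power_mult_distrib w(3) using \<tau> by simp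
    have 3: "u\<^sup>2 / 2 + a * u\<^sup>2 / 2 = (1 + \<tau>\<^sup>2) / 4 * U\<^sup>2"
      unfolding u power_mult_distrib w(3) a_def using \<tau> by (simp add: field_simps power2_eq_square)
    show "- u\<^sup>2 / 2 + - ((1 + \<tau>\<^sup>2) / (4 * \<tau>) * v\<^sup>2) + (b * v * s * u - a * u\<^sup>2 / 2) = B * (U * V * s) - (1 + \<tau>\<^sup>2) / 4 * (U\<^sup>2 + V\<^sup>2)"
      unfolding 1 2 using 3 by (simp add: distrib_left)
  qed
  have pw: "u powr \<beta> * v powr \<beta> * b powr (\<beta> + 1 / 2) = (U * V) powr \<beta> * B powr (\<beta> + 1 / 2) * (1 / w)"
  proof -
    have "u powr \<beta> * v powr \<beta> * b powr (\<beta> + 1 / 2) = (U * V) powr \<beta> * B powr (\<beta> + 1 / 2) * (w powr \<beta> * w powr \<beta> / (w * w) powr (\<beta> + 1 / 2))"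
      unfolding ab u using w UV B0 by (simp add: powr_mult powr_divide power2_eq_square)
    also have "w powr \<beta> * w powr \<beta> / (w * w) powr (\<beta> + 1 / 2) = w powr (\<beta> + \<beta> - (\<beta> + 1 / 2) - (\<beta> + 1 / 2))"
    proof -
      have "w powr \<beta> * w powr \<beta> / (w * w) powr c = w powr (\<beta> + \<beta> - c - c)" for c
      proof -
        have "w powr (\<beta> + \<beta> - c - c) = w powr \<beta> * w powr \<beta> / w powr c / w powr c"
          by (simp only: powr_diff powr_add)
        then show ?thesis using w(1) by (simp add: powr_mult)
      qed
      then show ?thesis .
    qed
    also have "\<beta> + \<beta> - (\<beta> + 1 / 2) - (\<beta> + 1 / 2) = - 1" by simp
    also have "w powr - 1 = 1 / w" using w(1) by (simp add: powr_minus divide_inverse)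
    finally show ?thesis .
  qed
  have "laguerre_weight \<nu> u * heat_factor p t v u = heat_constant * (u powr \<beta> * v powr \<beta> * b powr (\<beta> + 1 / 2)) *
      (exp (- (u\<^sup>2) / 2) * exp (- ((1 + \<tau>\<^sup>2) / (4 * \<tau>) * v\<^sup>2)) * (LINT s|M. scaled_hermite a p (b * v * s - a * u) * exp (b * v * s * u - a * u\<^sup>2 / 2)))"
  proof -
    define J where "J = (LINT s|M. scaled_hermite a p (b * v * s - a * u) * exp (b * v * s * u - a * u\<^sup>2 / 2))"
    have "laguerre_weight \<nu> u * heat_factor p t v u = (u powr \<beta> * exp (- (u\<^sup>2) / 2)) *
       (heat_constant * v powr \<beta> * exp (- ((1 + \<tau>\<^sup>2) / (4 * \<tau>) * v\<^sup>2)) * b powr (\<beta> + 1 / 2) * J)"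
      unfolding laguerre_weight_def heat_factor_def Let_def \<tau>_def[symmetric] a_def[symmetric] b_def[symmetric] \<nu> J_def ..
    then show ?thesis unfolding J_def[symmetric] by (simp only: mult_ac)
  qed
  also have "exp (- (u\<^sup>2) / 2) * exp (- ((1 + \<tau>\<^sup>2) / (4 * \<tau>) * v\<^sup>2)) * (LINT s|M. scaled_hermite a p (b * v * s - a * u) * exp (b * v * s * u - a * u\<^sup>2 / 2))
     = (LINT s|M. (1 / w) ^ p * riesz_integrand p \<tau> U V s)"
  proof -
    have "exp (- (u\<^sup>2) / 2) * exp (- ((1 + \<tau>\<^sup>2) / (4 * \<tau>) * v\<^sup>2)) * (scaled_hermite a p (b * v * s - a * u) * exp (b * v * s * u - a * u\<^sup>2 / 2))
       = (1 / w) ^ p * riesz_integrand p \<tau> U V s" for s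
      unfolding riesz_integrand_def A_def[symmetric] B_def[symmetric] expo[symmetric] herm
      by (simp only: mult_ac)
    then show ?thesis by (simp only: integral_mult_right_zero[symmetric])
  qed
  also have "\<dots> = (1 / w) ^ p * (LINT s|M. riesz_integrand p \<tau> U V s)" by simp
  finally show ?thesis
    unfolding pw weighted_kernel_def U_def[symmetric] V_def[symmetric] w_def[symmetric] B_def[symmetric] by simp
qed

end

section \<open>Size and smoothness in one and several variables\<close>

text \<open>The root of \<open>1 - tanh t\<close> keeps just enough of the exponential decay of the heat semigroup to make
the integral over large times converge, whatever the parameter.\<close>

definition time_decay :: "nat \<Rightarrow> real \<Rightarrow> real" where
  "time_decay p t = sqrt (1 - tanh t) * (1 / sqrt (tanh t)) ^ (p + 1)"

definition gauss :: "real \<Rightarrow> real \<Rightarrow> real" where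
  "gauss \<tau> x = exp (- (x\<^sup>2 / (16 * \<tau>)))"

text \<open>Collects what the estimates in several variables use about one coordinate, for a single constant in
all times: \<open>G p t v u\<close> is the \<open>p\<close>-th derivative in \<open>u\<close> of the heat kernel divided by its weight. The last two
conditions are Hoelder bounds in each of the two variables.\<close>

definition heat_derivative_family :: "real \<Rightarrow> real \<Rightarrow> (nat \<Rightarrow> real) \<Rightarrow> (nat \<Rightarrow> real \<Rightarrow> real \<Rightarrow> real \<Rightarrow> real) \<Rightarrow> bool" where
  "heat_derivative_family \<nu> \<gamma> K G \<longleftrightarrow>
     (\<forall>p. 0 \<le> K p) \<and>
     (\<forall>t>0. \<forall>u>0. \<forall>v>0. heat_kernel1 \<nu> t u v = laguerre_weight \<nu> u * G 0 t v u) \<and>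
     (\<forall>p t v u. (G p t v has_real_derivative G (Suc p) t v u) (at u)) \<and>
     (\<forall>p v u. (\<lambda>t. G p t v u) \<in> borel_measurable borel) \<and>
     (\<forall>p. \<forall>t>0. \<forall>u>0. \<forall>v>0. \<bar>laguerre_weight \<nu> u * G p t v u\<bar> \<le> K p * time_decay p t * gauss (tanh t) (u - v)) \<and>
     (\<forall>p. \<forall>t>0. \<forall>u>0. \<forall>v>0. \<forall>v'>0. \<bar>laguerre_weight \<nu> u * G p t v u - laguerre_weight \<nu> u * G p t v' u\<bar>
        \<le> K p * time_decay p t * (\<bar>v - v'\<bar> / sqrt (tanh t)) powr \<gamma> * (gauss (tanh t) (u - v) + gauss (tanh t) (u - v'))) \<and>
     (\<forall>p. \<forall>t>0. \<forall>u>0. \<forall>v>0. \<forall>v'>0. \<bar>laguerre_weight \<nu> v * G p t u v - laguerre_weight \<nu> v' * G p t u v'\<bar>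
        \<le> K p * time_decay p t * (\<bar>v - v'\<bar> / sqrt (tanh t)) powr \<gamma> * (gauss (tanh t) (u - v) + gauss (tanh t) (u - v')))"

text \<open>The rescaled kernel is estimated by \<open>weighted_kernel_estimates\<close>. For smoothness in the variable that is
differentiated, the roles of the two arguments of the integrand are exchanged, which is why the
transposed integrands were estimated as well.\<close>

lemma (in bessel_measure) heat_factor_estimates:
  assumes \<nu>: "\<nu> + 1 / 2 = \<beta>" and g: "0 < \<gamma>" "\<gamma> \<le> 1" "\<beta> = 0 \<or> \<gamma> \<le> \<beta>"
  shows "\<exists>K\<ge>0. \<forall>t>0.
     (\<forall>u>0. \<forall>v>0. \<bar>laguerre_weight \<nu> u * heat_factor p t v u\<bar> \<le> K * time_decay p t * gauss (tanh t) (u - v)) \<and>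
     (\<forall>u>0. \<forall>v>0. \<forall>v'>0. \<bar>laguerre_weight \<nu> u * heat_factor p t v u - laguerre_weight \<nu> u * heat_factor p t v' u\<bar>
        \<le> K * time_decay p t * (\<bar>v - v'\<bar> / sqrt (tanh t)) powr \<gamma> * (gauss (tanh t) (u - v) + gauss (tanh t) (u - v'))) \<and>
     (\<forall>u>0. \<forall>v>0. \<forall>v'>0. \<bar>laguerre_weight \<nu> v * heat_factor p t u v - laguerre_weight \<nu> v' * heat_factor p t u v'\<bar>
        \<le> K * time_decay p t * (\<bar>v - v'\<bar> / sqrt (tanh t)) powr \<gamma> * (gauss (tanh t) (u - v) + gauss (tanh t) (u - v')))"
proof -
  obtain C where C: "0 \<le> C" and fam: "\<forall>\<tau>. 0 < \<tau> \<longrightarrow> \<tau> < 1 \<longrightarrow> gaussian_family C (riesz_integrand p \<tau>) \<and> gaussian_family C (\<lambda>U V. riesz_integrand p \<tau> V U)"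
    using gaussian_family_riesz_integrand[of p] by (elim exE conjE)
  obtain K where K: "0 \<le> K" and est: "\<forall>f. gaussian_family C f \<longrightarrow>
    (\<forall>U>0. \<forall>V>0. \<bar>weighted_kernel f U V\<bar> \<le> K * exp (- ((U - V)\<^sup>2 / 16))) \<and>
    (\<forall>U>0. \<forall>V>0. \<forall>V'>0. \<bar>weighted_kernel f U V - weighted_kernel f U V'\<bar>
        \<le> K * \<bar>V - V'\<bar> powr \<gamma> * (exp (- ((U - V)\<^sup>2 / 16)) + exp (- ((U - V')\<^sup>2 / 16))))"
    using weighted_kernel_estimates[OF g C] by (elim exE conjE)
  define H where "H = \<bar>heat_constant\<bar> * K"
  have H: "0 \<le> H" using K by (simp add: H_def)
  have main: "\<bar>laguerre_weight \<nu> u * heat_factor p t v u\<bar> \<le> H * time_decay p t * gauss (tanh t) (u - v)"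
    "\<bar>laguerre_weight \<nu> u * heat_factor p t v u - laguerre_weight \<nu> u * heat_factor p t v' u\<bar>
        \<le> H * time_decay p t * (\<bar>v - v'\<bar> / sqrt (tanh t)) powr \<gamma> * (gauss (tanh t) (u - v) + gauss (tanh t) (u - v'))"
    "\<bar>laguerre_weight \<nu> v * heat_factor p t u v - laguerre_weight \<nu> v' * heat_factor p t u v'\<bar>
        \<le> H * time_decay p t * (\<bar>v - v'\<bar> / sqrt (tanh t)) powr \<gamma> * (gauss (tanh t) (u - v) + gauss (tanh t) (u - v'))"
    if t: "0 < t" and uv: "0 < u" "0 < v" "0 < v'" for t u v v'
  proof -
    define \<tau> where "\<tau> = tanh t"
    have \<tau>: "0 < \<tau>" "\<tau> < 1" using t by (auto simp: \<tau>_def tanh_real_lt_1)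
    define w where "w = sqrt \<tau>"
    have w: "0 < w" "w\<^sup>2 = \<tau>" using \<tau> by (auto simp: w_def)
    define X where "X = heat_constant * ((1 - \<tau>\<^sup>2) / 2) powr (\<beta> + 1 / 2) * (1 / w) ^ (p + 1)"
    have X: "\<bar>X\<bar> * K \<le> H * time_decay p t"
    proof -
      have "((1 - \<tau>\<^sup>2) / 2) powr (\<beta> + 1 / 2) \<le> (1 - \<tau>) powr (\<beta> + 1 / 2)"
      proof (rule powr_mono2)
        show "0 \<le> (1 - \<tau>\<^sup>2) / 2" using \<tau> by (simp add: power_le_one)
        have "(1 - \<tau>\<^sup>2) / 2 = (1 - \<tau>) * ((1 + \<tau>) / 2)" by (simp add: power2_eq_square algebra_simps diff_divide_distrib add_divide_distrib)
        also have "\<dots> \<le> (1 - \<tau>) * 1" using \<tau> by (intro mult_left_mono) auto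
        finally show "(1 - \<tau>\<^sup>2) / 2 \<le> 1 - \<tau>" by simp
      qed (use beta in auto)
      also have "\<dots> \<le> (1 - \<tau>) powr (1 / 2)" using \<tau> beta by (intro powr_mono') auto
      also have "\<dots> = sqrt (1 - \<tau>)" using \<tau> by (simp add: powr_half_sqrt)
      finally have le: "((1 - \<tau>\<^sup>2) / 2) powr (\<beta> + 1 / 2) \<le> sqrt (1 - \<tau>)" .
      have "\<bar>X\<bar> * K = H * (((1 - \<tau>\<^sup>2) / 2) powr (\<beta> + 1 / 2) * (1 / w) ^ (p + 1))"
        using w by (simp add: X_def H_def abs_mult power_abs)
      also have "\<dots> \<le> H * (sqrt (1 - \<tau>) * (1 / w) ^ (p + 1))"
        using H w le by (intro mult_left_mono mult_right_mono) auto
      finally show ?thesis by (simp only: time_decay_def \<tau>_def[symmetric] w_def[symmetric])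
    qed
    have re: "laguerre_weight \<nu> x * heat_factor p t y x = X * weighted_kernel (riesz_integrand p \<tau>) (x / w) (y / w)" if "0 < x" "0 < y" for x y
      using heat_factor_rescaled[OF \<nu> t that, of p] unfolding X_def \<tau>_def[symmetric] w_def[symmetric] by simp
    have ga: "exp (- ((x / w - y / w)\<^sup>2 / 16)) = gauss \<tau> (x - y)" for x y
      unfolding gauss_def diff_divide_distrib[symmetric] power_divide w(2) by simp
    have pos: "0 < x / w" if "0 < x" for x using that w by simp
    have f1: "gaussian_family C (riesz_integrand p \<tau>)" and f2: "gaussian_family C (\<lambda>U V. riesz_integrand p \<tau> V U)"
      using fam \<tau> by auto
    note e1 = est[rule_format, OF f1] and e2 = est[rule_format, OF f2]
    have swap: "weighted_kernel (\<lambda>U V. riesz_integrand p \<tau> V U) x y = weighted_kernel (riesz_integrand p \<tau>) y x" for x y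
      by (simp add: weighted_kernel_def mult.commute)
    have absdiff: "\<bar>v / w - v' / w\<bar> = \<bar>v - v'\<bar> / w"
      unfolding diff_divide_distrib[symmetric] using w by (simp add: abs_divide)
    have gn: "0 \<le> gauss \<tau> x" for x by (simp add: gauss_def)
    have fin: "\<bar>X * Y\<bar> \<le> H * time_decay p t * Z" if "\<bar>Y\<bar> \<le> K * Z" "0 \<le> Z" for Y Z
    proof -
      have "\<bar>X * Y\<bar> \<le> \<bar>X\<bar> * (K * Z)" unfolding abs_mult using that by (intro mult_left_mono) auto
      also have "\<dots> = \<bar>X\<bar> * K * Z" by simp
      also have "\<dots> \<le> H * time_decay p t * Z" using X that by (intro mult_right_mono)
      finally show ?thesis .
    qed
    show "\<bar>laguerre_weight \<nu> u * heat_factor p t v u\<bar> \<le> H * time_decay p t * gauss (tanh t) (u - v)"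
      unfolding re[OF uv(1,2)] \<tau>_def[symmetric]
      by (rule fin) (use conjunct1[OF e1, rule_format, OF pos[OF uv(1)] pos[OF uv(2)]] ga gn in auto)
    let ?Z = "(\<bar>v - v'\<bar> / w) powr \<gamma> * (gauss \<tau> (u - v) + gauss \<tau> (u - v'))"
    have Z: "0 \<le> ?Z" using gn by (intro mult_nonneg_nonneg add_nonneg_nonneg) auto
    have "\<bar>X * (weighted_kernel (riesz_integrand p \<tau>) (u / w) (v / w) - weighted_kernel (riesz_integrand p \<tau>) (u / w) (v' / w))\<bar> \<le> H * time_decay p t * ?Z"
      using conjunct2[OF e1, rule_format, OF pos[OF uv(1)] pos[OF uv(2)] pos[OF uv(3)]] Z
      by (intro fin) (simp_all only: ga absdiff mult.assoc)
    then show "\<bar>laguerre_weight \<nu> u * heat_factor p t v u - laguerre_weight \<nu> u * heat_factor p t v' u\<bar>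
        \<le> H * time_decay p t * (\<bar>v - v'\<bar> / sqrt (tanh t)) powr \<gamma> * (gauss (tanh t) (u - v) + gauss (tanh t) (u - v'))"
      unfolding re[OF uv(1,2)] re[OF uv(1,3)] \<tau>_def[symmetric] w_def[symmetric] by (simp only: right_diff_distrib mult.assoc)
    have "\<bar>X * (weighted_kernel (riesz_integrand p \<tau>) (v / w) (u / w) - weighted_kernel (riesz_integrand p \<tau>) (v' / w) (u / w))\<bar> \<le> H * time_decay p t * ?Z"
      using conjunct2[OF e2, rule_format, OF pos[OF uv(1)] pos[OF uv(2)] pos[OF uv(3)]] Z
      by (intro fin) (simp_all only: ga absdiff mult.assoc swap)
    then show "\<bar>laguerre_weight \<nu> v * heat_factor p t u v - laguerre_weight \<nu> v' * heat_factor p t u v'\<bar>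
        \<le> H * time_decay p t * (\<bar>v - v'\<bar> / sqrt (tanh t)) powr \<gamma> * (gauss (tanh t) (u - v) + gauss (tanh t) (u - v'))"
      unfolding re[OF uv(2,1)] re[OF uv(3,1)] \<tau>_def[symmetric] w_def[symmetric] by (simp only: right_diff_distrib mult.assoc)
  qed
  show ?thesis
    by (intro exI[of _ H] conjI H allI impI main; assumption)
qed

lemma heat_derivative_family_exists:
  assumes \<nu>: "- 1 / 2 \<le> \<nu>" and g: "0 < \<gamma>" "\<gamma> \<le> 1" "\<nu> = - 1 / 2 \<or> \<gamma> \<le> \<nu> + 1 / 2"
  shows "\<exists>K G. heat_derivative_family \<nu> \<gamma> K G"
proof -
  obtain M where M: "bessel_measure (\<nu> + 1 / 2) M" using bessel_measure_exists[of "\<nu> + 1 / 2"] \<nu> by auto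
  interpret bessel_measure "\<nu> + 1 / 2" M by (rule M)
  have g': "\<nu> + 1 / 2 = 0 \<or> \<gamma> \<le> \<nu> + 1 / 2" using g(3) by auto
  define P where "P p c \<longleftrightarrow> 0 \<le> c \<and> (\<forall>t>0.
     (\<forall>u>0. \<forall>v>0. \<bar>laguerre_weight \<nu> u * heat_factor p t v u\<bar> \<le> c * time_decay p t * gauss (tanh t) (u - v)) \<and>
     (\<forall>u>0. \<forall>v>0. \<forall>v'>0. \<bar>laguerre_weight \<nu> u * heat_factor p t v u - laguerre_weight \<nu> u * heat_factor p t v' u\<bar>
        \<le> c * time_decay p t * (\<bar>v - v'\<bar> / sqrt (tanh t)) powr \<gamma> * (gauss (tanh t) (u - v) + gauss (tanh t) (u - v'))) \<and>
     (\<forall>u>0. \<forall>v>0. \<forall>v'>0. \<bar>laguerre_weight \<nu> v * heat_factor p t u v - laguerre_weight \<nu> v' * heat_factor p t u v'\<bar>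
        \<le> c * time_decay p t * (\<bar>v - v'\<bar> / sqrt (tanh t)) powr \<gamma> * (gauss (tanh t) (u - v) + gauss (tanh t) (u - v'))))" for p c
  have "\<forall>p. \<exists>c. P p c"
    unfolding P_def by (intro allI heat_factor_estimates[OF refl g(1,2) g'])
  then obtain K where "\<forall>p. P p (K p)" using choice[of P] by auto
  note K = this[unfolded P_def]
  show ?thesis
    unfolding heat_derivative_family_def
  proof (intro exI[of _ K] exI[of _ heat_factor] conjI)
    show "\<forall>p. 0 \<le> K p" using K by (intro allI) (erule allE, erule conjunct1)
    show "\<forall>t>0. \<forall>u>0. \<forall>v>0. heat_kernel1 \<nu> t u v = laguerre_weight \<nu> u * heat_factor 0 t v u"
      using heat_kernel1_eq[OF refl] by simp
    show "\<forall>p t v u. (heat_factor p t v has_real_derivative heat_factor (Suc p) t v u) (at u)"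
      using has_real_derivative_heat_factor by simp
    show "\<forall>p v u. (\<lambda>t. heat_factor p t v u) \<in> borel_measurable borel"
      using borel_measurable_heat_factor by simp
  qed (use K in simp_all)
qed

text \<open>Telescoping: change one factor at a time.\<close>

lemma abs_prod_diff_le:
  fixes a b M :: "'i \<Rightarrow> real"
  assumes "finite I" and "\<And>i. i \<in> I \<Longrightarrow> \<bar>a i\<bar> \<le> M i" "\<And>i. i \<in> I \<Longrightarrow> \<bar>b i\<bar> \<le> M i"
    and "\<And>i. i \<in> I \<Longrightarrow> \<bar>a i - b i\<bar> \<le> \<theta> * M i" and \<theta>: "0 \<le> \<theta>"
  shows "\<bar>prod a I - prod b I\<bar> \<le> real (card I) * (\<theta> * prod M I)"
  using assms(1-4)
proof (induction I rule: finite_induct)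
  case (insert j I)
  have M0: "0 \<le> M i" if "i \<in> insert j I" for i using insert.prems(1)[OF that] by linarith
  have a: "\<bar>prod a I\<bar> \<le> prod M I" unfolding abs_prod using insert.prems by (intro prod_mono) auto
  have IH: "\<bar>prod a I - prod b I\<bar> \<le> real (card I) * (\<theta> * prod M I)" using insert by auto
  have "prod a (insert j I) - prod b (insert j I) = (a j - b j) * prod a I + b j * (prod a I - prod b I)"
    using insert.hyps by (simp add: algebra_simps)
  then have "\<bar>prod a (insert j I) - prod b (insert j I)\<bar> \<le> \<bar>a j - b j\<bar> * \<bar>prod a I\<bar> + \<bar>b j\<bar> * \<bar>prod a I - prod b I\<bar>"
    using abs_triangle_ineq[of "(a j - b j) * prod a I" "b j * (prod a I - prod b I)"] by (simp add: abs_mult)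
  also have "\<dots> \<le> (\<theta> * M j) * prod M I + M j * (real (card I) * (\<theta> * prod M I))"
    using insert.prems M0 \<theta> by (intro add_mono mult_mono a IH prod_nonneg) auto
  also have "\<dots> = real (card (insert j I)) * (\<theta> * prod M (insert j I))"
    using insert.hyps by (simp add: algebra_simps)
  finally show ?case .
qed simp

lemma prod_gauss: "(\<Prod>i\<in>UNIV. gauss \<tau> (z $ i)) = exp (- ((norm (z :: real ^ 'n))\<^sup>2 / (16 * \<tau>)))"
proof -
  have "(norm z)\<^sup>2 = (\<Sum>i\<in>UNIV. (z $ i)\<^sup>2)"
    unfolding power2_norm_eq_inner inner_vec_def by (simp add: power2_eq_square)
  then show ?thesis
    by (simp add: gauss_def exp_sum[symmetric] sum_negf sum_divide_distrib)
qed

text \<open>The Hoelder bounds contain Gaussians centred at both points, and multiplying them out mixes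
coordinates of \<open>y\<close> and \<open>y'\<close>. The mixed point stays as close to \<open>y\<close> as \<open>y'\<close> is, so that its distance from
\<open>x\<close> is still at least half of that of \<open>y\<close>.\<close>

lemma product_holder:
  fixes r :: "'n::finite \<Rightarrow> real \<Rightarrow> real \<Rightarrow> real" and x y y' :: "real ^ 'n"
  assumes \<tau>: "0 < \<tau>" and L: "\<And>i. 0 \<le> L i" and \<gamma>: "0 < \<gamma>"
    and size: "\<And>i u v. 0 < u \<Longrightarrow> 0 < v \<Longrightarrow> \<bar>r i u v\<bar> \<le> L i * gauss \<tau> (u - v)"
    and hol: "\<And>i u v v'. 0 < u \<Longrightarrow> 0 < v \<Longrightarrow> 0 < v' \<Longrightarrow>
      \<bar>r i u v - r i u v'\<bar> \<le> L i * (\<bar>v - v'\<bar> / sqrt \<tau>) powr \<gamma> * (gauss \<tau> (u - v) + gauss \<tau> (u - v'))"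
    and R: "x \<in> Rplus" "y \<in> Rplus" "y' \<in> Rplus"
    and near: "norm (y - y') \<le> norm (x - y) / 2"
  shows "\<bar>(\<Prod>i\<in>UNIV. r i (x $ i) (y $ i)) - (\<Prod>i\<in>UNIV. r i (x $ i) (y' $ i))\<bar>
     \<le> real CARD('n) * 2 ^ CARD('n) * (\<Prod>i\<in>UNIV. L i) * ((norm (y - y') / sqrt \<tau>) powr \<gamma> * exp (- ((norm (x - y))\<^sup>2 / (64 * \<tau>))))"
proof -
  let ?g = "gauss \<tau>"
  define \<theta> where "\<theta> = (norm (y - y') / sqrt \<tau>) powr \<gamma>"
  have pos: "0 < x $ i" "0 < y $ i" "0 < y' $ i" for i using R by (auto simp: Rplus_def)
  have g0: "0 \<le> ?g z" for z by (simp add: gauss_def)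
  define M where "M i = L i * (?g (x $ i - y $ i) + ?g (x $ i - y' $ i))" for i
  have M1: "L i * ?g (x $ i - y $ i) \<le> M i" "L i * ?g (x $ i - y' $ i) \<le> M i" for i
    unfolding M_def using L[of i] g0 by (intro mult_left_mono; simp)+
  have telescope: "\<bar>(\<Prod>i\<in>UNIV. r i (x $ i) (y $ i)) - (\<Prod>i\<in>UNIV. r i (x $ i) (y' $ i))\<bar> \<le> real CARD('n) * (\<theta> * prod M UNIV)"
  proof (rule abs_prod_diff_le)
    fix i
    show "\<bar>r i (x $ i) (y $ i)\<bar> \<le> M i" "\<bar>r i (x $ i) (y' $ i)\<bar> \<le> M i"
      using order_trans[OF size[OF pos(1) pos(2)] M1(1)] order_trans[OF size[OF pos(1) pos(3)] M1(2)] by auto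
    have "\<bar>r i (x $ i) (y $ i) - r i (x $ i) (y' $ i)\<bar> \<le> L i * (\<bar>y $ i - y' $ i\<bar> / sqrt \<tau>) powr \<gamma> * (?g (x $ i - y $ i) + ?g (x $ i - y' $ i))"
      by (intro hol pos)
    also have "\<dots> = (\<bar>y $ i - y' $ i\<bar> / sqrt \<tau>) powr \<gamma> * M i" by (simp add: M_def mult_ac)
    also have "\<dots> \<le> \<theta> * M i"
    proof (rule mult_right_mono)
      have "\<bar>y $ i - y' $ i\<bar> \<le> norm (y - y')" using component_le_norm_cart[of "y - y'" i] by simp
      then show "(\<bar>y $ i - y' $ i\<bar> / sqrt \<tau>) powr \<gamma> \<le> \<theta>"
        unfolding \<theta>_def using \<tau> \<gamma> by (intro powr_mono2 divide_right_mono) auto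
      show "0 \<le> M i" unfolding M_def using L[of i] g0 by (intro mult_nonneg_nonneg add_nonneg_nonneg)
    qed
    finally show "\<bar>r i (x $ i) (y $ i) - r i (x $ i) (y' $ i)\<bar> \<le> \<theta> * M i" .
  qed (auto simp: \<theta>_def)
  have prodM: "prod M UNIV \<le> (\<Prod>i\<in>UNIV. L i) * (2 ^ CARD('n) * exp (- ((norm (x - y))\<^sup>2 / (64 * \<tau>))))"
  proof -
    \<comment> \<open>In every coordinate keep the nearer of the two points.\<close>
    define z :: "real ^ 'n" where "z = (\<chi> i. if \<bar>x $ i - y $ i\<bar> \<le> \<bar>x $ i - y' $ i\<bar> then y $ i else y' $ i)"
    have gz: "?g (x $ i - y $ i) + ?g (x $ i - y' $ i) \<le> 2 * ?g ((x - z) $ i)" for i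
    proof -
      have mono: "?g b \<le> ?g a" if "\<bar>a\<bar> \<le> \<bar>b\<bar>" for a b
        using that \<tau> unfolding gauss_def abs_le_square_iff by (simp add: divide_right_mono)
      show ?thesis
        using mono[of "x $ i - y $ i" "x $ i - y' $ i"] mono[of "x $ i - y' $ i" "x $ i - y $ i"] by (auto simp: z_def)
    qed
    have "prod M UNIV = (\<Prod>i\<in>UNIV. L i) * (\<Prod>i\<in>UNIV. ?g (x $ i - y $ i) + ?g (x $ i - y' $ i))"
      unfolding M_def by (rule prod.distrib)
    also have "\<dots> \<le> (\<Prod>i\<in>UNIV. L i) * (\<Prod>i\<in>UNIV. 2 * ?g ((x - z) $ i))"
      using L g0 gz by (intro mult_left_mono prod_mono prod_nonneg conjI add_nonneg_nonneg) auto
    also have "(\<Prod>i\<in>(UNIV :: 'n set). 2 * ?g ((x - z) $ i)) = 2 ^ CARD('n) * (\<Prod>i\<in>UNIV. ?g ((x - z) $ i))"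
      by (simp add: prod.distrib)
    also have "\<dots> = 2 ^ CARD('n) * exp (- ((norm (x - z))\<^sup>2 / (16 * \<tau>)))" by (simp only: prod_gauss)
    also have "(\<Prod>i\<in>UNIV. L i) * \<dots> \<le> (\<Prod>i\<in>UNIV. L i) * (2 ^ CARD('n) * exp (- ((norm (x - y))\<^sup>2 / (64 * \<tau>))))"
    proof (intro mult_left_mono prod_nonneg)
      have "norm (z - y) \<le> norm (y - y')"
        by (rule norm_le_componentwise_cart) (auto simp: z_def)
      then have "norm (x - y) / 2 \<le> norm (x - z)"
        using near norm_triangle_ineq[of "x - z" "z - y"] by simp
      then have "(norm (x - y) / 2)\<^sup>2 \<le> (norm (x - z))\<^sup>2" by (intro power_mono) auto
      then have "(norm (x - y))\<^sup>2 / (64 * \<tau>) \<le> (norm (x - z))\<^sup>2 / (16 * \<tau>)"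
        using \<tau> by (simp add: power_divide field_simps)
      then show "exp (- ((norm (x - z))\<^sup>2 / (16 * \<tau>))) \<le> exp (- ((norm (x - y))\<^sup>2 / (64 * \<tau>)))" by simp
    qed (use L in auto)
    finally show ?thesis .
  qed
  have "0 \<le> \<theta>" by (simp add: \<theta>_def)
  then have "real CARD('n) * (\<theta> * prod M UNIV) \<le>
      real CARD('n) * (\<theta> * ((\<Prod>i\<in>UNIV. L i) * (2 ^ CARD('n) * exp (- ((norm (x - y))\<^sup>2 / (64 * \<tau>))))))"
    by (intro mult_left_mono prodM) auto
  from order_trans[OF telescope this] show ?thesis
    unfolding \<theta>_def by (simp only: mult_ac)
qed

section \<open>Integration over time\<close>

lemma powr_times_exp_bounded:
  assumes "0 \<le> p" "0 < c"
  shows "\<exists>K>0. \<forall>x\<ge>0. (1 + x) powr p * exp (- (c * x)) \<le> (K :: real)"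
proof (intro exI[of _ "((p + c) / c) powr p"] conjI allI impI)
  define m where "m = (p + c) / c"
  have m: "1 \<le> m" "p \<le> c * m" using assms by (auto simp: m_def field_simps)
  fix x :: real assume x: "0 \<le> x"
  have "(1 + x) / m \<le> 1 + x / m" using m by (simp add: add_divide_distrib)
  also have "\<dots> \<le> exp (x / m)" by (rule exp_ge_add_one_self)
  finally have "1 + x \<le> m * exp (x / m)" using m by (simp add: pos_divide_le_eq mult.commute)
  then have "(1 + x) powr p \<le> (m * exp (x / m)) powr p" using x assms by (intro powr_mono2) auto
  also have "\<dots> = m powr p * exp (p * x / m)" using m by (simp add: powr_mult exp_powr_real mult.commute)
  also have "\<dots> \<le> m powr p * exp (c * x)"
  proof -
    have "p * x \<le> c * m * x" using m(2) x by (rule mult_right_mono)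
    then have "p * x / m \<le> c * x" using m by (simp add: pos_divide_le_eq mult_ac)
    then show ?thesis by (intro mult_left_mono) auto
  qed
  finally have "(1 + x) powr p * exp (- (c * x)) \<le> m powr p * exp (c * x) * exp (- (c * x))"
    by (intro mult_right_mono) auto
  also have "\<dots> = m powr p" by (simp add: exp_minus)
  finally show "(1 + x) powr p * exp (- (c * x)) \<le> ((p + c) / c) powr p" by (simp add: m_def)
next
  have "(p + c) / c \<noteq> 0" using assms by simp
  then show "0 < ((p + c) / c) powr p" by simp
qed

text \<open>Split the integral at \<open>t = d\<^sup>2\<close>: before that time the exponential beats the singular power and leaves a
constant, afterwards the power is integrable. The function \<open>h\<close> is a majorant rather than the
integrand itself, so that domination also proves integrability.\<close>

lemma time_integral_majorant:
  fixes p c :: real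
  assumes p: "0 < p" and c: "0 < c"
  shows "\<exists>C\<ge>0. \<forall>d>0. \<exists>h. integrable lborel h \<and> (\<forall>t>0. t powr (- p - 1) * exp (- (c * (d\<^sup>2 / t))) \<le> h t) \<and>
     (\<forall>t. 0 \<le> h t) \<and> integral\<^sup>L lborel h \<le> C * d powr (- (2 * p))"
proof -
  have "0 \<le> p + 1" using p by simp
  from powr_times_exp_bounded[OF this c]
  obtain K where K: "0 < K" and KK: "\<forall>x\<ge>0. (1 + x) powr (p + 1) * exp (- (c * x)) \<le> K" by (elim exE conjE)
  show ?thesis
  proof (intro exI[of _ "K + 1 / p"] conjI allI impI)
    show "0 \<le> K + 1 / p" using K p by simp
    fix d :: real assume d: "0 < d"
    define A where "A = K * (d\<^sup>2) powr (- (p + 1))"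
    have A: "0 \<le> A" using K by (simp add: A_def)
    define h where "h t = indicator {0..d\<^sup>2} t * A + indicator {d\<^sup>2..} t * t powr (- p - 1)" for t :: real
    have h1: "has_bochner_integral lborel (\<lambda>t. indicator {0..d\<^sup>2} t * A) (d\<^sup>2 * A)"
      by (simp add: has_bochner_integral_iff)
    have h2: "has_bochner_integral lborel (\<lambda>t. indicator {d\<^sup>2..} t * t powr (- p - 1)) (- ((d\<^sup>2) powr (- p - 1 + 1)) / (- p - 1 + 1))"
      by (rule has_bochner_integral_lborel_nonneg[OF has_integral_powr_to_inf]) (use p d in auto)
    have h: "has_bochner_integral lborel h (d\<^sup>2 * A + (- ((d\<^sup>2) powr (- p - 1 + 1)) / (- p - 1 + 1)))"
      unfolding h_def by (rule has_bochner_integral_add[OF h1 h2])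
    have dp: "(d\<^sup>2) powr (- p) = d powr (- (2 * p))"
      using d by (simp add: powr_powr flip: powr_numeral)
    have "d\<^sup>2 * (d\<^sup>2) powr (- (p + 1)) = (d\<^sup>2) powr (1 + - (p + 1))"
      unfolding powr_add using d by simp
    also have "1 + - (p + 1) = - p" by simp
    finally have dA: "d\<^sup>2 * A = K * d powr (- (2 * p))" unfolding dp A_def by simp
    show "\<exists>h. integrable lborel h \<and> (\<forall>t>0. t powr (- p - 1) * exp (- (c * (d\<^sup>2 / t))) \<le> h t) \<and>
     (\<forall>t. 0 \<le> h t) \<and> integral\<^sup>L lborel h \<le> (K + 1 / p) * d powr (- (2 * p))"
    proof (intro exI[of _ h] conjI allI impI)
      show "integrable lborel h" using h by (simp add: has_bochner_integral_iff)
      have "integral\<^sup>L lborel h = K * d powr (- (2 * p)) + d powr (- (2 * p)) / p"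
        using h p dp dA by (simp add: has_bochner_integral_iff)
      then show "integral\<^sup>L lborel h \<le> (K + 1 / p) * d powr (- (2 * p))"
        by (simp add: distrib_right)
      show "0 \<le> h t" for t using A by (simp add: h_def)
      fix t :: real assume t: "0 < t"
      show "t powr (- p - 1) * exp (- (c * (d\<^sup>2 / t))) \<le> h t"
      proof (cases "t \<le> d\<^sup>2")
        case True
        define x where "x = d\<^sup>2 / t"
        have x: "0 < x" using t d by (simp add: x_def)
        have "x powr (p + 1) * exp (- (c * x)) \<le> (1 + x) powr (p + 1) * exp (- (c * x))"
          using x p by (intro mult_right_mono powr_mono2) auto
        also have "\<dots> \<le> K" using KK x by simp
        finally have "x powr (- (p + 1)) * (x powr (p + 1) * exp (- (c * x))) \<le> x powr (- (p + 1)) * K"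
          by (intro mult_left_mono) auto
        moreover have "x powr (- (p + 1)) * x powr (p + 1) = 1"
          unfolding powr_add[symmetric] using x by simp
        ultimately have "exp (- (c * x)) \<le> x powr (- (p + 1)) * K" by (simp add: mult.assoc[symmetric])
        also have "x powr (- (p + 1)) = (d\<^sup>2) powr (- (p + 1)) * t powr (p + 1)"
        proof -
          have "(d\<^sup>2 / t) powr (- r) = (d\<^sup>2) powr (- r) * t powr r" for r
            using t d by (simp add: powr_divide powr_minus_divide)
          then show ?thesis unfolding x_def .
        qed
        finally have "t powr (- p - 1) * exp (- (c * x)) \<le> t powr (- p - 1) * ((d\<^sup>2) powr (- (p + 1)) * t powr (p + 1) * K)"
          by (intro mult_left_mono) auto
        also have "\<dots> = (t powr (- p - 1) * t powr (p + 1)) * A" by (simp add: A_def)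
        also have "t powr (- p - 1) * t powr (p + 1) = 1"
          unfolding powr_add[symmetric] using t by simp
        also have "1 * A \<le> h t" using True t by (simp add: h_def)
        finally show ?thesis by (simp add: x_def)
      next
        case False
        have "t powr (- p - 1) * exp (- (c * (d\<^sup>2 / t))) \<le> t powr (- p - 1) * 1"
          using t c by (intro mult_left_mono) auto
        then show ?thesis using False A t by (simp add: h_def)
      qed
    qed
  qed
qed

text \<open>These comparisons replace \<open>tanh t\<close> by \<open>t\<close> for small and control \<open>1 - tanh t\<close> for large times.\<close>

lemma tanh_bounds:
  assumes t: "0 < (t :: real)"
  shows "t / (1 + t) \<le> tanh t" "tanh t \<le> 2 * t" "1 - tanh t \<le> 2 * exp (- (2 * t))"
proof -
  define q where "q = exp (- 2 * t)"
  have q: "0 < q" "q < 1" using t by (auto simp: q_def)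
  have tq: "tanh t = (1 - q) / (1 + q)" by (simp add: q_def tanh_real_altdef)
  have "1 + 2 * t \<le> exp (2 * t)" by (rule exp_ge_add_one_self)
  then have "q * (1 + 2 * t) \<le> q * exp (2 * t)" using q by (intro mult_left_mono) auto
  also have "q * exp (2 * t) = 1" unfolding q_def exp_add[symmetric] by simp
  finally have "t * (1 + q) \<le> (1 - q) * (1 + t)" by (simp add: algebra_simps)
  then show "t / (1 + t) \<le> tanh t"
    unfolding tq using q t by (simp add: frac_le_eq divide_le_0_iff algebra_simps)
  have "(1 - q) / (1 + q) \<le> (1 - q) / 1" using q by (intro divide_left_mono) auto
  also have "\<dots> \<le> 2 * t" using exp_ge_add_one_self[of "- 2 * t"] by (simp add: q_def)
  finally show "tanh t \<le> 2 * t" unfolding tq .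
  have "1 - tanh t = 2 * q / (1 + q)" unfolding tq using q by (simp add: field_simps)
  also have "\<dots> \<le> 2 * q / 1" using q by (intro divide_left_mono) auto
  finally show "1 - tanh t \<le> 2 * exp (- (2 * t))" by (simp add: q_def)
qed

text \<open>Near \<open>t = 0\<close> the powers of \<open>tanh t\<close> behave like powers of \<open>t\<close>, those from the \<open>m\<close> derivatives cancelling
\<open>t^(m/2)\<close>. For large \<open>t\<close> the decay \<open>exp (- t)\<close> beats every power; it is present since there is at least one
coordinate.\<close>

lemma time_weight_bound:
  fixes m n :: nat and \<gamma> :: real
  assumes n: "1 \<le> n" and \<gamma>: "0 \<le> \<gamma>"
  shows "\<exists>C\<ge>0. \<forall>t>0. t powr (real m / 2) * (sqrt (1 - tanh t) ^ n * (1 / sqrt (tanh t)) ^ (m + n) * (1 / sqrt (tanh t)) powr \<gamma>) / t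
     \<le> C * t powr (- ((real n + \<gamma>) / 2) - 1)"
proof -
  define e where "e = (real (m + n) + \<gamma>) / 2"
  have e: "0 \<le> e" using \<gamma> by (simp add: e_def)
  from powr_times_exp_bounded[OF e, of 1]
  obtain K where K: "0 < K" and KK: "\<forall>x\<ge>0. (1 + x) powr e * exp (- (1 * x)) \<le> K" by (auto elim!: exE conjE)
  show ?thesis
  proof (intro exI[of _ "sqrt 2 * K"] conjI allI impI)
    fix t :: real assume t: "0 < t"
    define \<tau> where "\<tau> = tanh t"
    have \<tau>: "0 < \<tau>" "\<tau> < 1" using t by (auto simp: \<tau>_def tanh_real_lt_1)
    have "(1 / sqrt \<tau>) ^ (m + n) * (1 / sqrt \<tau>) powr \<gamma> = (1 / sqrt \<tau>) powr (real (m + n) + \<gamma>)"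
      using \<tau> by (simp add: powr_add powr_realpow del: of_nat_add)
    also have "\<dots> = (1 / \<tau>) powr e"
    proof -
      have "1 / sqrt \<tau> = (1 / \<tau>) powr (1 / 2)" using \<tau> by (simp add: powr_half_sqrt real_sqrt_divide)
      then show ?thesis unfolding e_def by (simp add: powr_powr)
    qed
    also have "\<dots> \<le> ((1 + t) / t) powr e"
    proof (rule powr_mono2[OF e])
      have "1 / \<tau> \<le> 1 / (t / (1 + t))" using tanh_bounds(1)[OF t] t \<tau> unfolding \<tau>_def[symmetric]
        by (intro divide_left_mono) auto
      then show "1 / \<tau> \<le> (1 + t) / t" by simp
    qed (use \<tau> in auto)
    also have "\<dots> = (1 + t) powr e * t powr (- e)"
    proof -
      have "((1 + t) / t) powr e = (1 + t) powr e / t powr e" by (rule powr_divide)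
      then show ?thesis by (simp add: powr_minus divide_inverse)
    qed
    finally have 1: "(1 / sqrt \<tau>) ^ (m + n) * (1 / sqrt \<tau>) powr \<gamma> \<le> (1 + t) powr e * t powr (- e)" .
    have 2: "sqrt (1 - \<tau>) ^ n \<le> sqrt 2 * exp (- t)"
    proof -
      have "sqrt (1 - \<tau>) ^ n \<le> sqrt (1 - \<tau>) ^ 1" using \<tau> n by (intro power_decreasing) auto
      also have "\<dots> \<le> sqrt (2 * exp (- (2 * t)))" using tanh_bounds(3)[OF t] by (simp add: \<tau>_def)
      also have "\<dots> = sqrt 2 * exp (- t)"
      proof -
        have "exp (- (2 * t)) = (exp (- t))\<^sup>2" by (simp flip: exp_of_nat_mult)
        then show ?thesis by (simp add: real_sqrt_mult)
      qed
      finally show ?thesis .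
    qed
    have "sqrt (1 - \<tau>) ^ n * ((1 / sqrt \<tau>) ^ (m + n) * (1 / sqrt \<tau>) powr \<gamma>) \<le> (sqrt 2 * exp (- t)) * ((1 + t) powr e * t powr (- e))"
      by (rule mult_mono[OF 2 1]) (use \<tau> in auto)
    then have "sqrt (1 - \<tau>) ^ n * (1 / sqrt \<tau>) ^ (m + n) * (1 / sqrt \<tau>) powr \<gamma> \<le> (sqrt 2 * exp (- t)) * ((1 + t) powr e * t powr (- e))"
      by (simp only: mult.assoc)
    also have "\<dots> = sqrt 2 * ((1 + t) powr e * exp (- (1 * t))) * t powr (- e)" by simp
    also have "\<dots> \<le> sqrt 2 * K * t powr (- e)"
      using KK t by (intro mult_right_mono mult_left_mono) auto
    finally have "t powr (real m / 2) * (sqrt (1 - \<tau>) ^ n * (1 / sqrt \<tau>) ^ (m + n) * (1 / sqrt \<tau>) powr \<gamma>) / t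
       \<le> t powr (real m / 2) * (sqrt 2 * K * t powr (- e)) / t"
      using t by (intro divide_right_mono mult_left_mono) auto
    also have "\<dots> = sqrt 2 * K * (t powr (real m / 2) * t powr (- e) * t powr (- 1))"
    proof -
      have "t powr (- 1) = 1 / t" using t by (simp add: powr_minus divide_inverse)
      then show ?thesis by (simp only:) simp
    qed
    also have "t powr (real m / 2) * t powr (- e) * t powr (- 1) = t powr (- ((real n + \<gamma>) / 2) - 1)"
      unfolding powr_add[symmetric] by (simp add: e_def add_divide_distrib)
    finally show "t powr (real m / 2) * (sqrt (1 - tanh t) ^ n * (1 / sqrt (tanh t)) ^ (m + n) * (1 / sqrt (tanh t)) powr \<gamma>) / t
       \<le> sqrt 2 * K * t powr (- ((real n + \<gamma>) / 2) - 1)" unfolding \<tau>_def .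
  qed (use K in auto)
qed

text \<open>The integral over time that defines the Riesz kernel, for any function of time with the size of the
heat kernel or of its differences; \<open>\<gamma> = 0\<close> gives the size and \<open>\<gamma> > 0\<close> the smoothness
estimate.\<close>

lemma subordinated_integral_bound:
  fixes m n :: nat and \<gamma> :: real
  assumes n: "1 \<le> n" and \<gamma>: "0 \<le> \<gamma>"
  shows "\<exists>C\<ge>0. \<forall>d>0. \<forall>A\<ge>0. \<forall>F. F \<in> borel_measurable borel \<longrightarrow>
     (\<forall>t>0. \<bar>F t\<bar> \<le> A * (sqrt (1 - tanh t) ^ n * (1 / sqrt (tanh t)) ^ (m + n) * (1 / sqrt (tanh t)) powr \<gamma>) * exp (- (d\<^sup>2 / (64 * tanh t)))) \<longrightarrow>
     set_integrable lebesgue {0<..} (\<lambda>t. t powr (real m / 2) * F t / t) \<and>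
     \<bar>LINT t:{0<..}|lebesgue. t powr (real m / 2) * F t / t\<bar> \<le> C * (A * d powr (- (real n + \<gamma>)))"
proof -
  define p where "p = (real n + \<gamma>) / 2"
  have p: "0 < p" using n \<gamma> by (simp add: p_def)
  obtain C1 where C1: "0 \<le> C1" and w: "\<forall>t>0. t powr (real m / 2) * (sqrt (1 - tanh t) ^ n * (1 / sqrt (tanh t)) ^ (m + n) * (1 / sqrt (tanh t)) powr \<gamma>) / t
     \<le> C1 * t powr (- p - 1)"
    using time_weight_bound[OF n \<gamma>, of m] unfolding p_def by (elim exE conjE)
  obtain C2 where C2: "0 \<le> C2" and maj: "\<forall>d>0. \<exists>h. integrable lborel h \<and> (\<forall>t>0. t powr (- p - 1) * exp (- (1 / 128 * (d\<^sup>2 / t))) \<le> h t) \<and>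
     (\<forall>t. 0 \<le> h t) \<and> integral\<^sup>L lborel h \<le> C2 * d powr (- (2 * p))"
    using time_integral_majorant[OF p, of "1 / 128"] by (auto elim!: exE conjE)
  have main: "set_integrable lebesgue {0<..} (\<lambda>t. t powr (real m / 2) * F t / t) \<and>
     \<bar>LINT t:{0<..}|lebesgue. t powr (real m / 2) * F t / t\<bar> \<le> C1 * C2 * (A * d powr (- (real n + \<gamma>)))"
    if d: "0 < d" and A: "0 \<le> A" and [measurable]: "F \<in> borel_measurable borel"
      and F: "\<forall>t>0. \<bar>F t\<bar> \<le> A * (sqrt (1 - tanh t) ^ n * (1 / sqrt (tanh t)) ^ (m + n) * (1 / sqrt (tanh t)) powr \<gamma>) * exp (- (d\<^sup>2 / (64 * tanh t)))"
    for d A :: real and F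
  proof -
    obtain h where h: "integrable lborel h" "\<forall>t>0. t powr (- p - 1) * exp (- (1 / 128 * (d\<^sup>2 / t))) \<le> h t"
      "\<forall>t. 0 \<le> h t" "integral\<^sup>L lborel h \<le> C2 * d powr (- (2 * p))"
      using maj d by blast
    define \<Phi> where "\<Phi> t = indicator {0<..} t *\<^sub>R (t powr (real m / 2) * F t / t)" for t
    have [measurable]: "\<Phi> \<in> borel_measurable borel" unfolding \<Phi>_def by measurable
    have le: "\<bar>\<Phi> t\<bar> \<le> C1 * A * h t" for t
    proof (cases "0 < t")
      case t: True
      define W where "W = sqrt (1 - tanh t) ^ n * (1 / sqrt (tanh t)) ^ (m + n) * (1 / sqrt (tanh t)) powr \<gamma>"
      have th: "0 < tanh t" using t by simp
      have "exp (- (d\<^sup>2 / (64 * tanh t))) \<le> exp (- (1 / 128 * (d\<^sup>2 / t)))"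
      proof -
        have "d\<^sup>2 / (128 * t) \<le> d\<^sup>2 / (64 * tanh t)"
          using tanh_bounds(2)[OF t] t th by (intro divide_left_mono) auto
        then show ?thesis by simp
      qed
      then have FW: "\<bar>F t\<bar> \<le> A * W * exp (- (1 / 128 * (d\<^sup>2 / t)))"
        using F[rule_format, OF t] A t th unfolding W_def[symmetric]
        by (elim order_trans) (intro mult_left_mono, auto simp: W_def tanh_real_lt_1 less_imp_le)
      have "\<bar>\<Phi> t\<bar> = t powr (real m / 2) * \<bar>F t\<bar> / t" using t by (simp add: \<Phi>_def abs_mult)
      also have "\<dots> \<le> t powr (real m / 2) * (A * W * exp (- (1 / 128 * (d\<^sup>2 / t)))) / t"
        using t FW by (intro divide_right_mono mult_left_mono) auto
      also have "\<dots> = A * exp (- (1 / 128 * (d\<^sup>2 / t))) * (t powr (real m / 2) * W / t)" by simp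
      also have "\<dots> \<le> A * exp (- (1 / 128 * (d\<^sup>2 / t))) * (C1 * t powr (- p - 1))"
        using w[rule_format, OF t] A unfolding W_def by (intro mult_left_mono) auto
      also have "\<dots> = C1 * A * (t powr (- p - 1) * exp (- (1 / 128 * (d\<^sup>2 / t))))" by simp
      also have "\<dots> \<le> C1 * A * h t" using h(2) t C1 A by (intro mult_left_mono) auto
      finally show ?thesis .
    qed (use h(3) C1 A in \<open>simp add: \<Phi>_def\<close>)
    have hi: "integrable lborel (\<lambda>t. C1 * A * h t)" using h(1) by simp
    have int: "integrable lborel \<Phi>"
      by (rule Bochner_Integration.integrable_bound[OF hi]) (use le h(3) C1 A in \<open>auto intro!: AE_I2\<close>)
    have intl: "integrable lebesgue \<Phi>" "integral\<^sup>L lebesgue \<Phi> = integral\<^sup>L lborel \<Phi>"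
      using int by (simp_all add: integrable_completion integral_completion)
    have si: "set_integrable lebesgue {0<..} (\<lambda>t. t powr (real m / 2) * F t / t)"
      unfolding set_integrable_def \<Phi>_def[symmetric] by (rule intl(1))
    have "\<bar>LINT t:{0<..}|lebesgue. t powr (real m / 2) * F t / t\<bar> = \<bar>integral\<^sup>L lborel \<Phi>\<bar>"
      unfolding set_lebesgue_integral_def \<Phi>_def[symmetric] intl(2) ..
    also have "\<dots> \<le> (LINT t|lborel. \<bar>\<Phi> t\<bar>)" by (rule integral_abs_bound)
    also have "\<dots> \<le> (LINT t|lborel. C1 * A * h t)" using int hi le by (intro integral_mono) auto
    also have "\<dots> = C1 * A * integral\<^sup>L lborel h" by simp
    also have "\<dots> \<le> C1 * A * (C2 * d powr (- (2 * p)))" using h(4) C1 A by (intro mult_left_mono) auto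
    also have "2 * p = real n + \<gamma>" by (simp add: p_def)
    also have "C1 * A * (C2 * d powr (- (real n + \<gamma>))) = C1 * C2 * (A * d powr (- (real n + \<gamma>)))" by simp
    finally show ?thesis using si by blast
  qed
  have c0: "0 \<le> C1 * C2" using C1 C2 by simp
  show ?thesis
  proof (intro exI[of _ "C1 * C2"] conjI[OF c0] allI impI)
    fix d A :: real and F
    assume "0 < d" "0 \<le> A" "F \<in> borel_measurable borel"
      "\<forall>t>0. \<bar>F t\<bar> \<le> A * (sqrt (1 - tanh t) ^ n * (1 / sqrt (tanh t)) ^ (m + n) * (1 / sqrt (tanh t)) powr \<gamma>) * exp (- (d\<^sup>2 / (64 * tanh t)))"
    then show "set_integrable lebesgue {0<..} (\<lambda>t. t powr (real m / 2) * F t / t) \<and>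
     \<bar>LINT t:{0<..}|lebesgue. t powr (real m / 2) * F t / t\<bar> \<le> C1 * C2 * (A * d powr (- (real n + \<gamma>)))"
      by (rule main)
  qed
qed

section \<open>Calderon-Zygmund estimates\<close>

lemma heat_derivative_familyD:
  assumes "heat_derivative_family \<nu> \<gamma> K G"
  shows "0 \<le> K p"
    and "0 < t \<Longrightarrow> 0 < u \<Longrightarrow> 0 < v \<Longrightarrow> heat_kernel1 \<nu> t u v = laguerre_weight \<nu> u * G 0 t v u"
    and "(G p t v has_real_derivative G (Suc p) t v u) (at u)"
    and "(\<lambda>t. G p t v u) \<in> borel_measurable borel"
    and "0 < t \<Longrightarrow> 0 < u \<Longrightarrow> 0 < v \<Longrightarrow> \<bar>laguerre_weight \<nu> u * G p t v u\<bar> \<le> K p * time_decay p t * gauss (tanh t) (u - v)"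
    and "0 < t \<Longrightarrow> 0 < u \<Longrightarrow> 0 < v \<Longrightarrow> 0 < v' \<Longrightarrow> \<bar>laguerre_weight \<nu> u * G p t v u - laguerre_weight \<nu> u * G p t v' u\<bar>
        \<le> K p * time_decay p t * (\<bar>v - v'\<bar> / sqrt (tanh t)) powr \<gamma> * (gauss (tanh t) (u - v) + gauss (tanh t) (u - v'))"
    and "0 < t \<Longrightarrow> 0 < u \<Longrightarrow> 0 < v \<Longrightarrow> 0 < v' \<Longrightarrow> \<bar>laguerre_weight \<nu> v * G p t u v - laguerre_weight \<nu> v' * G p t u v'\<bar>
        \<le> K p * time_decay p t * (\<bar>v - v'\<bar> / sqrt (tanh t)) powr \<gamma> * (gauss (tanh t) (u - v) + gauss (tanh t) (u - v'))"
  using assms unfolding heat_derivative_family_def by (elim conjE; simp only:)+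

text \<open>Coordinates with \<open>\<nu>\<^sub>j = - 1/2\<close> carry no power of the variable and put no restriction on the exponent.\<close>

lemma gamma_nu_bounds:
  fixes \<nu> :: "real ^ 'n"
  assumes \<nu>: "\<forall>j. - 1 / 2 \<le> \<nu> $ j"
  shows "0 < gamma_nu \<nu>" "gamma_nu \<nu> \<le> 1" "\<nu> $ j = - 1 / 2 \<or> gamma_nu \<nu> \<le> \<nu> $ j + 1 / 2"
proof -
  have *: "0 < gamma_nu \<nu> \<and> gamma_nu \<nu> \<le> 1 \<and> (\<forall>j. \<nu> $ j = - 1 / 2 \<or> gamma_nu \<nu> \<le> \<nu> $ j + 1 / 2)"
  proof (cases "J_nu \<nu> = {}")
    case True
    then have "gamma_nu \<nu> = 1" by (simp add: gamma_nu_def nu_min_def top_ereal_def)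
    moreover have "\<nu> $ j = - 1 / 2" for j
    proof -
      have "\<not> - 1 / 2 < \<nu> $ j" using True by (auto simp: J_nu_def)
      then show ?thesis using \<nu>[rule_format, of j] by simp
    qed
    ultimately show ?thesis by simp
  next
    case False
    define \<mu> where "\<mu> = Min ((\<lambda>j. \<nu> $ j) ` J_nu \<nu>)"
    have fin: "finite ((\<lambda>j. \<nu> $ j) ` J_nu \<nu>)" by simp
    have ne: "(\<lambda>j. \<nu> $ j) ` J_nu \<nu> \<noteq> {}" using False by simp
    obtain j0 where j0: "j0 \<in> J_nu \<nu>" "\<mu> = \<nu> $ j0"
      using Min_in[OF fin ne] unfolding \<mu>_def by auto
    have le: "\<mu> \<le> \<nu> $ j" if "j \<in> J_nu \<nu>" for j
      unfolding \<mu>_def using that fin by (intro Min_le) auto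
    have "nu_min \<nu> = ereal \<mu>"
      unfolding nu_min_def
    proof (rule antisym)
      show "(INF j\<in>J_nu \<nu>. ereal (\<nu> $ j)) \<le> ereal \<mu>" unfolding j0(2) by (rule INF_lower[OF j0(1)])
      show "ereal \<mu> \<le> (INF j\<in>J_nu \<nu>. ereal (\<nu> $ j))" by (rule INF_greatest) (simp add: le)
    qed
    then have g: "gamma_nu \<nu> = min 1 (\<mu> + 1 / 2)"
      by (simp add: gamma_nu_def min_def one_ereal_def)
    have "- 1 / 2 < \<mu>" using j0 by (simp add: J_nu_def)
    moreover have "\<nu> $ j = - 1 / 2 \<or> gamma_nu \<nu> \<le> \<nu> $ j + 1 / 2" for j
    proof (cases "j \<in> J_nu \<nu>")
      case True
      then show ?thesis using le[OF True] unfolding g by (intro disjI2) (simp add: min_le_iff_disj)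
    next
      case False
      then have "\<not> - 1 / 2 < \<nu> $ j" by (simp add: J_nu_def)
      then show ?thesis using \<nu>[rule_format, of j] by simp
    qed
    ultimately show ?thesis using g by auto
  qed
  then show "0 < gamma_nu \<nu>" "gamma_nu \<nu> \<le> 1" "\<nu> $ j = - 1 / 2 \<or> gamma_nu \<nu> \<le> \<nu> $ j + 1 / 2" by auto
qed

text \<open>Both differences are integrals over time of differences of products of one-dimensional kernels; the
second one exchanges the roles of the two variables in each factor.\<close>

theorem riesz_kernel_estimates:
  fixes \<nu> :: "real ^ 'n::{finite,linorder}" and k :: "nat ^ 'n::{finite,linorder}"
  assumes \<nu>: "\<forall>j. - 1 / 2 \<le> \<nu> $ j"
  defines "\<gamma> \<equiv> gamma_nu \<nu>"
  shows "\<exists>C\<ge>0.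
     (\<forall>x\<in>Rplus. \<forall>y\<in>Rplus. x \<noteq> y \<longrightarrow> \<bar>riesz_kernel \<nu> k x y\<bar> \<le> C * norm (x - y) powr (- real CARD('n))) \<and>
     (\<forall>x\<in>Rplus. \<forall>y\<in>Rplus. \<forall>y'\<in>Rplus. x \<noteq> y \<longrightarrow> norm (y - y') \<le> norm (x - y) / 2 \<longrightarrow>
        \<bar>riesz_kernel \<nu> k x y - riesz_kernel \<nu> k x y'\<bar> \<le> C * (norm (y - y') powr \<gamma> * norm (x - y) powr (- (real CARD('n) + \<gamma>))) \<and>
        \<bar>riesz_kernel \<nu> k y x - riesz_kernel \<nu> k y' x\<bar> \<le> C * (norm (y - y') powr \<gamma> * norm (x - y) powr (- (real CARD('n) + \<gamma>))))"
proof (cases "msize k = 0")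
  case True
  then show ?thesis by (intro exI[of _ 0]) (simp add: riesz_kernel_def)
next
  case False
  let ?n = "CARD('n)"
  note gb = gamma_nu_bounds[OF \<nu>, folded \<gamma>_def]
  have "\<forall>i. \<exists>K G. heat_derivative_family (\<nu> $ i) \<gamma> K G"
    using heat_derivative_family_exists[OF \<nu>[rule_format] gb(1,2,3)] by simp
  then have "\<forall>i. \<exists>p. heat_derivative_family (\<nu> $ i) \<gamma> (fst p) (snd p)" by simp
  from choice[OF this] obtain P where P: "\<forall>i. heat_derivative_family (\<nu> $ i) \<gamma> (fst (P i)) (snd (P i))" by (elim exE)
  define K G where "K i = fst (P i)" and "G i = snd (P i)" for i
  have fam: "heat_derivative_family (\<nu> $ i) \<gamma> (K i) (G i)" for i using P by (simp add: K_def G_def)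
  note fam' = heat_derivative_familyD[OF fam]
  define r where "r t i u v = laguerre_weight (\<nu> $ i) u * G i (k $ i) t v u" for t i u v
  define R where "R t x y = (\<Prod>i\<in>UNIV. r t i (x $ i) (y $ i))" for t and x y :: "(real, 'n) vec"
  define L where "L t i = K i (k $ i) * time_decay (k $ i) t" for t i
  have td: "0 \<le> time_decay p t" if "0 < t" for p t
    using that by (simp add: time_decay_def tanh_real_lt_1 less_imp_le)
  have L0: "0 \<le> L t i" if "0 < t" for t i unfolding L_def by (intro mult_nonneg_nonneg fam'(1) td that)
  have r_size: "\<bar>r t i u v\<bar> \<le> L t i * gauss (tanh t) (u - v)" if "0 < t" "0 < u" "0 < v" for t i u v
    unfolding r_def L_def by (intro fam'(5) that)
  have r_hol: "\<bar>r t i u v - r t i u v'\<bar> \<le> L t i * (\<bar>v - v'\<bar> / sqrt (tanh t)) powr \<gamma> * (gauss (tanh t) (u - v) + gauss (tanh t) (u - v'))"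
    if "0 < t" "0 < u" "0 < v" "0 < v'" for t i u v v'
    unfolding r_def L_def by (intro fam'(6) that)
  have r_hol': "\<bar>r t i v u - r t i v' u\<bar> \<le> L t i * (\<bar>v - v'\<bar> / sqrt (tanh t)) powr \<gamma> * (gauss (tanh t) (u - v) + gauss (tanh t) (u - v'))"
    if "0 < t" "0 < u" "0 < v" "0 < v'" for t i u v v'
    unfolding r_def L_def by (intro fam'(7) that)
  have R_eq: "delta_pow \<nu> k (\<lambda>z. heat_kernel \<nu> t z y) x = R t x y" if t: "0 < t" and xy: "x \<in> Rplus" "y \<in> Rplus" for t x y
  proof -
    have "delta_pow \<nu> k (\<lambda>z. heat_kernel \<nu> t z y) x =
      (\<Sum>a\<in>{()}. (\<Prod>i\<in>UNIV. laguerre_weight (\<nu> $ i) (x $ i) * G i (k $ i) t (y $ i) (x $ i)) *\<^sub>R (1 :: real))"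
    proof (rule delta_pow_weighted_product[where H = "\<lambda>_ i p. G i p t (y $ i)"])
      fix z :: "(real, 'n) vec" assume z: "z \<in> Rplus"
      have "heat_kernel1 (\<nu> $ i) t (z $ i) (y $ i) = laguerre_weight (\<nu> $ i) (z $ i) * G i 0 t (y $ i) (z $ i)" for i
        using fam'(2)[OF t] z xy by (simp add: Rplus_def)
      then show "heat_kernel \<nu> t z y = (\<Sum>a\<in>{()}. (\<Prod>i\<in>UNIV. laguerre_weight (\<nu> $ i) (z $ i) * G i 0 t (y $ i) (z $ i)) *\<^sub>R 1)"
        by (simp add: heat_kernel_def)
    next
      fix i p u
      show "(G i p t (y $ i) has_real_derivative G i (Suc p) t (y $ i) u) (at u)"
        by (rule fam'(3))
    qed (rule xy)
    then show ?thesis by (simp add: R_def r_def)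
  qed
  have R_meas: "(\<lambda>t. R t x y) \<in> borel_measurable borel" for x y
  proof -
    have [measurable]: "(\<lambda>t. G i p t v u) \<in> borel_measurable borel" for i p v u by (rule fam'(4))
    show ?thesis unfolding R_def r_def by measurable
  qed
  define B where "B = (\<Prod>i\<in>UNIV. K i (k $ i))"
  have B0: "0 \<le> B" unfolding B_def by (intro prod_nonneg fam'(1))
  have prodL: "(\<Prod>i\<in>UNIV. L t i) = B * (sqrt (1 - tanh t) ^ ?n * (1 / sqrt (tanh t)) ^ (msize k + ?n))" for t
  proof -
    have "(\<Prod>i\<in>UNIV. (1 / sqrt (tanh t)) ^ (k $ i + 1)) = (1 / sqrt (tanh t)) ^ (\<Sum>i\<in>UNIV. k $ i + 1)"
      by (rule power_sum[symmetric])
    also have "(\<Sum>i\<in>UNIV. k $ i + 1) = msize k + ?n" unfolding msize_def sum.distrib by simp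
    finally have "(\<Prod>i\<in>UNIV. (1 / sqrt (tanh t)) ^ (k $ i + 1)) = (1 / sqrt (tanh t)) ^ (msize k + ?n)" .
    then show ?thesis unfolding L_def time_decay_def prod.distrib B_def by simp
  qed
  have n1: "1 \<le> ?n" by (simp add: Suc_leI)
  obtain C0 where C0: "0 \<le> C0" and I0: "\<forall>d>0. \<forall>A\<ge>0. \<forall>F. F \<in> borel_measurable borel \<longrightarrow>
     (\<forall>t>0. \<bar>F t\<bar> \<le> A * (sqrt (1 - tanh t) ^ ?n * (1 / sqrt (tanh t)) ^ (msize k + ?n) * (1 / sqrt (tanh t)) powr 0) * exp (- (d\<^sup>2 / (64 * tanh t)))) \<longrightarrow>
     set_integrable lebesgue {0<..} (\<lambda>t. t powr (real (msize k) / 2) * F t / t) \<and>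
     \<bar>LINT t:{0<..}|lebesgue. t powr (real (msize k) / 2) * F t / t\<bar> \<le> C0 * (A * d powr (- (real ?n + 0)))"
    using subordinated_integral_bound[OF n1 order_refl, of "msize k"] by (elim exE conjE)
  obtain C1 where C1: "0 \<le> C1" and I1: "\<forall>d>0. \<forall>A\<ge>0. \<forall>F. F \<in> borel_measurable borel \<longrightarrow>
     (\<forall>t>0. \<bar>F t\<bar> \<le> A * (sqrt (1 - tanh t) ^ ?n * (1 / sqrt (tanh t)) ^ (msize k + ?n) * (1 / sqrt (tanh t)) powr \<gamma>) * exp (- (d\<^sup>2 / (64 * tanh t)))) \<longrightarrow>
     set_integrable lebesgue {0<..} (\<lambda>t. t powr (real (msize k) / 2) * F t / t) \<and>
     \<bar>LINT t:{0<..}|lebesgue. t powr (real (msize k) / 2) * F t / t\<bar> \<le> C1 * (A * d powr (- (real ?n + \<gamma>)))"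
    using subordinated_integral_bound[OF n1 less_imp_le[OF gb(1)], of "msize k"] by (elim exE conjE)
  define c where "c = 1 / Gamma (real (msize k) / 2)"
  have kernel: "riesz_kernel \<nu> k x y = c * (LINT t:{0<..}|lebesgue. t powr (real (msize k) / 2) * R t x y / t)"
    if xy: "x \<in> Rplus" "y \<in> Rplus" for x y
  proof -
    have "(LINT t:{0<..}|lebesgue. t powr (real (msize k) / 2) * delta_pow \<nu> k (\<lambda>z. heat_kernel \<nu> t z y) x / t)
       = (LINT t:{0<..}|lebesgue. t powr (real (msize k) / 2) * R t x y / t)"
      unfolding set_lebesgue_integral_def
      by (intro Bochner_Integration.integral_cong refl) (auto simp: R_eq[OF _ xy] indicator_def)
    then show ?thesis using False by (simp add: riesz_kernel_def c_def)
  qed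
  have R_size: "\<bar>R t x y\<bar> \<le> B * (sqrt (1 - tanh t) ^ ?n * (1 / sqrt (tanh t)) ^ (msize k + ?n) * (1 / sqrt (tanh t)) powr 0) * exp (- ((norm (x - y))\<^sup>2 / (64 * tanh t)))"
    if t: "0 < t" and xy: "x \<in> Rplus" "y \<in> Rplus" for t x y
  proof -
    have pos: "0 < x $ i" "0 < y $ i" for i using xy by (auto simp: Rplus_def)
    have th: "0 < tanh t" using t by simp
    have "\<bar>R t x y\<bar> \<le> (\<Prod>i\<in>UNIV. L t i * gauss (tanh t) ((x - y) $ i))"
      unfolding R_def abs_prod using r_size[OF t pos(1) pos(2)] by (intro prod_mono) auto
    also have "\<dots> = (\<Prod>i\<in>UNIV. L t i) * exp (- ((norm (x - y))\<^sup>2 / (16 * tanh t)))"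
      unfolding prod.distrib prod_gauss ..
    also have "\<dots> \<le> (\<Prod>i\<in>UNIV. L t i) * exp (- ((norm (x - y))\<^sup>2 / (64 * tanh t)))"
    proof (intro mult_left_mono prod_nonneg)
      have "(norm (x - y))\<^sup>2 / (64 * tanh t) \<le> (norm (x - y))\<^sup>2 / (16 * tanh t)"
        using th by (intro divide_left_mono) auto
      then show "exp (- ((norm (x - y))\<^sup>2 / (16 * tanh t))) \<le> exp (- ((norm (x - y))\<^sup>2 / (64 * tanh t)))" by simp
    qed (use L0[OF t] in auto)
    finally show ?thesis using th by (simp add: prodL mult.assoc)
  qed
  have S0: "set_integrable lebesgue {0<..} (\<lambda>t. t powr (real (msize k) / 2) * R t x y / t) \<and>
     \<bar>LINT t:{0<..}|lebesgue. t powr (real (msize k) / 2) * R t x y / t\<bar> \<le> C0 * (B * norm (x - y) powr (- (real ?n + 0)))"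
    if "x \<in> Rplus" "y \<in> Rplus" "x \<noteq> y" for x y
  proof -
    have d: "0 < norm (x - y)" using that by simp
    show ?thesis
      using I0[rule_format, OF d B0 R_meas R_size[OF _ that(1,2)]] by simp
  qed
  define D where "D = real ?n * 2 ^ ?n * B"
  have D0: "0 \<le> D" using B0 by (simp add: D_def)
  have near_bound: "\<bar>R t x y - R t x y'\<bar> \<le> D * norm (y - y') powr \<gamma> * (sqrt (1 - tanh t) ^ ?n * (1 / sqrt (tanh t)) ^ (msize k + ?n) * (1 / sqrt (tanh t)) powr \<gamma>) * exp (- ((norm (x - y))\<^sup>2 / (64 * tanh t)))"
    "\<bar>R t y x - R t y' x\<bar> \<le> D * norm (y - y') powr \<gamma> * (sqrt (1 - tanh t) ^ ?n * (1 / sqrt (tanh t)) ^ (msize k + ?n) * (1 / sqrt (tanh t)) powr \<gamma>) * exp (- ((norm (x - y))\<^sup>2 / (64 * tanh t)))"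
    if t: "0 < t" and xy: "x \<in> Rplus" "y \<in> Rplus" "y' \<in> Rplus" and near: "norm (y - y') \<le> norm (x - y) / 2" for t x y y'
  proof -
    have th: "0 < tanh t" using t by simp
    have gsym: "gauss (tanh t) (u - v) = gauss (tanh t) (v - u)" for u v
      by (simp add: gauss_def power2_commute)
    have split: "(norm (y - y') / sqrt (tanh t)) powr \<gamma> = norm (y - y') powr \<gamma> * (1 / sqrt (tanh t)) powr \<gamma>"
      using th by (simp add: powr_divide)
    have "\<bar>R t x y - R t x y'\<bar> \<le> real ?n * 2 ^ ?n * (\<Prod>i\<in>UNIV. L t i) * ((norm (y - y') / sqrt (tanh t)) powr \<gamma> * exp (- ((norm (x - y))\<^sup>2 / (64 * tanh t))))"
      unfolding R_def by (intro product_holder th L0 t gb r_size r_hol xy near; assumption)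
    then show "\<bar>R t x y - R t x y'\<bar> \<le> D * norm (y - y') powr \<gamma> * (sqrt (1 - tanh t) ^ ?n * (1 / sqrt (tanh t)) ^ (msize k + ?n) * (1 / sqrt (tanh t)) powr \<gamma>) * exp (- ((norm (x - y))\<^sup>2 / (64 * tanh t)))"
      unfolding split prodL D_def by (simp only: mult_ac)
    have "\<bar>R t y x - R t y' x\<bar> \<le> real ?n * 2 ^ ?n * (\<Prod>i\<in>UNIV. L t i) * ((norm (y - y') / sqrt (tanh t)) powr \<gamma> * exp (- ((norm (x - y))\<^sup>2 / (64 * tanh t))))"
      unfolding R_def
    proof (rule product_holder[where r = "\<lambda>i u v. r t i v u"])
      fix i u v :: real and i' assume "0 < u" "0 < v"
      then show "\<bar>r t i' v u\<bar> \<le> L t i' * gauss (tanh t) (u - v)"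
        using r_size[OF t, of v u i'] by (simp add: gsym[of u v])
    qed (use th L0[OF t] gb(1) xy near r_hol'[OF t] in \<open>simp_all only:\<close>)
    then show "\<bar>R t y x - R t y' x\<bar> \<le> D * norm (y - y') powr \<gamma> * (sqrt (1 - tanh t) ^ ?n * (1 / sqrt (tanh t)) ^ (msize k + ?n) * (1 / sqrt (tanh t)) powr \<gamma>) * exp (- ((norm (x - y))\<^sup>2 / (64 * tanh t)))"
      unfolding split prodL D_def by (simp only: mult_ac)
  qed
  have smooth: "\<bar>riesz_kernel \<nu> k x1 y1 - riesz_kernel \<nu> k x2 y2\<bar> \<le> \<bar>c\<bar> * (C1 * (A * d powr (- (real ?n + \<gamma>))))"
    if xy: "x1 \<in> Rplus" "y1 \<in> Rplus" "x1 \<noteq> y1" "x2 \<in> Rplus" "y2 \<in> Rplus" "x2 \<noteq> y2" and d: "0 < d" and A: "0 \<le> A"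
      and est: "\<And>t. 0 < t \<Longrightarrow> \<bar>R t x1 y1 - R t x2 y2\<bar> \<le> A * (sqrt (1 - tanh t) ^ ?n * (1 / sqrt (tanh t)) ^ (msize k + ?n) * (1 / sqrt (tanh t)) powr \<gamma>) * exp (- (d\<^sup>2 / (64 * tanh t)))"
    for x1 y1 x2 y2 d A
  proof -
    have m: "(\<lambda>t. R t x1 y1 - R t x2 y2) \<in> borel_measurable borel"
      using R_meas by (intro borel_measurable_diff)
    have "riesz_kernel \<nu> k x1 y1 - riesz_kernel \<nu> k x2 y2 = c * ((LINT t:{0<..}|lebesgue. t powr (real (msize k) / 2) * R t x1 y1 / t) - (LINT t:{0<..}|lebesgue. t powr (real (msize k) / 2) * R t x2 y2 / t))"
      by (simp add: kernel xy right_diff_distrib)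
    also have "\<dots> = c * (LINT t:{0<..}|lebesgue. t powr (real (msize k) / 2) * R t x1 y1 / t - t powr (real (msize k) / 2) * R t x2 y2 / t)"
      using S0[OF xy(1,2,3)] S0[OF xy(4,5,6)] by (subst set_integral_diff(2)) auto
    also have "\<dots> = c * (LINT t:{0<..}|lebesgue. t powr (real (msize k) / 2) * (R t x1 y1 - R t x2 y2) / t)"
      by (simp only: right_diff_distrib diff_divide_distrib)
    finally have "\<bar>riesz_kernel \<nu> k x1 y1 - riesz_kernel \<nu> k x2 y2\<bar> = \<bar>c\<bar> * \<bar>LINT t:{0<..}|lebesgue. t powr (real (msize k) / 2) * (R t x1 y1 - R t x2 y2) / t\<bar>"
      by (simp only: abs_mult)
    also have "\<dots> \<le> \<bar>c\<bar> * (C1 * (A * d powr (- (real ?n + \<gamma>))))"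
      using I1[rule_format, OF d A m est] by (intro mult_left_mono) auto
    finally show ?thesis .
  qed
  define C where "C = \<bar>c\<bar> * (C0 * B) + \<bar>c\<bar> * (C1 * D)"
  have C: "0 \<le> \<bar>c\<bar> * (C0 * B)" "0 \<le> \<bar>c\<bar> * (C1 * D)" using C0 C1 B0 D0 by auto
  show ?thesis
  proof (intro exI[of _ C] conjI ballI impI)
    show "0 \<le> C" using C by (simp add: C_def)
    fix x y :: "(real, 'n) vec" assume xy: "x \<in> Rplus" "y \<in> Rplus" "x \<noteq> y"
    have "\<bar>riesz_kernel \<nu> k x y\<bar> \<le> \<bar>c\<bar> * (C0 * (B * norm (x - y) powr (- (real ?n + 0))))"
      unfolding kernel[OF xy(1,2)] abs_mult using S0[OF xy] by (intro mult_left_mono) auto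
    also have "\<dots> = \<bar>c\<bar> * (C0 * B) * norm (x - y) powr (- real ?n)" by (simp only: add_0_right mult.assoc)
    also have "\<dots> \<le> C * norm (x - y) powr (- real ?n)" using C by (intro mult_right_mono) (auto simp: C_def)
    finally show "\<bar>riesz_kernel \<nu> k x y\<bar> \<le> C * norm (x - y) powr (- real ?n)" .
  next
    fix x y y' :: "(real, 'n) vec" assume R: "x \<in> Rplus" "y \<in> Rplus" "y' \<in> Rplus" and ne: "x \<noteq> y" and near: "norm (y - y') \<le> norm (x - y) / 2"
    have d: "0 < norm (x - y)" using ne by simp
    have ne': "x \<noteq> y'"
    proof
      assume "x = y'"
      then have "norm (x - y) \<le> norm (x - y) / 2" using near by (simp add: norm_minus_commute)
      then show False using d by simp
    qed
    have fin: "\<bar>c\<bar> * (C1 * (D * norm (y - y') powr \<gamma> * norm (x - y) powr (- (real ?n + \<gamma>)))) \<le> C * (norm (y - y') powr \<gamma> * norm (x - y) powr (- (real ?n + \<gamma>)))"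
    proof -
      have "\<bar>c\<bar> * (C1 * (D * norm (y - y') powr \<gamma> * norm (x - y) powr (- (real ?n + \<gamma>)))) = \<bar>c\<bar> * (C1 * D) * (norm (y - y') powr \<gamma> * norm (x - y) powr (- (real ?n + \<gamma>)))"
        by (simp only: mult_ac)
      also have "\<dots> \<le> C * (norm (y - y') powr \<gamma> * norm (x - y) powr (- (real ?n + \<gamma>)))"
        using C by (intro mult_right_mono) (auto simp: C_def)
      finally show ?thesis .
    qed
    have A: "0 \<le> D * norm (y - y') powr \<gamma>" using D0 by simp
    show "\<bar>riesz_kernel \<nu> k x y - riesz_kernel \<nu> k x y'\<bar> \<le> C * (norm (y - y') powr \<gamma> * norm (x - y) powr (- (real ?n + \<gamma>)))"
      by (rule order_trans[OF smooth fin]) (use R ne ne' d A near_bound(1)[OF _ R near] in auto)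
    show "\<bar>riesz_kernel \<nu> k y x - riesz_kernel \<nu> k y' x\<bar> \<le> C * (norm (y - y') powr \<gamma> * norm (x - y) powr (- (real ?n + \<gamma>)))"
      by (rule order_trans[OF smooth fin]) (use R ne ne' d A near_bound(2)[OF _ R near] in auto)
  qed
qed

theorem theorem5p1:
  fixes \<nu> :: "real ^ 'n::{finite,linorder}" and k :: "nat ^ 'n::{finite,linorder}"
  assumes "\<forall>j. - 1 / 2 \<le> \<nu> $ j"
  shows "(\<exists>T. L2_bounded_operator T \<and>
            (\<forall>f\<in>laguerre_span \<nu>. AE x in lebesgue_on Rplus. T f x = riesz \<nu> k f x)) \<and>
         (\<exists>C>0.
            (\<forall>x\<in>Rplus. \<forall>y\<in>Rplus. x \<noteq> y \<longrightarrow>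
               \<bar>riesz_kernel \<nu> k x y\<bar> \<le> C / norm (x - y) ^ CARD('n)) \<and>
            (\<forall>x\<in>Rplus. \<forall>y\<in>Rplus. \<forall>y'\<in>Rplus.
               x \<noteq> y \<and> norm (y - y') \<le> norm (x - y) / 2 \<longrightarrow>
               \<bar>riesz_kernel \<nu> k x y - riesz_kernel \<nu> k x y'\<bar> +
               \<bar>riesz_kernel \<nu> k y x - riesz_kernel \<nu> k y' x\<bar>
               \<le> C * (norm (y - y') / norm (x - y)) powr gamma_nu \<nu> * (1 / norm (x - y) ^ CARD('n))))"
proof (rule conjI)
  show "\<exists>T. L2_bounded_operator T \<and>
            (\<forall>f\<in>laguerre_span \<nu>. AE x in lebesgue_on Rplus. T f x = riesz \<nu> k f x)"
    by (rule riesz_L2_bounded[OF assms])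
next
  let ?n = "CARD('n)" and ?\<gamma> = "gamma_nu \<nu>"
  obtain C where C: "0 \<le> C"
    and size: "\<forall>x\<in>Rplus. \<forall>y\<in>Rplus. x \<noteq> y \<longrightarrow> \<bar>riesz_kernel \<nu> k x y\<bar> \<le> C * norm (x - y) powr (- real ?n)"
    and smooth: "\<forall>x\<in>Rplus. \<forall>y\<in>Rplus. \<forall>y'\<in>Rplus. x \<noteq> y \<longrightarrow> norm (y - y') \<le> norm (x - y) / 2 \<longrightarrow>
        \<bar>riesz_kernel \<nu> k x y - riesz_kernel \<nu> k x y'\<bar> \<le> C * (norm (y - y') powr ?\<gamma> * norm (x - y) powr (- (real ?n + ?\<gamma>))) \<and>
        \<bar>riesz_kernel \<nu> k y x - riesz_kernel \<nu> k y' x\<bar> \<le> C * (norm (y - y') powr ?\<gamma> * norm (x - y) powr (- (real ?n + ?\<gamma>)))"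
    using riesz_kernel_estimates[OF assms, of k] by (elim exE conjE)
  have pow: "d powr (- real ?n) = 1 / d ^ ?n" if "0 < d" for d :: real
    using that by (simp add: powr_minus powr_realpow divide_inverse)
  show "\<exists>C>0.
            (\<forall>x\<in>Rplus. \<forall>y\<in>Rplus. x \<noteq> y \<longrightarrow>
               \<bar>riesz_kernel \<nu> k x y\<bar> \<le> C / norm (x - y) ^ CARD('n)) \<and>
            (\<forall>x\<in>Rplus. \<forall>y\<in>Rplus. \<forall>y'\<in>Rplus.
               x \<noteq> y \<and> norm (y - y') \<le> norm (x - y) / 2 \<longrightarrow>
               \<bar>riesz_kernel \<nu> k x y - riesz_kernel \<nu> k x y'\<bar> +
               \<bar>riesz_kernel \<nu> k y x - riesz_kernel \<nu> k y' x\<bar>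
               \<le> C * (norm (y - y') / norm (x - y)) powr gamma_nu \<nu> * (1 / norm (x - y) ^ CARD('n)))"
  proof (intro exI[of _ "2 * C + 1"] conjI ballI impI)
    show "0 < 2 * C + 1" using C by simp
    fix x y :: "(real, 'n) vec" assume xy: "x \<in> Rplus" "y \<in> Rplus" "x \<noteq> y"
    have d: "0 < norm (x - y)" using xy by simp
    have "\<bar>riesz_kernel \<nu> k x y\<bar> \<le> C / norm (x - y) ^ ?n"
      using size[rule_format, OF xy] unfolding pow[OF d] by simp
    also have "\<dots> \<le> (2 * C + 1) / norm (x - y) ^ ?n"
      using C by (intro divide_right_mono) auto
    finally show "\<bar>riesz_kernel \<nu> k x y\<bar> \<le> (2 * C + 1) / norm (x - y) ^ ?n" .
  next
    fix x y y' :: "(real, 'n) vec"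
    assume R: "x \<in> Rplus" "y \<in> Rplus" "y' \<in> Rplus" and a: "x \<noteq> y \<and> norm (y - y') \<le> norm (x - y) / 2"
    have d: "0 < norm (x - y)" using a by simp
    let ?b = "(norm (y - y') / norm (x - y)) powr ?\<gamma> * (1 / norm (x - y) ^ ?n)"
    have b: "norm (y - y') powr ?\<gamma> * norm (x - y) powr (- (real ?n + ?\<gamma>)) = ?b"
    proof -
      have "norm (x - y) powr (- (real ?n + ?\<gamma>)) = norm (x - y) powr (- real ?n) * norm (x - y) powr (- ?\<gamma>)"
        unfolding powr_add[symmetric] by simp
      also have "\<dots> = (1 / norm (x - y) ^ ?n) * (1 / norm (x - y) powr ?\<gamma>)"
        by (simp only: pow[OF d] powr_minus_divide[of _ ?\<gamma>])
      finally show ?thesis by (simp add: powr_divide)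
    qed
    note bounds = smooth[rule_format, OF R, OF conjunct1[OF a] conjunct2[OF a], unfolded b]
    have "\<bar>riesz_kernel \<nu> k x y - riesz_kernel \<nu> k x y'\<bar> + \<bar>riesz_kernel \<nu> k y x - riesz_kernel \<nu> k y' x\<bar> \<le> C * ?b + C * ?b"
      by (rule add_mono[OF conjunct1[OF bounds] conjunct2[OF bounds]])
    also have "\<dots> = 2 * C * ?b" by simp
    also have "\<dots> \<le> (2 * C + 1) * ?b"
      by (intro mult_right_mono mult_nonneg_nonneg) auto
    finally show "\<bar>riesz_kernel \<nu> k x y - riesz_kernel \<nu> k x y'\<bar> + \<bar>riesz_kernel \<nu> k y x - riesz_kernel \<nu> k y' x\<bar>
       \<le> (2 * C + 1) * (norm (y - y') / norm (x - y)) powr ?\<gamma> * (1 / norm (x - y) ^ ?n)"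
      by (simp only: mult.assoc)
  qed
qed

end
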